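(* Let $M_H=\{(z,w)\in\mathbb C^n\times\mathbb C:\operatorname{Im}w=P_C(z,\bar z)\}$ be a holomorphically nondegenerate model of finite Catlin multitype. The component $\mathfrak g_1$ of $\mathrm{aut}(M_H,0)$ satisfies $\dim\mathfrak g_1>0$ if and only if in suitable multitype coordinates $M_H$ is a balanced hypersurface.
   Context: Multitype and models. A weight is an $n$-tuple of rationals $\Lambda=(\lambda_1,\dots,\lambda_n)$ with $0\le\lambda_j\le\frac12$ and $\lambda_j\ge\lambda_{j+1}$. The variables $w,\operatorname{Re}w,\operatorname{Im}w$ have weight $1$ and $z_j,\bar z_j$ have weight $\lambda_j$; a polynomial is weighted homogeneous of degree $\kappa$ if all its monomials $c\,z^\alpha\bar z^\beta(\operatorname{Re}w)^l$ satisfy $l+\sum_i(\alpha_i+\beta_i)\lambda_i=\kappa$. For a smooth real hypersurface $M\subset\mathbb C^{n+1}$ and a point $p\in M$ of finite type in the sense of Kohn and Bloom–Graham, $\Lambda$ is distinguished if there are local holomorphic coordinates $(z,w)$ vanishing at $p$ in which $M$ is $\operatorname{Im}w=P(z,\bar z)+o_\Lambda(1)$, where $P\ne0$ is weighted homogeneous of degree $1$ without pluriharmonic terms and $o_\Lambda(1)$ is a smooth function whose derivatives of weighted order $\le1$ vanish at the origin. The multitype weight $(\mu_1,\dots,\mu_n)$ is the lexicographic infimum of all distinguished weights; $M$ has finite (Catlin) multitype at $p$ if all $\mu_j\neq0$. Coordinates in which $M$ has this form with $\Lambda=(\mu_1,\dots,\mu_n)$ are multitype coordinates; then $P$ is denoted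 $P_C$, and $M_H=\{\operatorname{Im}w=P_C(z,\bar z)\}$ is the model of $M$ at $p$. Multitype coordinates are not unique. $M_H$ is holomorphically nondegenerate if there is no nonzero germ at $0$ of a holomorphic vector field tangent to $M_H$. $\mathrm{aut}(M_H,0)$ is the Lie algebra of germs at $0$ of holomorphic vector fields in $\mathbb C^{n+1}$ whose real part is tangent to $M_H$. A field $\sum_jF_j\partial_{z_j}+G\partial_w$ has weight $\mu$ if each $F_j$ is weighted homogeneous of degree $\mu+\mu_j$ and $G$ of degree $\mu+1$. $\mathfrak g_1$ is the space of elements of $\mathrm{aut}(M_H,0)$ of weight $1$. Balanced. $P_C$ is balanced if it can be written as $$P_C(z,\bar z)=\sum_{|\alpha|_\Lambda=|\bar\alpha|_\Lambda=1}A_{\alpha,\bar\alpha}\,z^\alpha\bar z^{\bar\alpha}$$ for some nonzero $n$-tuple of real numbers $\Lambda=(\lambda_1,\dots,\lambda_n)$, where $\alpha$ and $\bar\alpha$ denote two (independent) multiindices and $|\alpha|_\Lambda=\sum_j\lambda_j\alpha_j$. The hypersurface $\{\operatorname{Im}w=P_C\}$ is then called a balanced hypersurface. *)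

theory Defs
  imports "HOL-Analysis.Analysis" "HOL-Library.Function_Algebras"
begin

(* C^(n+1) is the product of complex^'n (coordinates z) and complex (coordinate w). The index type
   'n is a finite linear order, because weights are ordered lexicographically. A holomorphic vector
   field sum_j F_j d/dz_j + G d/dw is the map (z,w) |-> (F (z,w), G (z,w)). *)

type_synonym 'n csp = "(complex^'n) \<times> complex"
type_synonym 'n vfield = "'n csp \<Rightarrow> 'n csp"


subsection \<open>Smooth and holomorphic maps\<close>

fun Ck_on :: "nat \<Rightarrow> 'a set \<Rightarrow> ('a::real_normed_vector \<Rightarrow> 'b::real_normed_vector) \<Rightarrow> bool" where
  "Ck_on 0 U f = continuous_on U f"
| "Ck_on (Suc k) U f =
     ((\<forall>x\<in>U. f differentiable (at x)) \<and> (\<forall>v. Ck_on k U (\<lambda>x. frechet_derivative f (at x) v)))"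

definition smooth_on :: "'a set \<Rightarrow> ('a::real_normed_vector \<Rightarrow> 'b::real_normed_vector) \<Rightarrow> bool" where
  "smooth_on U f \<longleftrightarrow> open U \<and> (\<forall>k. Ck_on k U f)"

definition cscale :: "complex \<Rightarrow> 'n csp \<Rightarrow> 'n::finite csp" where
  "cscale c x = (c *s fst x, c * snd x)"

definition hol_on :: "'n csp set \<Rightarrow> ('n csp \<Rightarrow> 'n::finite csp) \<Rightarrow> bool" where
  "hol_on U F \<longleftrightarrow> open U \<and>
     (\<forall>x\<in>U. \<exists>D. (F has_derivative D) (at x) \<and> (\<forall>c v. D (cscale c v) = cscale c (D v)))"

definition local_coords :: "'n csp set \<Rightarrow> 'n csp \<Rightarrow> ('n csp \<Rightarrow> 'n::finite csp) \<Rightarrow> bool" where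
  "local_coords U p \<Phi> \<longleftrightarrow> p \<in> U \<and> \<Phi> p = 0 \<and> hol_on U \<Phi> \<and> inj_on \<Phi> U \<and>
     hol_on (\<Phi> ` U) (inv_into U \<Phi>)"


subsection \<open>Real hypersurfaces and finite type\<close>

definition local_defining_function ::
  "'n csp set \<Rightarrow> 'n csp \<Rightarrow> 'n csp set \<Rightarrow> ('n::finite csp \<Rightarrow> real) \<Rightarrow> bool" where
  "local_defining_function M p U \<rho> \<longleftrightarrow> p \<in> U \<and> smooth_on U \<rho> \<and> M \<inter> U = {x \<in> U. \<rho> x = 0} \<and>
     (\<forall>x \<in> M \<inter> U. \<exists>v. frechet_derivative \<rho> (at x) v \<noteq> 0)"

definition smooth_real_hypersurface :: "'n::finite csp set \<Rightarrow> bool" where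
  "smooth_real_hypersurface M \<longleftrightarrow> (\<forall>p\<in>M. \<exists>U \<rho>. local_defining_function M p U \<rho>)"

(* v lies in the maximal complex subspace of the real tangent space of the level set of rho at x;
   for the (1,0) vector with components v this says that v itself, and not only its real part,
   annihilates rho. *)
definition complex_tangent :: "('n csp \<Rightarrow> real) \<Rightarrow> 'n csp \<Rightarrow> 'n::finite csp \<Rightarrow> bool" where
  "complex_tangent \<rho> x v \<longleftrightarrow>
     frechet_derivative \<rho> (at x) v = 0 \<and> frechet_derivative \<rho> (at x) (cscale \<i> v) = 0"

definition lie_bracket :: "'n vfield \<Rightarrow> 'n vfield \<Rightarrow> 'n::finite vfield" where
  "lie_bracket X Y =
     (\<lambda>x. frechet_derivative Y (at x) (X x) - frechet_derivative X (at x) (Y x))"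

(* Sections of the complex tangent bundle, extended to the ambient space, and their iterated
   commutators; along the hypersurface the commutators do not depend on the extensions. *)
inductive_set iterated_brackets :: "'n csp set \<Rightarrow> ('n::finite csp \<Rightarrow> real) \<Rightarrow> 'n vfield set"
  for U :: "'n csp set" and \<rho> :: "'n csp \<Rightarrow> real" where
  tangential: "\<lbrakk>smooth_on U X; \<And>x. x \<in> U \<Longrightarrow> \<rho> x = 0 \<Longrightarrow> complex_tangent \<rho> x (X x)\<rbrakk>
     \<Longrightarrow> X \<in> iterated_brackets U \<rho>"
| bracket: "\<lbrakk>X \<in> iterated_brackets U \<rho>; Y \<in> iterated_brackets U \<rho>\<rbrakk>
     \<Longrightarrow> lie_bracket X Y \<in> iterated_brackets U \<rho>"

(* Kohn, Bloom-Graham: some iterated commutator of complex tangential fields leaves the complex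
   tangent space at p. *)
definition finite_type :: "'n::finite csp set \<Rightarrow> 'n csp \<Rightarrow> bool" where
  "finite_type M p \<longleftrightarrow> (\<exists>U \<rho>. local_defining_function M p U \<rho> \<and>
     (\<exists>X \<in> iterated_brackets U \<rho>. \<not> complex_tangent \<rho> p (X p)))"


subsection \<open>Weights and weighted homogeneous polynomials\<close>

definition is_weight :: "('n::linorder \<Rightarrow> real) \<Rightarrow> bool" where
  "is_weight \<Lambda> \<longleftrightarrow>
     (\<forall>j. \<Lambda> j \<in> \<rat> \<and> 0 \<le> \<Lambda> j \<and> \<Lambda> j \<le> 1/2) \<and> (\<forall>i j. i \<le> j \<longrightarrow> \<Lambda> j \<le> \<Lambda> i)"

definition lex_le :: "('n::linorder \<Rightarrow> real) \<Rightarrow> ('n \<Rightarrow> real) \<Rightarrow> bool" where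
  "lex_le a b \<longleftrightarrow> a = b \<or> (\<exists>k. (\<forall>j<k. a j = b j) \<and> a k < b k)"

definition wlen :: "('n::finite \<Rightarrow> real) \<Rightarrow> ('n \<Rightarrow> nat) \<Rightarrow> real" where
  "wlen \<Lambda> \<alpha> = (\<Sum>j\<in>UNIV. \<Lambda> j * real (\<alpha> j))"

definition zmonom :: "('n::finite \<Rightarrow> nat) \<Rightarrow> complex^'n \<Rightarrow> complex" where
  "zmonom \<alpha> z = (\<Prod>j\<in>UNIV. (z $ j) ^ \<alpha> j)"

(* P(z, zbar) is the polynomial with coefficient A a b at z^a zbar^b. *)
definition poly_rep ::
  "(('n::finite \<Rightarrow> nat) \<Rightarrow> ('n \<Rightarrow> nat) \<Rightarrow> complex) \<Rightarrow> (complex^'n \<Rightarrow> real) \<Rightarrow> bool" where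
  "poly_rep A P \<longleftrightarrow> finite {(\<alpha>, \<beta>). A \<alpha> \<beta> \<noteq> 0} \<and>
     (\<forall>z. complex_of_real (P z) =
        (\<Sum>(\<alpha>, \<beta>)\<in>{(\<alpha>, \<beta>). A \<alpha> \<beta> \<noteq> 0}. A \<alpha> \<beta> * zmonom \<alpha> z * cnj (zmonom \<beta> z)))"

definition model_polynomial :: "('n::finite \<Rightarrow> real) \<Rightarrow> (complex^'n \<Rightarrow> real) \<Rightarrow> bool" where
  "model_polynomial \<Lambda> P \<longleftrightarrow> (\<exists>z. P z \<noteq> 0) \<and>
     (\<exists>A. poly_rep A P \<and>
        (\<forall>\<alpha> \<beta>. A \<alpha> \<beta> \<noteq> 0 \<longrightarrow> wlen \<Lambda> \<alpha> + wlen \<Lambda> \<beta> = 1) \<and>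
        (\<forall>\<alpha>. A \<alpha> (\<lambda>_. 0) = 0 \<and> A (\<lambda>_. 0) \<alpha> = 0))"

definition balanced :: "(complex^'n::finite \<Rightarrow> real) \<Rightarrow> bool" where
  "balanced P \<longleftrightarrow> (\<exists>(\<Lambda>::'n \<Rightarrow> real) A. (\<exists>j. \<Lambda> j \<noteq> 0) \<and> poly_rep A P \<and>
     (\<forall>\<alpha> \<beta>. A \<alpha> \<beta> \<noteq> 0 \<longrightarrow> wlen \<Lambda> \<alpha> = 1 \<and> wlen \<Lambda> \<beta> = 1))"


subsection \<open>Multitype\<close>

(* The functions o_Lambda(1) are functions of (z, u) with u = Re w; wdir lists the Wirtinger
   derivatives d/dz_j, d/dzbar_j and d/du. *)
datatype 'n wdir = DZ 'n | DZbar 'n | DU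

fun wderiv ::
  "'n wdir \<Rightarrow> ((complex^'n) \<times> real \<Rightarrow> complex) \<Rightarrow> ((complex^'n::finite) \<times> real \<Rightarrow> complex)" where
  "wderiv (DZ j) f = (\<lambda>x. (frechet_derivative f (at x) (axis j 1, 0)
      - \<i> * frechet_derivative f (at x) (axis j \<i>, 0)) / 2)"
| "wderiv (DZbar j) f = (\<lambda>x. (frechet_derivative f (at x) (axis j 1, 0)
      + \<i> * frechet_derivative f (at x) (axis j \<i>, 0)) / 2)"
| "wderiv DU f = (\<lambda>x. frechet_derivative f (at x) (0, 1))"

fun wdir_weight :: "('n \<Rightarrow> real) \<Rightarrow> 'n wdir \<Rightarrow> real" where
  "wdir_weight \<Lambda> (DZ j) = \<Lambda> j"
| "wdir_weight \<Lambda> (DZbar j) = \<Lambda> j"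
| "wdir_weight \<Lambda> DU = 1"

definition weighted_little_o :: "('n \<Rightarrow> real) \<Rightarrow> ((complex^'n::finite) \<times> real \<Rightarrow> real) \<Rightarrow> bool" where
  "weighted_little_o \<Lambda> R \<longleftrightarrow>
     (\<forall>ds. sum_list (map (wdir_weight \<Lambda>) ds) \<le> 1 \<longrightarrow>
        foldr wderiv ds (\<lambda>x. complex_of_real (R x)) 0 = 0)"

(* In the coordinates Phi at p, M is Im w = P(z, zbar) + o_Lambda(1). *)
definition distinguished_form ::
  "('n::finite \<Rightarrow> real) \<Rightarrow> 'n csp set \<Rightarrow> 'n csp \<Rightarrow> ('n csp \<Rightarrow> 'n csp) \<Rightarrow> (complex^'n \<Rightarrow> real) \<Rightarrow> bool"
where
  "distinguished_form \<Lambda> M p \<Phi> P \<longleftrightarrow> model_polynomial \<Lambda> P \<and>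
     (\<exists>U V R. local_coords U p \<Phi> \<and> smooth_on V R \<and> weighted_little_o \<Lambda> R \<and>
        (\<forall>x\<in>U. (fst (\<Phi> x), Re (snd (\<Phi> x))) \<in> V) \<and>
        (\<forall>x\<in>U. x \<in> M \<longleftrightarrow>
           Im (snd (\<Phi> x)) = P (fst (\<Phi> x)) + R (fst (\<Phi> x), Re (snd (\<Phi> x)))))"

definition distinguished_weight ::
  "'n csp set \<Rightarrow> 'n csp \<Rightarrow> ('n::{finite,linorder} \<Rightarrow> real) \<Rightarrow> bool" where
  "distinguished_weight M p \<Lambda> \<longleftrightarrow> is_weight \<Lambda> \<and> (\<exists>\<Phi> P. distinguished_form \<Lambda> M p \<Phi> P)"

definition multitype_weight ::
  "'n csp set \<Rightarrow> 'n csp \<Rightarrow> ('n::{finite,linorder} \<Rightarrow> real) \<Rightarrow> bool" where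
  "multitype_weight M p \<mu> \<longleftrightarrow>
     (\<forall>\<Lambda>. distinguished_weight M p \<Lambda> \<longrightarrow> lex_le \<mu> \<Lambda>) \<and>
     (\<forall>\<nu>. (\<forall>\<Lambda>. distinguished_weight M p \<Lambda> \<longrightarrow> lex_le \<nu> \<Lambda>) \<longrightarrow> lex_le \<nu> \<mu>)"

definition multitype_coords ::
  "'n csp set \<Rightarrow> 'n csp \<Rightarrow> ('n::{finite,linorder} \<Rightarrow> real) \<Rightarrow> ('n csp \<Rightarrow> 'n csp)
     \<Rightarrow> (complex^'n::{finite,linorder} \<Rightarrow> real) \<Rightarrow> bool" where
  "multitype_coords M p \<mu> \<Phi> P \<longleftrightarrow>
     is_weight \<mu> \<and> multitype_weight M p \<mu> \<and> distinguished_form \<mu> M p \<Phi> P"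


subsection \<open>Models and their infinitesimal automorphisms\<close>

definition model_hypersurface :: "(complex^'n::finite \<Rightarrow> real) \<Rightarrow> 'n csp set" where
  "model_hypersurface P = {x. Im (snd x) = P (fst x)}"

definition model_defining :: "(complex^'n::finite \<Rightarrow> real) \<Rightarrow> 'n csp \<Rightarrow> real" where
  "model_defining P x = Im (snd x) - P (fst x)"

(* Psi is a system of local holomorphic coordinates at 0 in which M_H (given by P) is, as a germ
   at 0, exactly the hypersurface Im w = Q(z, zbar). *)
definition model_in_coords ::
  "(complex^'n::finite \<Rightarrow> real) \<Rightarrow> ('n csp \<Rightarrow> 'n csp) \<Rightarrow> (complex^'n \<Rightarrow> real) \<Rightarrow> bool" where
  "model_in_coords P \<Psi> Q \<longleftrightarrow> (\<exists>V. local_coords V 0 \<Psi> \<and>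
     (\<forall>x\<in>V. x \<in> model_hypersurface P \<longleftrightarrow> \<Psi> x \<in> model_hypersurface Q))"

definition hol_nondegenerate :: "(complex^'n::finite \<Rightarrow> real) \<Rightarrow> bool" where
  "hol_nondegenerate P \<longleftrightarrow>
     (\<forall>U X. 0 \<in> U \<longrightarrow> hol_on U X \<longrightarrow>
        (\<forall>x \<in> U \<inter> model_hypersurface P. complex_tangent (model_defining P) x (X x)) \<longrightarrow>
        (\<forall>\<^sub>F x in nhds 0. X x = 0))"

(* Representatives of the germs in aut(M_H,0). The real part of X, as a real vector field, is
   a constant multiple of the field with components X x. *)
definition aut_model :: "(complex^'n::finite \<Rightarrow> real) \<Rightarrow> 'n vfield set" where
  "aut_model P = {X. \<exists>U. 0 \<in> U \<and> hol_on U X \<and>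
     (\<forall>x \<in> U \<inter> model_hypersurface P. frechet_derivative (model_defining P) (at x) (X x) = 0)}"

(* Holomorphic polynomials in (z,w), all of whose monomials z^a w^l have weight kappa. *)
definition hol_weighted_homogeneous ::
  "('n::finite \<Rightarrow> real) \<Rightarrow> real \<Rightarrow> ('n csp \<Rightarrow> complex) \<Rightarrow> bool" where
  "hol_weighted_homogeneous \<mu> \<kappa> f \<longleftrightarrow>
     (\<exists>C::('n \<Rightarrow> nat) \<Rightarrow> nat \<Rightarrow> complex. finite {(\<alpha>, l). C \<alpha> l \<noteq> 0} \<and>
        (\<forall>z w. f (z, w) = (\<Sum>(\<alpha>, l)\<in>{(\<alpha>, l). C \<alpha> l \<noteq> 0}. C \<alpha> l * zmonom \<alpha> z * w ^ l)) \<and>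
        (\<forall>\<alpha> l. C \<alpha> l \<noteq> 0 \<longrightarrow> wlen \<mu> \<alpha> + real l = \<kappa>))"

definition vfield_weight :: "('n::finite \<Rightarrow> real) \<Rightarrow> real \<Rightarrow> 'n vfield \<Rightarrow> bool" where
  "vfield_weight \<mu> \<kappa> X \<longleftrightarrow>
     (\<forall>j. hol_weighted_homogeneous \<mu> (\<kappa> + \<mu> j) (\<lambda>x. fst (X x) $ j)) \<and>
     hol_weighted_homogeneous \<mu> (\<kappa> + 1) (\<lambda>x. snd (X x))"

(* Elements of g_1 are germs of polynomial fields; each germ is represented by its unique
   polynomial representative on C^(n+1), so this is a real vector space of functions. *)
definition g1 :: "('n::finite \<Rightarrow> real) \<Rightarrow> (complex^'n \<Rightarrow> real) \<Rightarrow> 'n vfield set" where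
  "g1 \<mu> P = {X \<in> aut_model P. vfield_weight \<mu> 1 X}"

global_interpretation vf: vector_space "\<lambda>(c::real) (X::'n::finite vfield) x. c *\<^sub>R X x"
  by standard (auto simp: fun_eq_iff plus_fun_def algebra_simps)

end

theory Submission
  imports Defs "HOL-Complex_Analysis.Conformal_Mappings" "HOL-Computational_Algebra.Fundamental_Theorem_Algebra"
begin

text \<open>A field of weight 1 has the form \<open>(w a(z) + b(z), \<gamma> w\<^sup>2 + \<dots>)\<close>. Let \<open>L a\<close> be the (1,0) derivative
  along \<open>a\<close>. Tangency gives \<open>2 Re (L a P) = 2 \<gamma> P\<close> and \<open>Re (L b P) = P q\<close> with \<open>q = Im (L a P)\<close>, and
  nondegeneracy gives \<open>[a, b] = 2 \<gamma> b\<close>. As \<open>b\<close> acts nilpotently on \<open>P\<close> and \<open>q\<close>, comparing degrees along its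
  flow forces \<open>q = 0\<close>, \<open>b = 0\<close>, so that the field \<open>a / \<gamma>\<close> reproduces \<open>P\<close>. Coordinates made of
  generalized eigenvectors of this field balance \<open>P\<close>, with the real parts of the eigenvalues as weights.

  Conversely, a balanced hypersurface has the tangent field \<open>(w \<Lambda>\<^sub>j z\<^sub>j / 2, w\<^sup>2 / 2)\<close>. The balancing coordinates
  map \<open>w = 0\<close> to \<open>w' = 0\<close>, since this set is the Segre variety of the origin, so the field pulls back to
  one of the form \<open>w (F, w G)\<close>, up to a unit. Weighted rescaling extracts from it a nonzero tangent field
  of weight 1.\<close>

subsection \<open>Polynomials in z and its conjugate\<close>

text \<open>Two obstacles shape the argument. In the forward direction weights alone do not remove
  \<open>b\<close>: the derivative \<open>L b P\<close> has holomorphic weights above 1, but so do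
  some terms of the product \<open>P q\<close>. Only the relation
  \<open>[a, b] = 2 \<gamma> b\<close> makes \<open>q\<close> inherit nilpotency from
  \<open>P\<close>, and only then do degrees along the flow become available. In the converse
  direction the balancing coordinates are an arbitrary local biholomorphism with no relation to the
  weights, so the pulled back field may a priori have components of too low weight. The factor
  \<open>w\<close> in front of it excludes them: a component \<open>w a(z)\<close> with
  \<open>a\<close> of negative weight has to satisfy \<open>Re (w L a P) = 0\<close> for all values
  of \<open>Re w\<close>, hence \<open>P L a P = 0\<close>, and nondegeneracy gives
  \<open>a = 0\<close>. The weight 1 part is nonzero because its last component is a nonzero
  multiple of \<open>w\<^sup>2\<close>, which is the purpose of following the values
  \<open>E 0\<close> and \<open>G 0\<close> through the construction.\<close>

definition bimonom :: "('n::finite \<Rightarrow> nat) \<Rightarrow> ('n \<Rightarrow> nat) \<Rightarrow> complex^'n \<Rightarrow> complex" where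
  "bimonom \<alpha> \<beta> z = zmonom \<alpha> z * cnj (zmonom \<beta> z)"

text \<open>The predicate \<open>Q\<close> records which exponent pairs may occur in some
  representation of the function. Weight statements are thereby carried through sums, products and
  derivatives, and \<open>bipoly_weight_separate\<close> takes over the role of comparing
  coefficients.\<close>

inductive bipoly :: "(('n::finite \<Rightarrow> nat) \<Rightarrow> ('n \<Rightarrow> nat) \<Rightarrow> bool) \<Rightarrow> (complex^'n \<Rightarrow> complex) \<Rightarrow> bool"
  for Q where
  zero: "bipoly Q (\<lambda>z. 0)"
| step: "bipoly Q f \<Longrightarrow> Q \<alpha> \<beta> \<Longrightarrow> bipoly Q (\<lambda>z. c * bimonom \<alpha> \<beta> z + f z)"

abbreviation hpoly :: "(('n::finite \<Rightarrow> nat) \<Rightarrow> bool) \<Rightarrow> (complex^'n \<Rightarrow> complex) \<Rightarrow> bool" where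
  "hpoly Q \<equiv> bipoly (\<lambda>\<alpha> \<beta>. \<beta> = (\<lambda>_. 0) \<and> Q \<alpha>)"

abbreviation anypoly :: "(complex^'n::finite \<Rightarrow> complex) \<Rightarrow> bool" where
  "anypoly \<equiv> bipoly (\<lambda>_ _. True)"

lemma bipoly_mono:
  assumes "bipoly Q f" "\<And>\<alpha> \<beta>. Q \<alpha> \<beta> \<Longrightarrow> R \<alpha> \<beta>"
  shows "bipoly R f"
  using assms(1) by induction (auto intro: bipoly.intros assms(2))

lemma bipoly_any: "bipoly Q f \<Longrightarrow> anypoly f"
  by (erule bipoly_mono) auto

lemma bipoly_add:
  assumes "bipoly Q f" "bipoly Q g"
  shows "bipoly Q (\<lambda>z. f z + g z)"
  using assms(1)
proof induction
  case (step f \<alpha> \<beta> c)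
  then show ?case using bipoly.step[of Q "\<lambda>z. f z + g z" \<alpha> \<beta> c] by (simp add: add.assoc)
qed (use assms(2) in simp)

lemma bipoly_scale:
  assumes "bipoly Q f"
  shows "bipoly Q (\<lambda>z. c * f z)"
  using assms
proof induction
  case (step f \<alpha> \<beta> d)
  then show ?case using bipoly.step[of Q "\<lambda>z. c * f z" \<alpha> \<beta> "c * d"] by (simp add: algebra_simps)
qed (simp add: bipoly.zero)

lemma bipoly_minus: "bipoly Q f \<Longrightarrow> bipoly Q (\<lambda>z. - f z)"
  using bipoly_scale[of Q f "-1"] by simp

lemma bipoly_diff: "bipoly Q f \<Longrightarrow> bipoly Q g \<Longrightarrow> bipoly Q (\<lambda>z. f z - g z)"
  using bipoly_add[of Q f "\<lambda>z. - g z"] bipoly_minus[of Q g] by simp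

lemma bipoly_divide: "bipoly Q f \<Longrightarrow> bipoly Q (\<lambda>z. f z / c)"
  using bipoly_scale[of Q f "inverse c"] by (simp add: field_simps)

lemma bipoly_sum: "(\<And>i. i \<in> I \<Longrightarrow> bipoly Q (f i)) \<Longrightarrow> bipoly Q (\<lambda>z. \<Sum>i\<in>I. f i z)"
  by (induction I rule: infinite_finite_induct) (auto intro: bipoly.zero bipoly_add)

lemma bipoly_bimonom: "Q \<alpha> \<beta> \<Longrightarrow> bipoly Q (bimonom \<alpha> \<beta>)"
  using bipoly.step[OF bipoly.zero, of Q \<alpha> \<beta> 1] by simp

lemma zmonom_add: "zmonom (\<lambda>j. \<alpha> j + \<beta> j) z = zmonom \<alpha> z * zmonom \<beta> z"
  by (simp add: zmonom_def power_add prod.distrib)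

lemma zmonom_zero [simp]: "zmonom (\<lambda>_. 0) z = 1"
  by (simp add: zmonom_def)

lemma bimonom_mult:
  "bimonom \<alpha> \<beta> z * bimonom \<alpha>' \<beta>' z = bimonom (\<lambda>j. \<alpha> j + \<alpha>' j) (\<lambda>j. \<beta> j + \<beta>' j) z"
  by (simp add: bimonom_def zmonom_add)

lemma bipoly_mult:
  assumes "bipoly Q f" "bipoly R g"
    and "\<And>\<alpha> \<beta> \<alpha>' \<beta>'. Q \<alpha> \<beta> \<Longrightarrow> R \<alpha>' \<beta>' \<Longrightarrow> S (\<lambda>j. \<alpha> j + \<alpha>' j) (\<lambda>j. \<beta> j + \<beta>' j)"
  shows "bipoly S (\<lambda>z. f z * g z)"
  using assms(1)
proof induction
  case (step f \<alpha> \<beta> c)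
  have "bipoly S (\<lambda>z. bimonom \<alpha> \<beta> z * g z)"
    using assms(2)
  proof induction
    case (step g \<alpha>' \<beta>' d)
    have "bipoly S (\<lambda>z. d * bimonom (\<lambda>j. \<alpha> j + \<alpha>' j) (\<lambda>j. \<beta> j + \<beta>' j) z + bimonom \<alpha> \<beta> z * g z)"
      using step assms(3) \<open>Q \<alpha> \<beta>\<close> by (intro bipoly.step) auto
    then show ?case by (simp add: bimonom_mult[symmetric] algebra_simps)
  qed (simp add: bipoly.zero)
  from bipoly_add[OF bipoly_scale[OF this, of c] step.IH] show ?case
    by (simp add: algebra_simps)
qed (simp add: bipoly.zero)

lemma anypoly_mult: "anypoly f \<Longrightarrow> anypoly g \<Longrightarrow> anypoly (\<lambda>z. f z * g z)"
  by (erule (1) bipoly_mult) simp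

lemma bipoly_cnj:
  assumes "bipoly Q f"
  shows "bipoly (\<lambda>\<alpha> \<beta>. Q \<beta> \<alpha>) (\<lambda>z. cnj (f z))"
  using assms
proof induction
  case (step f \<alpha> \<beta> c)
  then have "bipoly (\<lambda>\<alpha> \<beta>. Q \<beta> \<alpha>) (\<lambda>z. cnj c * bimonom \<beta> \<alpha> z + cnj (f z))"
    by (intro bipoly.step) auto
  then show ?case by (simp add: bimonom_def mult.commute)
qed (simp add: bipoly.zero)

lemma bipoly_const: "Q (\<lambda>_. 0) (\<lambda>_. 0) \<Longrightarrow> bipoly Q (\<lambda>z. c)"
  using bipoly_scale[OF bipoly_bimonom[of Q "\<lambda>_. 0" "\<lambda>_. 0"], of c] by (simp add: bimonom_def)

definition unit_index :: "'n \<Rightarrow> 'n \<Rightarrow> nat" where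
  "unit_index j = (\<lambda>i. if i = j then 1 else 0)"

lemma zmonom_unit_index [simp]: "zmonom (unit_index j) z = z $ j"
proof -
  have "zmonom (unit_index j) z = (\<Prod>i\<in>UNIV. if i = j then z $ i else 1)"
    unfolding zmonom_def unit_index_def by (intro prod.cong) auto
  then show ?thesis by (simp add: prod.delta)
qed

lemma wlen_unit_index [simp]: "wlen m (unit_index j) = m j"
proof -
  have "wlen m (unit_index j) = (\<Sum>i\<in>UNIV. if i = j then m i else 0)"
    unfolding wlen_def unit_index_def by (intro sum.cong) auto
  then show ?thesis by (simp add: sum.delta)
qed

lemma wlen_zero [simp]: "wlen m (\<lambda>_. 0) = 0"
  by (simp add: wlen_def)

lemma wlen_add: "wlen m (\<lambda>j. \<alpha> j + \<beta> j) = wlen m \<alpha> + wlen m \<beta>"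
  by (simp add: wlen_def algebra_simps sum.distrib)

lemma wlen_dec: "\<alpha> i > 0 \<Longrightarrow> wlen m (\<alpha>(i := \<alpha> i - 1)) = wlen m \<alpha> - m i"
proof -
  assume a: "\<alpha> i > 0"
  then have "\<alpha> = (\<lambda>j. (\<alpha>(i := \<alpha> i - 1)) j + unit_index i j)"
    by (auto simp: unit_index_def fun_eq_iff)
  then have "wlen m \<alpha> = wlen m (\<alpha>(i := \<alpha> i - 1)) + m i"
    by (metis wlen_add wlen_unit_index)
  then show ?thesis by simp
qed

lemma bipoly_coord: "Q (unit_index j) (\<lambda>_. 0) \<Longrightarrow> bipoly Q (\<lambda>z. z $ j)"
  using bipoly_bimonom[of Q "unit_index j" "\<lambda>_. 0"] by (simp add: bimonom_def[abs_def])

lemma zmonom_induct: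
  assumes "R (\<lambda>z. 1)" "\<And>j. R (\<lambda>z::complex^'n::finite. z $ j)"
    and "\<And>f g. R f \<Longrightarrow> R g \<Longrightarrow> R (\<lambda>z. f z * g z)"
  shows "R (zmonom \<alpha>)"
proof -
  have pw: "R (\<lambda>z. (z $ j) ^ k)" for j k
    by (induction k) (auto intro: assms)
  have "R (\<lambda>z. \<Prod>j\<in>I. (z $ j) ^ \<alpha> j)" if "finite I" for I
    using that by induction (auto intro: assms pw)
  from this[of UNIV] show ?thesis by (simp add: zmonom_def[abs_def])
qed

text \<open>Properties that survive ring operations are checked on constants and coordinates only.
  The \<open>anypoly\<close> assumptions in the last two cases supply differentiability of the
  operands.\<close>

lemma bipoly_ring_induct [consumes 1, case_names const coord cnj_coord add mult]:
  fixes f :: "complex^'n::finite \<Rightarrow> complex"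
  assumes "bipoly Q f"
    and const: "\<And>c. R (\<lambda>z. c)" and coord: "\<And>j. R (\<lambda>z. z $ j)" and ccoord: "\<And>j. R (\<lambda>z. cnj (z $ j))"
    and add: "\<And>f g. anypoly f \<Longrightarrow> anypoly g \<Longrightarrow> R f \<Longrightarrow> R g \<Longrightarrow> R (\<lambda>z. f z + g z)"
    and mult: "\<And>f g. anypoly f \<Longrightarrow> anypoly g \<Longrightarrow> R f \<Longrightarrow> R g \<Longrightarrow> R (\<lambda>z. f z * g z)"
  shows "R f"
proof -
  have 1: "anypoly (\<lambda>z. z $ j)" "anypoly (\<lambda>z. cnj (z $ j))" "anypoly (\<lambda>z. c)" for j and c
    using bipoly_coord[of "\<lambda>_ _. True" j] bipoly_cnj[of "\<lambda>_ _. True"]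
    by (auto intro: bipoly_const)
  have "anypoly (zmonom \<alpha>) \<and> R (zmonom \<alpha>)" for \<alpha>
    by (rule zmonom_induct) (auto intro: const coord mult 1 anypoly_mult)
  moreover have "anypoly (\<lambda>z. cnj (zmonom \<alpha> z)) \<and> R (\<lambda>z. cnj (zmonom \<alpha> z))" for \<alpha>
    by (rule zmonom_induct[where R="\<lambda>f. anypoly (\<lambda>z. cnj (f z)) \<and> R (\<lambda>z. cnj (f z))"])
       (auto intro: const ccoord mult 1 anypoly_mult)
  ultimately have *: "R (bimonom \<alpha> \<beta>)" "anypoly (bimonom \<alpha> \<beta>)" for \<alpha> \<beta>
    unfolding bimonom_def[abs_def] by (auto intro: mult anypoly_mult)
  have "anypoly f \<and> R f" using assms(1)
    by induction (auto intro!: const add mult * 1 anypoly_mult bipoly_add)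
  then show ?thesis ..
qed

lemma bipoly_split:
  assumes "bipoly Q f"
  shows "\<exists>g h. bipoly (\<lambda>\<alpha> \<beta>. Q \<alpha> \<beta> \<and> R \<alpha> \<beta>) g \<and> bipoly (\<lambda>\<alpha> \<beta>. Q \<alpha> \<beta> \<and> \<not> R \<alpha> \<beta>) h \<and>
           f = (\<lambda>z. g z + h z)"
  using assms
proof induction
  case zero
  show ?case by (rule exI[of _ "\<lambda>z. 0"], rule exI[of _ "\<lambda>z. 0"]) (simp add: bipoly.zero)
next
  case (step f \<alpha> \<beta> c)
  then obtain g h where gh: "bipoly (\<lambda>\<alpha> \<beta>. Q \<alpha> \<beta> \<and> R \<alpha> \<beta>) g"
    "bipoly (\<lambda>\<alpha> \<beta>. Q \<alpha> \<beta> \<and> \<not> R \<alpha> \<beta>) h" "f = (\<lambda>z. g z + h z)" by blast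
  show ?case
  proof (cases "R \<alpha> \<beta>")
    case True
    then have "bipoly (\<lambda>\<alpha> \<beta>. Q \<alpha> \<beta> \<and> R \<alpha> \<beta>) (\<lambda>z. c * bimonom \<alpha> \<beta> z + g z)"
      using gh step by (intro bipoly.step) auto
    with gh show ?thesis
      by (intro exI[of _ "\<lambda>z. c * bimonom \<alpha> \<beta> z + g z"] exI[of _ h]) auto
  next
    case False
    then have "bipoly (\<lambda>\<alpha> \<beta>. Q \<alpha> \<beta> \<and> \<not> R \<alpha> \<beta>) (\<lambda>z. c * bimonom \<alpha> \<beta> z + h z)"
      using gh step by (intro bipoly.step) auto
    with gh show ?thesis
      by (intro exI[of _ g] exI[of _ "\<lambda>z. c * bimonom \<alpha> \<beta> z + h z"]) auto
  qed
qed

text \<open>Bridge to \<open>poly_rep\<close>, which speaks of coefficient functions.\<close>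

lemma bipoly_iff_coeffs:
  "bipoly Q f \<longleftrightarrow> (\<exists>A. finite {(\<alpha>, \<beta>). A \<alpha> \<beta> \<noteq> 0} \<and> (\<forall>\<alpha> \<beta>. A \<alpha> \<beta> \<noteq> 0 \<longrightarrow> Q \<alpha> \<beta>) \<and>
     (\<forall>z. f z = (\<Sum>(\<alpha>, \<beta>)\<in>{(\<alpha>, \<beta>). A \<alpha> \<beta> \<noteq> 0}. A \<alpha> \<beta> * bimonom \<alpha> \<beta> z)))"
  (is "_ \<longleftrightarrow> (\<exists>A. ?C A f)")
proof
  assume "bipoly Q f"
  then show "\<exists>A. ?C A f"
  proof induction
    case zero
    show ?case by (rule exI[of _ "\<lambda>_ _. 0"]) simp
  next
    case (step f a b c)
    then obtain A where A: "?C A f" by blast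
    define B where "B = A(a := (A a)(b := A a b + c))"
    let ?S = "{(\<alpha>, \<beta>). A \<alpha> \<beta> \<noteq> 0}" and ?T = "{(\<alpha>, \<beta>). B \<alpha> \<beta> \<noteq> 0}"
    have fin: "finite (insert (a, b) ?S)" using A by simp
    \<comment> \<open>Adding \<open>c\<close> may cancel the old coefficient, so the new support can
      be smaller than \<open>insert (a, b) ?S\<close>.\<close>
    have Tsub: "?T \<subseteq> insert (a, b) ?S" by (auto simp: B_def split: if_splits)
    have "c * bimonom a b z + f z = (\<Sum>(\<alpha>, \<beta>)\<in>?T. B \<alpha> \<beta> * bimonom \<alpha> \<beta> z)" for z
    proof -
      have "(\<Sum>(\<alpha>, \<beta>)\<in>?T. B \<alpha> \<beta> * bimonom \<alpha> \<beta> z) =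
            (\<Sum>(\<alpha>, \<beta>)\<in>insert (a, b) ?S. B \<alpha> \<beta> * bimonom \<alpha> \<beta> z)"
        by (rule sum.mono_neutral_left[OF fin Tsub]) auto
      also have "\<dots> = (\<Sum>(\<alpha>, \<beta>)\<in>insert (a, b) ?S. A \<alpha> \<beta> * bimonom \<alpha> \<beta> z +
                          (if (\<alpha>, \<beta>) = (a, b) then c * bimonom a b z else 0))"
        by (intro sum.cong) (auto simp: B_def algebra_simps)
      also have "\<dots> = (\<Sum>(\<alpha>, \<beta>)\<in>insert (a, b) ?S. A \<alpha> \<beta> * bimonom \<alpha> \<beta> z) +
          (\<Sum>p\<in>insert (a, b) ?S. if p = (a, b) then c * bimonom a b z else 0)"
        unfolding sum.distrib[symmetric] by (intro sum.cong refl) (auto split: prod.splits if_splits)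
      also have "(\<Sum>p\<in>insert (a, b) ?S. if p = (a, b) then c * bimonom a b z else 0) = c * bimonom a b z"
        using fin by (subst sum.delta) auto
      also have "(\<Sum>(\<alpha>, \<beta>)\<in>insert (a, b) ?S. A \<alpha> \<beta> * bimonom \<alpha> \<beta> z) = f z"
        using A by (subst sum.mono_neutral_right[OF fin, of ?S]) auto
      finally show ?thesis by simp
    qed
    moreover have "finite ?T" using Tsub fin by (rule finite_subset)
    moreover have "\<forall>\<alpha> \<beta>. B \<alpha> \<beta> \<noteq> 0 \<longrightarrow> Q \<alpha> \<beta>" using A step by (auto simp: B_def)
    ultimately show ?case by blast
  qed
next
  assume "\<exists>A. ?C A f"
  then obtain A where A: "?C A f" by blast
  have "bipoly Q (\<lambda>z. \<Sum>(\<alpha>, \<beta>)\<in>{(\<alpha>, \<beta>). A \<alpha> \<beta> \<noteq> 0}. A \<alpha> \<beta> * bimonom \<alpha> \<beta> z)"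
    unfolding case_prod_unfold by (rule bipoly_sum) (use A in \<open>auto intro: bipoly_scale bipoly_bimonom\<close>)
  with A show "bipoly Q f" by (metis (no_types, lifting) ext)
qed

lemma poly_rep_imp_bipoly:
  assumes "poly_rep A P" "\<And>\<alpha> \<beta>. A \<alpha> \<beta> \<noteq> 0 \<Longrightarrow> Q \<alpha> \<beta>"
  shows "bipoly Q (\<lambda>z. complex_of_real (P z))"
  unfolding bipoly_iff_coeffs using assms unfolding poly_rep_def bimonom_def
  by (intro exI[of _ A]) (auto simp: mult.assoc)

lemma bipoly_imp_poly_rep:
  assumes "bipoly Q (\<lambda>z. complex_of_real (P z))"
  shows "\<exists>A. poly_rep A P \<and> (\<forall>\<alpha> \<beta>. A \<alpha> \<beta> \<noteq> 0 \<longrightarrow> Q \<alpha> \<beta>)"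
  using assms unfolding bipoly_iff_coeffs poly_rep_def bimonom_def by (auto simp: mult.assoc)

text \<open>Restriction to real lines reduces vanishing questions to univariate polynomials with
  infinitely many roots.\<close>

lemma bipoly_line:
  fixes f :: "complex^'n::finite \<Rightarrow> complex"
  assumes "bipoly Q f"
  shows "\<exists>p. \<forall>t::real. f (z + t *\<^sub>R v) = poly p (of_real t)"
  using assms
proof (induction rule: bipoly_ring_induct)
  case (const c)
  show ?case by (rule exI[of _ "[:c:]"]) simp
next
  case (coord j)
  show ?case by (rule exI[of _ "[:z $ j, v $ j:]"]) (simp add: scaleR_conv_of_real[where 'a=complex])
next
  case (cnj_coord j)
  show ?case by (rule exI[of _ "[:cnj (z $ j), cnj (v $ j):]"]) (simp add: scaleR_conv_of_real[where 'a=complex])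
next
  case (add f g)
  then show ?case by (metis poly_add)
next
  case (mult f g)
  then show ?case by (metis poly_mult)
qed

text \<open>On the line from \<open>z\<close> to \<open>z0\<close> the product of two univariate
  polynomials vanishes at all real points, and the first factor is nonzero because its value at 1 is
  \<open>f z0\<close>.\<close>

lemma bipoly_no_zero_divisors:
  fixes f :: "complex^'n::finite \<Rightarrow> complex"
  assumes "bipoly Q f" "bipoly R g" "\<And>z. f z * g z = 0" "f z0 \<noteq> 0"
  shows "g z = 0"
proof -
  obtain p where p: "\<And>t::real. f (z + t *\<^sub>R (z0 - z)) = poly p (of_real t)"
    using bipoly_line[OF assms(1)] by meson
  obtain q where q: "\<And>t::real. g (z + t *\<^sub>R (z0 - z)) = poly q (of_real t)"
    using bipoly_line[OF assms(2)] by meson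
  have "poly p 1 \<noteq> 0" using p[of 1] assms(4) by simp
  then have "p \<noteq> 0" by auto
  have "poly (p * q) (of_real t) = 0" for t :: real
    using p[of t] q[of t] assms(3)[of "z + t *\<^sub>R (z0 - z)"] by simp
  then have "range complex_of_real \<subseteq> {x. poly (p * q) x = 0}" by auto
  moreover have "infinite (range complex_of_real)"
    using inj_of_real finite_imageD infinite_UNIV_char_0 by blast
  ultimately have "p * q = 0" by (metis poly_roots_finite infinite_super)
  with \<open>p \<noteq> 0\<close> have "q = 0" by simp
  with q[of 0] show ?thesis by simp
qed

subsection \<open>Wirtinger derivatives along vector fields\<close>

text \<open>In coordinates this is the sum of \<open>a_j df/dz_j\<close>, and \<open>dbar\<close> is
  the sum of \<open>cnj a_j df/dzbar_j\<close>. Both are written through the real derivative, so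
  that the rules of \<open>has_derivative\<close> apply.\<close>

definition dhol :: "(complex^'n::finite \<Rightarrow> complex^'n) \<Rightarrow> (complex^'n \<Rightarrow> complex) \<Rightarrow> complex^'n \<Rightarrow> complex" where
  "dhol a f z = (frechet_derivative f (at z) (a z) - \<i> * frechet_derivative f (at z) (\<i> *s a z)) / 2"

definition dbar :: "(complex^'n::finite \<Rightarrow> complex^'n) \<Rightarrow> (complex^'n \<Rightarrow> complex) \<Rightarrow> complex^'n \<Rightarrow> complex" where
  "dbar a f z = (frechet_derivative f (at z) (a z) + \<i> * frechet_derivative f (at z) (\<i> *s a z)) / 2"

lemma dhol_eqI:
  "(f has_derivative D) (at z) \<Longrightarrow> dhol a f z = (D (a z) - \<i> * D (\<i> *s a z)) / 2"
  "(f has_derivative D) (at z) \<Longrightarrow> dbar a f z = (D (a z) + \<i> * D (\<i> *s a z)) / 2"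
  by (simp_all add: dhol_def dbar_def frechet_derivative_at[symmetric])

lemma bipoly_differentiable:
  fixes f :: "complex^'n::finite \<Rightarrow> complex"
  assumes "bipoly Q f"
  shows "f differentiable (at z)"
  using assms
proof (induction rule: bipoly_ring_induct)
  case (coord j)
  show ?case by (rule bounded_linear_imp_differentiable[OF bounded_linear_vec_nth])
next
  case (cnj_coord j)
  show ?case
    by (rule bounded_linear_imp_differentiable)
       (rule bounded_linear_compose[OF bounded_linear_cnj bounded_linear_vec_nth])
qed auto

lemma bipoly_has_derivative:
  "bipoly Q f \<Longrightarrow> (f has_derivative frechet_derivative f (at z)) (at z)"
  using bipoly_differentiable frechet_derivative_works by blast

lemma dhol_add_dbar: "dhol a f z + dbar a f z = frechet_derivative f (at z) (a z)"
  by (simp add: dhol_def dbar_def field_simps)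

lemma
  assumes "f differentiable (at z)" "g differentiable (at z)"
  shows dhol_add: "dhol a (\<lambda>z. f z + g z) z = dhol a f z + dhol a g z"
    and dbar_add: "dbar a (\<lambda>z. f z + g z) z = dbar a f z + dbar a g z"
    and dhol_mult: "dhol a (\<lambda>z. f z * g z) z = dhol a f z * g z + f z * dhol a g z"
    and dbar_mult: "dbar a (\<lambda>z. f z * g z) z = dbar a f z * g z + f z * dbar a g z"
proof -
  note d = assms[unfolded frechet_derivative_works]
  note da = has_derivative_add[OF d] and dm = has_derivative_mult[OF d]
  show "dhol a (\<lambda>z. f z + g z) z = dhol a f z + dhol a g z"
    unfolding dhol_eqI(1)[OF da] by (simp add: dhol_def field_simps)
  show "dbar a (\<lambda>z. f z + g z) z = dbar a f z + dbar a g z"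
    unfolding dhol_eqI(2)[OF da] by (simp add: dbar_def field_simps)
  show "dhol a (\<lambda>z. f z * g z) z = dhol a f z * g z + f z * dhol a g z"
    unfolding dhol_eqI(1)[OF dm] by (simp add: dhol_def field_simps)
  show "dbar a (\<lambda>z. f z * g z) z = dbar a f z * g z + f z * dbar a g z"
    unfolding dhol_eqI(2)[OF dm] by (simp add: dbar_def field_simps)
qed

lemma dhol_const [simp]: "dhol a (\<lambda>z. c) z = 0" "dbar a (\<lambda>z. c) z = 0"
  by (simp_all add: dhol_def dbar_def)

lemma
  assumes "f differentiable (at z)"
  shows dhol_scale: "dhol a (\<lambda>z. c * f z) z = c * dhol a f z"
    and dbar_scale: "dbar a (\<lambda>z. c * f z) z = c * dbar a f z"
  using dhol_mult[OF _ assms, of "\<lambda>z. c" a] dbar_mult[OF _ assms, of "\<lambda>z. c" a] by simp_all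

lemma dhol_coord [simp]: "dhol a (\<lambda>z. z $ j) z = a z $ j" "dbar a (\<lambda>z. z $ j) z = 0"
  by (simp_all add: dhol_eqI[OF bounded_linear_imp_has_derivative[OF bounded_linear_vec_nth]] mult.assoc[symmetric])

lemma
  assumes "f differentiable (at z)"
  shows dhol_cnj: "dhol a (\<lambda>z. cnj (f z)) z = cnj (dbar a f z)"
    and dbar_cnj: "dbar a (\<lambda>z. cnj (f z)) z = cnj (dhol a f z)"
proof -
  have "((\<lambda>z. cnj (f z)) has_derivative (\<lambda>v. cnj (frechet_derivative f (at z) v))) (at z)"
    by (rule bounded_linear.has_derivative[OF bounded_linear_cnj])
       (use assms frechet_derivative_works in blast)
  from dhol_eqI[OF this, of a] show "dhol a (\<lambda>z. cnj (f z)) z = cnj (dbar a f z)"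
    "dbar a (\<lambda>z. cnj (f z)) z = cnj (dhol a f z)" by (simp_all add: dhol_def dbar_def)
qed

lemma dhol_cnj_coord [simp]: "dhol a (\<lambda>z. cnj (z $ j)) z = 0" "dbar a (\<lambda>z. cnj (z $ j)) z = cnj (a z $ j)"
  using dhol_cnj[of "\<lambda>z. z $ j" z a] dbar_cnj[of "\<lambda>z. z $ j" z a]
    bounded_linear_imp_differentiable[OF bounded_linear_vec_nth, of j "at z"] by auto

text \<open>The (1,0) part is complex linear in the field although the real derivative is only real
  linear: split \<open>h z\<close> into real and imaginary part and use
  \<open>\<i> * \<i> = -1\<close>.\<close>

lemma dhol_field_scale:
  assumes "f differentiable (at z)"
  shows "dhol (\<lambda>z. h z *s a z) f z = h z * dhol a f z"
proof -
  define D where "D = frechet_derivative f (at z)"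
  have D: "(f has_derivative D) (at z)"
    using assms unfolding D_def frechet_derivative_works .
  interpret bounded_linear D using D by (rule has_derivative_bounded_linear)
  have *: "c *s v = Re c *\<^sub>R v + Im c *\<^sub>R (\<i> *s v)" for c and v :: "complex^'a"
    by (simp add: vec_eq_iff scaleR_conv_of_real[where 'a=complex] complex_eq_iff)
  have **: "\<i> *s (\<i> *s v) = - v" for v :: "complex^'a"
    by (simp add: vec_eq_iff mult.assoc[symmetric])
  have "D (h z *s a z) = Re (h z) *\<^sub>R D (a z) + Im (h z) *\<^sub>R D (\<i> *s a z)"
    by (subst *) (simp add: add scaleR)
  moreover have "D (\<i> *s (h z *s a z)) = Re (h z) *\<^sub>R D (\<i> *s a z) - Im (h z) *\<^sub>R D (a z)"
  proof -
    have "\<i> *s (h z *s a z) = h z *s (\<i> *s a z)" by (simp add: vec_eq_iff)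
    also have "\<dots> = Re (h z) *\<^sub>R (\<i> *s a z) - Im (h z) *\<^sub>R a z"
      by (subst *) (simp add: **)
    finally show ?thesis by (simp add: diff scaleR)
  qed
  ultimately show ?thesis
    by (simp add: dhol_def D_def[symmetric] complex_eq_iff field_simps)
qed

lemma zmonom_has_derivative:
  "(zmonom \<alpha> has_derivative (\<lambda>v. \<Sum>i\<in>UNIV. of_nat (\<alpha> i) * zmonom (\<alpha>(i := \<alpha> i - 1)) z * v $ i)) (at z)"
proof -
  have c: "((\<lambda>z::complex^'a. (z $ i) ^ \<alpha> i) has_derivative (\<lambda>v. of_nat (\<alpha> i) * v $ i * (z $ i) ^ (\<alpha> i - 1))) (at z)" for i
    by (rule has_derivative_power[OF bounded_linear_imp_has_derivative[OF bounded_linear_vec_nth]])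
  have "(zmonom \<alpha> has_derivative (\<lambda>v. \<Sum>i\<in>UNIV. (of_nat (\<alpha> i) * v $ i * (z $ i) ^ (\<alpha> i - 1)) *
        (\<Prod>j\<in>UNIV - {i}. (z $ j) ^ \<alpha> j))) (at z)"
    unfolding zmonom_def[abs_def] by (rule has_derivative_prod[OF c])
  moreover have "zmonom (\<alpha>(i := \<alpha> i - 1)) z = (z $ i) ^ (\<alpha> i - 1) * (\<Prod>j\<in>UNIV - {i}. (z $ j) ^ \<alpha> j)" for i
    unfolding zmonom_def by (subst prod.remove[of _ i]) (auto intro: prod.cong)
  ultimately show ?thesis by (simp add: mult_ac)
qed

lemma
  shows dhol_bimonom: "dhol a (bimonom \<alpha> \<beta>) z =
      (\<Sum>i\<in>UNIV. of_nat (\<alpha> i) * (a z $ i * bimonom (\<alpha>(i := \<alpha> i - 1)) \<beta> z))" (is ?th1)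
    and dhol_zmonom: "dhol a (zmonom \<alpha>) z =
      (\<Sum>i\<in>UNIV. of_nat (\<alpha> i) * (a z $ i * zmonom (\<alpha>(i := \<alpha> i - 1)) z))" (is ?th2)
    and dbar_zmonom: "dbar a (zmonom \<alpha>) z = 0" (is ?th3)
proof -
  have d: "zmonom \<gamma> differentiable (at z)" for \<gamma> :: "'a \<Rightarrow> nat"
    using zmonom_has_derivative by (rule differentiableI)
  show 2: ?th2
    by (simp add: dhol_eqI[OF zmonom_has_derivative] sum_distrib_left sum_divide_distrib
        sum_subtractf[symmetric] mult_ac)
  have 3: "dbar a (zmonom \<gamma>) z = 0" for \<gamma>
    by (simp add: dhol_eqI[OF zmonom_has_derivative] sum_distrib_left sum.distrib[symmetric] field_simps)
  show ?th3 by (rule 3)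
  have "(\<lambda>z. cnj (zmonom \<beta> z)) differentiable (at z)"
    by (rule differentiableI, rule bounded_linear.has_derivative[OF bounded_linear_cnj zmonom_has_derivative])
  then show ?th1
    unfolding bimonom_def[abs_def]
    by (subst dhol_mult) (simp_all add: d dhol_cnj 2 3 sum_distrib_left sum_distrib_right mult_ac)
qed

text \<open>Differentiation removes one factor \<open>z_j\<close> and multiplies by a monomial of
  the j-th component of the field; \<open>R\<close> has to admit every exponent pair so
  produced.\<close>

lemma bipoly_dhol:
  assumes "bipoly Q f" "\<And>j. bipoly (Qa j) (\<lambda>z. a z $ j)"
    and "\<And>\<alpha> \<beta> j \<alpha>' \<beta>'. Q \<alpha> \<beta> \<Longrightarrow> \<alpha> j > 0 \<Longrightarrow> Qa j \<alpha>' \<beta>' \<Longrightarrow>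
           R (\<lambda>i. \<alpha>' i + (\<alpha>(j := \<alpha> j - 1)) i) (\<lambda>i. \<beta>' i + \<beta> i)"
  shows "bipoly R (dhol a f)"
  using assms(1)
proof induction
  case zero
  then show ?case by (simp add: bipoly.zero dhol_def[abs_def])
next
  case (step f \<alpha> \<beta> c)
  have d: "bimonom \<alpha> \<beta> differentiable (at z)" for z
    by (rule bipoly_differentiable[OF bipoly_bimonom[of "\<lambda>_ _. True"]]) simp
  have *: "bipoly R (\<lambda>z. of_nat (\<alpha> i) * (a z $ i * bimonom (\<alpha>(i := \<alpha> i - 1)) \<beta> z))" for i
  proof (cases "\<alpha> i > 0")
    case True
    show ?thesis
      by (rule bipoly_scale, rule bipoly_mult[OF assms(2) bipoly_bimonom[where Q="\<lambda>\<alpha>' \<beta>'. \<alpha>' = \<alpha>(i := \<alpha> i - 1) \<and> \<beta>' = \<beta>"]])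
         (use True step assms(3) in auto)
  qed (simp add: bipoly.zero)
  have "bipoly R (\<lambda>z. c * dhol a (bimonom \<alpha> \<beta>) z + dhol a f z)"
    by (intro bipoly_add bipoly_scale step.IH) (unfold dhol_bimonom[abs_def], rule bipoly_sum, rule *)
  moreover have "dhol a (\<lambda>z. c * bimonom \<alpha> \<beta> z + f z) = (\<lambda>z. c * dhol a (bimonom \<alpha> \<beta>) z + dhol a f z)"
    by (rule ext) (simp add: dhol_add dhol_scale differentiable_mult d bipoly_differentiable[OF step.hyps(1)])
  ultimately show ?case by simp
qed

lemma anypoly_dhol: "anypoly f \<Longrightarrow> (\<And>j. anypoly (\<lambda>z. a z $ j)) \<Longrightarrow> anypoly (dhol a f)"
  by (erule bipoly_dhol) auto

lemma dbar_conv_dhol: "f differentiable (at z) \<Longrightarrow> dbar a f z = cnj (dhol a (\<lambda>z. cnj (f z)) z)"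
  by (simp add: dhol_cnj)

lemma bipoly_dbar:
  assumes "bipoly Q f" "\<And>j. bipoly (Qa j) (\<lambda>z. a z $ j)"
    and "\<And>\<alpha> \<beta> j \<alpha>' \<beta>'. Q \<alpha> \<beta> \<Longrightarrow> \<beta> j > 0 \<Longrightarrow> Qa j \<alpha>' \<beta>' \<Longrightarrow>
           R (\<lambda>i. \<beta>' i + \<alpha> i) (\<lambda>i. \<alpha>' i + (\<beta>(j := \<beta> j - 1)) i)"
  shows "bipoly R (dbar a f)"
proof -
  have "bipoly (\<lambda>\<alpha> \<beta>. R \<beta> \<alpha>) (dhol a (\<lambda>z. cnj (f z)))"
    by (rule bipoly_dhol[OF bipoly_cnj[OF assms(1)] assms(2)]) (use assms(3) in auto)
  from bipoly_cnj[OF this] have "bipoly R (\<lambda>z. cnj (dhol a (\<lambda>z. cnj (f z)) z))" .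
  then show ?thesis
    using dbar_conv_dhol[OF bipoly_differentiable[OF assms(1)]] by presburger
qed

lemma anypoly_dbar: "anypoly f \<Longrightarrow> (\<And>j. anypoly (\<lambda>z. a z $ j)) \<Longrightarrow> anypoly (dbar a f)"
  by (erule bipoly_dbar) auto

lemma hpoly_dbar:
  assumes "hpoly Q f"
  shows "dbar a f z = 0"
  using assms
proof induction
  case (step f \<alpha> \<beta> c)
  then have *: "bimonom \<alpha> \<beta> = zmonom \<alpha>" by (simp add: bimonom_def[abs_def])
  have d: "zmonom \<alpha> differentiable (at z)"
    using zmonom_has_derivative by (rule differentiableI)
  show ?case
    by (simp add: * dbar_add dbar_scale d dbar_zmonom bipoly_differentiable[OF step.hyps(1)] step.IH)
qed simp

lemma hpoly_dhol:
  assumes "hpoly Q f"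
  shows "dhol a f z = frechet_derivative f (at z) (a z)"
    and "frechet_derivative f (at z) (c *s v) = c * frechet_derivative f (at z) v"
proof -
  show 1: "dhol a f z = frechet_derivative f (at z) (a z)" for a
    using dhol_add_dbar[of a f z] hpoly_dbar[OF assms] by simp
  show "frechet_derivative f (at z) (c *s v) = c * frechet_derivative f (at z) v"
    using dhol_field_scale[OF bipoly_differentiable[OF assms], of "\<lambda>_. c" "\<lambda>_. v" z] by (simp add: 1)
qed

text \<open>On each ray from 0 the function is a univariate polynomial that vanishes on an interval,
  hence also at parameter 1.\<close>

lemma bipoly_eventually_zero:
  fixes f :: "complex^'n::finite \<Rightarrow> complex"
  assumes "bipoly Q f" "\<forall>\<^sub>F z in nhds 0. f z = 0"
  shows "f z = 0"
proof -
  obtain p where p: "\<And>t::real. f (0 + t *\<^sub>R z) = poly p (of_real t)"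
    using bipoly_line[OF assms(1)] by meson
  have "((\<lambda>t::real. t *\<^sub>R z) \<longlongrightarrow> 0 *\<^sub>R z) (at_right 0)" by (intro tendsto_intros)
  then have "\<forall>\<^sub>F t in at_right (0::real). f (t *\<^sub>R z) = 0"
    using eventually_compose_filterlim[OF assms(2)] by simp
  then obtain e where e: "e > 0" "\<And>t. 0 < t \<Longrightarrow> t < e \<Longrightarrow> f (t *\<^sub>R z) = 0"
    by (auto simp: eventually_at_right_field)
  have "of_real ` {0<..<e} \<subseteq> {x. poly p x = 0}"
    using p e by auto
  moreover have "infinite (complex_of_real ` {0<..<e})"
    using e(1) by (simp add: finite_image_iff inj_on_def)
  ultimately have "p = 0" by (metis poly_roots_finite infinite_super)
  with p[of 1] show ?thesis by simp
qed

text \<open>Weighted dilation. With positive weights it moves every point towards the origin as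
  \<open>s\<close> tends to 0, which turns statements about germs into global ones.\<close>

definition dil :: "('n \<Rightarrow> real) \<Rightarrow> real \<Rightarrow> complex^'n \<Rightarrow> complex^'n::finite" where
  "dil m s z = (\<chi> j. of_real (s powr m j) * z $ j)"

lemma dil_nth [simp]: "dil m s z $ j = of_real (s powr m j) * z $ j"
  by (simp add: dil_def)

lemma zmonom_dil: "s > 0 \<Longrightarrow> zmonom \<alpha> (dil m s z) = of_real (s powr wlen m \<alpha>) * zmonom \<alpha> z"
proof -
  assume s: "s > 0"
  have "(\<Prod>j\<in>UNIV. (s powr m j) ^ \<alpha> j) = s powr wlen m \<alpha>"
    using s unfolding wlen_def by (subst powr_sum) (auto simp: powr_powr[symmetric] powr_realpow)
  then show ?thesis
    by (simp add: zmonom_def power_mult_distrib prod.distrib flip: of_real_power of_real_prod)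
qed

lemma bipoly_dil:
  assumes "bipoly (\<lambda>\<alpha> \<beta>. wlen m \<alpha> + wlen m \<beta> = k) f" "s > 0"
  shows "f (dil m s z) = of_real (s powr k) * f z"
  using assms(1)
proof induction
  case (step f \<alpha> \<beta> c)
  then show ?case
    using assms(2) by (auto simp: bimonom_def zmonom_dil powr_add algebra_simps)
qed simp

lemma hpoly_dil:
  assumes "hpoly (\<lambda>\<alpha>. wlen m \<alpha> = k) f" "s > 0"
  shows "f (dil m s z) = of_real (s powr k) * f z"
  by (rule bipoly_dil[OF bipoly_mono[OF assms(1)] assms(2)]) auto

lemma bipoly_zero_at_0:
  assumes "bipoly Q f" "\<not> Q (\<lambda>_. 0) (\<lambda>_. 0)"
  shows "f 0 = 0"
  using assms(1)
proof induction
  case (step f \<alpha> \<beta> c)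
  then have "\<alpha> \<noteq> (\<lambda>_. 0) \<or> \<beta> \<noteq> (\<lambda>_. 0)" using assms(2) by auto
  then have "bimonom \<alpha> \<beta> 0 = 0"
    by (auto simp: bimonom_def zmonom_def fun_eq_iff prod_zero_iff)
  with step show ?case by simp
qed simp

text \<open>A derivation is determined by its values on generators. It is applied to the difference
  of the two sides of an operator identity, which is a derivation even when the single sides are
  not.\<close>

lemma derivation_ext:
  fixes T :: "(complex^'n::finite \<Rightarrow> complex) \<Rightarrow> complex^'n \<Rightarrow> complex"
  assumes "\<And>f g. anypoly f \<Longrightarrow> anypoly g \<Longrightarrow> T (\<lambda>z. f z + g z) = (\<lambda>z. T f z + T g z)"
    and "\<And>f g. anypoly f \<Longrightarrow> anypoly g \<Longrightarrow> T (\<lambda>z. f z * g z) = (\<lambda>z. T f z * g z + f z * T g z)"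
    and "\<And>c. T (\<lambda>z. c) = (\<lambda>z. 0)"
    and "\<And>j. T (\<lambda>z. z $ j) = (\<lambda>z. 0)" "\<And>j. T (\<lambda>z. cnj (z $ j)) = (\<lambda>z. 0)"
    and "bipoly Q f"
  shows "T f = (\<lambda>z. 0)"
  using assms(6) by (induction rule: bipoly_ring_induct) (simp_all add: assms(1-5))

lemma
  assumes "anypoly f" "anypoly g"
  shows dhol_add_fun: "dhol a (\<lambda>z. f z + g z) = (\<lambda>z. dhol a f z + dhol a g z)"
    and dbar_add_fun: "dbar a (\<lambda>z. f z + g z) = (\<lambda>z. dbar a f z + dbar a g z)"
    and dhol_mult_fun: "dhol a (\<lambda>z. f z * g z) = (\<lambda>z. dhol a f z * g z + f z * dhol a g z)"
    and dbar_mult_fun: "dbar a (\<lambda>z. f z * g z) = (\<lambda>z. dbar a f z * g z + f z * dbar a g z)"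
  using assms[THEN bipoly_differentiable] by (simp_all add: dhol_add dbar_add dhol_mult dbar_mult fun_eq_iff)

lemma
  assumes "anypoly f"
  shows dhol_scale_fun: "dhol a (\<lambda>z. c * f z) = (\<lambda>z. c * dhol a f z)"
    and dbar_scale_fun: "dbar a (\<lambda>z. c * f z) = (\<lambda>z. c * dbar a f z)"
  using assms[THEN bipoly_differentiable] by (simp_all add: dhol_scale dbar_scale fun_eq_iff)

lemma dhol_diff_fun:
  assumes "anypoly f" "anypoly g"
  shows "dhol a (\<lambda>z. f z - g z) = (\<lambda>z. dhol a f z - dhol a g z)"
  using dhol_add_fun[OF assms(1) bipoly_minus[OF assms(2)], of a] dhol_scale_fun[OF assms(2), of a "-1"]
  by simp

lemma dbar_diff_fun:
  assumes "anypoly f" "anypoly g"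
  shows "dbar a (\<lambda>z. f z - g z) = (\<lambda>z. dbar a f z - dbar a g z)"
  using dbar_add_fun[OF assms(1) bipoly_minus[OF assms(2)], of a] dbar_scale_fun[OF assms(2), of a "-1"]
  by simp

lemma dhol_const_fun [simp]: "dhol a (\<lambda>z. c) = (\<lambda>z. 0)" "dbar a (\<lambda>z. c) = (\<lambda>z. 0)"
  by (simp_all add: fun_eq_iff)

lemma dhol_coord_fun:
  "dhol a (\<lambda>z. z $ j) = (\<lambda>z. a z $ j)" "dbar a (\<lambda>z. z $ j) = (\<lambda>z. 0)"
  "dhol a (\<lambda>z. cnj (z $ j)) = (\<lambda>z. 0)" "dbar a (\<lambda>z. cnj (z $ j)) = (\<lambda>z. cnj (a z $ j))"
  by (simp_all add: fun_eq_iff)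

lemma dhol_cnj_fun:
  assumes "anypoly f"
  shows "dhol a (\<lambda>z. cnj (f z)) = (\<lambda>z. cnj (dbar a f z))"
    and "dbar a (\<lambda>z. cnj (f z)) = (\<lambda>z. cnj (dhol a f z))"
  using bipoly_differentiable[OF assms] by (simp_all add: dhol_cnj dbar_cnj fun_eq_iff)

lemma hpoly_dbar_fun: "hpoly Q f \<Longrightarrow> dbar a f = (\<lambda>z. 0)"
  by (auto simp: hpoly_dbar)

lemma hpoly_any: "hpoly Q f \<Longrightarrow> anypoly f"
  by (rule bipoly_any)

lemma dhol_dbar_commute:
  fixes f :: "complex^'n::finite \<Rightarrow> complex"
  assumes a: "\<And>j. hpoly (Qa j) (\<lambda>z. a z $ j)" and b: "\<And>j. hpoly (Qb j) (\<lambda>z. b z $ j)"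
    and f: "anypoly f"
  shows "dhol a (dbar b f) = dbar b (dhol a f)"
proof -
  note ab = hpoly_any[OF a] hpoly_any[OF b]
  define T where "T f = (\<lambda>z. dhol a (dbar b f) z - dbar b (dhol a f) z)" for f
  note anys = anypoly_dhol[OF _ ab(1)] anypoly_dhol[OF _ ab(2)] anypoly_dbar[OF _ ab(1)] anypoly_dbar[OF _ ab(2)]
    anypoly_mult bipoly_add
  have bc: "dhol a (\<lambda>z. cnj (b z $ j)) = (\<lambda>z. 0)" for j
    by (simp add: dhol_cnj_fun[OF ab(2)] hpoly_dbar_fun[OF b])
  have "T f = (\<lambda>z. 0)"
    by (rule derivation_ext[where T=T, OF _ _ _ _ _ f])
       (simp_all only: T_def dhol_add_fun dbar_add_fun dhol_mult_fun dbar_mult_fun hpoly_dbar_fun[OF a]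
         anys dhol_coord_fun dhol_const_fun bc, simp_all add: fun_eq_iff algebra_simps)
  then show ?thesis by (simp add: T_def fun_eq_iff)
qed

text \<open>A commutator of derivations is a derivation, so it suffices to compare coordinates,
  where it gives the bracket of the fields. The term with \<open>k\<close> prepares the relation
  \<open>[a, b] = 2 \<gamma> b\<close>.\<close>

lemma dhol_bracket:
  fixes f :: "complex^'n::finite \<Rightarrow> complex"
  assumes a: "\<And>j. anypoly (\<lambda>z. a z $ j)" and b: "\<And>j. anypoly (\<lambda>z. b z $ j)"
    and f: "anypoly f"
    and c: "\<And>j z. c z $ j = dhol a (\<lambda>z. b z $ j) z - dhol b (\<lambda>z. a z $ j) z - k * b z $ j"
  shows "dhol c f z = dhol a (dhol b f) z - dhol b (dhol a f) z - k * dhol b f z"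
proof -
  define T where "T f = (\<lambda>z. dhol a (dhol b f) z - dhol b (dhol a f) z - k * dhol b f z - dhol c f z)" for f
  note anys = anypoly_dhol[OF _ a] anypoly_dhol[OF _ b] anypoly_mult bipoly_add
  have "T f = (\<lambda>z. 0)"
    by (rule derivation_ext[where T=T, OF _ _ _ _ _ f])
       (simp_all only: T_def dhol_add_fun dhol_mult_fun anys dhol_coord_fun dhol_const_fun,
         simp_all add: fun_eq_iff c algebra_simps)
  then show ?thesis by (simp add: T_def fun_eq_iff)
qed

subsection \<open>Generalized eigenvectors\<close>

definition lshift :: "(complex^'n::finite \<Rightarrow> complex^'n) \<Rightarrow> complex \<Rightarrow> (complex^'n \<Rightarrow> complex) \<Rightarrow> complex^'n \<Rightarrow> complex" where
  "lshift a l f = (\<lambda>z. dhol a f z - l * f z)"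

definition gen_eig :: "(complex^'n::finite \<Rightarrow> complex^'n) \<Rightarrow> complex \<Rightarrow> (complex^'n \<Rightarrow> complex) \<Rightarrow> bool" where
  "gen_eig a l f \<longleftrightarrow> anypoly f \<and> (\<exists>k. (lshift a l ^^ k) f = (\<lambda>z. 0))"

locale poly_field =
  fixes a :: "complex^'n::finite \<Rightarrow> complex^'n"
  assumes a: "\<And>j. anypoly (\<lambda>z. a z $ j)"
begin

lemma anypoly_lshift: "anypoly f \<Longrightarrow> anypoly (lshift a l f)"
  unfolding lshift_def by (intro bipoly_diff bipoly_scale anypoly_dhol a)

lemma lshift_zero [simp]: "lshift a l (\<lambda>z. 0) = (\<lambda>z. 0)"
  by (simp add: lshift_def)

lemma lshift_pow_zero [simp]: "(lshift a l ^^ k) (\<lambda>z. 0) = (\<lambda>z. 0)"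
  by (induction k) auto

lemma anypoly_lshift_pow: "anypoly f \<Longrightarrow> anypoly ((lshift a l ^^ k) f)"
  by (induction k) (auto intro: anypoly_lshift)

lemma lshift_add: "anypoly f \<Longrightarrow> anypoly g \<Longrightarrow> lshift a l (\<lambda>z. f z + g z) = (\<lambda>z. lshift a l f z + lshift a l g z)"
  by (simp add: lshift_def dhol_add_fun algebra_simps)

lemma lshift_scale: "anypoly f \<Longrightarrow> lshift a l (\<lambda>z. c * f z) = (\<lambda>z. c * lshift a l f z)"
  by (simp add: lshift_def dhol_scale_fun algebra_simps)

lemma lshift_pow_add: "anypoly f \<Longrightarrow> anypoly g \<Longrightarrow>
    (lshift a l ^^ k) (\<lambda>z. f z + g z) = (\<lambda>z. (lshift a l ^^ k) f z + (lshift a l ^^ k) g z)"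
  by (induction k) (simp_all add: lshift_add anypoly_lshift_pow)

lemma lshift_pow_scale: "anypoly f \<Longrightarrow>
    (lshift a l ^^ k) (\<lambda>z. c * f z) = (\<lambda>z. c * (lshift a l ^^ k) f z)"
  by (induction k) (simp_all add: lshift_scale anypoly_lshift_pow)

lemma lshift_pow_sum: "(\<And>i. i \<in> I \<Longrightarrow> anypoly (f i)) \<Longrightarrow>
    (lshift a l ^^ k) (\<lambda>z. \<Sum>i\<in>I. f i z) = (\<lambda>z. \<Sum>i\<in>I. (lshift a l ^^ k) (f i) z)"
  by (induction I rule: infinite_finite_induct) (simp_all add: lshift_pow_add bipoly_sum)

lemma lshift_commute: "anypoly f \<Longrightarrow> lshift a l (lshift a k f) = lshift a k (lshift a l f)"
  unfolding lshift_def
  by (simp add: dhol_diff_fun dhol_scale_fun anypoly_dhol a bipoly_scale algebra_simps)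

lemma lshift_pow_commute:
  "anypoly f \<Longrightarrow> lshift a l ((lshift a k ^^ n) f) = (lshift a k ^^ n) (lshift a l f)"
  by (induction n) (auto simp: lshift_commute anypoly_lshift_pow)

lemma lshift_pow_ge: "(lshift a l ^^ k) f = (\<lambda>z. 0) \<Longrightarrow> k \<le> n \<Longrightarrow> (lshift a l ^^ n) f = (\<lambda>z. 0)"
  by (auto simp: le_iff_add funpow_add add.commute[of k])

lemma gen_eigI: "anypoly f \<Longrightarrow> (lshift a l ^^ k) f = (\<lambda>z. 0) \<Longrightarrow> gen_eig a l f"
  by (auto simp: gen_eig_def)

lemma gen_eig_zero: "gen_eig a l (\<lambda>z. 0)"
  by (rule gen_eigI[where k=0]) (auto intro: bipoly.zero)

lemma gen_eig_add:
  assumes "gen_eig a l f" "gen_eig a l g"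
  shows "gen_eig a l (\<lambda>z. f z + g z)"
proof -
  from assms obtain i k where *: "anypoly f" "anypoly g"
      "(lshift a l ^^ i) f = (\<lambda>z. 0)" "(lshift a l ^^ k) g = (\<lambda>z. 0)"
    by (auto simp: gen_eig_def)
  have "(lshift a l ^^ max i k) f = (\<lambda>z. 0)" "(lshift a l ^^ max i k) g = (\<lambda>z. 0)"
    by (rule lshift_pow_ge[OF *(3)], simp, rule lshift_pow_ge[OF *(4)], simp)
  with * show ?thesis by (intro gen_eigI[where k="max i k"]) (auto simp: lshift_pow_add bipoly_add)
qed

lemma gen_eig_scale:
  assumes "gen_eig a l f"
  shows "gen_eig a l (\<lambda>z. c * f z)"
proof -
  from assms obtain k where "anypoly f" "(lshift a l ^^ k) f = (\<lambda>z. 0)" by (auto simp: gen_eig_def)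
  then show ?thesis by (intro gen_eigI[where k=k]) (auto simp: lshift_pow_scale bipoly_scale)
qed

lemma gen_eig_lshift:
  assumes "gen_eig a l f"
  shows "gen_eig a l (lshift a k f)"
proof -
  from assms obtain n where "anypoly f" "(lshift a l ^^ n) f = (\<lambda>z. 0)" by (auto simp: gen_eig_def)
  then show ?thesis by (intro gen_eigI[where k=n]) (auto simp: anypoly_lshift lshift_pow_commute[symmetric])
qed

text \<open>Leibniz rule: the shift by \<open>l + k\<close> of a product is the shifted first factor
  times the second plus the first times the shifted second. Induct on the sum of the two nilpotency
  orders.\<close>

lemma gen_eig_mult:
  assumes "gen_eig a l f" "gen_eig a k g"
  shows "gen_eig a (l + k) (\<lambda>z. f z * g z)"
proof -
  have *: "(lshift a l ^^ i) f = (\<lambda>z. 0) \<Longrightarrow> (lshift a k ^^ j) g = (\<lambda>z. 0) \<Longrightarrow> anypoly f \<Longrightarrow> anypoly g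
    \<Longrightarrow> (lshift a (l + k) ^^ (i + j)) (\<lambda>z. f z * g z) = (\<lambda>z. 0)" for i j f g
  proof (induction "i + j" arbitrary: i j f g)
    case (Suc n)
    show ?case
    proof (cases "i = 0 \<or> j = 0")
      case True
      then have "(\<lambda>z. f z * g z) = (\<lambda>z. 0)" using Suc.prems by (auto simp: fun_eq_iff)
      then show ?thesis by simp
    next
      case False
      then obtain i' j' where ij: "i = Suc i'" "j = Suc j'" by (meson not0_implies_Suc)
      have 1: "lshift a (l + k) (\<lambda>z. f z * g z) = (\<lambda>z. lshift a l f z * g z + f z * lshift a k g z)"
        using Suc.prems by (simp add: lshift_def dhol_mult_fun algebra_simps)
      have "(lshift a (l + k) ^^ (i' + j)) (\<lambda>z. lshift a l f z * g z) = (\<lambda>z. 0)"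
        by (rule Suc.hyps(1)) (use Suc ij in \<open>auto simp: funpow_Suc_right anypoly_lshift simp del: funpow.simps\<close>)
      moreover have "(lshift a (l + k) ^^ (i + j')) (\<lambda>z. f z * lshift a k g z) = (\<lambda>z. 0)"
        by (rule Suc.hyps(1)) (use Suc ij in \<open>auto simp: funpow_Suc_right anypoly_lshift simp del: funpow.simps\<close>)
      moreover have "(lshift a (l + k) ^^ (i + j)) (\<lambda>z. f z * g z) =
        (lshift a (l + k) ^^ n) (\<lambda>z. lshift a l f z * g z + f z * lshift a k g z)"
        using Suc(2) 1 by (simp add: funpow_Suc_right flip: Suc(2) del: funpow.simps)
      moreover have "i' + j = n" "i + j' = n" using Suc(2) ij by auto
      ultimately show ?thesis
        using Suc.prems by (simp add: lshift_pow_add anypoly_mult anypoly_lshift)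
    qed
  qed auto
  from assms obtain i j where ij: "anypoly f" "anypoly g"
      "(lshift a l ^^ i) f = (\<lambda>z. 0)" "(lshift a k ^^ j) g = (\<lambda>z. 0)"
    by (auto simp: gen_eig_def)
  show ?thesis by (rule gen_eigI[OF anypoly_mult[OF ij(1,2)] *[OF ij(3,4,1,2)]])
qed

text \<open>If the shift by \<open>k\<close> kills \<open>f\<close>, then the shift by
  \<open>l\<close> multiplies \<open>f\<close> by \<open>k - l\<close>, and no power of this nonzero
  number vanishes.\<close>

lemma gen_eig_injective:
  assumes "gen_eig a l f" "l \<noteq> k" "(lshift a k ^^ n) f = (\<lambda>z. 0)"
  shows "f = (\<lambda>z. 0)"
proof -
  have 1: "f = (\<lambda>z. 0)" if "gen_eig a l f" "lshift a k f = (\<lambda>z. 0)" for f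
  proof -
    have f: "anypoly f" using that by (simp add: gen_eig_def)
    have "lshift a l f = (\<lambda>z. (k - l) * f z)"
      using that(2) by (simp add: lshift_def fun_eq_iff algebra_simps)
    then have "(lshift a l ^^ m) f = (\<lambda>z. (k - l) ^ m * f z)" for m
    proof (induction m)
      case (Suc m)
      then show ?case using \<open>lshift a l f = _\<close> by (simp add: lshift_scale[OF f] mult.assoc power_Suc2 del: power_Suc)
    qed simp
    with that(1) \<open>l \<noteq> k\<close> show ?thesis by (auto simp: gen_eig_def fun_eq_iff)
  qed
  have g: "gen_eig a l ((lshift a k ^^ m) f)" for m
    by (induction m) (auto intro: gen_eig_lshift assms(1))
  show ?thesis using assms(3)
  proof (induction n)
    case (Suc n)
    then show ?case using 1[OF g[of n]] by simp
  qed simp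
qed

text \<open>A power of the shift by \<open>m\<close> that kills \<open>g m\<close> leaves a shorter
  vanishing sum, and by \<open>gen_eig_injective\<close> that power loses nothing on the other
  summands.\<close>

lemma gen_eig_independent:
  assumes "finite I" "\<And>l. l \<in> I \<Longrightarrow> gen_eig a l (g l)" "(\<lambda>z. \<Sum>l\<in>I. g l z) = (\<lambda>z. 0)" "l \<in> I"
  shows "g l = (\<lambda>z. 0)"
  using assms
proof (induction I arbitrary: g l rule: finite_induct)
  case (insert m I)
  obtain n where n: "(lshift a m ^^ n) (g m) = (\<lambda>z. 0)"
    using insert.prems(1)[of m] by (auto simp: gen_eig_def)
  have any: "anypoly (g i)" if "i \<in> insert m I" for i using insert.prems(1) that by (auto simp: gen_eig_def)
  have "(\<lambda>z. \<Sum>l\<in>insert m I. (lshift a m ^^ n) (g l) z) = (lshift a m ^^ n) (\<lambda>z. 0)"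
    unfolding insert.prems(2)[symmetric] using any by (intro lshift_pow_sum[symmetric]) auto
  then have "(\<lambda>z. \<Sum>l\<in>I. (lshift a m ^^ n) (g l) z) = (\<lambda>z. 0)"
    using insert.hyps n by (simp add: fun_eq_iff)
  moreover have "gen_eig a i ((lshift a m ^^ n) (g i))" if "i \<in> I" for i
    using that insert.prems(1)[of i] by (induction n) (auto intro: gen_eig_lshift)
  ultimately have "(lshift a m ^^ n) (g i) = (\<lambda>z. 0)" if "i \<in> I" for i
    using insert.IH[of "\<lambda>i. (lshift a m ^^ n) (g i)" i] that by blast
  then have gi: "g i = (\<lambda>z. 0)" if "i \<in> I" for i
    using gen_eig_injective[of i "g i" m n] insert.prems(1)[of i] insert.hyps that by auto
  then have "g m = (\<lambda>z. 0)" using insert.prems(2) insert.hyps by (simp add: fun_eq_iff)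
  with gi insert.prems show ?case by auto
qed simp

text \<open>On a generalized eigenspace the shift by a different number is a nonzero scalar plus a
  nilpotent map, hence invertible. \<open>V\<close> stands for an invariant subspace in which the
  solution has to stay.\<close>

lemma lshift_solve:
  assumes "gen_eig a l g" "l \<noteq> k" "V g"
    and V: "\<And>f i. V f \<Longrightarrow> V (lshift a i f)" "\<And>f c. V f \<Longrightarrow> V (\<lambda>z. c * f z)"
      "\<And>f g. V f \<Longrightarrow> V g \<Longrightarrow> V (\<lambda>z. f z + g z)"
  shows "\<exists>h. gen_eig a l h \<and> V h \<and> lshift a k h = g"
proof -
  have "\<exists>h. gen_eig a l h \<and> V h \<and> lshift a k h = g"
    if "(lshift a l ^^ n) g = (\<lambda>z. 0)" "anypoly g" "V g" for n g
    using that
  proof (induction n arbitrary: g)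
    case 0
    then show ?case by (intro exI[of _ g]) (auto simp: gen_eig_zero)
  next
    case (Suc n)
    then obtain h where h: "gen_eig a l h" "V h" "lshift a k h = lshift a l g"
      using Suc.IH[of "lshift a l g", OF _ anypoly_lshift V(1)]
      by (auto simp: funpow_Suc_right simp del: funpow.simps)
    \<comment> \<open>From \<open>lshift a k h = lshift a l g\<close> and
      \<open>lshift a k g = lshift a l g + (l - k) g\<close> one gets
      \<open>lshift a k (g - h) = (l - k) g\<close>.\<close>
    define c where "c = inverse (l - k)"
    have c: "c * (l - k) = 1" using assms(2) by (simp add: c_def)
    define h' where "h' = (\<lambda>z. c * g z + (- c) * h z)"
    have ag: "gen_eig a l g" by (rule gen_eigI[OF Suc.prems(2,1)])
    have "gen_eig a l h'" unfolding h'_def by (intro gen_eig_add gen_eig_scale ag h)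
    moreover have "V h'" unfolding h'_def by (intro V Suc.prems h)
    moreover have "lshift a k h' = g"
    proof
      fix z
      have ah: "anypoly h" using h by (simp add: gen_eig_def)
      have "lshift a k h' z = c * lshift a k g z - c * lshift a k h z"
        unfolding h'_def lshift_add[OF bipoly_scale[OF Suc.prems(2)] bipoly_scale[OF ah]]
          lshift_scale[OF Suc.prems(2)] lshift_scale[OF ah] by simp
      also have "\<dots> = (c * (l - k)) * g z" by (simp add: h(3)) (simp add: lshift_def algebra_simps)
      finally show "lshift a k h' z = g z" by (simp add: c)
    qed
    ultimately show ?case by blast
  qed
  with assms show ?thesis by (auto simp: gen_eig_def)
qed

text \<open>Split off a root \<open>r\<close> of the annihilating polynomial: the cofactor
  annihilates the shifted function, which is decomposed by induction. Its components with eigenvalue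
  other than \<open>r\<close> are pulled back with \<open>lshift_solve\<close>, and what remains
  belongs to \<open>r\<close>.\<close>

lemma gen_eig_decomposition:
  fixes V :: "(complex^'n \<Rightarrow> complex) \<Rightarrow> bool"
  assumes V: "\<And>f i. V f \<Longrightarrow> V (lshift a i f)" "\<And>f c. V f \<Longrightarrow> V (\<lambda>z. c * f z)"
      "\<And>f g. V f \<Longrightarrow> V g \<Longrightarrow> V (\<lambda>z. f z + g z)" "\<And>f. V f \<Longrightarrow> anypoly f"
    and p: "p \<noteq> 0" "V f" "degree p \<le> n" "(\<lambda>z. \<Sum>i\<le>n. coeff p i * (dhol a ^^ i) f z) = (\<lambda>z. 0)"
  shows "\<exists>I g. finite I \<and> (\<forall>l\<in>I. gen_eig a l (g l) \<and> V (g l)) \<and> f = (\<lambda>z. \<Sum>l\<in>I. g l z)"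
  using p
proof (induction "degree p" arbitrary: p f n)
  case 0
  then obtain c where c: "p = [:c:]" "c \<noteq> 0" by (metis degree_eq_zeroE pCons_eq_0_iff)
  have "c * f z = 0" for z
  proof -
    have "(\<Sum>i\<le>n. coeff p i * (dhol a ^^ i) f z) = (\<Sum>i\<in>{0}. coeff p i * (dhol a ^^ i) f z)"
      by (rule sum.mono_neutral_right) (auto simp: c coeff_pCons split: nat.splits)
    then show ?thesis using 0 c by (simp add: fun_eq_iff)
  qed
  then have "f = (\<lambda>z. 0)" using c by auto
  then show ?case by (intro exI[of _ "{}"]) auto
next
  case (Suc d)
  then have "\<not> constant (poly p)" by (simp add: constant_degree)
  then obtain r where "poly p r = 0" using fundamental_theorem_of_algebra by blast
  then obtain q where q: "p = [:- r, 1:] * q" by (auto simp: poly_eq_0_iff_dvd)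
  have q0: "q \<noteq> 0" using q Suc.prems by auto
  have dq: "degree p = Suc (degree q)" using q q0 by (simp add: degree_mult_eq del: mult_pCons_left)
  then have dn: "degree q < n" using Suc.prems by simp
  have af: "anypoly f" using V Suc.prems by auto
  have *: "(dhol a ^^ i) (lshift a r f) = (\<lambda>z. (dhol a ^^ Suc i) f z - r * (dhol a ^^ i) f z)" for i
  proof (induction i)
    case (Suc i)
    have any: "anypoly ((dhol a ^^ i) f)" for i by (induction i) (auto simp: af anypoly_dhol a)
    have any': "anypoly (dhol a ((dhol a ^^ i) f))" for i using any[of "Suc i"] by simp
    show ?case using Suc by (simp add: dhol_diff_fun dhol_scale_fun any any' bipoly_scale)
  qed (simp add: lshift_def)
  have "(\<Sum>i\<le>n. coeff q i * (dhol a ^^ i) (lshift a r f) z) = 0" for z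
  proof -
    obtain n' where n': "n = Suc n'" using dn by (cases n) auto
    let ?F = "\<lambda>i. (dhol a ^^ i) f z"
    have cq: "coeff q (Suc n') = 0" using dn n' by (intro coeff_eq_0) simp
    have "(\<Sum>i\<le>n. coeff q i * (dhol a ^^ i) (lshift a r f) z) =
          (\<Sum>i\<le>n. coeff q i * ?F (Suc i)) - r * (\<Sum>i\<le>n. coeff q i * ?F i)"
      by (simp add: * sum_subtractf sum_distrib_left algebra_simps del: funpow.simps)
    also have "(\<Sum>i\<le>n. coeff q i * ?F (Suc i)) = (\<Sum>i\<le>n'. coeff q i * ?F (Suc i))"
      unfolding n' by (simp add: cq del: funpow.simps)
    \<comment> \<open>Index shift: these are the coefficients of \<open>X q\<close>, so subtracting
      those of \<open>r q\<close> leaves the coefficients of \<open>p\<close>.\<close>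
    also have "\<dots> = (\<Sum>i\<le>n. (case i of 0 \<Rightarrow> 0 | Suc j \<Rightarrow> coeff q j) * ?F i)"
      unfolding n' by (subst sum.atMost_Suc_shift) (simp del: funpow.simps)
    also have "\<dots> - r * (\<Sum>i\<le>n. coeff q i * ?F i) = (\<Sum>i\<le>n. coeff p i * ?F i)"
      unfolding sum_distrib_left sum_subtractf[symmetric]
      by (intro sum.cong) (auto simp: q coeff_pCons algebra_simps split: nat.splits)
    finally show ?thesis using Suc.prems by (simp add: fun_eq_iff)
  qed
  then have sum0: "(\<lambda>z. \<Sum>i\<le>n. coeff q i * (dhol a ^^ i) (lshift a r f) z) = (\<lambda>z. 0)" by (rule ext)
  have "d = degree q" "degree q \<le> n" using Suc.hyps(2) dq dn by auto
  from Suc.hyps(1)[OF this(1) q0 V(1)[OF Suc.prems(2)] this(2) sum0]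
  obtain I g where Ig: "finite I" "\<And>l. l \<in> I \<Longrightarrow> gen_eig a l (g l) \<and> V (g l)"
      "lshift a r f = (\<lambda>z. \<Sum>l\<in>I. g l z)"
    by blast
  have "\<forall>l\<in>I - {r}. \<exists>h. gen_eig a l h \<and> V h \<and> lshift a r h = g l"
  proof
    fix l assume "l \<in> I - {r}"
    then have "gen_eig a l (g l)" "l \<noteq> r" "V (g l)" using Ig(2) by auto
    then show "\<exists>h. gen_eig a l h \<and> V h \<and> lshift a r h = g l"
      by (rule lshift_solve[where V=V, OF _ _ _ V(1-3)])
  qed
  then obtain h where h: "\<And>l. l \<in> I - {r} \<Longrightarrow> gen_eig a l (h l) \<and> V (h l) \<and> lshift a r (h l) = g l"
    by metis
  \<comment> \<open>After subtraction of the solutions for all \<open>l \<noteq> r\<close>, the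
    shift by \<open>r\<close> only leaves the component of \<open>r\<close>, so \<open>h'\<close> is
    itself a generalized eigenvector for \<open>r\<close>.\<close>
  define h' where "h' = (\<lambda>z. f z + (-1) * (\<Sum>l\<in>I - {r}. h l z))"
  have V0: "V (\<lambda>z. 0)" using V(2)[OF Suc.prems(2), of 0] by simp
  have Vs: "V (\<lambda>z. \<Sum>l\<in>J. h l z)" if "finite J" "J \<subseteq> I - {r}" for J
    using that by induction (use V0 V(3) h in auto)
  have Vh': "V h'" unfolding h'_def by (intro V(2,3) Suc.prems(2) Vs) (use Ig in auto)
  have anyh: "anypoly (h l)" if "l \<in> I - {r}" for l using h[OF that] V(4) by blast
  have shs: "lshift a r (\<lambda>z. \<Sum>l\<in>I - {r}. h l z) = (\<lambda>z. \<Sum>l\<in>I - {r}. lshift a r (h l) z)"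
    using lshift_pow_sum[of "I - {r}" h 1 r] anyh by simp
  have anys: "anypoly (\<lambda>z. \<Sum>l\<in>I - {r}. h l z)" by (intro bipoly_sum anyh)
  have "lshift a r h' = (\<lambda>z. lshift a r f z - (\<Sum>l\<in>I - {r}. lshift a r (h l) z))"
    unfolding h'_def lshift_add[OF af bipoly_scale[OF anys]] lshift_scale[OF anys] shs by simp
  also have "\<dots> = (\<lambda>z. lshift a r f z - (\<Sum>l\<in>I - {r}. g l z))"
    using h by (intro ext arg_cong2[where f="(-)"] sum.cong) auto
  also have "\<dots> = (\<lambda>z. if r \<in> I then g r z else 0)"
    by (auto simp: Ig(3) fun_eq_iff sum_diff1 Ig(1))
  finally have sh': "lshift a r h' = (\<lambda>z. if r \<in> I then g r z else 0)" .
  have "gen_eig a r (lshift a r h')"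
    unfolding sh' using Ig(2)[of r] gen_eig_zero by (cases "r \<in> I") auto
  then obtain k where "(lshift a r ^^ k) (lshift a r h') = (\<lambda>z. 0)" by (auto simp: gen_eig_def)
  then have gh': "gen_eig a r h'"
    using V(4)[OF Vh'] by (intro gen_eigI[where k="Suc k"]) (auto simp: funpow_Suc_right simp del: funpow.simps)
  define H where "H = (\<lambda>l. if l = r then h' else h l)"
  have "f = (\<lambda>z. \<Sum>l\<in>insert r I. H l z)"
  proof
    fix z
    have "(\<Sum>l\<in>insert r I. H l z) = h' z + (\<Sum>l\<in>I - {r}. H l z)"
      using Ig(1) by (subst sum.insert_remove) (auto simp: H_def)
    also have "(\<Sum>l\<in>I - {r}. H l z) = (\<Sum>l\<in>I - {r}. h l z)"
      by (intro sum.cong) (auto simp: H_def)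
    finally show "f z = (\<Sum>l\<in>insert r I. H l z)" by (simp add: h'_def)
  qed
  moreover have "\<forall>l\<in>insert r I. gen_eig a l (H l) \<and> V (H l)"
    using h gh' Vh' by (auto simp: H_def)
  ultimately show ?case using Ig(1) by (intro exI[of _ "insert r I"] exI[of _ H]) auto
qed

end

subsection \<open>Weight decompositions\<close>

text \<open>Its (1,0) derivative multiplies \<open>bimonom \<alpha> \<beta>\<close> by
  \<open>wlen m \<alpha>\<close>, so that weights become eigenvalues.\<close>

definition euler :: "('n \<Rightarrow> real) \<Rightarrow> complex^'n \<Rightarrow> complex^'n::finite" where
  "euler m z = (\<chi> j. of_real (m j) * z $ j)"

lemma anypoly_coord: "anypoly (\<lambda>z. z $ j)"
  by (rule bipoly_coord) simp

lemma anypoly_euler: "anypoly (\<lambda>z. euler m z $ j)"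
  by (simp add: euler_def bipoly_scale anypoly_coord)

lemma zmonom_dec: "\<alpha> i > 0 \<Longrightarrow> z $ i * zmonom (\<alpha>(i := \<alpha> i - 1)) z = zmonom \<alpha> z"
proof -
  assume a: "\<alpha> i > 0"
  then have "(\<lambda>j. (\<alpha>(i := \<alpha> i - 1)) j + unit_index i j) = \<alpha>"
    by (auto simp: unit_index_def fun_eq_iff)
  then show ?thesis using zmonom_add[of "\<alpha>(i := \<alpha> i - 1)" "unit_index i" z] by (simp add: mult.commute)
qed

lemma dhol_euler_bimonom: "dhol (euler m) (bimonom \<alpha> \<beta>) z = of_real (wlen m \<alpha>) * bimonom \<alpha> \<beta> z"
proof -
  have "of_nat (\<alpha> i) * (euler m z $ i * bimonom (\<alpha>(i := \<alpha> i - 1)) \<beta> z) =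
        of_real (m i * real (\<alpha> i)) * bimonom \<alpha> \<beta> z" for i
    using zmonom_dec[of \<alpha> i z] by (cases "\<alpha> i = 0") (auto simp: bimonom_def euler_def simp flip: of_nat_Suc)
  then show ?thesis unfolding dhol_bimonom wlen_def of_real_sum sum_distrib_right by (intro sum.cong) auto
qed

lemma dhol_euler:
  assumes "bipoly (\<lambda>\<alpha> \<beta>. Q \<alpha> \<beta> \<and> wlen m \<alpha> = v) f"
  shows "dhol (euler m) f = (\<lambda>z. of_real v * f z)"
  using assms
proof induction
  case (step f \<alpha> \<beta> c)
  have 1: "anypoly (bimonom \<alpha> \<beta>)" "anypoly f" using step bipoly_any by (auto intro: bipoly_bimonom)
  show ?case
    using step.hyps(2)
    unfolding dhol_add_fun[OF bipoly_scale[OF 1(1)] 1(2)] dhol_scale_fun[OF 1(1)] step.IH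
    by (simp add: dhol_euler_bimonom algebra_simps)
qed simp

lemma bipoly_empty: "bipoly (\<lambda>\<alpha> \<beta>. Q \<alpha> \<beta>) f \<Longrightarrow> (\<And>\<alpha> \<beta>. \<not> Q \<alpha> \<beta>) \<Longrightarrow> f = (\<lambda>z. 0)"
  by (induction rule: bipoly.induct) auto

text \<open>\<open>w\<close> is left arbitrary because it is used both for real weights and for the
  complex eigenvalue of a monomial in eigencoordinates.\<close>

lemma bipoly_weight_decomposition:
  fixes w :: "('n::finite \<Rightarrow> nat) \<Rightarrow> 'b"
  assumes "bipoly Q f"
  shows "\<exists>I g. finite I \<and> (\<forall>v. bipoly (\<lambda>\<alpha> \<beta>. Q \<alpha> \<beta> \<and> w \<alpha> = v) (g v)) \<and>
     (\<forall>v. v \<notin> I \<longrightarrow> g v = (\<lambda>z. 0)) \<and> f = (\<lambda>z. \<Sum>v\<in>I. g v z)"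
  using assms
proof induction
  case zero
  show ?case by (intro exI[of _ "{}"] exI[of _ "\<lambda>_ _. 0"]) (auto intro: bipoly.zero)
next
  case (step f \<alpha> \<beta> c)
  then obtain I g where g: "finite I" "\<And>v. bipoly (\<lambda>\<alpha> \<beta>. Q \<alpha> \<beta> \<and> w \<alpha> = v) (g v)"
    "\<And>v. v \<notin> I \<Longrightarrow> g v = (\<lambda>z. 0)" "f = (\<lambda>z. \<Sum>v\<in>I. g v z)" by blast
  define u where "u = w \<alpha>"
  define h where "h v = (\<lambda>z. (if v = u then c * bimonom \<alpha> \<beta> z else 0) + g v z)" for v
  have "(\<Sum>v\<in>insert u I. h v z) = c * bimonom \<alpha> \<beta> z + f z" for z
  proof -
    have "(\<Sum>v\<in>insert u I. h v z) = (\<Sum>v\<in>insert u I. if v = u then c * bimonom \<alpha> \<beta> z else 0) + (\<Sum>v\<in>insert u I. g v z)"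
      by (simp add: h_def sum.distrib)
    also have "(\<Sum>v\<in>insert u I. g v z) = f z"
      using g(1,3,4) by (cases "u \<in> I") (auto simp: insert_absorb)
    finally show ?thesis using g(1) by simp
  qed
  moreover have "bipoly (\<lambda>\<alpha> \<beta>. Q \<alpha> \<beta> \<and> w \<alpha> = v) (h v)" for v
    using step.hyps(2) bipoly.step[OF g(2)[of v], of \<alpha> \<beta> c] g(2)[of v] unfolding h_def u_def by (cases "v = w \<alpha>") auto
  moreover have "h v = (\<lambda>z. 0)" if "v \<notin> insert u I" for v using that g(3) by (auto simp: h_def)
  ultimately show ?case using g(1) by (intro exI[of _ "insert u I"] exI[of _ h]) auto
qed

text \<open>Parts of different holomorphic weight are eigenvectors of the Euler field for different
  eigenvalues, hence independent. Disjointness of the weights leaves no part of \<open>g\<close>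
  that could cancel a part of \<open>f\<close>.\<close>

lemma bipoly_weight_separate:
  fixes f g :: "complex^'n::finite \<Rightarrow> complex"
  assumes f: "bipoly Q f" and g: "bipoly R g" and sum0: "\<And>z. f z + g z = 0"
    and disj: "\<And>\<alpha> \<beta> \<alpha>' \<beta>'. Q \<alpha> \<beta> \<Longrightarrow> R \<alpha>' \<beta>' \<Longrightarrow> wlen m \<alpha> \<noteq> wlen m \<alpha>'"
  shows "f = (\<lambda>z. 0)"
proof -
  interpret poly_field "euler m" by unfold_locales (rule anypoly_euler)
  obtain I F where F: "finite I" "\<And>v. bipoly (\<lambda>\<alpha> \<beta>. Q \<alpha> \<beta> \<and> wlen m \<alpha> = v) (F v)"
    "\<And>v. v \<notin> I \<Longrightarrow> F v = (\<lambda>z. 0)" "f = (\<lambda>z. \<Sum>v\<in>I. F v z)"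
    using bipoly_weight_decomposition[OF f, of "wlen m"] by blast
  obtain J G where G: "finite J" "\<And>v. bipoly (\<lambda>\<alpha> \<beta>. R \<alpha> \<beta> \<and> wlen m \<alpha> = v) (G v)"
    "\<And>v. v \<notin> J \<Longrightarrow> G v = (\<lambda>z. 0)" "g = (\<lambda>z. \<Sum>v\<in>J. G v z)"
    using bipoly_weight_decomposition[OF g, of "wlen m"] by blast
  define K where "K = complex_of_real ` (I \<union> J)"
  define H where "H l = (\<lambda>z. F (Re l) z + G (Re l) z)" for l
  have fe: "f z = (\<Sum>v\<in>I \<union> J. F v z)" for z
    unfolding F(4) using F(1,3) G(1) by (intro sum.mono_neutral_left) auto
  have ge: "g z = (\<Sum>v\<in>I \<union> J. G v z)" for z
    unfolding G(4) using F(1) G(1,3) by (intro sum.mono_neutral_left) auto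
  have "(\<Sum>l\<in>K. H l z) = f z + g z" for z
    unfolding K_def H_def fe ge by (subst sum.reindex) (auto simp: sum.distrib inj_on_def)
  then have "(\<lambda>z. \<Sum>l\<in>K. H l z) = (\<lambda>z. 0)" using sum0 by simp
  moreover have "gen_eig (euler m) (complex_of_real v) (H (complex_of_real v))" for v
  proof (rule gen_eigI[where k=1])
    note 1 = bipoly_any[OF F(2)[of v]] bipoly_any[OF G(2)[of v]]
    show "anypoly (H (complex_of_real v))" by (simp add: H_def bipoly_add 1)
    show "(lshift (euler m) (complex_of_real v) ^^ 1) (H (complex_of_real v)) = (\<lambda>z. 0)"
      by (simp add: H_def lshift_def dhol_add_fun 1 dhol_euler[OF F(2)] dhol_euler[OF G(2)] algebra_simps)
  qed
  ultimately have H0: "H l = (\<lambda>z. 0)" if "l \<in> K" for l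
    using gen_eig_independent[of K H l] F(1) G(1) that by (auto simp: K_def)
  have "F v = (\<lambda>z. 0)" if "v \<in> I" for v
  proof (cases "\<exists>\<alpha> \<beta>. Q \<alpha> \<beta> \<and> wlen m \<alpha> = v")
    case True
    then obtain \<alpha>' \<beta>' where "Q \<alpha>' \<beta>'" "wlen m \<alpha>' = v" by blast
    then have "\<not> (R \<alpha> \<beta> \<and> wlen m \<alpha> = v)" for \<alpha> \<beta> using disj[of \<alpha>' \<beta>' \<alpha> \<beta>] by auto
    then have "G v = (\<lambda>z. 0)" using bipoly_empty[OF G(2)] by blast
    then show ?thesis using H0[of "of_real v"] that by (simp add: K_def H_def)
  next
    case False
    then show ?thesis using bipoly_empty[OF F(2)] by blast
  qed
  then show ?thesis by (simp add: F(4))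
qed

lemma bipoly_coweight_separate:
  fixes f g :: "complex^'n::finite \<Rightarrow> complex"
  assumes f: "bipoly Q f" and g: "bipoly R g" and sum0: "\<And>z. f z + g z = 0"
    and disj: "\<And>\<alpha> \<beta> \<alpha>' \<beta>'. Q \<alpha> \<beta> \<Longrightarrow> R \<alpha>' \<beta>' \<Longrightarrow> wlen m \<beta> \<noteq> wlen m \<beta>'"
  shows "f = (\<lambda>z. 0)"
proof -
  have "(\<lambda>z. cnj (f z)) = (\<lambda>z. 0)"
    by (rule bipoly_weight_separate[OF bipoly_cnj[OF f] bipoly_cnj[OF g], where m=m])
       (use sum0 disj in \<open>auto simp flip: complex_cnj_add\<close>)
  then show ?thesis by (simp add: fun_eq_iff)
qed

lemma hpoly_scalar:
  assumes "bipoly (\<lambda>\<alpha> \<beta>. \<alpha> = (\<lambda>_. 0) \<and> \<beta> = (\<lambda>_. 0)) f"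
  shows "\<exists>c. f = (\<lambda>z. c)"
  using assms by induction (auto simp: bimonom_def)

lemma dhol_cong: "a z = b z \<Longrightarrow> dhol a f z = dhol b f z"
  by (simp add: dhol_def)

lemma dhol_field_add:
  assumes "f differentiable (at z)"
  shows "dhol (\<lambda>z. a z + b z) f z = dhol a f z + dhol b f z"
proof -
  interpret bounded_linear "frechet_derivative f (at z)"
    using assms frechet_derivative_works has_derivative_bounded_linear by blast
  have "\<i> *s (a z + b z) = \<i> *s a z + \<i> *s b z" by (rule vector_add_ldistrib)
  then show ?thesis by (simp add: dhol_def add algebra_simps add_divide_distrib diff_divide_distrib)
qed

subsection \<open>Holomorphic maps\<close>

definition chol :: "('n csp \<Rightarrow> complex) \<Rightarrow> 'n::finite csp \<Rightarrow> bool" where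
  "chol g x \<longleftrightarrow> (\<exists>D. (g has_derivative D) (at x) \<and> (\<forall>c v. D (cscale c v) = c * D v))"

lemma chol_const: "chol (\<lambda>x. c) x"
  unfolding chol_def by (rule exI[of _ "\<lambda>v. 0"]) auto

lemma chol_mult: "chol f x \<Longrightarrow> chol g x \<Longrightarrow> chol (\<lambda>x. f x * g x) x"
  unfolding chol_def
  by (elim exE conjE, rule exI, rule conjI, erule (1) has_derivative_mult) (simp add: algebra_simps)

lemma chol_snd: "chol snd x"
  unfolding chol_def
  by (rule exI[of _ snd]) (auto simp: cscale_def intro: bounded_linear_imp_has_derivative bounded_linear_snd)

lemma chol_hpoly_fst:
  assumes "hpoly Q f"
  shows "chol (\<lambda>x. f (fst x)) x"
proof -
  have "((\<lambda>x. f (fst x)) has_derivative (\<lambda>v. frechet_derivative f (at (fst x)) (fst v))) (at x)"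
    by (rule has_derivative_compose[OF bounded_linear_imp_has_derivative[OF bounded_linear_fst] bipoly_has_derivative[OF assms]])
  then show ?thesis unfolding chol_def
    by (intro exI conjI) (auto simp: cscale_def hpoly_dhol(2)[OF assms])
qed

lemma has_derivative_cvec:
  fixes f :: "'a::real_normed_vector \<Rightarrow> complex^'n::finite"
  assumes "\<And>j. ((\<lambda>x. f x $ j) has_derivative (\<lambda>v. D v $ j)) (at x)"
  shows "(f has_derivative D) (at x)"
proof (subst has_derivative_componentwise_within, intro ballI)
  fix b :: "complex^'n" assume "b \<in> Basis"
  then obtain j c where b: "b = axis j c" by (auto simp: Basis_vec_def)
  have "((\<lambda>x. f x $ j \<bullet> c) has_derivative (\<lambda>v. D v $ j \<bullet> c)) (at x)"
    by (intro has_derivative_inner_left assms)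
  then show "((\<lambda>x. f x \<bullet> b) has_derivative (\<lambda>v. D v \<bullet> b)) (at x)"
    by (simp add: b inner_axis)
qed

lemma hol_onI:
  fixes X :: "'n csp \<Rightarrow> 'n::finite csp"
  assumes "open U" "\<And>x j. x \<in> U \<Longrightarrow> chol (\<lambda>x. fst (X x) $ j) x" "\<And>x. x \<in> U \<Longrightarrow> chol (\<lambda>x. snd (X x)) x"
  shows "hol_on U X"
  unfolding hol_on_def
proof (intro conjI ballI assms(1))
  fix x assume x: "x \<in> U"
  have "\<forall>j. \<exists>D. ((\<lambda>x. fst (X x) $ j) has_derivative D) (at x) \<and> (\<forall>c v. D (cscale c v) = c * D v)"
    using assms(2)[OF x] by (auto simp: chol_def)
  then obtain D where D: "\<And>j. ((\<lambda>x. fst (X x) $ j) has_derivative D j) (at x)" "\<And>j c v. D j (cscale c v) = c * D j v"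
    by metis
  obtain E where E: "((\<lambda>x. snd (X x)) has_derivative E) (at x)" "\<And>c v. E (cscale c v) = c * E v"
    using assms(3)[OF x] by (auto simp: chol_def)
  have 1: "((\<lambda>x. fst (X x)) has_derivative (\<lambda>v. \<chi> j. D j v)) (at x)"
    by (rule has_derivative_cvec) (simp add: D)
  have "((\<lambda>x. (fst (X x), snd (X x))) has_derivative (\<lambda>v. (\<chi> j. D j v, E v))) (at x)"
    by (intro has_derivative_Pair 1 E)
  then show "\<exists>D. (X has_derivative D) (at x) \<and> (\<forall>c v. D (cscale c v) = cscale c (D v))"
    by (intro exI[of _ "\<lambda>v. (\<chi> j. D j v, E v)"]) (simp_all add: D E, simp add: cscale_def vec_eq_iff)
qed

text \<open>For real \<open>P\<close> the two halves of the derivative are conjugate to each other,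
  so their sum is twice the real part of the (1,0) half.\<close>

lemma bipoly_real_derivative:
  fixes P :: "complex^'n::finite \<Rightarrow> real"
  assumes "bipoly Q (\<lambda>z. complex_of_real (P z))"
  shows "(P has_derivative (\<lambda>v. 2 * Re (dhol (\<lambda>_. v) (\<lambda>z. complex_of_real (P z)) z))) (at z)"
    and "dbar a (\<lambda>z. complex_of_real (P z)) z = cnj (dhol a (\<lambda>z. complex_of_real (P z)) z)"
proof -
  let ?p = "\<lambda>z. complex_of_real (P z)"
  have d: "?p differentiable (at z)" by (rule bipoly_differentiable[OF assms])
  show 2: "dbar a ?p z = cnj (dhol a ?p z)" for a
    using dbar_cnj[OF d, of a] by simp
  have "frechet_derivative ?p (at z) v = of_real (2 * Re (dhol (\<lambda>_. v) ?p z))" for v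
    using dhol_add_dbar[of "\<lambda>_. v" ?p z] 2[of "\<lambda>_. v"] by (simp add: complex_eq_iff)
  then have "(?p has_derivative (\<lambda>v. of_real (2 * Re (dhol (\<lambda>_. v) ?p z)))) (at z)"
    using bipoly_has_derivative[OF assms, of z] by presburger
  from bounded_linear.has_derivative[OF bounded_linear_Re this]
  show "(P has_derivative (\<lambda>v. 2 * Re (dhol (\<lambda>_. v) ?p z))) (at z)" by simp
qed

lemma model_defining_derivative:
  fixes P :: "complex^'n::finite \<Rightarrow> real"
  assumes "bipoly Q (\<lambda>z. complex_of_real (P z))"
  shows "(model_defining P has_derivative
      (\<lambda>v. Im (snd v) - 2 * Re (dhol (\<lambda>_. fst v) (\<lambda>z. complex_of_real (P z)) (fst x)))) (at x)"
  unfolding model_defining_def[abs_def]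
  by (intro has_derivative_diff bounded_linear_imp_has_derivative
      bounded_linear_compose[OF bounded_linear_Im bounded_linear_snd]
      has_derivative_compose[OF bounded_linear_imp_has_derivative[OF bounded_linear_fst] bipoly_real_derivative(1)[OF assms]])

lemma model_defining_frechet:
  fixes P :: "complex^'n::finite \<Rightarrow> real"
  assumes "bipoly Q (\<lambda>z. complex_of_real (P z))"
  shows "frechet_derivative (model_defining P) (at x) v =
     Im (snd v) - 2 * Re (dhol (\<lambda>_. fst v) (\<lambda>z. complex_of_real (P z)) (fst x))"
  by (simp add: frechet_derivative_at[OF model_defining_derivative[OF assms], symmetric])

subsection \<open>Polynomial models\<close>

locale poly_model =
  fixes \<mu> :: "'n::finite \<Rightarrow> real" and P :: "complex^'n \<Rightarrow> real"
  assumes \<mu>_pos: "\<And>j. 0 < \<mu> j" and \<mu>_half: "\<And>j. \<mu> j \<le> 1/2"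
    and model: "model_polynomial \<mu> P"
begin

definition p :: "complex^'n \<Rightarrow> complex" where
  "p z = complex_of_real (P z)"

lemma Re_p [simp]: "Re (p z) = P z" and Im_p [simp]: "Im (p z) = 0" and cnj_p [simp]: "cnj (p z) = p z"
  by (simp_all add: p_def)

lemma wlen_nonneg: "wlen \<mu> \<alpha> \<ge> 0"
  unfolding wlen_def by (intro sum_nonneg) (simp add: less_imp_le \<mu>_pos)

lemma wlen_pos: "\<alpha> \<noteq> (\<lambda>_. 0) \<Longrightarrow> wlen \<mu> \<alpha> > 0"
proof -
  assume "\<alpha> \<noteq> (\<lambda>_. 0)"
  then obtain j where "\<alpha> j > 0" by (auto simp: fun_eq_iff)
  then have "0 < \<mu> j * real (\<alpha> j)" using \<mu>_pos by simp
  also have "\<dots> \<le> wlen \<mu> \<alpha>"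
    unfolding wlen_def by (rule member_le_sum) (auto simp: less_imp_le \<mu>_pos)
  finally show ?thesis .
qed

lemma wlen_eq_0_iff: "wlen \<mu> \<alpha> = 0 \<longleftrightarrow> \<alpha> = (\<lambda>_. 0)"
  using wlen_pos[of \<alpha>] by (metis less_irrefl wlen_zero)

text \<open>The smallest \<open>\<mu> j\<close> serves as the gap. It makes sets of bounded weight
  finite and lets inductions on weights proceed in steps of a fixed size.\<close>

lemma wlen_gap: "\<exists>e>0. \<forall>\<alpha>. wlen \<mu> \<alpha> > 0 \<longrightarrow> wlen \<mu> \<alpha> \<ge> e"
proof -
  define e where "e = Min (range \<mu>)"
  have "wlen \<mu> \<alpha> \<ge> e" if "wlen \<mu> \<alpha> > 0" for \<alpha>
  proof -
    have "\<alpha> \<noteq> (\<lambda>_. 0)" using that by auto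
    then obtain j where j: "\<alpha> j > 0" by (auto simp: fun_eq_iff)
    have "e \<le> \<mu> j" by (simp add: e_def)
    also have "\<dots> \<le> \<mu> j * real (\<alpha> j)" using j \<mu>_pos[of j] by simp
    also have "\<dots> \<le> wlen \<mu> \<alpha>"
      unfolding wlen_def by (rule member_le_sum) (auto simp: less_imp_le \<mu>_pos)
    finally show ?thesis .
  qed
  moreover have "e > 0" using \<mu>_pos by (simp add: e_def)
  ultimately show ?thesis by blast
qed

text \<open>Positivity of both weights encodes the absence of pluriharmonic terms, since weight 0
  belongs to the zero exponent only.\<close>

definition mixed :: "('n \<Rightarrow> nat) \<Rightarrow> ('n \<Rightarrow> nat) \<Rightarrow> bool" where
  "mixed \<alpha> \<beta> \<longleftrightarrow> wlen \<mu> \<alpha> + wlen \<mu> \<beta> = 1 \<and> 0 < wlen \<mu> \<alpha> \<and> 0 < wlen \<mu> \<beta>"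

lemma bipoly_p: "bipoly mixed p"
proof -
  from model obtain A where A: "poly_rep A P" "\<And>\<alpha> \<beta>. A \<alpha> \<beta> \<noteq> 0 \<Longrightarrow> wlen \<mu> \<alpha> + wlen \<mu> \<beta> = 1"
    "\<And>\<alpha>. A \<alpha> (\<lambda>_. 0) = 0 \<and> A (\<lambda>_. 0) \<alpha> = 0"
    unfolding model_polynomial_def by blast
  have "mixed \<alpha> \<beta>" if "A \<alpha> \<beta> \<noteq> 0" for \<alpha> \<beta>
    using A(2)[OF that] A(3) that wlen_pos unfolding mixed_def by metis
  from poly_rep_imp_bipoly[OF A(1) this] show ?thesis unfolding p_def[abs_def] .
qed

lemma anypoly_p: "anypoly p"
  by (rule bipoly_any[OF bipoly_p])

lemma P_nonzero: "\<exists>z. P z \<noteq> 0"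
  using model by (simp add: model_polynomial_def)

lemma P_dil: "s > 0 \<Longrightarrow> P (dil \<mu> s z) = s * P z"
proof -
  assume "s > 0"
  then have "p (dil \<mu> s z) = of_real (s powr 1) * p z"
    by (intro bipoly_dil bipoly_mono[OF bipoly_p]) (auto simp: mixed_def)
  with \<open>s > 0\<close> show ?thesis by (simp add: p_def flip: of_real_mult)
qed

lemma dil_tendsto: "((\<lambda>s. dil \<mu> s z) \<longlongrightarrow> 0) (at_right 0)"
proof (rule vec_tendstoI)
  fix j
  have "((\<lambda>s. s powr \<mu> j) \<longlongrightarrow> 0) (at_right 0)"
    by (rule tendsto_zero_powrI[OF tendsto_ident_at tendsto_const _ \<mu>_pos])
       (use eventually_at_right_less in eventually_elim, simp)
  then have "((\<lambda>s. complex_of_real (s powr \<mu> j) * z $ j) \<longlongrightarrow> of_real 0 * z $ j) (at_right 0)"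
    by (intro tendsto_intros)
  then show "((\<lambda>s. dil \<mu> s z $ j) \<longlongrightarrow> 0 $ j) (at_right 0)" by simp
qed

lemma dbar_p: "dbar a p z = cnj (dhol a p z)"
  using bipoly_real_derivative(2)[of mixed P a z] bipoly_p by (simp add: p_def[abs_def])

lemma model_frechet:
  "frechet_derivative (model_defining P) (at x) v = Im (snd v) - 2 * Re (dhol (\<lambda>_. fst v) p (fst x))"
  using model_defining_frechet[of mixed P x v] bipoly_p by (simp add: p_def[abs_def])

lemma dhol_fscale: "dhol (\<lambda>_. c *s v) p z = c * dhol (\<lambda>_. v) p z"
  by (rule dhol_field_scale[OF bipoly_differentiable[OF bipoly_p], of "\<lambda>_. c"])

lemma dhol_fadd: "dhol (\<lambda>_. u + v) p z = dhol (\<lambda>_. u) p z + dhol (\<lambda>_. v) p z"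
  by (rule dhol_field_add[OF bipoly_differentiable[OF bipoly_p], of "\<lambda>_. u" "\<lambda>_. v"])

end

locale nondeg_model = poly_model +
  assumes nondeg: "hol_nondegenerate P"
begin

text \<open>Nondegeneracy is tested on the field \<open>(c(z), 0)\<close>. As \<open>dhol\<close> is
  complex linear in the field, both \<open>X\<close> and \<open>\<i> X\<close> annihilate the
  defining function; the resulting vanishing near 0 is global for polynomials.\<close>

lemma field_zero:
  assumes c: "\<And>j. hpoly (Q j) (\<lambda>z. c z $ j)" and 0: "\<And>z. dhol c p z = 0"
  shows "c z = 0"
proof -
  define X :: "'a vfield" where "X x = (c (fst x), 0)" for x
  have "hol_on UNIV X"
    by (rule hol_onI) (auto simp: X_def intro: chol_hpoly_fst[OF c] chol_const)
  moreover have "complex_tangent (model_defining P) x (X x)" for x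
  proof -
    have "dhol (\<lambda>_. c (fst x)) p (fst x) = 0"
      using 0[of "fst x"] dhol_cong[of "\<lambda>_. c (fst x)" "fst x" c p] by simp
    then show ?thesis
      by (simp add: complex_tangent_def model_frechet X_def cscale_def dhol_fscale)
  qed
  ultimately have ev: "\<forall>\<^sub>F x in nhds 0. X x = 0"
    using nondeg unfolding hol_nondegenerate_def by blast
  have "((\<lambda>z::complex^'a. (z, 0::complex)) \<longlongrightarrow> (0, 0)) (nhds 0)"
    by (intro tendsto_intros) (simp add: filterlim_ident)
  then have "\<forall>\<^sub>F z in nhds 0. X (z, 0) = 0"
    using eventually_compose_filterlim[OF ev, of "\<lambda>z. (z, 0)" "nhds 0"] by (simp add: zero_prod_def)
  then have ev': "\<forall>\<^sub>F z in nhds 0. c z = 0" by eventually_elim (simp add: X_def zero_prod_def)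
  have "c z $ j = 0" for j
    by (rule bipoly_eventually_zero[OF c]) (use ev' in eventually_elim, simp)
  then show ?thesis by (simp add: vec_eq_iff)
qed

end

section \<open>Fields of weight 1 on a polynomial model\<close>

context poly_model begin

text \<open>Weights of monomials in \<open>z\<close> are nonnegative, so a power of \<open>w\<close>
  above the second would exceed the total weight.\<close>

lemma hwh_split:
  assumes f: "hol_weighted_homogeneous \<mu> \<kappa> f" and k: "\<kappa> \<le> 2"
  shows "\<exists>f0 f1 f2. hpoly (\<lambda>\<alpha>. wlen \<mu> \<alpha> = \<kappa>) f0 \<and> hpoly (\<lambda>\<alpha>. wlen \<mu> \<alpha> = \<kappa> - 1) f1 \<and>
     hpoly (\<lambda>\<alpha>. wlen \<mu> \<alpha> = \<kappa> - 2) f2 \<and> (\<forall>z w. f (z, w) = f0 z + w * f1 z + w\<^sup>2 * f2 z)"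
proof -
  from f obtain C :: "('n \<Rightarrow> nat) \<Rightarrow> nat \<Rightarrow> complex" where C: "finite {(\<alpha>, l). C \<alpha> l \<noteq> 0}"
    "\<And>z w. f (z, w) = (\<Sum>(\<alpha>, l)\<in>{(\<alpha>, l). C \<alpha> l \<noteq> 0}. C \<alpha> l * zmonom \<alpha> z * w ^ l)"
    "\<And>\<alpha> l. C \<alpha> l \<noteq> 0 \<Longrightarrow> wlen \<mu> \<alpha> + real l = \<kappa>"
    unfolding hol_weighted_homogeneous_def by blast
  define S where "S = {(\<alpha>, l). C \<alpha> l \<noteq> 0}"
  have S: "finite S" using C(1) by (simp add: S_def)
  define A where "A = fst ` S"
  have A: "finite A" using S by (simp add: A_def)
  define F where "F l z = (\<Sum>\<alpha>\<in>{\<alpha>\<in>A. C \<alpha> l \<noteq> 0}. C \<alpha> l * bimonom \<alpha> (\<lambda>_. 0) z)" for l z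
  have hp: "hpoly (\<lambda>\<alpha>. wlen \<mu> \<alpha> = \<kappa> - real l) (F l)" for l
    unfolding F_def[abs_def] using C(3)
    by (intro bipoly_sum bipoly_scale bipoly_bimonom) (force simp: algebra_simps)
  have "f (z, w) = F 0 z + w * F 1 z + w\<^sup>2 * F 2 z" for z w
  proof -
    have "l \<le> 2" if "(\<alpha>, l) \<in> S" for \<alpha> l
      using C(3)[of \<alpha> l] wlen_nonneg[of \<alpha>] that k by (auto simp: S_def)
    then have sub: "S \<subseteq> A \<times> {..2}" by (force simp: A_def)
    have "f (z, w) = (\<Sum>(\<alpha>, l)\<in>A \<times> {..2}. C \<alpha> l * zmonom \<alpha> z * w ^ l)"
      unfolding C(2) S_def[symmetric] using sub A by (intro sum.mono_neutral_left) (auto simp: S_def)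
    also have "\<dots> = (\<Sum>l\<le>2. \<Sum>\<alpha>\<in>A. C \<alpha> l * zmonom \<alpha> z * w ^ l)"
      by (subst sum.swap) (simp add: sum.cartesian_product)
    also have "\<dots> = (\<Sum>l\<le>2. w ^ l * F l z)"
    proof (intro sum.cong refl)
      fix l
      have "F l z = (\<Sum>\<alpha>\<in>A. C \<alpha> l * zmonom \<alpha> z)"
        unfolding F_def bimonom_def using A by (intro sum.mono_neutral_cong_left) auto
      then show "(\<Sum>\<alpha>\<in>A. C \<alpha> l * zmonom \<alpha> z * w ^ l) = w ^ l * F l z"
        by (simp add: sum_distrib_left mult_ac)
    qed
    finally show ?thesis by (simp add: numeral_2_eq_2)
  qed
  then show ?thesis using hp[of 0] hp[of 1] hp[of 2] by (intro exI[of _ "F 0"] exI[of _ "F 1"] exI[of _ "F 2"]) simp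
qed

lemma hpoly_negative_weight: "hpoly (\<lambda>\<alpha>. wlen \<mu> \<alpha> = k) f \<Longrightarrow> k < 0 \<Longrightarrow> f = (\<lambda>z. 0)"
  by (erule bipoly_empty) (metis not_le wlen_nonneg)

lemma hpoly_weight_0:
  assumes "hpoly (\<lambda>\<alpha>. wlen \<mu> \<alpha> = 0) f"
  shows "\<exists>c. f = (\<lambda>z. c)"
  by (rule hpoly_scalar, rule bipoly_mono[OF assms]) (simp add: wlen_eq_0_iff)

text \<open>A holomorphic field of weight \<open>k\<close> shifts the holomorphic weight by
  \<open>k\<close> and does not touch the conjugate exponents. The later separation arguments rest
  on this asymmetry.\<close>

lemma dhol_weight:
  assumes f: "bipoly Q f" and a: "\<And>j. hpoly (\<lambda>\<alpha>. wlen \<mu> \<alpha> = k + \<mu> j) (\<lambda>z. a z $ j)"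
    and R: "\<And>\<alpha> \<beta> \<alpha>'. Q \<alpha> \<beta> \<Longrightarrow> wlen \<mu> \<alpha>' = wlen \<mu> \<alpha> + k \<Longrightarrow> R \<alpha>' \<beta>"
  shows "bipoly R (dhol a f)"
  by (rule bipoly_dhol[OF f a]) (elim conjE, simp del: fun_upd_apply, erule R, simp add: wlen_add wlen_dec[unfolded One_nat_def] del: fun_upd_apply)

lemma dbar_weight:
  assumes f: "bipoly Q f" and a: "\<And>j. hpoly (\<lambda>\<alpha>. wlen \<mu> \<alpha> = k + \<mu> j) (\<lambda>z. a z $ j)"
    and R: "\<And>\<alpha> \<beta> \<beta>'. Q \<alpha> \<beta> \<Longrightarrow> wlen \<mu> \<beta>' = wlen \<mu> \<beta> + k \<Longrightarrow> R \<alpha> \<beta>'"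
  shows "bipoly R (dbar a f)"
  by (rule bipoly_dbar[OF f a]) (elim conjE, simp del: fun_upd_apply, erule R, simp add: wlen_add wlen_dec[unfolded One_nat_def] del: fun_upd_apply)

lemma quadratic_zero:
  fixes a b c :: real
  assumes "\<And>u. a * u\<^sup>2 + b * u + c = 0"
  shows "a = 0" "b = 0" "c = 0"
  using assms[of 0] assms[of 1] assms[of "-1"] by auto

text \<open>On the hypersurface the tangency condition is a polynomial in \<open>u = Re w\<close>; compare its coefficients.\<close>

lemma g1_structure:
  assumes X: "X \<in> g1 \<mu> P"
  obtains a b \<gamma> where "\<And>j. hpoly (\<lambda>\<alpha>. wlen \<mu> \<alpha> = 0 + \<mu> j) (\<lambda>z. a z $ j)"
    "\<And>j. hpoly (\<lambda>\<alpha>. wlen \<mu> \<alpha> = 1 + \<mu> j) (\<lambda>z. b z $ j)"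
    "\<And>z w. X (z, w) = (w *s a z + b z, complex_of_real \<gamma> * w\<^sup>2)"
    "\<And>z. dhol a p z + dbar a p z = 2 * of_real \<gamma> * p z"
    "\<And>z. dhol b p z + dbar b p z = p z * ((dhol a p z - dbar a p z) / \<i>)"
proof -
  have F: "hol_weighted_homogeneous \<mu> (1 + \<mu> j) (\<lambda>x. fst (X x) $ j)" for j
    using X by (auto simp: g1_def vfield_weight_def)
  have G: "hol_weighted_homogeneous \<mu> 2 (\<lambda>x. snd (X x))"
    using X by (auto simp: g1_def vfield_weight_def)
  have "\<forall>j. \<exists>f. hpoly (\<lambda>\<alpha>. wlen \<mu> \<alpha> = 1 + \<mu> j) (fst f) \<and> hpoly (\<lambda>\<alpha>. wlen \<mu> \<alpha> = 0 + \<mu> j) (snd f) \<and>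
      (\<forall>z w. fst (X (z, w)) $ j = fst f z + w * snd f z)"
  proof
    fix j
    have "1 + \<mu> j \<le> 2" using \<mu>_half[of j] by simp
    from hwh_split[OF F this] obtain f0 f1 f2 where
      f: "hpoly (\<lambda>\<alpha>. wlen \<mu> \<alpha> = 1 + \<mu> j) f0" "hpoly (\<lambda>\<alpha>. wlen \<mu> \<alpha> = 1 + \<mu> j - 1) f1"
         "hpoly (\<lambda>\<alpha>. wlen \<mu> \<alpha> = 1 + \<mu> j - 2) f2"
         "\<And>z w. fst (X (z, w)) $ j = f0 z + w * f1 z + w\<^sup>2 * f2 z" by blast
    \<comment> \<open>Since \<open>\<mu> j \<le> 1/2\<close>, the coefficient of
      \<open>w\<^sup>2\<close> has the negative weight \<open>\<mu> j - 1\<close>.\<close>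
    have "f2 = (\<lambda>z. 0)" using \<mu>_half[of j] by (intro hpoly_negative_weight[OF f(3)]) simp
    with f show "\<exists>f. hpoly (\<lambda>\<alpha>. wlen \<mu> \<alpha> = 1 + \<mu> j) (fst f) \<and> hpoly (\<lambda>\<alpha>. wlen \<mu> \<alpha> = 0 + \<mu> j) (snd f) \<and>
      (\<forall>z w. fst (X (z, w)) $ j = fst f z + w * snd f z)"
      by (intro exI[of _ "(f0, f1)"]) simp
  qed
  from choice[OF this] obtain g where f: "\<And>j. hpoly (\<lambda>\<alpha>. wlen \<mu> \<alpha> = 1 + \<mu> j) (fst (g j))"
     "\<And>j. hpoly (\<lambda>\<alpha>. wlen \<mu> \<alpha> = 0 + \<mu> j) (snd (g j))"
     "\<And>j z w. fst (X (z, w)) $ j = fst (g j) z + w * snd (g j) z"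
    by blast
  define a where "a z = (\<chi> j. snd (g j) z)" for z
  define b where "b z = (\<chi> j. fst (g j) z)" for z
  have a: "hpoly (\<lambda>\<alpha>. wlen \<mu> \<alpha> = 0 + \<mu> j) (\<lambda>z. a z $ j)" for j using f(2)[of j] by (simp add: a_def)
  have b: "hpoly (\<lambda>\<alpha>. wlen \<mu> \<alpha> = 1 + \<mu> j) (\<lambda>z. b z $ j)" for j using f(1)[of j] by (simp add: b_def)
  have Xab: "fst (X (z, w)) = w *s a z + b z" for z w
    by (simp add: vec_eq_iff f(3) a_def b_def)
  from hwh_split[OF G order.refl] obtain g0 g1 g2 where
    g: "hpoly (\<lambda>\<alpha>. wlen \<mu> \<alpha> = 2) g0" "hpoly (\<lambda>\<alpha>. wlen \<mu> \<alpha> = 1) g1" "hpoly (\<lambda>\<alpha>. wlen \<mu> \<alpha> = 0) g2"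
      "\<And>z w. snd (X (z, w)) = g0 z + w * g1 z + w\<^sup>2 * g2 z" by auto
  from hpoly_weight_0[OF g(3)] obtain c where c: "g2 = (\<lambda>z. c)" by blast
  have A1: "bipoly (\<lambda>\<alpha> \<beta>. mixed \<alpha> \<beta>) (dhol a p)" and A2: "bipoly (\<lambda>\<alpha> \<beta>. mixed \<alpha> \<beta>) (dbar a p)"
    by (rule dhol_weight[OF bipoly_p a] dbar_weight[OF bipoly_p a], simp add: mixed_def)+
  have B1: "bipoly (\<lambda>\<alpha> \<beta>. wlen \<mu> \<alpha> + wlen \<mu> \<beta> = 2 \<and> 1 < wlen \<mu> \<alpha> \<and> 0 < wlen \<mu> \<beta>) (dhol b p)"
    by (rule dhol_weight[OF bipoly_p b]) (auto simp: mixed_def)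
  have B2: "bipoly (\<lambda>\<alpha> \<beta>. wlen \<mu> \<alpha> + wlen \<mu> \<beta> = 2 \<and> 0 < wlen \<mu> \<alpha> \<and> 1 < wlen \<mu> \<beta>) (dbar b p)"
    by (rule dbar_weight[OF bipoly_p b]) (auto simp: mixed_def)
  from X obtain U where U: "0 \<in> U" "open U"
    "\<And>x. x \<in> U \<Longrightarrow> x \<in> model_hypersurface P \<Longrightarrow> frechet_derivative (model_defining P) (at x) (X x) = 0"
    by (auto simp: g1_def aut_model_def hol_on_def)
  \<comment> \<open>Tangency is given near the origin only. A weighted dilation moves any point of
    the hypersurface into \<open>U\<close>, and both sides scale by
    \<open>s\<^sup>2\<close>.\<close>
  have tang: "Im (snd (X (z, w))) = 2 * Re (dhol b p z + w * dhol a p z)" if w: "Im w = P z" for z w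
  proof -
    have "((\<lambda>s. (dil \<mu> s z, of_real s * w)) \<longlongrightarrow> (0, of_real 0 * w)) (at_right 0)"
      by (intro tendsto_intros dil_tendsto)
    then have "\<forall>\<^sub>F s in at_right (0::real). (dil \<mu> s z, of_real s * w) \<in> U"
      using U(1,2) by (intro topological_tendstoD) (auto simp: zero_prod_def)
    then have "\<forall>\<^sub>F s in at_right (0::real). s > 0 \<and> (dil \<mu> s z, of_real s * w) \<in> U"
      using eventually_at_right_less by eventually_elim auto
    then obtain s :: real where s: "s > 0" "(dil \<mu> s z, of_real s * w) \<in> U"
      using eventually_happens' trivial_limit_at_right_real by blast
    have "(dil \<mu> s z, of_real s * w) \<in> model_hypersurface P"
      using w s by (simp add: model_hypersurface_def P_dil)
    from U(3)[OF s(2) this]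
    have 1: "Im (snd (X (dil \<mu> s z, of_real s * w))) =
        2 * Re (dhol (\<lambda>_. (of_real s * w) *s a (dil \<mu> s z) + b (dil \<mu> s z)) p (dil \<mu> s z))"
      by (simp add: model_frechet Xab)
    have 2: "dhol (\<lambda>_. (of_real s * w) *s a (dil \<mu> s z) + b (dil \<mu> s z)) p (dil \<mu> s z) =
        (of_real s * w) * dhol a p (dil \<mu> s z) + dhol b p (dil \<mu> s z)"
      unfolding dhol_fadd dhol_fscale
      by (intro arg_cong2[where f="(+)"] arg_cong2[where f="(*)"] refl dhol_cong)
    have 3: "dhol a p (dil \<mu> s z) = of_real (s powr 1) * dhol a p z"
      by (rule bipoly_dil[OF bipoly_mono[OF A1] s(1)]) (simp add: mixed_def)
    have 4: "dhol b p (dil \<mu> s z) = of_real (s powr 2) * dhol b p z"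
      by (rule bipoly_dil[OF bipoly_mono[OF B1] s(1)]) simp
    have 5: "snd (X (dil \<mu> s z, of_real s * w)) = of_real (s\<^sup>2) * snd (X (z, w))"
      using hpoly_dil[OF g(1) s(1)] hpoly_dil[OF g(2) s(1)] s(1)
      by (simp add: g(4) c algebra_simps power2_eq_square)
    have "s\<^sup>2 * Im (snd (X (z, w))) = s\<^sup>2 * (2 * Re (dhol b p z + w * dhol a p z))"
      using 1 s(1) unfolding 2 3 4 5 by (simp add: algebra_simps power2_eq_square)
    then show ?thesis using s(1) by simp
  qed
  have quad: "Im c = 0" "2 * P z * Re c + Im (g1 z) - 2 * Re (dhol a p z) = 0"
     "- (P z)\<^sup>2 * Im c + P z * Re (g1 z) + Im (g0 z) - 2 * Re (dhol b p z) + 2 * P z * Im (dhol a p z) = 0" for z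
  proof -
    have "Im c * u\<^sup>2 + (2 * P z * Re c + Im (g1 z) - 2 * Re (dhol a p z)) * u +
      (- (P z)\<^sup>2 * Im c + P z * Re (g1 z) + Im (g0 z) - 2 * Re (dhol b p z) + 2 * P z * Im (dhol a p z)) = 0" for u
      using tang[of "Complex u (P z)" z] by (simp add: g(4) c algebra_simps power2_eq_square)
    note q = quadratic_zero[OF this]
    show "Im c = 0" "2 * P z * Re c + Im (g1 z) - 2 * Re (dhol a p z) = 0"
     "- (P z)\<^sup>2 * Im c + P z * Re (g1 z) + Im (g0 z) - 2 * Re (dhol b p z) + 2 * P z * Im (dhol a p z) = 0"
      by (fact q)+
  qed
  define \<gamma> where "\<gamma> = Re c"
  have c\<gamma>: "c = of_real \<gamma>" using quad(1) by (simp add: \<gamma>_def complex_eq_iff)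
  \<comment> \<open>\<open>g1\<close> has holomorphic weight 1, while its conjugate and all terms
    built from \<open>p\<close> have holomorphic weight below 1.\<close>
  have g1z: "g1 = (\<lambda>z. 0)"
  proof (rule bipoly_weight_separate[where m=\<mu>])
    show "bipoly (\<lambda>\<alpha> \<beta>. \<beta> = (\<lambda>_. 0) \<and> wlen \<mu> \<alpha> = 1) g1" by (fact g(2))
    have "bipoly (\<lambda>\<alpha> \<beta>. wlen \<mu> \<alpha> < 1) (\<lambda>z. (- cnj (g1 z)) + (4 * of_real \<gamma> * \<i> * p z - 2 * \<i> * (dhol a p z + dbar a p z)))"
    proof (intro bipoly_add bipoly_minus bipoly_diff bipoly_scale)
      show "bipoly (\<lambda>\<alpha> \<beta>. wlen \<mu> \<alpha> < 1) (\<lambda>z. cnj (g1 z))"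
        by (rule bipoly_mono[OF bipoly_cnj[OF g(2)]]) simp
      show "bipoly (\<lambda>\<alpha> \<beta>. wlen \<mu> \<alpha> < 1) p" by (rule bipoly_mono[OF bipoly_p]) (simp add: mixed_def)
      show "bipoly (\<lambda>\<alpha> \<beta>. wlen \<mu> \<alpha> < 1) (dhol a p)" by (rule bipoly_mono[OF A1]) (simp add: mixed_def)
      show "bipoly (\<lambda>\<alpha> \<beta>. wlen \<mu> \<alpha> < 1) (dbar a p)" by (rule bipoly_mono[OF A2]) (simp add: mixed_def)
    qed
    then show "bipoly (\<lambda>\<alpha> \<beta>. wlen \<mu> \<alpha> < 1) (\<lambda>z. (- cnj (g1 z)) + (4 * of_real \<gamma> * \<i> * p z - 2 * \<i> * (dhol a p z + dbar a p z)))" .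
    show "g1 z + ((- cnj (g1 z)) + (4 * of_real \<gamma> * \<i> * p z - 2 * \<i> * (dhol a p z + dbar a p z))) = 0" for z
      using quad(2)[of z] by (simp add: complex_eq_iff dbar_p \<gamma>_def algebra_simps)
  qed auto
  \<comment> \<open>The same comparison with threshold 2: products of two mixed terms stay below it,
    and so does \<open>dhol b p\<close>, whose terms keep a conjugate factor of positive
    weight.\<close>
  have g0z: "g0 = (\<lambda>z. 0)"
  proof (rule bipoly_weight_separate[where m=\<mu>])
    show "bipoly (\<lambda>\<alpha> \<beta>. \<beta> = (\<lambda>_. 0) \<and> wlen \<mu> \<alpha> = 2) g0" by (fact g(1))
    show "bipoly (\<lambda>\<alpha> \<beta>. wlen \<mu> \<alpha> < 2) (\<lambda>z. (- cnj (g0 z)) + (2 * (p z * (dhol a p z - dbar a p z)) - 2 * \<i> * (dhol b p z + dbar b p z)))"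
    proof (intro bipoly_add bipoly_minus bipoly_diff bipoly_scale)
      show "bipoly (\<lambda>\<alpha> \<beta>. wlen \<mu> \<alpha> < 2) (\<lambda>z. cnj (g0 z))"
        by (rule bipoly_mono[OF bipoly_cnj[OF g(1)]]) simp
      show "bipoly (\<lambda>\<alpha> \<beta>. wlen \<mu> \<alpha> < 2) (\<lambda>z. p z * (dhol a p z - dbar a p z))"
        by (rule bipoly_mult[OF bipoly_p bipoly_diff[OF A1 A2]]) (auto simp: mixed_def wlen_add)
      show "bipoly (\<lambda>\<alpha> \<beta>. wlen \<mu> \<alpha> < 2) (dhol b p)" by (rule bipoly_mono[OF B1]) simp
      show "bipoly (\<lambda>\<alpha> \<beta>. wlen \<mu> \<alpha> < 2) (dbar b p)" by (rule bipoly_mono[OF B2]) simp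
    qed
    show "g0 z + ((- cnj (g0 z)) + (2 * (p z * (dhol a p z - dbar a p z)) - 2 * \<i> * (dhol b p z + dbar b p z))) = 0" for z
      using quad(3)[of z] by (simp add: complex_eq_iff dbar_p g1z quad(1) algebra_simps)
  qed auto
  show ?thesis
  proof (rule that[OF a b])
    show "X (z, w) = (w *s a z + b z, complex_of_real \<gamma> * w\<^sup>2)" for z w
      using Xab[of z w] g(4)[of z w] by (simp add: prod_eq_iff g0z g1z c c\<gamma>)
    show "dhol a p z + dbar a p z = 2 * of_real \<gamma> * p z" for z
      using quad(2)[of z] by (simp add: complex_eq_iff dbar_p g1z \<gamma>_def mult.commute)
    show "dhol b p z + dbar b p z = p z * ((dhol a p z - dbar a p z) / \<i>)" for z
      using quad(3)[of z] by (simp add: complex_eq_iff dbar_p g1z g0z quad(1))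
  qed
qed

end

subsection \<open>The reproducing field\<close>

context nondeg_model
begin

context
  fixes a b :: "complex^'a \<Rightarrow> complex^'a" and \<gamma> :: real
  assumes a: "\<And>j. hpoly (\<lambda>\<alpha>. wlen \<mu> \<alpha> = 0 + \<mu> j) (\<lambda>z. a z $ j)"
    and b: "\<And>j. hpoly (\<lambda>\<alpha>. wlen \<mu> \<alpha> = 1 + \<mu> j) (\<lambda>z. b z $ j)"
    and eqA: "\<And>z. dhol a p z + dbar a p z = 2 * of_real \<gamma> * p z"
    and eqB: "\<And>z. dhol b p z + dbar b p z = p z * ((dhol a p z - dbar a p z) / \<i>)"
begin

lemma any_ab: "anypoly f \<Longrightarrow> anypoly (dhol a f)" "anypoly f \<Longrightarrow> anypoly (dhol b f)"
  "anypoly f \<Longrightarrow> anypoly (dbar a f)" "anypoly f \<Longrightarrow> anypoly (dbar b f)"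
  by (auto intro: anypoly_dhol anypoly_dbar hpoly_any[OF a] hpoly_any[OF b])

text \<open>As \<open>p\<close> is real, this is the imaginary part of \<open>dhol a p\<close>; the
  real part is \<open>\<gamma> p\<close>.\<close>

definition q :: "complex^'a \<Rightarrow> complex" where
  "q z = (dhol a p z - dbar a p z) / (2 * \<i>)"

lemma anypoly_q: "anypoly q"
  unfolding q_def[abs_def] by (intro bipoly_divide bipoly_diff any_ab anypoly_p)

lemma dhol_a_p: "dhol a p = (\<lambda>z. of_real \<gamma> * p z + \<i> * q z)"
proof
  fix z
  show "dhol a p z = of_real \<gamma> * p z + \<i> * q z"
  proof -
    have "\<i> * (x / (2 * \<i>)) = x / 2" for x by (simp add: field_simps)
    then have "\<i> * q z = (dhol a p z - dbar a p z) / 2" by (simp only: q_def)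
    then have "2 * (\<i> * q z) = dhol a p z - dbar a p z" by (simp add: mult.commute)
    then have "2 * dhol a p z = 2 * (of_real \<gamma> * p z + \<i> * q z)" using eqA[of z] by algebra
    then show ?thesis by (rule mult_left_cancel[THEN iffD1, rotated]) simp
  qed
qed

lemma dhol_b_p: "dhol b p z + dbar b p z = 2 * (p z * q z)"
  unfolding eqB q_def by simp

text \<open>Put \<open>A = dhol a + dbar a\<close>, \<open>B = dhol b + dbar b\<close> and
  \<open>k = 2 \<gamma>\<close>. Tangency says \<open>A p = k p\<close> and
  \<open>B p = 2 p q\<close>, whence \<open>A q = k q\<close> and \<open>[A, B] p = k B p\<close>.
  Since \<open>dhol\<close> and \<open>dbar\<close> commute, this says that the derivatives of
  \<open>p\<close> along \<open>c = [a, b] - k b\<close> and along its conjugate add up to 0. Their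
  holomorphic weights lie above and below 1, so each vanishes, and nondegeneracy gives
  \<open>c = 0\<close>.\<close>

lemma commutator:
  assumes f: "anypoly f"
  shows "dhol a (dhol b f) z = dhol b (dhol a f) z + 2 * of_real \<gamma> * dhol b f z"
proof -
  define k where "k = 2 * complex_of_real \<gamma>"
  define c where "c z = (\<chi> j. dhol a (\<lambda>z. b z $ j) z - dhol b (\<lambda>z. a z $ j) z - k * b z $ j)" for z
  have c: "hpoly (\<lambda>\<alpha>. wlen \<mu> \<alpha> = 1 + \<mu> j) (\<lambda>z. c z $ j)" for j
    unfolding c_def vec_lambda_beta
    by (intro bipoly_diff bipoly_scale b dhol_weight[OF b a] dhol_weight[OF a b]) auto
  have bracket: "dhol c f z = dhol a (dhol b f) z - dhol b (dhol a f) z - k * dhol b f z" if "anypoly f" for f z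
    by (rule dhol_bracket[OF hpoly_any[OF a] hpoly_any[OF b] that]) (simp add: c_def)
  have "dhol c p = (\<lambda>z. 0)"
  proof (rule bipoly_weight_separate[where m=\<mu>])
    show "bipoly (\<lambda>\<alpha> \<beta>. 1 < wlen \<mu> \<alpha>) (dhol c p)"
      by (rule dhol_weight[OF bipoly_p c]) (simp add: mixed_def)
    have 1: "bipoly mixed (dbar a p)"
      by (rule dbar_weight[OF bipoly_p a]) (simp add: mixed_def)
    have 2: "bipoly (\<lambda>\<alpha> \<beta>. wlen \<mu> \<alpha> < 1) (dbar b p)"
      by (rule dbar_weight[OF bipoly_p b]) (simp add: mixed_def)
    show "bipoly (\<lambda>\<alpha> \<beta>. wlen \<mu> \<alpha> < 1) (\<lambda>z. dbar a (dbar b p) z - dbar b (dbar a p) z - k * dbar b p z)"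
      by (intro bipoly_diff bipoly_scale 2 dbar_weight[OF 2 a] dbar_weight[OF 1 b]) (simp_all add: mixed_def)
    fix z
    note anys = any_ab anypoly_p anypoly_q anypoly_mult bipoly_scale
    have eA: "(\<lambda>z. dhol a p z + dbar a p z) = (\<lambda>z. k * p z)" using eqA by (simp add: k_def)
    have eB: "(\<lambda>z. dhol b p z + dbar b p z) = (\<lambda>z. 2 * (p z * q z))" using dhol_b_p by simp
    have AA: "dhol a (dhol a p) z + dhol a (dbar a p) z = k * dhol a p z"
      using fun_cong[OF arg_cong[OF eA, of "dhol a"], of z]
      by (simp only: dhol_add_fun dhol_scale_fun anys)
    have AA': "dbar a (dhol a p) z + dbar a (dbar a p) z = k * dbar a p z"
      using fun_cong[OF arg_cong[OF eA, of "dbar a"], of z]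
      by (simp only: dbar_add_fun dbar_scale_fun anys)
    have BA: "dhol b (dhol a p) z + dhol b (dbar a p) z = k * dhol b p z"
      using fun_cong[OF arg_cong[OF eA, of "dhol b"], of z]
      by (simp only: dhol_add_fun dhol_scale_fun anys)
    have BA': "dbar b (dhol a p) z + dbar b (dbar a p) z = k * dbar b p z"
      using fun_cong[OF arg_cong[OF eA, of "dbar b"], of z]
      by (simp only: dbar_add_fun dbar_scale_fun anys)
    have AB: "dhol a (dhol b p) z + dhol a (dbar b p) z = 2 * (dhol a p z * q z + p z * dhol a q z)"
      using fun_cong[OF arg_cong[OF eB, of "dhol a"], of z]
      by (simp only: dhol_add_fun dhol_scale_fun dhol_mult_fun anys)
    have AB': "dbar a (dhol b p) z + dbar a (dbar b p) z = 2 * (dbar a p z * q z + p z * dbar a q z)"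
      using fun_cong[OF arg_cong[OF eB, of "dbar a"], of z]
      by (simp only: dbar_add_fun dbar_scale_fun dbar_mult_fun anys)
    have qe: "q = (\<lambda>z. inverse (2 * \<i>) * (dhol a p z - dbar a p z))"
      by (intro ext) (simp only: q_def divide_inverse mult.commute)
    have Aq: "dhol a q z = inverse (2 * \<i>) * (dhol a (dhol a p) z - dhol a (dbar a p) z)"
      unfolding qe by (simp only: dhol_scale_fun dhol_diff_fun anys bipoly_diff)
    have Aq': "dbar a q z = inverse (2 * \<i>) * (dbar a (dhol a p) z - dbar a (dbar a p) z)"
      unfolding qe by (simp only: dbar_scale_fun dbar_diff_fun anys bipoly_diff)
    have c1: "dhol a (dbar a p) z = dbar a (dhol a p) z"
      using dhol_dbar_commute[OF a a anypoly_p] by simp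
    have c2: "dhol a (dbar b p) z = dbar b (dhol a p) z"
      using dhol_dbar_commute[OF a b anypoly_p] by simp
    have c3: "dhol b (dbar a p) z = dbar a (dhol b p) z"
      using dhol_dbar_commute[OF b a anypoly_p] by simp
    have "dhol a q z + dbar a q z = inverse (2 * \<i>) * (dhol a (dhol a p) z - dbar a (dbar a p) z)"
      unfolding Aq Aq' c1 by (simp add: algebra_simps)
    also have "dhol a (dhol a p) z - dbar a (dbar a p) z = k * (dhol a p z - dbar a p z)"
      using AA AA' c1 by algebra
    finally have qq: "dhol a q z + dbar a q z = k * q z" by (simp add: q_def[of z] field_simps)
    have s1: "dhol a p z + dbar a p z = k * p z" using eqA by (simp add: k_def)
    have "(dhol a (dhol b p) z + dhol a (dbar b p) z) + (dbar a (dhol b p) z + dbar a (dbar b p) z) =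
       2 * ((dhol a p z + dbar a p z) * q z + p z * (dhol a q z + dbar a q z))"
      unfolding AB AB' by (simp add: algebra_simps)
    also have "\<dots> = 2 * k * (2 * (p z * q z))" unfolding qq s1 by (simp add: algebra_simps)
    also have "\<dots> = 2 * k * (dhol b p z + dbar b p z)" by (simp only: dhol_b_p)
    finally show "dhol c p z + (dbar a (dbar b p) z - dbar b (dbar a p) z - k * dbar b p z) = 0"
      using BA BA' unfolding bracket[OF anypoly_p] c2 c3 by algebra
  qed simp
  then have "c z = 0" for z using field_zero[OF c] by (simp add: fun_eq_iff)
  then have "dhol c f z = 0"
    using linear_0[OF has_derivative_linear[OF bipoly_has_derivative[OF f]]]
    by (simp add: dhol_def)
  with bracket[OF f, of z] show ?thesis by (simp add: k_def algebra_simps)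
qed

section \<open>Nilpotency of \<open>b\<close> on \<open>p\<close> and \<open>q\<close>\<close>

abbreviation nil :: "(complex^'a \<Rightarrow> complex) \<Rightarrow> bool" where
  "nil \<equiv> gen_eig b 0"

lemma b_any: "anypoly (\<lambda>z. b z $ j)" by (rule hpoly_any[OF b])

interpretation bf: poly_field b
  by unfold_locales (rule b_any)

lemma lshift_b0: "lshift b 0 = dhol b"
  by (simp add: lshift_def fun_eq_iff)

lemma nil_if_dhol: "nil (dhol b f) \<Longrightarrow> anypoly f \<Longrightarrow> nil f"
  unfolding gen_eig_def lshift_b0 by (metis funpow_Suc_right comp_apply)

text \<open>By the commutator relation \<open>dhol b (dhol a f)\<close> is a combination of
  \<open>dhol a (dhol b f)\<close> and \<open>dhol b f\<close>, so an induction on the nilpotency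
  order of \<open>f\<close> applies.\<close>

lemma nil_dhol_a:
  assumes "nil f"
  shows "nil (dhol a f)"
proof -
  have "nil (dhol a f)" if "(dhol b ^^ k) f = (\<lambda>z. 0)" "anypoly f" for k f
    using that
  proof (induction k arbitrary: f)
    case 0
    then show ?case by (simp add: bf.gen_eig_zero)
  next
    case (Suc k)
    have 1: "(dhol b ^^ k) (dhol b f) = (\<lambda>z. 0)"
      using Suc.prems(1) by (simp add: funpow_Suc_right del: funpow.simps)
    have n1: "nil (dhol a (dhol b f))" by (rule Suc.IH[OF 1 any_ab(2)[OF Suc.prems(2)]])
    have n2: "nil (dhol b f)"
      using 1 any_ab(2)[OF Suc.prems(2)] unfolding gen_eig_def lshift_b0 by blast
    have "dhol b (dhol a f) = (\<lambda>z. dhol a (dhol b f) z + (- 2 * of_real \<gamma>) * dhol b f z)"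
      using commutator[OF Suc.prems(2)] by (simp add: fun_eq_iff)
    moreover have "nil (\<lambda>z. dhol a (dhol b f) z + (- 2 * of_real \<gamma>) * dhol b f z)"
      by (rule bf.gen_eig_add[OF n1 bf.gen_eig_scale[OF n2]])
    ultimately have "nil (dhol b (dhol a f))" by simp
    then show ?case by (rule nil_if_dhol) (intro any_ab Suc.prems)
  qed
  with assms show ?thesis unfolding gen_eig_def lshift_b0 by blast
qed

text \<open>\<open>dhol b\<close> preserves conjugate exponents, so a power that kills
  \<open>f\<close> kills its parts of low and of high conjugate weight separately.\<close>

lemma nil_part:
  assumes "nil f" "f = (\<lambda>z. g z + h z)"
    and "bipoly (\<lambda>\<alpha> \<beta>. wlen \<mu> \<beta> < c) g" "bipoly (\<lambda>\<alpha> \<beta>. \<not> wlen \<mu> \<beta> < c) h"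
  shows "nil g"
proof -
  from assms(1) obtain k where k: "(dhol b ^^ k) f = (\<lambda>z. 0)" by (auto simp: gen_eig_def lshift_b0)
  have gh: "anypoly g" "anypoly h" using assms bipoly_any by blast+
  have "(dhol b ^^ k) f = (\<lambda>z. (dhol b ^^ k) g z + (dhol b ^^ k) h z)"
    unfolding assms(2) using bf.lshift_pow_add[OF gh, of k 0] by (simp add: lshift_b0)
  then have sum0: "(dhol b ^^ k) g z + (dhol b ^^ k) h z = 0" for z using k by (simp add: fun_eq_iff)
  have "bipoly (\<lambda>\<alpha> \<beta>. wlen \<mu> \<beta> < c) ((dhol b ^^ k) g)"
  proof (induction k)
    case (Suc k)
    show ?case unfolding funpow.simps comp_apply by (rule dhol_weight[OF Suc b])
  qed (simp add: assms)
  moreover have "bipoly (\<lambda>\<alpha> \<beta>. \<not> wlen \<mu> \<beta> < c) ((dhol b ^^ k) h)"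
  proof (induction k)
    case (Suc k)
    show ?case unfolding funpow.simps comp_apply by (rule dhol_weight[OF Suc b])
  qed (simp add: assms)
  ultimately have "(dhol b ^^ k) g = (\<lambda>z. 0)"
    using sum0 by (rule bipoly_coweight_separate[where m=\<mu>]) auto
  with gh show ?thesis unfolding gen_eig_def lshift_b0 by blast
qed

text \<open>The component of \<open>dhol b p\<close> of a given conjugate weight is built from components of \<open>p\<close> and \<open>q\<close>
  of strictly smaller conjugate weight; hence nilpotency propagates upwards in this weight.\<close>

lemma nil_low_weight:
  assumes e: "e > 0" "\<And>\<alpha>. wlen \<mu> \<alpha> > 0 \<Longrightarrow> wlen \<mu> \<alpha> \<ge> e"
    and "p = (\<lambda>z. g z + h z)" "bipoly (\<lambda>\<alpha> \<beta>. mixed \<alpha> \<beta> \<and> wlen \<mu> \<beta> < real n * e) g"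
      "bipoly (\<lambda>\<alpha> \<beta>. mixed \<alpha> \<beta> \<and> \<not> wlen \<mu> \<beta> < real n * e) h"
  shows "nil g"
  using assms(3-)
proof (induction n arbitrary: g h)
  case 0
  have "g = (\<lambda>z. 0)" by (rule bipoly_empty[OF 0(2)]) (auto simp: mixed_def)
  then show ?case by (simp add: bf.gen_eig_zero)
next
  case (Suc n)
  \<comment> \<open>The cap at 1 keeps \<open>dbar b p\<close>, whose conjugate weights exceed 1,
    out of the low part. Conjugate weights in \<open>p\<close> are below 1 in any case.\<close>
  define c where "c = min (real (Suc n) * e) 1"
  obtain p1 p2 where p12: "bipoly (\<lambda>\<alpha> \<beta>. mixed \<alpha> \<beta> \<and> wlen \<mu> \<beta> < real n * e) p1"
    "bipoly (\<lambda>\<alpha> \<beta>. mixed \<alpha> \<beta> \<and> \<not> wlen \<mu> \<beta> < real n * e) p2" "p = (\<lambda>z. p1 z + p2 z)"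
    using bipoly_split[OF bipoly_p, of "\<lambda>\<alpha> \<beta>. wlen \<mu> \<beta> < real n * e"] by blast
  have nil1: "nil p1" by (rule Suc.IH[OF p12(3,1,2)])
  note any12 = bipoly_any[OF p12(1)] bipoly_any[OF p12(2)]
  \<comment> \<open>\<open>a\<close> has weight 0, so the splitting of \<open>p\<close> induces one
    of \<open>q = - \<i> dhol a p + \<i> \<gamma> p\<close>.\<close>
  define q1 where "q1 z = (- \<i>) * dhol a p1 z + (\<i> * of_real \<gamma>) * p1 z" for z
  define q2 where "q2 z = (- \<i>) * dhol a p2 z + (\<i> * of_real \<gamma>) * p2 z" for z
  have qe: "q z = q1 z + q2 z" for z
  proof -
    have "dhol a p1 z + dhol a p2 z = of_real \<gamma> * p z + \<i> * q z"
      using fun_cong[OF dhol_a_p, of z] unfolding p12(3) by (simp add: dhol_add_fun any12)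
    then have "q z = - \<i> * (dhol a p1 z + dhol a p2 z - of_real \<gamma> * p z)" by (simp add: algebra_simps)
    then show ?thesis by (simp add: q1_def q2_def fun_cong[OF p12(3)] algebra_simps)
  qed
  have nilq1: "nil q1" unfolding q1_def[abs_def]
    by (intro bf.gen_eig_add bf.gen_eig_scale nil1 nil_dhol_a)
  have Q2: "bipoly (\<lambda>\<alpha> \<beta>. mixed \<alpha> \<beta> \<and> \<not> wlen \<mu> \<beta> < real n * e) q2" unfolding q2_def[abs_def]
    by (intro bipoly_add bipoly_scale p12(2) dhol_weight[OF p12(2) a]) (auto simp: mixed_def)
  have Q1: "bipoly mixed q1" unfolding q1_def[abs_def]
    by (intro bipoly_add bipoly_scale bipoly_mono[OF p12(1)] dhol_weight[OF p12(1) a]) (auto simp: mixed_def)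
  have nil11: "nil (\<lambda>z. 2 * (p1 z * q1 z))"
    using bf.gen_eig_scale[OF bf.gen_eig_mult[OF nil1 nilq1]] by simp
  obtain r1 r2 where r: "bipoly (\<lambda>\<alpha> \<beta>. True \<and> wlen \<mu> \<beta> < c) r1" "bipoly (\<lambda>\<alpha> \<beta>. True \<and> \<not> wlen \<mu> \<beta> < c) r2"
      "(\<lambda>z. 2 * (p1 z * q1 z)) = (\<lambda>z. r1 z + r2 z)"
    using bipoly_split[of "\<lambda>_ _. True" "\<lambda>z. 2 * (p1 z * q1 z)" "\<lambda>\<alpha> \<beta>. wlen \<mu> \<beta> < c"] nil11
    by (auto simp: gen_eig_def)
  have nilr: "nil r1"
    by (rule nil_part[OF nil11 r(3)]) (use r in simp_all)
  have ge: "wlen \<mu> \<beta> \<ge> e" if "mixed \<alpha> \<beta>" for \<alpha> \<beta> using that e by (auto simp: mixed_def)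
  \<comment> \<open>One factor has conjugate weight at least \<open>n e\<close> and the other at
    least \<open>e\<close>. Hence only the product \<open>p1 q1\<close> can contribute below
    \<open>c\<close>.\<close>
  have big: "bipoly (\<lambda>\<alpha> \<beta>. \<not> wlen \<mu> \<beta> < c) (\<lambda>z. f z * k z)"
    if "bipoly (\<lambda>\<alpha> \<beta>. mixed \<alpha> \<beta> \<and> \<not> wlen \<mu> \<beta> < real n * e) f" "bipoly mixed k" for f k
  proof (rule bipoly_mult[OF that])
    fix \<alpha> \<beta> \<alpha>' \<beta>' assume "mixed \<alpha> \<beta> \<and> \<not> wlen \<mu> \<beta> < real n * e" "mixed \<alpha>' \<beta>'"
    with ge[of \<alpha>' \<beta>'] show "\<not> wlen \<mu> (\<lambda>j. \<beta> j + \<beta>' j) < c"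
      by (simp add: c_def wlen_add algebra_simps)
  qed
  have anygh: "anypoly g" "anypoly h" using Suc.prems bipoly_any by blast+
  have "(\<lambda>z. dhol b g z - r1 z) = (\<lambda>z. 0)"
  proof (rule bipoly_coweight_separate[where m=\<mu>])
    show "bipoly (\<lambda>\<alpha> \<beta>. wlen \<mu> \<beta> < c) (\<lambda>z. dhol b g z - r1 z)"
      by (intro bipoly_diff dhol_weight[OF Suc.prems(2) b]) (use r in \<open>auto simp: mixed_def c_def\<close>)
    have mp2: "bipoly mixed p2" by (rule bipoly_mono[OF p12(2)]) simp
    have mq2: "bipoly mixed q2" by (rule bipoly_mono[OF Q2]) simp
    show "bipoly (\<lambda>\<alpha> \<beta>. \<not> wlen \<mu> \<beta> < c)
       (\<lambda>z. dhol b h z + (dbar b p z - (r2 z + (2 * (q2 z * p1 z) + 2 * (p2 z * q1 z) + 2 * (p2 z * q2 z)))))"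
    proof (intro bipoly_add bipoly_diff bipoly_scale big p12 Q2 Q1 mp2 mq2)
      show "bipoly (\<lambda>\<alpha> \<beta>. \<not> wlen \<mu> \<beta> < c) (dhol b h)"
        by (rule dhol_weight[OF Suc.prems(3) b]) (auto simp: c_def)
      show "bipoly (\<lambda>\<alpha> \<beta>. \<not> wlen \<mu> \<beta> < c) (dbar b p)"
        by (rule dbar_weight[OF bipoly_p b]) (auto simp: c_def mixed_def)
      show "bipoly (\<lambda>\<alpha> \<beta>. \<not> wlen \<mu> \<beta> < c) r2" using r by simp
      show "bipoly mixed p1" by (rule bipoly_mono[OF p12(1)]) simp
    qed
    fix z
    have "dhol b g z + dhol b h z + dbar b p z = 2 * ((p1 z + p2 z) * (q1 z + q2 z))"
      using dhol_b_p[of z] fun_cong[OF p12(3), of z] qe[of z]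
      unfolding dhol_add_fun[OF anygh, of b, folded Suc.prems(1)] by simp
    then show "(dhol b g z - r1 z) + (dhol b h z + (dbar b p z - (r2 z + (2 * (q2 z * p1 z) + 2 * (p2 z * q1 z) + 2 * (p2 z * q2 z))))) = 0"
      using fun_cong[OF r(3), of z] by (simp add: algebra_simps)
  qed auto
  then have "dhol b g = r1" by (simp add: fun_eq_iff)
  with nilr anygh show ?case by (auto intro: nil_if_dhol)
qed

text \<open>Conjugate weights in \<open>p\<close> are below 1, so with a threshold above 1 the low
  part is all of \<open>p\<close>.\<close>

lemma nil_p: "nil p" and nil_q: "nil q"
proof -
  obtain e where e: "e > 0" "\<And>\<alpha>. wlen \<mu> \<alpha> > 0 \<Longrightarrow> wlen \<mu> \<alpha> \<ge> e" using wlen_gap by blast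
  obtain n where n: "1 < real n * e" using reals_Archimedean3[OF e(1)] by blast
  show 1: "nil p"
  proof (rule nil_low_weight[OF e(1) e(2)])
    show "p = (\<lambda>z. p z + 0)" by simp
    show "bipoly (\<lambda>\<alpha> \<beta>. mixed \<alpha> \<beta> \<and> wlen \<mu> \<beta> < real n * e) p"
      by (rule bipoly_mono[OF bipoly_p]) (use n in \<open>auto simp: mixed_def\<close>)
    show "bipoly (\<lambda>\<alpha> \<beta>. mixed \<alpha> \<beta> \<and> \<not> wlen \<mu> \<beta> < real n * e) (\<lambda>z. 0)" by (rule bipoly.zero)
  qed
  have "q = (\<lambda>z. (- \<i>) * dhol a p z + (\<i> * of_real \<gamma>) * p z)"
    by (simp add: dhol_a_p fun_eq_iff algebra_simps)
  then show "nil q"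
    using bf.gen_eig_add[OF bf.gen_eig_scale[OF nil_dhol_a[OF 1], of "- \<i>"] bf.gen_eig_scale[OF 1, of "\<i> * of_real \<gamma>"]]
    by simp
qed

section \<open>Degrees along the real flow of \<open>b\<close>\<close>

definition S :: "(complex^'a \<Rightarrow> complex) \<Rightarrow> complex^'a \<Rightarrow> complex" where
  "S f = (\<lambda>z. dhol b f z + dbar b f z)"

lemma anypoly_S: "anypoly f \<Longrightarrow> anypoly (S f)"
  unfolding S_def by (intro bipoly_add any_ab)

lemma S_add: "anypoly f \<Longrightarrow> anypoly g \<Longrightarrow> S (\<lambda>z. f z + g z) = (\<lambda>z. S f z + S g z)"
  by (simp add: S_def dhol_add_fun dbar_add_fun algebra_simps)

lemma S_mult: "anypoly f \<Longrightarrow> anypoly g \<Longrightarrow> S (\<lambda>z. f z * g z) = (\<lambda>z. S f z * g z + f z * S g z)"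
  by (simp add: S_def dhol_mult_fun dbar_mult_fun algebra_simps)

lemma S_pow_any: "anypoly f \<Longrightarrow> anypoly ((S ^^ n) f)"
  by (induction n) (auto intro: anypoly_S)

lemma S_pow_zero [simp]: "(S ^^ n) (\<lambda>z. 0) = (\<lambda>z. 0)"
  by (induction n) (simp_all add: S_def)

lemma S_pow_add: "anypoly f \<Longrightarrow> anypoly g \<Longrightarrow> (S ^^ n) (\<lambda>z. f z + g z) = (\<lambda>z. (S ^^ n) f z + (S ^^ n) g z)"
  by (induction n) (simp_all add: S_add S_pow_any)

text \<open>\<open>dhol b\<close> and \<open>dbar b\<close> commute, so every term in the binomial
  expansion of a high power of \<open>S\<close> contains one of the two vanishing powers. The
  expansion is replaced by an induction on \<open>i + j\<close>.\<close>

lemma S_nilpotent: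
  assumes "(dhol b ^^ i) f = (\<lambda>z. 0)" "(dbar b ^^ j) f = (\<lambda>z. 0)" "anypoly f"
  shows "(S ^^ (i + j)) f = (\<lambda>z. 0)"
  using assms
proof (induction "i + j" arbitrary: i j f)
  case (Suc n)
  have comm: "(dhol b ^^ k) (dbar b f) = dbar b ((dhol b ^^ k) f)"
      "(dbar b ^^ k) (dhol b f) = dhol b ((dbar b ^^ k) f)" if f: "anypoly f" for k f
  proof (induction k)
    case (Suc k)
    have anyk: "anypoly ((dhol b ^^ k) f)" "anypoly ((dbar b ^^ k) f)" for k
      by (induction k) (auto intro: any_ab f)
    { case 1 show ?case using Suc by (simp add: dhol_dbar_commute[OF b b anyk(1)]) }
    { case 2 show ?case using Suc by (simp add: dhol_dbar_commute[OF b b anyk(2)]) }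
  qed simp_all
  show ?case
  proof (cases "i = 0 \<or> j = 0")
    case True
    then have "f = (\<lambda>z. 0)" using Suc.prems by auto
    then show ?thesis by simp
  next
    case False
    then obtain i' j' where ij: "i = Suc i'" "j = Suc j'" by (meson not0_implies_Suc)
    have j: "(dbar b ^^ j) (dhol b f) = (\<lambda>z. 0)" and i: "(dhol b ^^ i) (dbar b f) = (\<lambda>z. 0)"
      using Suc.prems by (simp_all add: comm)
    have 1: "(S ^^ (i' + j)) (dhol b f) = (\<lambda>z. 0)"
      by (rule Suc.hyps(1)[OF _ _ j any_ab(2)[OF Suc.prems(3)]])
         (use Suc.prems Suc.hyps(2) ij in \<open>auto simp: funpow_Suc_right simp del: funpow.simps\<close>)
    have 2: "(S ^^ (i + j')) (dbar b f) = (\<lambda>z. 0)"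
      by (rule Suc.hyps(1)[OF _ i _ any_ab(4)[OF Suc.prems(3)]])
         (use Suc.prems Suc.hyps(2) ij in \<open>auto simp: funpow_Suc_right simp del: funpow.simps\<close>)
    have "(S ^^ Suc n) f = (S ^^ n) (\<lambda>z. dhol b f z + dbar b f z)"
      by (simp add: funpow_Suc_right S_def[of f] del: funpow.simps)
    also have "\<dots> = (\<lambda>z. (S ^^ n) (dhol b f) z + (S ^^ n) (dbar b f) z)"
      by (rule S_pow_add) (intro any_ab Suc.prems)+
    also have "\<dots> = (\<lambda>z. 0)"
    proof -
      have "i' + j = n" "i + j' = n" using Suc.hyps(2) ij by auto
      with 1 2 show ?thesis by simp
    qed
    finally show ?thesis using Suc(2) by simp
  qed
qed auto

lemma S_nilpotent_real:
  assumes "nil f" "\<And>z. cnj (f z) = f z"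
  shows "\<exists>k. (S ^^ k) f = (\<lambda>z. 0)"
proof -
  from assms obtain i where i: "(dhol b ^^ i) f = (\<lambda>z. 0)" "anypoly f" by (auto simp: gen_eig_def lshift_b0)
  have "(dbar b ^^ n) f = (\<lambda>z. cnj ((dhol b ^^ n) f z))" for n
  proof (induction n)
    case (Suc n)
    have "anypoly ((dhol b ^^ n) f)" by (induction n) (auto intro: any_ab i)
    with Suc show ?case by (simp add: dhol_cnj_fun)
  qed (use assms(2) in simp)
  with i(1) have "(dbar b ^^ i) f = (\<lambda>z. 0)" by simp
  from S_nilpotent[OF i(1) this i(2)] show ?thesis by blast
qed

text \<open>Leibniz rule in top degree: the only surviving term is the product of the two top
  derivatives. Its coefficient is binomial, and positivity is the information that is kept.\<close>

lemma S_top: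
  assumes "anypoly f" "anypoly g" "(S ^^ Suc d) f = (\<lambda>z. 0)" "(S ^^ Suc e) g = (\<lambda>z. 0)"
  shows "\<exists>c>0. (S ^^ (d + e)) (\<lambda>z. f z * g z) = (\<lambda>z. of_nat c * ((S ^^ d) f z * (S ^^ e) g z))"
  using assms
proof (induction "d + e" arbitrary: d e f g)
  case 0
  then show ?case by (intro exI[of _ 1]) auto
next
  case (Suc n)
  have 1: "(S ^^ Suc n) (\<lambda>z. f z * g z) = (\<lambda>z. (S ^^ n) (\<lambda>z. S f z * g z) z + (S ^^ n) (\<lambda>z. f z * S g z) z)"
    using Suc.prems
    by (simp add: funpow_Suc_right S_mult S_pow_add anypoly_mult anypoly_S del: funpow.simps)
  have A: "\<exists>c. (S ^^ n) (\<lambda>z. S f z * g z) = (\<lambda>z. of_nat c * ((S ^^ d) f z * (S ^^ e) g z)) \<and> (d > 0 \<longrightarrow> c > 0)"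
  proof (cases d)
    case 0
    then have "S f = (\<lambda>z. 0)" using Suc.prems by simp
    then show ?thesis using 0 by (intro exI[of _ 0]) simp
  next
    case (Suc d')
    then have "\<exists>c>0. (S ^^ (d' + e)) (\<lambda>z. S f z * g z) = (\<lambda>z. of_nat c * ((S ^^ d') (S f) z * (S ^^ e) g z))"
      using Suc.hyps(2) Suc.prems
      by (intro Suc.hyps(1)) (auto simp: funpow_Suc_right anypoly_S simp del: funpow.simps)
    moreover have "d' + e = n" using Suc Suc.hyps(2) by simp
    ultimately show ?thesis using Suc by (auto simp: funpow_Suc_right simp del: funpow.simps)
  qed
  have B: "\<exists>c. (S ^^ n) (\<lambda>z. f z * S g z) = (\<lambda>z. of_nat c * ((S ^^ d) f z * (S ^^ e) g z)) \<and> (e > 0 \<longrightarrow> c > 0)"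
  proof (cases e)
    case 0
    then have "S g = (\<lambda>z. 0)" using Suc.prems by simp
    then show ?thesis using 0 by (intro exI[of _ 0]) simp
  next
    case (Suc e')
    then have "\<exists>c>0. (S ^^ (d + e')) (\<lambda>z. f z * S g z) = (\<lambda>z. of_nat c * ((S ^^ d) f z * (S ^^ e') (S g) z))"
      using Suc.hyps(2) Suc.prems
      by (intro Suc.hyps(1)) (auto simp: funpow_Suc_right anypoly_S simp del: funpow.simps)
    moreover have "d + e' = n" using Suc Suc.hyps(2) by simp
    ultimately show ?thesis using Suc by (auto simp: funpow_Suc_right simp del: funpow.simps)
  qed
  from A B obtain c1 c2 where c: "(S ^^ n) (\<lambda>z. S f z * g z) = (\<lambda>z. of_nat c1 * ((S ^^ d) f z * (S ^^ e) g z))" "d > 0 \<longrightarrow> c1 > 0"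
    "(S ^^ n) (\<lambda>z. f z * S g z) = (\<lambda>z. of_nat c2 * ((S ^^ d) f z * (S ^^ e) g z))" "e > 0 \<longrightarrow> c2 > 0" by blast
  have "d > 0 \<or> e > 0" using Suc.hyps(2) by auto
  then have "c1 + c2 > 0" using c by auto
  moreover have "(S ^^ (d + e)) (\<lambda>z. f z * g z) = (\<lambda>z. of_nat (c1 + c2) * ((S ^^ d) f z * (S ^^ e) g z))"
    unfolding Suc.hyps(2)[symmetric] 1 c by (simp add: algebra_simps)
  ultimately show ?case by blast
qed

text \<open>The \<open>d\<close> obtained plays the role of the degree of \<open>f\<close> along the
  flow of \<open>S\<close>.\<close>

lemma S_last:
  assumes "f \<noteq> (\<lambda>z. 0)" "(S ^^ k) f = (\<lambda>z. 0)"
  obtains d where "(S ^^ d) f \<noteq> (\<lambda>z. 0)" "(S ^^ Suc d) f = (\<lambda>z. 0)"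
proof -
  define d where "d = (LEAST k. (S ^^ k) f = (\<lambda>z. 0))"
  have 1: "(S ^^ d) f = (\<lambda>z. 0)" unfolding d_def using assms(2) by (rule LeastI)
  then obtain d' where d: "d = Suc d'" using assms(1) by (cases d) auto
  have "(S ^^ d') f \<noteq> (\<lambda>z. 0)" using not_less_Least[of d' "\<lambda>k. (S ^^ k) f = (\<lambda>z. 0)"] d by (simp add: d_def)
  with 1 d that show ?thesis by blast
qed

text \<open>If \<open>d\<close> and \<open>e\<close> are the degrees of \<open>p\<close> and \<open>q\<close> along the flow of \<open>S\<close>, then \<open>S p = 2 p q\<close> has
  degree \<open>d + e\<close>, but also degree less than \<open>d\<close>.\<close>

lemma q_zero: "q = (\<lambda>z. 0)"
proof (rule ccontr)
  assume q0: "q \<noteq> (\<lambda>z. 0)"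
  have p0: "p \<noteq> (\<lambda>z. 0)" using P_nonzero by (auto simp: p_def fun_eq_iff)
  have "cnj (q z) = q z" for z
    by (simp add: q_def dbar_p) (simp add: field_simps)
  from S_nilpotent_real[OF nil_q this] obtain k2 where k2: "(S ^^ k2) q = (\<lambda>z. 0)" by blast
  from S_nilpotent_real[OF nil_p cnj_p] obtain k1 where k1: "(S ^^ k1) p = (\<lambda>z. 0)" by blast
  obtain d where d: "(S ^^ d) p \<noteq> (\<lambda>z. 0)" "(S ^^ Suc d) p = (\<lambda>z. 0)" using S_last[OF p0 k1] by blast
  obtain e where e: "(S ^^ e) q \<noteq> (\<lambda>z. 0)" "(S ^^ Suc e) q = (\<lambda>z. 0)" using S_last[OF q0 k2] by blast
  \<comment> \<open>The top coefficient of \<open>S p = 2 p q\<close> is a positive multiple of the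
    product of the top coefficients of \<open>2 p\<close> and \<open>q\<close>.\<close>
  have "\<exists>c>0. (S ^^ (d + e)) (\<lambda>z. (2 * p z) * q z) = (\<lambda>z. of_nat c * ((S ^^ d) (\<lambda>z. 2 * p z) z * (S ^^ e) q z))"
  proof (rule S_top[OF bipoly_scale[OF anypoly_p] anypoly_q _ e(2)])
    have "(S ^^ Suc d) (\<lambda>z. p z + p z) = (\<lambda>z. 0)" unfolding S_pow_add[OF anypoly_p anypoly_p] d(2) by simp
    then show "(S ^^ Suc d) (\<lambda>z. 2 * p z) = (\<lambda>z. 0)" by (simp only: mult_2)
  qed
  then obtain c where c: "c > 0" "(S ^^ (d + e)) (\<lambda>z. 2 * (p z * q z)) = (\<lambda>z. of_nat c * ((S ^^ d) (\<lambda>z. 2 * p z) z * (S ^^ e) q z))"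
    by (auto simp: mult.assoc)
  have "(S ^^ d) (\<lambda>z. 2 * p z) z = 2 * (S ^^ d) p z" for z
    using fun_cong[OF S_pow_add[OF anypoly_p anypoly_p, of d], of z] by (simp only: mult_2)
  with c have c': "(S ^^ (d + e)) (\<lambda>z. 2 * (p z * q z)) = (\<lambda>z. of_nat c * (2 * ((S ^^ d) p z * (S ^^ e) q z)))"
    by (simp add: mult.assoc)
  have "S p = (\<lambda>z. 2 * (p z * q z))" using dhol_b_p by (simp add: S_def)
  then have "(S ^^ (d + e)) (\<lambda>z. 2 * (p z * q z)) = (S ^^ Suc (d + e)) p"
    by (simp add: funpow_Suc_right del: funpow.simps)
  \<comment> \<open>Counted from \<open>p\<close> itself, this power lies beyond the degree
    \<open>d\<close>.\<close>
  also have "\<dots> = (S ^^ e) ((S ^^ Suc d) p)"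
    using funpow_add[of e "Suc d" S] by (simp add: add.commute del: funpow.simps)
  also have "\<dots> = (\<lambda>z. 0)" unfolding d(2) by simp
  finally have 0: "(S ^^ d) p z * (S ^^ e) q z = 0" for z using c' c(1) by (simp add: fun_eq_iff)
  obtain z0 where "(S ^^ d) p z0 \<noteq> 0" using d(1) by auto
  from bipoly_no_zero_divisors[OF S_pow_any[OF anypoly_p] S_pow_any[OF anypoly_q] 0 this]
  have "(S ^^ e) q = (\<lambda>z. 0)" by auto
  with e(1) show False by simp
qed

text \<open>With \<open>q = 0\<close> the two halves of \<open>S p\<close> cancel, yet their
  holomorphic weights lie above and below 1. So \<open>dhol b p\<close> vanishes, and nondegeneracy
  applies to \<open>b\<close>.\<close>

lemma b_zero: "b z = 0" and dhol_a_p_eq: "dhol a p = (\<lambda>z. of_real \<gamma> * p z)"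
proof -
  show "dhol a p = (\<lambda>z. of_real \<gamma> * p z)" by (simp add: dhol_a_p q_zero)
  have "dhol b p = (\<lambda>z. 0)"
  proof (rule bipoly_weight_separate[where m=\<mu>])
    show "bipoly (\<lambda>\<alpha> \<beta>. 1 < wlen \<mu> \<alpha>) (dhol b p)"
      by (rule dhol_weight[OF bipoly_p b]) (simp add: mixed_def)
    show "bipoly (\<lambda>\<alpha> \<beta>. wlen \<mu> \<alpha> < 1) (dbar b p)"
      by (rule dbar_weight[OF bipoly_p b]) (simp add: mixed_def)
    show "dhol b p z + dbar b p z = 0" for z by (simp add: dhol_b_p q_zero)
  qed simp
  then show "b z = 0" using field_zero[OF b] by simp
qed

end

lemma reproducing_field:
  assumes "X \<in> g1 \<mu> P" "X \<noteq> (\<lambda>x. 0)"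
  obtains E where "\<And>j. hpoly (\<lambda>\<alpha>. wlen \<mu> \<alpha> = 0 + \<mu> j) (\<lambda>z. E z $ j)" "dhol E p = p"
proof -
  obtain a b \<gamma> where ab: "\<And>j. hpoly (\<lambda>\<alpha>. wlen \<mu> \<alpha> = 0 + \<mu> j) (\<lambda>z. a z $ j)"
    "\<And>j. hpoly (\<lambda>\<alpha>. wlen \<mu> \<alpha> = 1 + \<mu> j) (\<lambda>z. b z $ j)"
    "\<And>z w. X (z, w) = (w *s a z + b z, complex_of_real \<gamma> * w\<^sup>2)"
    "\<And>z. dhol a p z + dbar a p z = 2 * of_real \<gamma> * p z"
    "\<And>z. dhol b p z + dbar b p z = p z * ((dhol a p z - dbar a p z) / \<i>)"
    using g1_structure[OF assms(1)] by blast
  have b: "b z = 0" for z by (rule b_zero[OF ab(1,2,4,5)])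
  have a: "dhol a p = (\<lambda>z. of_real \<gamma> * p z)" by (rule dhol_a_p_eq[OF ab(1,2,4,5)])
  \<comment> \<open>For \<open>\<gamma> = 0\<close> one has \<open>dhol a p = 0\<close>, so
    nondegeneracy gives \<open>a = 0\<close> and the whole field vanishes.\<close>
  have "\<gamma> \<noteq> 0"
  proof
    assume "\<gamma> = 0"
    then have "a z = 0" for z using field_zero[OF ab(1)] a by simp
    then have "X (z, w) = 0" for z w by (simp add: ab(3) b \<open>\<gamma> = 0\<close> zero_prod_def)
    then show False using assms(2) by auto
  qed
  define E where "E z = inverse (complex_of_real \<gamma>) *s a z" for z
  show ?thesis
  proof
    show "hpoly (\<lambda>\<alpha>. wlen \<mu> \<alpha> = 0 + \<mu> j) (\<lambda>z. E z $ j)" for j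
      using bipoly_scale[OF ab(1)[of j]] by (simp add: E_def)
    show "dhol E p = p"
      unfolding E_def[abs_def] dhol_field_scale[OF bipoly_differentiable[OF bipoly_p], abs_def] a
      using \<open>\<gamma> \<noteq> 0\<close> by (auto simp: fun_eq_iff)
  qed
qed

end

subsection \<open>Weighted polynomial changes of coordinates\<close>

interpretation cfun: vector_space "\<lambda>(c::complex) (f::complex^'n::finite \<Rightarrow> complex) z. c * f z"
  by unfold_locales (auto simp: fun_eq_iff plus_fun_def algebra_simps)

lemma sum_fun_apply: "(\<Sum>i\<in>I. f i) z = (\<Sum>i\<in>I. f i z :: complex)"
  by (induction I rule: infinite_finite_induct) (auto simp: plus_fun_def zero_fun_def)

text \<open>For holomorphic \<open>f\<close> this is the complex gradient at the origin, a row of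
  the Jacobian matrix.\<close>

definition lin :: "(complex^'n::finite \<Rightarrow> complex) \<Rightarrow> complex^'n" where
  "lin f = (\<chi> i. frechet_derivative f (at 0) (axis i 1))"

lemma lin_sum: "finite I \<Longrightarrow> (\<And>i. i \<in> I \<Longrightarrow> anypoly (f i)) \<Longrightarrow> lin (\<lambda>z. \<Sum>i\<in>I. f i z) = (\<Sum>i\<in>I. lin (f i))"
proof (induction I rule: finite_induct)
  case empty
  then show ?case by (simp add: lin_def vec_eq_iff)
next
  case (insert i I)
  have 1: "anypoly (f i)" "anypoly (\<lambda>z. \<Sum>i\<in>I. f i z)" using insert.prems by (auto intro: bipoly_sum)
  note D = frechet_derivative_at[OF has_derivative_add[OF bipoly_has_derivative[OF 1(1)] bipoly_has_derivative[OF 1(2)]], symmetric]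
  have "lin (\<lambda>z. f i z + (\<Sum>i\<in>I. f i z)) = lin (f i) + lin (\<lambda>z. \<Sum>i\<in>I. f i z)"
    unfolding lin_def D by (simp add: vec_eq_iff)
  with insert show ?case by simp
qed

lemma lin_coord: "lin (\<lambda>z. z $ j) = axis j 1"
  by (simp add: lin_def vec_eq_iff axis_def
      frechet_derivative_at[OF bounded_linear_imp_has_derivative[OF bounded_linear_vec_nth], symmetric])

lemma hpoly_induct [consumes 1, case_names zero step]:
  assumes "hpoly Q f" "R (\<lambda>z. 0)"
    and "\<And>f \<alpha> c. hpoly Q f \<Longrightarrow> R f \<Longrightarrow> Q \<alpha> \<Longrightarrow> R (\<lambda>z. c * zmonom \<alpha> z + f z)"
  shows "R f"
  using assms(1)
proof induction
  case (step f \<alpha> \<beta> c)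
  then show ?case using assms(3)[of f \<alpha> c] by (simp add: bimonom_def)
qed (rule assms(2))

lemma lin_nonlinear:
  assumes "hpoly Q f" "\<And>i. \<not> Q (unit_index i)"
  shows "lin f = 0"
  using assms(1)
proof (induction rule: hpoly_induct)
  case zero
  then show ?case by (simp add: lin_def vec_eq_iff)
next
  case (step f \<alpha> c)
  have z: "of_nat (\<alpha> i) * zmonom (\<alpha>(i := \<alpha> i - 1)) 0 = (0::complex)" for i
  proof (rule ccontr)
    assume a: "\<not> ?thesis"
    then have 0: "(\<alpha>(i := \<alpha> i - 1)) j = 0" for j by (auto simp: zmonom_def prod_zero_iff)
    have "\<alpha> j = 0" if "j \<noteq> i" for j using 0[of j] that by simp
    moreover have "\<alpha> i = 1" using a 0[of i] by auto
    ultimately have "\<alpha> = unit_index i" by (auto simp: unit_index_def fun_eq_iff)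
    with step assms(2) show False by simp
  qed
  have "((\<lambda>z. c * zmonom \<alpha> z + f z) has_derivative
     (\<lambda>v. c * (\<Sum>i\<in>UNIV. of_nat (\<alpha> i) * zmonom (\<alpha>(i := \<alpha> i - 1)) 0 * v $ i) + frechet_derivative f (at 0) v)) (at 0)"
    by (intro has_derivative_add has_derivative_mult_right zmonom_has_derivative bipoly_has_derivative[OF step.hyps(1)])
  moreover have "(\<Sum>i\<in>UNIV. of_nat (\<alpha> i) * zmonom (\<alpha>(i := \<alpha> i - 1)) 0 * v $ i) = 0" for v :: "complex^'a"
    unfolding z by simp
  ultimately have "((\<lambda>z. c * zmonom \<alpha> z + f z) has_derivative frechet_derivative f (at 0)) (at 0)" by simp
  from frechet_derivative_at[OF this, symmetric] have "lin (\<lambda>z. c * zmonom \<alpha> z + f z) = lin f"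
    by (simp only: lin_def)
  with step.IH show ?case by simp
qed

lemma hpoly_linear:
  assumes "hpoly (\<lambda>\<alpha>. Q \<alpha> \<and> (\<exists>i. \<alpha> = unit_index i)) f"
  shows "\<exists>c. (\<forall>z. f z = (\<Sum>i\<in>UNIV. c i * z $ i)) \<and> (\<forall>i. c i \<noteq> 0 \<longrightarrow> Q (unit_index i)) \<and> lin f = (\<chi> i. c i)"
proof -
  have "\<exists>c. (\<forall>z. f z = (\<Sum>i\<in>UNIV. c i * z $ i)) \<and> (\<forall>i. c i \<noteq> 0 \<longrightarrow> Q (unit_index i))"
    using assms
  proof (induction rule: hpoly_induct)
    case zero
    then show ?case by (intro exI[of _ "\<lambda>_. 0"]) simp
  next
    case (step f \<alpha> d)
    then obtain c k where c: "\<And>z. f z = (\<Sum>i\<in>UNIV. c i * z $ i)" "\<And>i. c i \<noteq> 0 \<Longrightarrow> Q (unit_index i)" "\<alpha> = unit_index k"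
      by blast
    have "d * zmonom \<alpha> z + f z = (\<Sum>i\<in>UNIV. (c i + (if i = k then d else 0)) * z $ i)" for z
      by (simp add: c distrib_right sum.distrib if_distrib[of "\<lambda>x. x * _"] cong: if_cong)
    then show ?case using c step.hyps by (intro exI[of _ "\<lambda>i. c i + (if i = k then d else 0)"]) (auto split: if_splits)
  qed
  then obtain c where c: "\<And>z. f z = (\<Sum>i\<in>UNIV. c i * z $ i)" "\<And>i. c i \<noteq> 0 \<Longrightarrow> Q (unit_index i)" by blast
  have "(f has_derivative (\<lambda>v. \<Sum>i\<in>UNIV. c i * v $ i)) (at 0)"
    unfolding c(1)[abs_def]
    by (intro has_derivative_sum has_derivative_mult_right bounded_linear_imp_has_derivative bounded_linear_vec_nth)
  from frechet_derivative_at[OF this, symmetric]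
  have "lin f $ j = (\<Sum>i\<in>UNIV. if i = j then c i else 0)" for j
    unfolding lin_def by (auto simp: axis_def if_distrib cong: if_cong)
  then have "lin f = (\<chi> i. c i)" by (simp add: vec_eq_iff)
  with c show ?thesis by blast
qed

lemma has_derivative_finite_axes:
  fixes f :: "complex^'n::finite \<Rightarrow> complex"
  assumes "hpoly Q f"
  shows "frechet_derivative f (at 0) v = (\<Sum>i\<in>UNIV. lin f $ i * v $ i)"
proof -
  interpret bounded_linear "frechet_derivative f (at 0)"
    by (rule has_derivative_bounded_linear[OF bipoly_has_derivative[OF assms]])
  have "v = (\<Sum>i\<in>UNIV. v $ i *s axis i 1)" by (simp add: vec_eq_iff axis_def if_distrib cong: if_cong)
  then have "frechet_derivative f (at 0) v = (\<Sum>i\<in>UNIV. frechet_derivative f (at 0) (v $ i *s axis i 1))"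
    by (metis sum)
  then show ?thesis by (simp add: hpoly_dhol(2)[OF assms] lin_def mult.commute)
qed

section \<open>Coordinates made of generalized eigenvectors\<close>

context poly_model
begin

lemma finite_weight_le: "finite {\<alpha>. wlen \<mu> \<alpha> \<le> k}"
proof -
  obtain e where e: "e > 0" "\<And>\<alpha>. wlen \<mu> \<alpha> > 0 \<Longrightarrow> wlen \<mu> \<alpha> \<ge> e" using wlen_gap by blast
  have em: "\<mu> j \<ge> e" for j using e(2)[of "unit_index j"] \<mu>_pos[of j] by simp
  obtain N :: nat where N: "k / e < real N" using reals_Archimedean2 by blast
  have "\<alpha> j \<le> N" if "wlen \<mu> \<alpha> \<le> k" for \<alpha> j
  proof -
    have "e * real (\<alpha> j) \<le> \<mu> j * real (\<alpha> j)" using em by (intro mult_right_mono) auto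
    also have "\<dots> \<le> wlen \<mu> \<alpha>" unfolding wlen_def by (rule member_le_sum) (auto simp: less_imp_le \<mu>_pos)
    finally have "real (\<alpha> j) \<le> k / e" using that e(1) by (simp add: field_simps)
    then show ?thesis using N by simp
  qed
  then have "{\<alpha>. wlen \<mu> \<alpha> \<le> k} \<subseteq> PiE UNIV (\<lambda>_. {..N})" by auto
  then show ?thesis by (rule finite_subset) (simp add: finite_PiE)
qed

lemma hpoly_span: "hpoly Q f \<Longrightarrow> f \<in> cfun.span (zmonom ` {\<alpha>. Q \<alpha>})"
proof (induction rule: hpoly_induct)
  case zero
  then show ?case using cfun.span_zero by (simp add: zero_fun_def)
next
  case (step f \<alpha> c)
  have "(\<lambda>z. c * zmonom \<alpha> z) \<in> cfun.span (zmonom ` {\<alpha>. Q \<alpha>})"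
    by (rule cfun.span_scale) (use step in \<open>auto intro: cfun.span_base\<close>)
  from cfun.span_add[OF this step.IH] show ?case by (simp add: plus_fun_def)
qed

text \<open>\<open>a\<close> has weight 0, so all iterates lie in the finite-dimensional space of
  polynomials of weight \<open>k\<close>; more iterates than its dimension satisfy a linear
  relation.\<close>

lemma krylov:
  assumes a: "\<And>j. hpoly (\<lambda>\<alpha>. wlen \<mu> \<alpha> = 0 + \<mu> j) (\<lambda>z. a z $ j)" and f: "hpoly (\<lambda>\<alpha>. wlen \<mu> \<alpha> = k) f"
  shows "\<exists>p n. p \<noteq> 0 \<and> degree p \<le> n \<and> (\<lambda>z. \<Sum>i\<le>n. coeff p i * (dhol a ^^ i) f z) = (\<lambda>z. 0)"
proof -
  let ?B = "zmonom ` {\<alpha>. wlen \<mu> \<alpha> = k}"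
  let ?T = "\<lambda>i. (dhol a ^^ i) f"
  have fin: "finite ?B" by (rule finite_imageI, rule finite_subset[OF _ finite_weight_le[of k]]) auto
  have T: "hpoly (\<lambda>\<alpha>. wlen \<mu> \<alpha> = k) (?T i)" for i
  proof (induction i)
    case (Suc i)
    show ?case unfolding funpow.simps comp_apply by (rule dhol_weight[OF Suc a]) simp
  qed (simp add: f)
  have Ts: "?T i \<in> cfun.span ?B" for i by (rule hpoly_span[OF T])
  define N where "N = card ?B"
  show ?thesis
  proof (cases "inj_on ?T {..N}")
    \<comment> \<open>Linear dependence of a set does not see repeated iterates. A repetition gives
      the relation directly, with the polynomial \<open>X^i - X^j\<close>.\<close>
    case False
    then obtain i j where ij: "i \<le> N" "j \<le> N" "i \<noteq> j" "?T i = ?T j" by (auto simp: inj_on_def)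
    define p where "p = monom (1::complex) i - monom 1 j"
    have "coeff p i = 1" using ij by (simp add: p_def)
    then have "p \<noteq> 0" by auto
    moreover have "degree p \<le> N" unfolding p_def using ij
      by (intro degree_diff_le order.trans[OF degree_monom_le]) auto
    moreover have "(\<Sum>l\<le>N. coeff p l * ?T l z) = 0" for z
    proof -
      have "(\<Sum>l\<le>N. coeff p l * ?T l z) = (\<Sum>l\<le>N. (if l = i then ?T l z else 0) - (if l = j then ?T l z else 0))"
        by (intro sum.cong) (auto simp: p_def)
      then show ?thesis using ij by (simp add: sum_subtractf)
    qed
    ultimately show ?thesis by blast
  next
    case True
    have "cfun.dependent (?T ` {..N})"
    proof (rule ccontr)
      assume "\<not> cfun.dependent (?T ` {..N})"
      from cfun.independent_span_bound[OF fin this] Ts have "card (?T ` {..N}) \<le> card ?B" by auto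
      with True show False by (simp add: card_image N_def)
    qed
    then obtain S u where S: "finite S" "S \<subseteq> ?T ` {..N}" "(\<Sum>v\<in>S. (\<lambda>z. u v * v z)) = 0" "\<exists>v\<in>S. u v \<noteq> 0"
      unfolding cfun.dependent_explicit by blast
    define c where "c i = (if i \<le> N \<and> ?T i \<in> S then u (?T i) else 0)" for i
    define p where "p = (\<Sum>i\<le>N. monom (c i) i)"
    have cp: "coeff p i = c i" for i
    proof -
      have "coeff p i = (\<Sum>j\<le>N. if j = i then c j else 0)" by (simp add: p_def coeff_sum)
      then show ?thesis by (auto simp: c_def)
    qed
    from S obtain i where "i \<le> N" "?T i \<in> S" "u (?T i) \<noteq> 0" by blast
    then have "coeff p i \<noteq> 0" by (simp add: cp c_def)
    then have "p \<noteq> 0" by auto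
    moreover have "degree p \<le> N" by (rule degree_le) (simp add: cp c_def)
    moreover have "(\<Sum>i\<le>N. coeff p i * ?T i z) = 0" for z
    proof -
      have "(\<Sum>i\<le>N. coeff p i * ?T i z) = (\<Sum>i\<in>{i\<in>{..N}. ?T i \<in> S}. u (?T i) * ?T i z)"
        by (rule sum.mono_neutral_cong_right) (auto simp: cp c_def)
      also have "\<dots> = (\<Sum>v\<in>?T ` {i\<in>{..N}. ?T i \<in> S}. u v * v z)"
        by (subst sum.reindex) (auto intro: inj_on_subset[OF True])
      also have "?T ` {i\<in>{..N}. ?T i \<in> S} = S" using S by auto
      also have "(\<Sum>v\<in>S. u v * v z) = 0" using fun_cong[OF S(3), of z] by (simp add: sum_fun_apply zero_fun_def)
      finally show ?thesis .
    qed
    ultimately show ?thesis by blast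
  qed
qed

text \<open>Each coordinate is a sum of generalized eigenvectors of its own weight. Coordinates are
  replaced one at a time: the determinant is linear in the row of \<open>z $ k\<close>, so some
  summand can take that place and keep it nonzero.\<close>

lemma eigen_coordinates:
  assumes a: "\<And>j. hpoly (\<lambda>\<alpha>. wlen \<mu> \<alpha> = 0 + \<mu> j) (\<lambda>z. a z $ j)"
  obtains h l where "\<And>j. hpoly (\<lambda>\<alpha>. wlen \<mu> \<alpha> = \<mu> j) (h j)" "\<And>j. gen_eig a (l j) (h j)" "det (\<chi> j. lin (h j)) \<noteq> 0"
proof -
  interpret af: poly_field a by unfold_locales (rule hpoly_any[OF a])
  have dec: "\<exists>I g. finite I \<and> (\<forall>l\<in>I. gen_eig a l (g l) \<and> hpoly (\<lambda>\<alpha>. wlen \<mu> \<alpha> = \<mu> k) (g l)) \<and> (\<lambda>z. z $ k) = (\<lambda>z. \<Sum>l\<in>I. g l z)" for k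
  proof -
    have zk: "hpoly (\<lambda>\<alpha>. wlen \<mu> \<alpha> = \<mu> k) (\<lambda>z. z $ k)" by (rule bipoly_coord) simp
    obtain p n where "p \<noteq> 0" "degree p \<le> n" "(\<lambda>z. \<Sum>i\<le>n. coeff p i * (dhol a ^^ i) (\<lambda>z. z $ k) z) = (\<lambda>z. 0)"
      using krylov[OF a zk] by blast
    then show ?thesis
    proof (intro af.gen_eig_decomposition[where V="hpoly (\<lambda>\<alpha>. wlen \<mu> \<alpha> = \<mu> k)", OF _ _ _ _ _ zk])
      show "hpoly (\<lambda>\<alpha>. wlen \<mu> \<alpha> = \<mu> k) (lshift a i f)" if "hpoly (\<lambda>\<alpha>. wlen \<mu> \<alpha> = \<mu> k) f" for f i
        unfolding lshift_def by (intro bipoly_diff bipoly_scale that dhol_weight[OF that a]) simp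
    qed (auto intro: bipoly_scale bipoly_add bipoly_any)
  qed
  have "\<exists>h l. (\<forall>j\<in>S. hpoly (\<lambda>\<alpha>. wlen \<mu> \<alpha> = \<mu> j) (h j) \<and> gen_eig a (l j) (h j)) \<and>
      det (\<chi> j. if j \<in> S then lin (h j) else axis j 1) \<noteq> 0" if "finite S" for S
    using that
  proof induction
    case empty
    have "(\<chi> j. axis j 1) = (mat 1 :: complex^'n^'n)" by (simp add: vec_eq_iff mat_def axis_def)
    then show ?case by (simp add: det_I)
  next
    case (insert k S)
    then obtain h l where hl: "\<And>j. j \<in> S \<Longrightarrow> hpoly (\<lambda>\<alpha>. wlen \<mu> \<alpha> = \<mu> j) (h j) \<and> gen_eig a (l j) (h j)"
      "det (\<chi> j. if j \<in> S then lin (h j) else axis j 1) \<noteq> 0" by blast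
    obtain I g where g: "finite I" "\<And>l. l \<in> I \<Longrightarrow> gen_eig a l (g l) \<and> hpoly (\<lambda>\<alpha>. wlen \<mu> \<alpha> = \<mu> k) (g l)"
      "(\<lambda>z. z $ k) = (\<lambda>z. \<Sum>l\<in>I. g l z)" using dec[of k] by blast
    let ?c = "\<lambda>j. if j \<in> S then lin (h j) else axis j 1"
    have "axis k 1 = (\<Sum>l\<in>I. lin (g l))"
      unfolding lin_coord[symmetric] g(3) using g(1,2) by (intro lin_sum) (auto simp: gen_eig_def)
    then have "(\<chi> j. ?c j) = (\<chi> j. if j = k then \<Sum>l\<in>I. lin (g l) else ?c j)"
      using insert.hyps(2) by (auto simp: vec_eq_iff)
    with hl(2) have "(\<Sum>l\<in>I. det (\<chi> j. if j = k then lin (g l) else ?c j)) \<noteq> 0"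
      using det_linear_row_sum[OF g(1), of k "\<lambda>_ l. lin (g l)" ?c] by simp
    then obtain m where m: "m \<in> I" "det (\<chi> j. if j = k then lin (g m) else ?c j) \<noteq> 0" by (meson sum.neutral)
    have eq: "(\<chi> j. if j = k then lin (g m) else ?c j) = (\<chi> j. if j \<in> insert k S then lin ((h(k := g m)) j) else axis j 1)"
      using insert.hyps(2) by (auto simp: vec_eq_iff)
    have ne: "det (\<chi> j. if j \<in> insert k S then lin ((h(k := g m)) j) else axis j 1) \<noteq> 0"
      using m(2) unfolding eq .
    have "\<forall>j\<in>insert k S. hpoly (\<lambda>\<alpha>. wlen \<mu> \<alpha> = \<mu> j) ((h(k := g m)) j) \<and> gen_eig a ((l(k := m)) j) ((h(k := g m)) j)"
      using hl(1) g(2)[OF m(1)] insert.hyps(2) by auto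
    with ne show ?case by blast
  qed
  from this[of UNIV] that show ?thesis by auto
qed

section \<open>Inverses of weighted polynomial maps\<close>

lemma zmonom_compose:
  assumes "\<And>i. \<alpha> i > 0 \<Longrightarrow> hpoly (\<lambda>\<alpha>. wlen \<mu> \<alpha> = \<mu> i) (g i)"
  shows "hpoly (\<lambda>\<gamma>. wlen \<mu> \<gamma> = wlen \<mu> \<alpha>) (\<lambda>y. zmonom \<alpha> (\<chi> i. g i y))"
proof -
  have pw: "hpoly (\<lambda>\<gamma>. wlen \<mu> \<gamma> = \<mu> i * real n) (\<lambda>y. g i y ^ n)" if "hpoly (\<lambda>\<alpha>. wlen \<mu> \<alpha> = \<mu> i) (g i)" for i n
  proof (induction n)
    case 0
    show ?case by (simp add: bipoly_const)
  next
    case (Suc n)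
    show ?case unfolding power_Suc
      by (rule bipoly_mult[OF that Suc]) (auto simp: wlen_add algebra_simps)
  qed
  have pw': "hpoly (\<lambda>\<gamma>. wlen \<mu> \<gamma> = \<mu> i * real (\<alpha> i)) (\<lambda>y. g i y ^ \<alpha> i)" for i
    using pw[OF assms] by (cases "\<alpha> i = 0") (auto simp: bipoly_const)
  have "hpoly (\<lambda>\<gamma>. wlen \<mu> \<gamma> = (\<Sum>i\<in>I. \<mu> i * real (\<alpha> i))) (\<lambda>y. \<Prod>i\<in>I. g i y ^ \<alpha> i)" if "finite I" for I
    using that
  proof induction
    case empty
    show ?case by (simp add: bipoly_const)
  next
    case (insert i I)
    show ?case using insert.hyps
      by (simp, intro bipoly_mult[OF pw' insert.IH]) (auto simp: wlen_add)
  qed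
  from this[of UNIV] show ?thesis by (simp add: zmonom_def wlen_def)
qed

text \<open>A nonlinear monomial of weight \<open>\<mu> j\<close> involves only variables of
  strictly smaller weight, and the linear part mixes only variables of equal weight. The map is thus
  triangular with respect to the weights and is inverted from low weights upwards.\<close>

lemma polynomial_left_inverse:
  assumes h: "\<And>j. hpoly (\<lambda>\<alpha>. wlen \<mu> \<alpha> = \<mu> j) (h j)" and det: "det (\<chi> j. lin (h j)) \<noteq> 0"
  shows "\<exists>g. \<forall>i. hpoly (\<lambda>\<alpha>. wlen \<mu> \<alpha> = \<mu> i) (g i) \<and> (\<forall>z. g i (\<chi> j. h j z) = z $ i)"
proof -
  have "\<forall>j. \<exists>cn. (\<forall>z. h j z = (\<Sum>i\<in>UNIV. fst cn i * z $ i) + snd cn z) \<and> (\<forall>i. fst cn i \<noteq> 0 \<longrightarrow> \<mu> i = \<mu> j) \<and>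
      lin (h j) = (\<chi> i. fst cn i) \<and> hpoly (\<lambda>\<alpha>. wlen \<mu> \<alpha> = \<mu> j \<and> (\<forall>i. \<alpha> \<noteq> unit_index i)) (snd cn)"
  proof
    fix j
    obtain r n where rn: "bipoly (\<lambda>\<alpha> \<beta>. (\<beta> = (\<lambda>_. 0) \<and> wlen \<mu> \<alpha> = \<mu> j) \<and> (\<exists>i. \<alpha> = unit_index i)) r"
      "bipoly (\<lambda>\<alpha> \<beta>. (\<beta> = (\<lambda>_. 0) \<and> wlen \<mu> \<alpha> = \<mu> j) \<and> \<not> (\<exists>i. \<alpha> = unit_index i)) n" "h j = (\<lambda>z. r z + n z)"
      using bipoly_split[OF h[of j], of "\<lambda>\<alpha> \<beta>. \<exists>i. \<alpha> = unit_index i"] by blast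
    have r: "hpoly (\<lambda>\<alpha>. wlen \<mu> \<alpha> = \<mu> j \<and> (\<exists>i. \<alpha> = unit_index i)) r" by (rule bipoly_mono[OF rn(1)]) auto
    have n: "hpoly (\<lambda>\<alpha>. wlen \<mu> \<alpha> = \<mu> j \<and> (\<forall>i. \<alpha> \<noteq> unit_index i)) n" by (rule bipoly_mono[OF rn(2)]) auto
    obtain c where c: "\<And>z. r z = (\<Sum>i\<in>UNIV. c i * z $ i)" "\<And>i. c i \<noteq> 0 \<Longrightarrow> wlen \<mu> (unit_index i) = \<mu> j" "lin r = (\<chi> i. c i)"
      using hpoly_linear[OF r] by blast
    have "lin (h j) = lin r + lin n"
    proof -
      have "anypoly (if b then r else n)" for b using r n by (auto intro: bipoly_any)
      from lin_sum[of "UNIV::bool set" "\<lambda>b. if b then r else n", OF _ this] show ?thesis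
        unfolding rn(3) by (simp add: UNIV_bool add.commute)
    qed
    moreover have "lin n = 0" by (rule lin_nonlinear[OF n]) auto
    ultimately show "\<exists>cn. (\<forall>z. h j z = (\<Sum>i\<in>UNIV. fst cn i * z $ i) + snd cn z) \<and> (\<forall>i. fst cn i \<noteq> 0 \<longrightarrow> \<mu> i = \<mu> j) \<and>
      lin (h j) = (\<chi> i. fst cn i) \<and> hpoly (\<lambda>\<alpha>. wlen \<mu> \<alpha> = \<mu> j \<and> (\<forall>i. \<alpha> \<noteq> unit_index i)) (snd cn)"
      using c n rn(3) by (intro exI[of _ "(c, n)"]) auto
  qed
  from choice[OF this] obtain cn where cn: "\<And>j z. h j z = (\<Sum>i\<in>UNIV. fst (cn j) i * z $ i) + snd (cn j) z"
    "\<And>j i. fst (cn j) i \<noteq> 0 \<Longrightarrow> \<mu> i = \<mu> j" "\<And>j. lin (h j) = (\<chi> i. fst (cn j) i)"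
    "\<And>j. hpoly (\<lambda>\<alpha>. wlen \<mu> \<alpha> = \<mu> j \<and> (\<forall>i. \<alpha> \<noteq> unit_index i)) (snd (cn j))" by blast
  define M :: "complex^'n^'n" where "M = (\<chi> j. lin (h j))"
  define n where "n j = snd (cn j)" for j
  have M: "M $ j $ i = fst (cn j) i" for i j by (simp add: M_def cn(3))
  have hM: "h j z = (\<Sum>i\<in>UNIV. M $ j $ i * z $ i) + n j z" for j z by (simp add: M cn(1) n_def)
  from det obtain N where N: "N ** M = mat 1" unfolding M_def[symmetric] invertible_det_nz[symmetric] invertible_def by blast
  \<comment> \<open>The Jacobian is block diagonal along equal weights. Keeping only the
    corresponding blocks of its inverse still gives a left inverse, now one that respects
    weights.\<close>
  define N' where "N' i j = (if \<mu> j = \<mu> i then N $ i $ j else 0)" for i j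
  have N'M: "(\<Sum>j\<in>UNIV. N' i j * M $ j $ k) = (if k = i then 1 else 0)" for i k
  proof -
    have "(\<Sum>j\<in>UNIV. N $ i $ j * M $ j $ k) = (N ** M) $ i $ k" by (simp add: matrix_matrix_mult_def)
    then have *: "(\<Sum>j\<in>UNIV. N $ i $ j * M $ j $ k) = (if k = i then 1 else 0)" by (simp add: N mat_def)
    show ?thesis
    proof (cases "\<mu> k = \<mu> i")
      case True
      then have "N' i j * M $ j $ k = N $ i $ j * M $ j $ k" for j
        using cn(2)[of j k] by (cases "fst (cn j) k = 0") (auto simp: N'_def M)
      then have "(\<Sum>j\<in>UNIV. N' i j * M $ j $ k) = (\<Sum>j\<in>UNIV. N $ i $ j * M $ j $ k)" by (intro sum.cong refl)
      with * show ?thesis by (simp only:)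
    next
      case False
      then have "N' i j * M $ j $ k = 0" for j using cn(2)[of j k] by (auto simp: N'_def M)
      then have "(\<Sum>j\<in>UNIV. N' i j * M $ j $ k) = 0" by (intro sum.neutral ballI)
      moreover have "k \<noteq> i" using False by auto
      ultimately show ?thesis by (simp only: if_False)
    qed
  qed
  have inv: "z $ i = (\<Sum>j\<in>UNIV. N' i j * (h j z - n j z))" for i z
  proof -
    have "(\<Sum>j\<in>UNIV. N' i j * (h j z - n j z)) = (\<Sum>j\<in>UNIV. \<Sum>k\<in>UNIV. N' i j * M $ j $ k * z $ k)"
      by (simp add: hM sum_distrib_left mult.assoc)
    also have "\<dots> = (\<Sum>k\<in>UNIV. (\<Sum>j\<in>UNIV. N' i j * M $ j $ k) * z $ k)"
      by (subst sum.swap) (simp add: sum_distrib_right)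
    also have "\<dots> = z $ i" by (simp add: N'M if_distrib[of "\<lambda>x. x * _"] cong: if_cong)
    finally show ?thesis by simp
  qed
  have "\<exists>g. hpoly (\<lambda>\<alpha>. wlen \<mu> \<alpha> = \<mu> i) g \<and> (\<forall>z. g (\<chi> j. h j z) = z $ i)" for i
  \<comment> \<open>The number of variables of smaller weight serves as a natural number measure for
    the order of the weights.\<close>
  proof (induction i rule: measure_induct_rule[where f="\<lambda>i. card {k. \<mu> k < \<mu> i}"])
    case (less i)
    have IH: "\<exists>g. hpoly (\<lambda>\<alpha>. wlen \<mu> \<alpha> = \<mu> k) g \<and> (\<forall>z. g (\<chi> j. h j z) = z $ k)" if "\<mu> k < \<mu> i" for k
      by (rule less.IH, rule psubset_card_mono) (use that in auto)
    then have "\<forall>k. \<exists>g. \<mu> k < \<mu> i \<longrightarrow> hpoly (\<lambda>\<alpha>. wlen \<mu> \<alpha> = \<mu> k) g \<and> (\<forall>z. g (\<chi> j. h j z) = z $ k)" by blast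
    from choice[OF this] obtain g where g: "\<And>k. \<mu> k < \<mu> i \<Longrightarrow> hpoly (\<lambda>\<alpha>. wlen \<mu> \<alpha> = \<mu> k) (g k)"
       "\<And>k z. \<mu> k < \<mu> i \<Longrightarrow> g k (\<chi> j. h j z) = z $ k" by blast
    have sub: "\<exists>m. hpoly (\<lambda>\<alpha>. wlen \<mu> \<alpha> = \<mu> i) m \<and> (\<forall>z. m (\<chi> j. h j z) = n j z)" if j: "\<mu> j = \<mu> i" for j
    proof -
      have "hpoly (\<lambda>\<alpha>. wlen \<mu> \<alpha> = \<mu> i \<and> (\<forall>k. \<alpha> \<noteq> unit_index k)) (n j)" using cn(4)[of j] j by (simp add: n_def)
      then show ?thesis
      proof (induction rule: hpoly_induct)
        case zero
        then show ?case by (intro exI[of _ "\<lambda>z. 0"]) (auto intro: bipoly.zero)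
      next
        case (step f \<alpha> c)
        \<comment> \<open>A variable of weight at least \<open>\<mu> i\<close> uses up the whole
          weight, so the monomial would be that variable alone.\<close>
        have low: "\<mu> k < \<mu> i" if "\<alpha> k > 0" for k
        proof (rule ccontr)
          assume "\<not> \<mu> k < \<mu> i"
          then have "wlen \<mu> (\<alpha>(k := \<alpha> k - 1)) \<le> 0" using step.hyps(2) wlen_dec[of \<alpha> k \<mu>] that by simp
          then have 0: "\<alpha>(k := \<alpha> k - 1) = (\<lambda>_. 0)" using wlen_pos[of "\<alpha>(k := \<alpha> k - 1)"] by linarith
          have "\<alpha> l = 0" if "l \<noteq> k" for l using fun_cong[OF 0, of l] that by simp
          moreover have "\<alpha> k = 1" using fun_cong[OF 0, of k] that by simp
          ultimately have "\<alpha> = unit_index k" by (auto simp: unit_index_def fun_eq_iff)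
          with step.hyps(2) show False by blast
        qed
        from step.IH obtain m where m: "hpoly (\<lambda>\<alpha>. wlen \<mu> \<alpha> = \<mu> i) m" "\<And>z. m (\<chi> j. h j z) = f z" by blast
        have "hpoly (\<lambda>\<gamma>. wlen \<mu> \<gamma> = \<mu> i) (\<lambda>y. zmonom \<alpha> (\<chi> k. g k y))"
          using zmonom_compose[of \<alpha> g] g(1) low step.hyps(2) by auto
        moreover have "zmonom \<alpha> (\<chi> k. g k (\<chi> j. h j z)) = zmonom \<alpha> z" for z
          unfolding zmonom_def using low g(2) by (intro prod.cong refl) (metis gr0I power_0 vec_lambda_beta)
        ultimately show ?case using m
          by (intro exI[of _ "\<lambda>y. c * zmonom \<alpha> (\<chi> k. g k y) + m y"]) (auto intro: bipoly_add bipoly_scale)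
      qed
    qed
    then have "\<forall>j. \<exists>m. \<mu> j = \<mu> i \<longrightarrow> hpoly (\<lambda>\<alpha>. wlen \<mu> \<alpha> = \<mu> i) m \<and> (\<forall>z. m (\<chi> j. h j z) = n j z)" by blast
    from choice[OF this] obtain m where m: "\<And>j. \<mu> j = \<mu> i \<Longrightarrow> hpoly (\<lambda>\<alpha>. wlen \<mu> \<alpha> = \<mu> i) (m j)"
      "\<And>j z. \<mu> j = \<mu> i \<Longrightarrow> m j (\<chi> j. h j z) = n j z" by blast
    define G where "G y = (\<Sum>j\<in>{j. \<mu> j = \<mu> i}. N $ i $ j * (y $ j - m j y))" for y
    have "hpoly (\<lambda>\<alpha>. wlen \<mu> \<alpha> = \<mu> i) G"
      unfolding G_def[abs_def] by (intro bipoly_sum bipoly_scale bipoly_diff m bipoly_coord) auto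
    moreover have "G (\<chi> j. h j z) = z $ i" for z
    proof -
      have "z $ i = (\<Sum>j\<in>{j. \<mu> j = \<mu> i}. N $ i $ j * (h j z - n j z))"
        unfolding inv[of z i] by (rule sum.mono_neutral_cong_right) (auto simp: N'_def)
      then show ?thesis by (simp add: G_def m(2))
    qed
    ultimately show ?case by blast
  qed
  then have "\<forall>i. \<exists>g. hpoly (\<lambda>\<alpha>. wlen \<mu> \<alpha> = \<mu> i) g \<and> (\<forall>z. g (\<chi> j. h j z) = z $ i)" by blast
  from choice[OF this] show ?thesis by blast
qed

lemma hpoly_zero_at_0: "hpoly (\<lambda>\<alpha>. wlen \<mu> \<alpha> = \<mu> j) h \<Longrightarrow> h 0 = 0"
  by (erule bipoly_zero_at_0) (use \<mu>_pos[of j] in auto)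

text \<open>By the chain rule the Jacobian of the left inverse \<open>g\<close> is invertible, so
  \<open>g\<close> has a left inverse \<open>k\<close> as well. Evaluating the composition of
  \<open>k\<close>, \<open>g\<close> and \<open>h\<close> in two ways gives
  \<open>k = h\<close>.\<close>

lemma polynomial_inverse:
  assumes h: "\<And>j. hpoly (\<lambda>\<alpha>. wlen \<mu> \<alpha> = \<mu> j) (h j)" and det: "det (\<chi> j. lin (h j)) \<noteq> 0"
  obtains g where "\<And>i. hpoly (\<lambda>\<alpha>. wlen \<mu> \<alpha> = \<mu> i) (g i)" "\<And>i z. g i (\<chi> j. h j z) = z $ i"
    "\<And>j y. h j (\<chi> i. g i y) = y $ j"
proof -
  obtain g where g: "\<And>i. hpoly (\<lambda>\<alpha>. wlen \<mu> \<alpha> = \<mu> i) (g i)" "\<And>i z. g i (\<chi> j. h j z) = z $ i"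
    using polynomial_left_inverse[OF h det] by blast
  have H: "((\<lambda>z. \<chi> j. h j z) has_derivative (\<lambda>v. \<chi> j. frechet_derivative (h j) (at 0) v)) (at 0)"
    by (rule has_derivative_cvec) (simp add: bipoly_has_derivative[OF h])
  have H0: "(\<chi> j. h j 0) = 0" using hpoly_zero_at_0[OF h] by (simp add: vec_eq_iff)
  have "(\<chi> i. lin (g i)) ** (\<chi> j. lin (h j)) = (mat 1 :: complex^'n^'n)"
  proof -
    have "(\<Sum>j\<in>UNIV. lin (g i) $ j * lin (h j) $ k) = (if i = k then 1 else 0)" for i k
    proof -
      have "((\<lambda>z. g i (\<chi> j. h j z)) has_derivative
          (\<lambda>v. frechet_derivative (g i) (at 0) (\<chi> j. frechet_derivative (h j) (at 0) v))) (at 0)"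
        by (rule has_derivative_compose[OF H]) (simp add: H0 bipoly_has_derivative[OF g(1)])
      then have "((\<lambda>z. z $ i) has_derivative
          (\<lambda>v. frechet_derivative (g i) (at 0) (\<chi> j. frechet_derivative (h j) (at 0) v))) (at 0)" by (simp add: g(2))
      from has_derivative_unique[OF this bounded_linear_imp_has_derivative[OF bounded_linear_vec_nth]]
      have "frechet_derivative (g i) (at 0) (\<chi> j. frechet_derivative (h j) (at 0) (axis k 1)) = axis k 1 $ i"
        by (rule fun_cong)
      then show ?thesis
        unfolding has_derivative_finite_axes[OF g(1)] by (simp add: lin_def axis_def)
    qed
    then show ?thesis by (simp add: vec_eq_iff matrix_matrix_mult_def mat_def)
  qed
  then have "det (\<chi> i. lin (g i)) \<noteq> 0" by (metis det_I det_mul mult_zero_left zero_neq_one)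
  from polynomial_left_inverse[OF g(1) this] obtain k where
    k: "\<And>j. hpoly (\<lambda>\<alpha>. wlen \<mu> \<alpha> = \<mu> j) (k j)" "\<And>j y. k j (\<chi> i. g i y) = y $ j" by blast
  have "k j z = h j z" for j z
  proof -
    have "k j (\<chi> i. g i (\<chi> j. h j z)) = (\<chi> j. h j z) $ j" by (rule k(2))
    moreover have "(\<chi> i. g i (\<chi> j. h j z)) = z" by (simp add: g(2) vec_eq_iff)
    ultimately show ?thesis by simp
  qed
  then have "h j (\<chi> i. g i y) = y $ j" for j y using k(2)[of j y] by simp
  then show ?thesis by (rule that[OF g])
qed

lemma bipoly_compose:
  assumes f: "bipoly Q f" and g: "\<And>i. hpoly (\<lambda>\<alpha>. wlen \<mu> \<alpha> = \<mu> i) (g i)"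
    and R: "\<And>\<alpha> \<beta> \<alpha>' \<beta>'. Q \<alpha> \<beta> \<Longrightarrow> wlen \<mu> \<alpha>' = wlen \<mu> \<alpha> \<Longrightarrow> wlen \<mu> \<beta>' = wlen \<mu> \<beta> \<Longrightarrow> R \<alpha>' \<beta>'"
  shows "bipoly R (\<lambda>y. f (\<chi> i. g i y))"
  using f
proof induction
  case zero
  show ?case by (rule bipoly.zero)
next
  case (step f \<alpha> \<beta> c)
  have "bipoly R (\<lambda>y. zmonom \<alpha> (\<chi> i. g i y) * cnj (zmonom \<beta> (\<chi> i. g i y)))"
    by (rule bipoly_mult[OF zmonom_compose[OF g] bipoly_cnj[OF zmonom_compose[OF g]]])
       (use step.hyps(2) in \<open>auto intro!: R simp: wlen_add\<close>)
  then show ?case unfolding bimonom_def by (intro bipoly_add bipoly_scale step.IH)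
qed

text \<open>Eigenvalues add under multiplication, so the eigenvalue of a monomial is a linear form
  in its exponents. The equations of a balanced polynomial arise in this way.\<close>

lemma gen_eig_zmonom:
  assumes "\<And>j. gen_eig a (l j) (h j)" and a: "\<And>j. anypoly (\<lambda>z. a z $ j)"
  shows "gen_eig a (\<Sum>j\<in>UNIV. l j * of_nat (\<alpha> j)) (\<lambda>z. zmonom \<alpha> (\<chi> j. h j z))"
proof -
  interpret af: poly_field a by unfold_locales (rule a)
  have one: "gen_eig a 0 (\<lambda>z. 1)"
    by (rule af.gen_eigI[where k=1]) (auto simp: lshift_def intro: bipoly_const)
  have pw: "gen_eig a (l j * of_nat n) (\<lambda>z. h j z ^ n)" for j n
  proof (induction n)
    case (Suc n)
    show ?case using af.gen_eig_mult[OF assms(1)[of j] Suc] by (simp add: algebra_simps)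
  qed (simp add: one)
  have "gen_eig a (\<Sum>j\<in>I. l j * of_nat (\<alpha> j)) (\<lambda>z. \<Prod>j\<in>I. h j z ^ \<alpha> j)" if "finite I" for I
    using that by induction (use one af.gen_eig_mult[OF pw] in auto)
  from this[of UNIV] show ?thesis by (simp add: zmonom_def)
qed

text \<open>In eigencoordinates a monomial is a generalized eigenvector times an antiholomorphic
  factor, on which \<open>a\<close> acts as 0. As \<open>e\<close> has eigenvalue 1, independence
  leaves only the part of eigenvalue 1. \<open>Q\<close> is arbitrary so that the result can be
  applied a second time after conjugation.\<close>

lemma eigen_projection:
  assumes a: "\<And>j. hpoly (\<lambda>\<alpha>. wlen \<mu> \<alpha> = 0 + \<mu> j) (\<lambda>z. a z $ j)"
    and h: "\<And>j. hpoly (\<lambda>\<alpha>. wlen \<mu> \<alpha> = \<mu> j) (h j)" "\<And>j. gen_eig a (l j) (h j)"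
    and g: "\<And>j y. h j (\<chi> i. g i y) = y $ j"
    and f: "bipoly Q f" "\<And>z. f (\<chi> j. h j z) = e z" "anypoly e" "dhol a e = e"
  shows "bipoly (\<lambda>\<alpha> \<beta>. Q \<alpha> \<beta> \<and> (\<Sum>j\<in>UNIV. l j * of_nat (\<alpha> j)) = 1) f"
proof -
  interpret af: poly_field a by unfold_locales (rule hpoly_any[OF a])
  define w where "w \<alpha> = (\<Sum>j\<in>UNIV. l j * of_nat (\<alpha> j))" for \<alpha> :: "'n \<Rightarrow> nat"
  define H where "H z = (\<chi> j. h j z)" for z
  obtain I F where F: "finite I" "\<And>v. bipoly (\<lambda>\<alpha> \<beta>. Q \<alpha> \<beta> \<and> w \<alpha> = v) (F v)"
    "\<And>v. v \<notin> I \<Longrightarrow> F v = (\<lambda>z. 0)" "f = (\<lambda>z. \<Sum>v\<in>I. F v z)"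
    using bipoly_weight_decomposition[OF f(1), of w] by blast
  have gF: "gen_eig a v (\<lambda>z. F v (H z))" for v
    using F(2)[of v]
  proof induction
    case (step f \<alpha> \<beta> c)
    have 1: "gen_eig a v (\<lambda>z. zmonom \<alpha> (H z))"
      using gen_eig_zmonom[of a l h \<alpha>, OF h(2) hpoly_any[OF a]] step.hyps(2) by (simp add: w_def H_def)
    have hb: "hpoly (\<lambda>\<gamma>. wlen \<mu> \<gamma> = wlen \<mu> \<beta>) (\<lambda>z. zmonom \<beta> (H z))"
      unfolding H_def by (rule zmonom_compose[OF h(1)])
    have "gen_eig a 0 (\<lambda>z. cnj (zmonom \<beta> (H z)))"
      by (rule af.gen_eigI[where k=1])
         (auto simp: lshift_def dhol_cnj_fun(1)[OF hpoly_any[OF hb]] hpoly_dbar_fun[OF hb] intro: bipoly_any[OF bipoly_cnj[OF hb]])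
    from af.gen_eig_mult[OF 1 this] have "gen_eig a v (\<lambda>z. bimonom \<alpha> \<beta> (H z))" by (simp add: bimonom_def)
    then show ?case by (intro af.gen_eig_add af.gen_eig_scale step.IH)
  qed (rule af.gen_eig_zero)
  have ge: "gen_eig a 1 e"
    by (rule af.gen_eigI[where k=1]) (simp_all add: f lshift_def)
  \<comment> \<open>Moving \<open>e\<close> into the component of eigenvalue 1 turns the equation
    into a vanishing sum of generalized eigenvectors.\<close>
  define K where "K v = (if v = 1 then (\<lambda>z. F 1 (H z) + (-1) * e z) else (\<lambda>z. F v (H z)))" for v
  have "gen_eig a v (K v)" for v
    unfolding K_def using gF[of v] af.gen_eig_add[OF gF[of 1] af.gen_eig_scale[OF ge, of "-1"]] by auto
  moreover have "(\<lambda>z. \<Sum>v\<in>insert 1 I. K v z) = (\<lambda>z. 0)"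
  proof
    fix z
    have "(\<Sum>v\<in>insert 1 I. K v z) = (\<Sum>v\<in>insert 1 I. F v (H z) - (if v = 1 then e z else 0))"
      by (intro sum.cong) (auto simp: K_def)
    also have "\<dots> = (\<Sum>v\<in>insert 1 I. F v (H z)) - e z" using F(1) by (simp add: sum_subtractf)
    also have "(\<Sum>v\<in>insert 1 I. F v (H z)) = f (H z)"
      unfolding F(4) using F(1,3) by (intro sum.mono_neutral_right) auto
    finally show "(\<Sum>v\<in>insert 1 I. K v z) = 0" by (simp add: f(2) H_def)
  qed
  ultimately have "K 1 = (\<lambda>z. 0)" using af.gen_eig_independent[of "insert 1 I" K 1] F(1) by blast
  then have e: "F 1 (H z) = e z" for z by (simp add: K_def fun_eq_iff)
  have "F 1 y = f y" for y
  proof -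
    have "H (\<chi> i. g i y) = y" by (simp add: H_def g vec_eq_iff)
    then show ?thesis using e[of "\<chi> i. g i y"] f(2)[of "\<chi> i. g i y"] by (simp add: H_def)
  qed
  then have "f = F 1" by auto
  with F(2)[of 1] show ?thesis by (simp add: w_def)
qed

end

lemma (in nondeg_model) balanced_coordinates:
  assumes "X \<in> g1 \<mu> P" "X \<noteq> (\<lambda>x. 0)"
  obtains h g where "\<And>j. hpoly (\<lambda>\<alpha>. wlen \<mu> \<alpha> = \<mu> j) (h j)" "\<And>j. hpoly (\<lambda>\<alpha>. wlen \<mu> \<alpha> = \<mu> j) (g j)"
    "\<And>i z. g i (\<chi> j. h j z) = z $ i" "\<And>j y. h j (\<chi> i. g i y) = y $ j"
    "model_polynomial \<mu> (\<lambda>y. P (\<chi> i. g i y))" "balanced (\<lambda>y. P (\<chi> i. g i y))"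
proof -
  obtain E where E: "\<And>j. hpoly (\<lambda>\<alpha>. wlen \<mu> \<alpha> = 0 + \<mu> j) (\<lambda>z. E z $ j)" "dhol E p = p"
    using reproducing_field[OF assms] by blast
  obtain h l where h: "\<And>j. hpoly (\<lambda>\<alpha>. wlen \<mu> \<alpha> = \<mu> j) (h j)" "\<And>j. gen_eig E (l j) (h j)" "det (\<chi> j. lin (h j)) \<noteq> 0"
    using eigen_coordinates[OF E(1)] by blast
  obtain g where g: "\<And>i. hpoly (\<lambda>\<alpha>. wlen \<mu> \<alpha> = \<mu> i) (g i)" "\<And>i z. g i (\<chi> j. h j z) = z $ i"
    "\<And>j y. h j (\<chi> i. g i y) = y $ j" using polynomial_inverse[OF h(1,3)] by blast
  define P' where "P' y = P (\<chi> i. g i y)" for y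
  have p': "bipoly mixed (\<lambda>y. complex_of_real (P' y))"
    using bipoly_compose[OF bipoly_p g(1), of mixed] by (simp add: P'_def p_def mixed_def)
  have gh: "(\<chi> i. g i (\<chi> j. h j z)) = z" for z by (simp add: g(2) vec_eq_iff)
  have P'h: "complex_of_real (P' (\<chi> j. h j z)) = p z" for z by (simp add: P'_def p_def gh)
  obtain z0 where z0: "P z0 \<noteq> 0" using P_nonzero by blast
  have nz: "P' (\<chi> j. h j z0) \<noteq> 0" using z0 by (simp add: P'_def gh)
  have "model_polynomial \<mu> P'"
  proof -
    obtain A where A: "poly_rep A P'" "\<And>\<alpha> \<beta>. A \<alpha> \<beta> \<noteq> 0 \<Longrightarrow> mixed \<alpha> \<beta>" using bipoly_imp_poly_rep[OF p'] by blast
    have "A \<alpha> (\<lambda>_. 0) = 0" "A (\<lambda>_. 0) \<alpha> = 0" for \<alpha>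
      using A(2)[of \<alpha> "\<lambda>_. 0"] A(2)[of "\<lambda>_. 0" \<alpha>] by (auto simp: mixed_def)
    with A nz show ?thesis unfolding model_polynomial_def mixed_def by blast
  qed
  moreover have "balanced P'"
  proof -
    let ?w = "\<lambda>\<alpha>. (\<Sum>j\<in>UNIV. l j * of_nat (\<alpha> j)) = 1"
    note proj = eigen_projection[OF E(1) h(1,2) g(3) _ P'h anypoly_p E(2)]
    \<comment> \<open>Since \<open>P'\<close> is real, conjugation transfers the condition to the
      conjugate exponents; the second projection adds it for the holomorphic ones.\<close>
    have "bipoly (\<lambda>\<alpha> \<beta>. ?w \<beta>) (\<lambda>y. complex_of_real (P' y))"
      by (rule bipoly_mono[OF bipoly_cnj[OF proj[OF p'], unfolded complex_cnj_complex_of_real]]) simp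
    from proj[OF this] have "bipoly (\<lambda>\<alpha> \<beta>. ?w \<alpha> \<and> ?w \<beta>) (\<lambda>y. complex_of_real (P' y))"
      by (rule bipoly_mono) auto
    then obtain A where A: "poly_rep A P'" "\<And>\<alpha> \<beta>. A \<alpha> \<beta> \<noteq> 0 \<Longrightarrow> ?w \<alpha> \<and> ?w \<beta>" using bipoly_imp_poly_rep by blast
    \<comment> \<open>Exponents are real numbers, so the real parts of the eigenvalues satisfy the
      same equation and can serve as real weights.\<close>
    have w: "wlen (\<lambda>j. Re (l j)) \<alpha> = 1" if "?w \<alpha>" for \<alpha>
    proof -
      have "Re (\<Sum>j\<in>UNIV. l j * of_nat (\<alpha> j)) = 1" using that by simp
      then show ?thesis by (simp add: wlen_def)
    qed
    have "\<exists>\<alpha> \<beta>. A \<alpha> \<beta> \<noteq> 0"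
    proof (rule ccontr)
      assume "\<not> ?thesis"
      then have "P' y = 0" for y using A(1) by (simp add: poly_rep_def)
      with nz show False by blast
    qed
    then obtain \<alpha> \<beta> where "A \<alpha> \<beta> \<noteq> 0" by blast
    then have w1: "wlen (\<lambda>j. Re (l j)) \<alpha> = 1" using A(2) w by blast
    have "\<exists>j. Re (l j) \<noteq> 0"
    proof (rule ccontr)
      assume "\<not> ?thesis"
      then have "wlen (\<lambda>j. Re (l j)) \<alpha> = 0" by (simp add: wlen_def)
      with w1 show False by simp
    qed
    moreover have "\<forall>\<alpha> \<beta>. A \<alpha> \<beta> \<noteq> 0 \<longrightarrow> wlen (\<lambda>j. Re (l j)) \<alpha> = 1 \<and> wlen (\<lambda>j. Re (l j)) \<beta> = 1"
      using A(2) w by blast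
    ultimately show ?thesis unfolding balanced_def using A(1) by (intro exI[of _ "\<lambda>j. Re (l j)"] exI[of _ A]) simp
  qed
  ultimately show ?thesis using that[OF h(1) g] unfolding P'_def by blast
qed

subsection \<open>Calculus of smooth maps\<close>

lemma frechet_derivative_cong_open:
  assumes "open U" "x \<in> U" "\<And>y. y \<in> U \<Longrightarrow> f y = g y"
  shows "frechet_derivative f (at x) = frechet_derivative g (at x)"
proof -
  have "(f has_derivative D) (at x) \<longleftrightarrow> (g has_derivative D) (at x)" for D
    using assms has_derivative_transform_within_open[OF _ assms(1,2)] by metis
  then show ?thesis unfolding frechet_derivative_def by simp
qed

lemma Ck_on_cong:
  assumes "open U" "\<And>y. y \<in> U \<Longrightarrow> f y = g y" "Ck_on k U f"
  shows "Ck_on k U g"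
  using assms(2,3)
proof (induction k arbitrary: f g)
  case 0
  then show ?case by (simp cong: continuous_on_cong)
next
  case (Suc k)
  have "g differentiable (at x)" if "x \<in> U" for x
    using Suc.prems that has_derivative_transform_within_open[OF _ assms(1) that, of f _ UNIV g]
    unfolding Ck_on.simps differentiable_def by blast
  moreover have "Ck_on k U (\<lambda>x. frechet_derivative g (at x) v)" for v
  proof (rule Suc.IH)
    show "Ck_on k U (\<lambda>x. frechet_derivative f (at x) v)" using Suc.prems by simp
    show "frechet_derivative f (at y) v = frechet_derivative g (at y) v" if "y \<in> U" for y
      using frechet_derivative_cong_open[OF assms(1) that, of f g] Suc.prems(1) by simp
  qed
  ultimately show ?case by simp
qed

lemma Ck_on_Suc_imp: "Ck_on (Suc k) U f \<Longrightarrow> Ck_on k U f"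
proof (induction k arbitrary: f)
  case 0
  then show ?case
    by (simp add: continuous_at_imp_continuous_on differentiable_imp_continuous_within)
next
  case (Suc k)
  then show ?case by (metis Ck_on.simps(2))
qed

lemma Ck_on_SucI:
  assumes "open U" "\<And>x. x \<in> U \<Longrightarrow> (f has_derivative D x) (at x)" "\<And>v. Ck_on k U (\<lambda>x. D x v)"
  shows "Ck_on (Suc k) U f"
proof -
  have "Ck_on k U (\<lambda>x. frechet_derivative f (at x) v)" for v
    by (rule Ck_on_cong[OF assms(1) _ assms(3)[of v]]) (simp add: frechet_derivative_at[OF assms(2)])
  then show ?thesis using assms(2) by (auto intro: differentiableI)
qed

lemma Ck_on_SucD:
  assumes "Ck_on (Suc k) U f"
  shows "x \<in> U \<Longrightarrow> (f has_derivative frechet_derivative f (at x)) (at x)"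
    and "Ck_on k U (\<lambda>x. frechet_derivative f (at x) v)"
  using assms frechet_derivative_works by auto

lemma Ck_on_const: "open U \<Longrightarrow> Ck_on k U (\<lambda>x. c)"
proof (induction k arbitrary: c)
  case (Suc k)
  then show ?case by (intro Ck_on_SucI[where D="\<lambda>_ _. 0"]) auto
qed simp

lemma Ck_on_linear:
  assumes "open U" "bounded_linear L"
  shows "Ck_on k U L"
proof (cases k)
  case 0
  then show ?thesis using linear_continuous_on[OF assms(2)] by simp
next
  case (Suc n)
  then show ?thesis using assms
    by (auto intro!: Ck_on_SucI[where D="\<lambda>_. L"] bounded_linear_imp_has_derivative Ck_on_const simp del: Ck_on.simps)
qed

lemma Ck_on_linear_compose:
  assumes "open U" "bounded_linear L" "Ck_on k U f"
  shows "Ck_on k U (\<lambda>x. L (f x))"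
  using assms(3)
proof (induction k arbitrary: f)
  case 0
  then show ?case using bounded_linear.continuous_on[OF assms(2)] by simp
next
  case (Suc k)
  show ?case
    by (rule Ck_on_SucI[OF assms(1) bounded_linear.has_derivative[OF assms(2) Ck_on_SucD(1)[OF Suc.prems]]])
       (auto intro: Suc.IH Ck_on_SucD(2)[OF Suc.prems])
qed

lemma Ck_on_add:
  assumes "open U" "Ck_on k U f" "Ck_on k U g"
  shows "Ck_on k U (\<lambda>x. f x + g x)"
  using assms(2,3)
proof (induction k arbitrary: f g)
  case 0
  then show ?case by (simp add: continuous_on_add)
next
  case (Suc k)
  show ?case
    by (rule Ck_on_SucI[OF assms(1) has_derivative_add[OF Ck_on_SucD(1)[OF Suc.prems(1)] Ck_on_SucD(1)[OF Suc.prems(2)]]])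
       (auto intro: Suc.IH Ck_on_SucD(2)[OF Suc.prems(1)] Ck_on_SucD(2)[OF Suc.prems(2)])
qed

lemma Ck_on_sum: "open U \<Longrightarrow> (\<And>i. i \<in> I \<Longrightarrow> Ck_on k U (f i)) \<Longrightarrow> Ck_on k U (\<lambda>x. \<Sum>i\<in>I. f i x)"
  by (induction I rule: infinite_finite_induct) (auto intro: Ck_on_const Ck_on_add)

lemma Ck_on_bilinear:
  assumes "open U" "bounded_bilinear B" "Ck_on k U f" "Ck_on k U g"
  shows "Ck_on k U (\<lambda>x. B (f x) (g x))"
  using assms(3,4)
proof (induction k arbitrary: f g)
  case 0
  then show ?case using bounded_bilinear.continuous_on[OF assms(2)] by simp
next
  case (Suc k)
  show ?case
  proof (rule Ck_on_SucI[OF assms(1) bounded_bilinear.FDERIV[OF assms(2) Ck_on_SucD(1)[OF Suc.prems(1)] Ck_on_SucD(1)[OF Suc.prems(2)]]])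
    show "Ck_on k U (\<lambda>x. B (f x) (frechet_derivative g (at x) v) + B (frechet_derivative f (at x) v) (g x))" for v
      by (intro Ck_on_add[OF assms(1)] Suc.IH[OF Ck_on_Suc_imp[OF Suc.prems(1)] Ck_on_SucD(2)[OF Suc.prems(2)]]
          Suc.IH[OF Ck_on_SucD(2)[OF Suc.prems(1)] Ck_on_Suc_imp[OF Suc.prems(2)]])
  qed
qed

lemma Ck_on_mult:
  fixes f g :: "'a::real_normed_vector \<Rightarrow> complex"
  shows "open U \<Longrightarrow> Ck_on k U f \<Longrightarrow> Ck_on k U g \<Longrightarrow> Ck_on k U (\<lambda>x. f x * g x)"
  by (rule Ck_on_bilinear[OF _ bounded_bilinear_mult])

lemma Ck_on_compose:
  fixes G :: "'a::real_normed_vector \<Rightarrow> 'b::euclidean_space"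
  assumes "open U" "open V" "\<And>k. Ck_on k U G" "\<And>x. x \<in> U \<Longrightarrow> G x \<in> V" "Ck_on k V f"
  shows "Ck_on k U (\<lambda>x. f (G x))"
  using assms(5)
proof (induction k arbitrary: f)
  case 0
  then show ?case using assms(3)[of 0] assms(4) by (auto intro: continuous_on_compose2)
next
  case (Suc k)
  note G = Ck_on_SucD[OF assms(3)] and f = Ck_on_SucD[OF Suc.prems]
  have D: "((\<lambda>x. f (G x)) has_derivative (\<lambda>v. frechet_derivative f (at (G x)) (frechet_derivative G (at x) v))) (at x)"
    if "x \<in> U" for x
    by (rule has_derivative_compose[OF G(1)[OF that] f(1)[OF assms(4)[OF that]]])
  show ?case
  proof (rule Ck_on_SucI[OF assms(1) D])
    fix v
    \<comment> \<open>\<open>Ck_on\<close> speaks of derivatives in a fixed direction, while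
      \<open>frechet_derivative G (at x) v\<close> moves with \<open>x\<close>. Expansion in a basis
      restores fixed directions.\<close>
    have "Ck_on k U (\<lambda>x. \<Sum>b\<in>Basis. (frechet_derivative G (at x) v \<bullet> b) *\<^sub>R frechet_derivative f (at (G x)) b)"
      by (intro Ck_on_sum assms(1) Ck_on_bilinear[OF _ bounded_bilinear_scaleR]
          Ck_on_linear_compose[OF _ bounded_linear_inner_left] G(2) Suc.IH f(2))
    then show "Ck_on k U (\<lambda>x. frechet_derivative f (at (G x)) (frechet_derivative G (at x) v))"
    proof (rule Ck_on_cong[OF assms(1), rotated])
      fix x assume x: "x \<in> U"
      interpret bounded_linear "frechet_derivative f (at (G x))"
        by (rule has_derivative_bounded_linear[OF f(1)[OF assms(4)[OF x]]])
      have "frechet_derivative f (at (G x)) (\<Sum>b\<in>Basis. (frechet_derivative G (at x) v \<bullet> b) *\<^sub>R b) =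
        (\<Sum>b\<in>Basis. (frechet_derivative G (at x) v \<bullet> b) *\<^sub>R frechet_derivative f (at (G x)) b)"
        by (simp add: sum scaleR)
      then show "(\<Sum>b\<in>Basis. (frechet_derivative G (at x) v \<bullet> b) *\<^sub>R frechet_derivative f (at (G x)) b) =
          frechet_derivative f (at (G x)) (frechet_derivative G (at x) v)"
        by (simp add: euclidean_representation)
    qed
  qed
qed

lemma Ck_on_bipoly_fst:
  assumes "bipoly Q f" "open U"
  shows "Ck_on k U (\<lambda>x::(complex^'n::finite) \<times> real. f (fst x))"
  using assms(1)
proof (induction arbitrary: k rule: bipoly_ring_induct)
  case (const c)
  then show ?case using assms(2) by (rule Ck_on_const)
next
  case (coord j)
  show ?case by (rule Ck_on_linear[OF assms(2) bounded_linear_compose[OF bounded_linear_vec_nth bounded_linear_fst]])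
next
  case (cnj_coord j)
  show ?case
    by (rule Ck_on_linear[OF assms(2) bounded_linear_compose[OF bounded_linear_cnj bounded_linear_compose[OF bounded_linear_vec_nth bounded_linear_fst]]])
next
  case (add f g)
  show ?case by (intro Ck_on_add assms add.IH)
next
  case (mult f g)
  show ?case by (intro Ck_on_mult assms mult.IH)
qed

lemma Ck_on_cvec:
  fixes f :: "'a::real_normed_vector \<Rightarrow> complex^'n::finite"
  assumes U: "open U" and "\<And>j. Ck_on k U (\<lambda>x. f x $ j)"
  shows "Ck_on k U f"
proof -
  have L: "bounded_linear (\<lambda>c. \<chi> i. if i = j then c else (0::complex))" for j :: 'n
    by (rule bounded_linearI'[where 'a=complex]) (auto simp: vec_eq_iff)
  have "Ck_on k U (\<lambda>x. \<Sum>j\<in>UNIV. \<chi> i. if i = j then f x $ j else 0)"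
    by (rule Ck_on_sum[OF U Ck_on_linear_compose[OF U L assms(2)]])
  then show ?thesis by (rule Ck_on_cong[OF U, rotated]) (simp add: vec_eq_iff sum.delta)
qed

subsection \<open>Weighted vanishing order under weighted coordinate changes\<close>

lemma wderiv_cong_open:
  assumes "open U" "x \<in> U" "\<And>y. y \<in> U \<Longrightarrow> f y = g y"
  shows "wderiv d f x = wderiv d g x"
  by (cases d) (simp_all add: frechet_derivative_cong_open[OF assms(1,2), of f g] assms(3))

lemma Ck_on_wderiv:
  assumes "open U" "Ck_on (Suc k) U f"
  shows "Ck_on k U (wderiv d f)"
proof -
  note D = Ck_on_SucD(2)[OF assms(2)]
  have *: "Ck_on k U (\<lambda>x. (frechet_derivative f (at x) a + c * frechet_derivative f (at x) b) * (1/2))" for a b and c :: complex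
    by (intro Ck_on_mult Ck_on_add Ck_on_const assms D)
  show ?thesis
    using *[of "(axis j 1, 0)" "-\<i>" "(axis j \<i>, 0)" for j] *[of "(axis j 1, 0)" \<i> "(axis j \<i>, 0)" for j] D
    by (cases d) simp_all
qed

lemma wderiv_add:
  assumes "f differentiable (at x)" "g differentiable (at x)"
  shows "wderiv d (\<lambda>x. f x + g x) x = wderiv d f x + wderiv d g x"
proof -
  note D = frechet_derivative_at[OF has_derivative_add[OF assms[unfolded frechet_derivative_works]], symmetric]
  show ?thesis by (cases d) (simp_all add: D field_simps)
qed

lemma wderiv_mult:
  assumes "f differentiable (at x)" "g differentiable (at x)"
  shows "wderiv d (\<lambda>x. f x * g x) x = wderiv d f x * g x + f x * wderiv d g x"
proof -
  note D = frechet_derivative_at[OF has_derivative_mult[OF assms[unfolded frechet_derivative_works]], symmetric]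
  show ?thesis by (cases d) (simp_all add: D field_simps)
qed

lemma axis_ii: "\<i> *s axis j 1 = (axis j \<i> :: complex^'n::finite)"
  by (simp add: vec_eq_iff axis_def)

lemma wderiv_bipoly_fst:
  assumes "anypoly c"
  shows "wderiv (DZ j) (\<lambda>x. c (fst x)) x = dhol (\<lambda>_. axis j 1) c (fst x)"
    "wderiv (DZbar j) (\<lambda>x. c (fst x)) x = dbar (\<lambda>_. axis j 1) c (fst x)"
    "wderiv DU (\<lambda>x. c (fst x)) x = 0"
proof -
  have "((\<lambda>x. c (fst x)) has_derivative (\<lambda>v. frechet_derivative c (at (fst x)) (fst v))) (at x)"
    by (rule has_derivative_compose[OF bounded_linear_imp_has_derivative[OF bounded_linear_fst] bipoly_has_derivative[OF assms]])
  note D = frechet_derivative_at[OF this, symmetric]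
  show "wderiv (DZ j) (\<lambda>x. c (fst x)) x = dhol (\<lambda>_. axis j 1) c (fst x)"
    "wderiv (DZbar j) (\<lambda>x. c (fst x)) x = dbar (\<lambda>_. axis j 1) c (fst x)"
    by (simp_all add: D dhol_def dbar_def axis_ii)
  show "wderiv DU (\<lambda>x. c (fst x)) x = 0"
    using linear_0[OF has_derivative_linear[OF bipoly_has_derivative[OF assms]]] by (simp add: D)
qed

text \<open>The (1,0) part depends complex linearly on the direction and the (0,1) part conjugate
  linearly. Applied to an outer derivative, this is the chain rule for a holomorphic inner
  map.\<close>

lemma wirtinger_linear:
  fixes D :: "(complex^'n::finite) \<times> real \<Rightarrow> complex"
  assumes "bounded_linear D"
  shows "(D (a, 0) - \<i> * D (\<i> *s a, 0)) / 2 = (\<Sum>i\<in>UNIV. a $ i * ((D (axis i 1, 0) - \<i> * D (axis i \<i>, 0)) / 2))"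
    and "(D (a, 0) + \<i> * D (\<i> *s a, 0)) / 2 = (\<Sum>i\<in>UNIV. cnj (a $ i) * ((D (axis i 1, 0) + \<i> * D (axis i \<i>, 0)) / 2))"
proof -
  interpret bounded_linear D by fact
  have *: "D (b, 0) = (\<Sum>i\<in>UNIV. of_real (Re (b $ i)) * D (axis i 1, 0) + of_real (Im (b $ i)) * D (axis i \<i>, 0))" for b
  proof -
    have "b = (\<Sum>i\<in>UNIV. Re (b $ i) *\<^sub>R axis i 1 + Im (b $ i) *\<^sub>R axis i \<i>)"
      by (simp add: vec_eq_iff axis_def if_distrib complex_eq_iff cong: if_cong)
    then have "(b, 0::real) = (\<Sum>i\<in>UNIV. Re (b $ i) *\<^sub>R (axis i 1, 0) + Im (b $ i) *\<^sub>R (axis i \<i>, 0))"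
      by (simp add: sum_prod)
    then have "D (b, 0) = (\<Sum>i\<in>UNIV. Re (b $ i) *\<^sub>R D (axis i 1, 0) + Im (b $ i) *\<^sub>R D (axis i \<i>, 0))"
      by (simp only: sum add scaleR)
    then show ?thesis by (simp add: scaleR_conv_of_real[where 'a=complex])
  qed
  show "(D (a, 0) - \<i> * D (\<i> *s a, 0)) / 2 = (\<Sum>i\<in>UNIV. a $ i * ((D (axis i 1, 0) - \<i> * D (axis i \<i>, 0)) / 2))"
    unfolding *[of a] *[of "\<i> *s a"] sum_distrib_left sum_subtractf[symmetric] sum_divide_distrib
    by (intro sum.cong refl) (simp add: complex_eq_iff field_simps)
  show "(D (a, 0) + \<i> * D (\<i> *s a, 0)) / 2 = (\<Sum>i\<in>UNIV. cnj (a $ i) * ((D (axis i 1, 0) + \<i> * D (axis i \<i>, 0)) / 2))"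
    unfolding *[of a] *[of "\<i> *s a"] sum_distrib_left sum.distrib[symmetric] sum_divide_distrib
    by (intro sum.cong refl) (simp add: complex_eq_iff field_simps)
qed

locale weighted_change = poly_model +
  fixes g :: "'a \<Rightarrow> complex^'a \<Rightarrow> complex"
  assumes g: "\<And>i. hpoly (\<lambda>\<alpha>. wlen \<mu> \<alpha> = \<mu> i) (g i)"
begin

definition G :: "(complex^'a) \<times> real \<Rightarrow> (complex^'a) \<times> real" where
  "G x = (\<chi> i. g i (fst x), snd x)"

lemma G0: "G 0 = 0"
  using hpoly_zero_at_0[OF g] by (simp add: G_def zero_prod_def vec_eq_iff)

lemma Ck_on_G: "open U \<Longrightarrow> Ck_on k U G"
proof -
  assume U: "open U"
  have 1: "Ck_on k U (\<lambda>x::(complex^'a) \<times> real. \<chi> i. g i (fst x))"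
    by (rule Ck_on_cvec[OF U]) (simp add: Ck_on_bipoly_fst[OF g U])
  have "bounded_linear (\<lambda>v::complex^'a. (v, 0::real))" "bounded_linear (\<lambda>v::(complex^'a) \<times> real. (0::complex^'a, snd v))"
    by (intro bounded_linear_Pair bounded_linear_ident bounded_linear_zero bounded_linear_snd)+
  then have "Ck_on k U (\<lambda>x. (\<chi> i. g i (fst x), 0) + (0, snd x))"
    by (intro Ck_on_add[OF U] Ck_on_linear_compose[OF U _ 1] Ck_on_linear[OF U])
  then show ?thesis by (simp add: G_def[abs_def])
qed

lemma G_has_derivative:
  "(G has_derivative (\<lambda>v. (\<chi> i. frechet_derivative (g i) (at (fst x)) (fst v), snd v))) (at x)"
  unfolding G_def[abs_def]
  by (intro has_derivative_Pair has_derivative_cvec bounded_linear_imp_has_derivative bounded_linear_snd)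
     (simp add: has_derivative_compose[OF bounded_linear_imp_has_derivative[OF bounded_linear_fst] bipoly_has_derivative[OF g]])

lemma wderiv_compose_G:
  assumes "f differentiable (at (G x))"
  shows "wderiv (DZ j) (\<lambda>x. f (G x)) x = (\<Sum>i\<in>UNIV. dhol (\<lambda>_. axis j 1) (g i) (fst x) * wderiv (DZ i) f (G x))"
    and "wderiv (DZbar j) (\<lambda>x. f (G x)) x = (\<Sum>i\<in>UNIV. cnj (dhol (\<lambda>_. axis j 1) (g i) (fst x)) * wderiv (DZbar i) f (G x))"
    and "wderiv DU (\<lambda>x. f (G x)) x = wderiv DU f (G x)"
proof -
  note fd = assms[unfolded frechet_derivative_works]
  note D = frechet_derivative_at[OF has_derivative_compose[OF G_has_derivative fd], symmetric]
  define a where "a = (\<chi> i. frechet_derivative (g i) (at (fst x)) (axis j 1))"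
  have a: "a $ i = dhol (\<lambda>_. axis j 1) (g i) (fst x)" for i by (simp add: a_def hpoly_dhol(1)[OF g])
  have ia: "(\<chi> i. frechet_derivative (g i) (at (fst x)) (axis j \<i>)) = \<i> *s a"
    by (simp add: a_def vec_eq_iff hpoly_dhol(2)[OF g] flip: axis_ii)
  note W = wirtinger_linear[OF has_derivative_bounded_linear[OF fd], of a]
  show "wderiv (DZ j) (\<lambda>x. f (G x)) x = (\<Sum>i\<in>UNIV. dhol (\<lambda>_. axis j 1) (g i) (fst x) * wderiv (DZ i) f (G x))"
    "wderiv (DZbar j) (\<lambda>x. f (G x)) x = (\<Sum>i\<in>UNIV. cnj (dhol (\<lambda>_. axis j 1) (g i) (fst x)) * wderiv (DZbar i) f (G x))"
    using W by (simp_all add: D ia a a_def[symmetric])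
  have "(\<chi> i. frechet_derivative (g i) (at (fst x)) 0) = 0"
    using linear_0[OF has_derivative_linear[OF bipoly_has_derivative[OF g]]] by (simp add: vec_eq_iff)
  then show "wderiv DU (\<lambda>x. f (G x)) x = wderiv DU f (G x)" by (simp add: D)
qed

definition weight :: "'a wdir list \<Rightarrow> real" where
  "weight ds = sum_list (map (wdir_weight \<mu>) ds)"

text \<open>The shape of a derivative of weighted order \<open>k\<close> of the composition of
  \<open>f\<close> with \<open>G\<close>. A derivative of \<open>f\<close> of order
  \<open>weight ds\<close> comes with a coefficient of weight \<open>weight ds - k\<close>, so that
  orders above \<open>k\<close> are compensated by coefficients vanishing at the origin.\<close>

inductive weighted_comb :: "((complex^'a) \<times> real \<Rightarrow> complex) \<Rightarrow> real \<Rightarrow> ((complex^'a) \<times> real \<Rightarrow> complex) \<Rightarrow> bool"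
  for f k where
  wc_zero: "weighted_comb f k (\<lambda>x. 0)"
| wc_step: "weighted_comb f k F \<Longrightarrow> bipoly (\<lambda>\<alpha> \<beta>. wlen \<mu> \<alpha> + wlen \<mu> \<beta> = weight ds - k) c \<Longrightarrow>
    weighted_comb f k (\<lambda>x. c (fst x) * foldr wderiv ds f (G x) + F x)"

lemma weighted_comb_add:
  assumes "weighted_comb f k F" "weighted_comb f k H"
  shows "weighted_comb f k (\<lambda>x. F x + H x)"
  using assms(1)
proof induction
  case (wc_step F ds c)
  from wc_step.IH wc_step.hyps(2) have "weighted_comb f k (\<lambda>x. c (fst x) * foldr wderiv ds f (G x) + (F x + H x))"
    using assms(2) by (intro weighted_comb.wc_step) 
  then show ?case by (simp add: add.assoc)
qed (use assms(2) in simp)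

lemma weighted_comb_term:
  "bipoly (\<lambda>\<alpha> \<beta>. wlen \<mu> \<alpha> + wlen \<mu> \<beta> = weight ds - k) c \<Longrightarrow>
    weighted_comb f k (\<lambda>x. c (fst x) * foldr wderiv ds f (G x))"
  using wc_step[OF wc_zero, of ds k c f] by simp

lemma weighted_comb_sum:
  "(\<And>i. i \<in> I \<Longrightarrow> weighted_comb f k (F i)) \<Longrightarrow> weighted_comb f k (\<lambda>x. \<Sum>i\<in>I. F i x)"
  by (induction I rule: infinite_finite_induct) (auto intro: wc_zero weighted_comb_add)

context
  fixes V and f :: "(complex^'a) \<times> real \<Rightarrow> complex"
  assumes V: "open V" and f: "\<And>k. Ck_on k V f"
begin

lemma Ck_on_foldr: "Ck_on k V (foldr wderiv ds f)"
  by (induction ds arbitrary: k) (auto intro: f Ck_on_wderiv[OF V] simp del: Ck_on.simps)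

lemma open_preimage: "open (G -` V)"
  using Ck_on_G[of UNIV 0] V by (simp add: open_vimage)

lemma differentiable_foldr: "x \<in> V \<Longrightarrow> foldr wderiv ds f differentiable (at x)"
  using Ck_on_foldr[of 1 ds] by simp

lemma differentiable_comp: "x \<in> G -` V \<Longrightarrow> (\<lambda>x. foldr wderiv ds f (G x)) differentiable (at x)"
  by (rule differentiableI, rule has_derivative_compose[OF G_has_derivative],
      rule differentiable_foldr[unfolded frechet_derivative_works]) simp

lemma differentiable_fst_poly: "anypoly c \<Longrightarrow> (\<lambda>x::(complex^'a) \<times> real. c (fst x)) differentiable (at x)"
  by (rule differentiableI, rule has_derivative_compose[OF bounded_linear_imp_has_derivative[OF bounded_linear_fst]
      bipoly_has_derivative])

text \<open>Differentiating a coefficient in direction \<open>j\<close> lowers its weight by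
  \<open>\<mu> j\<close>. The chain rule instead contributes a derivative of \<open>g i\<close>, of
  weight \<open>\<mu> i - \<mu> j\<close>, and one more derivative of \<open>f\<close>, of weight
  \<open>\<mu> i\<close>. Both fit the shape for the increased order.\<close>

lemma wderiv_weighted_comb:
  assumes "weighted_comb f k F"
  shows "(\<forall>x\<in>G -` V. F differentiable (at x)) \<and>
    (\<exists>F'. weighted_comb f (k + wdir_weight \<mu> d) F' \<and> (\<forall>x\<in>G -` V. wderiv d F x = F' x))"
  using assms
proof induction
  case wc_zero
  have "wderiv d (\<lambda>x. 0) x = 0" for x by (cases d) simp_all
  then show ?case by (auto intro: weighted_comb.wc_zero)
next
  case (wc_step F ds c)
  let ?k = "k + wdir_weight \<mu> d"
  let ?\<phi> = "foldr wderiv ds f"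
  from wc_step.IH obtain F' where F': "\<And>x. x \<in> G -` V \<Longrightarrow> F differentiable (at x)" "weighted_comb f ?k F'"
    "\<And>x. x \<in> G -` V \<Longrightarrow> wderiv d F x = F' x" by blast
  have c: "anypoly c" by (rule bipoly_any[OF wc_step.hyps(2)])
  have d1: "(\<lambda>x. c (fst x) * ?\<phi> (G x)) differentiable (at x)" if "x \<in> G -` V" for x
    by (intro differentiable_mult differentiable_fst_poly c differentiable_comp that)
  have ax: "hpoly (\<lambda>\<alpha>. \<alpha> = (\<lambda>_. 0)) (\<lambda>z. (axis j 1 :: complex^'a) $ i)" "i \<noteq> j \<Longrightarrow> (axis j 1 :: complex^'a) $ i = 0" for i j
    by (auto simp: axis_def intro: bipoly_const)
  have ax': "hpoly (\<lambda>\<alpha>. \<alpha> = (\<lambda>_. 0) \<and> i = j) (\<lambda>z. (axis j 1 :: complex^'a) $ i)" for i j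
    by (cases "i = j") (auto simp: axis_def intro: bipoly_const bipoly.zero)
  have dc: "bipoly (\<lambda>\<alpha> \<beta>. wlen \<mu> \<alpha> + wlen \<mu> \<beta> = m - \<mu> j) (dhol (\<lambda>_. axis j 1) e)"
     "bipoly (\<lambda>\<alpha> \<beta>. wlen \<mu> \<alpha> + wlen \<mu> \<beta> = m - \<mu> j) (dbar (\<lambda>_. axis j 1) e)"
    if "bipoly (\<lambda>\<alpha> \<beta>. wlen \<mu> \<alpha> + wlen \<mu> \<beta> = m) e" for m j e
    by (rule bipoly_dhol[OF that ax'] bipoly_dbar[OF that ax'];
        auto simp: wlen_add wlen_dec[unfolded One_nat_def] simp del: fun_upd_apply)+
  have dg: "bipoly (\<lambda>\<alpha> \<beta>. wlen \<mu> \<alpha> + wlen \<mu> \<beta> = \<mu> i - \<mu> j) (dhol (\<lambda>_. axis j 1) (g i))" for i j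
    by (rule dc(1), rule bipoly_mono[OF g]) auto
  have "\<exists>H. weighted_comb f ?k H \<and> (\<forall>x\<in>G -` V. wderiv d (\<lambda>x. c (fst x) * ?\<phi> (G x)) x = H x)"
  proof (cases d)
    case (DZ j)
    define H where "H = (\<lambda>x. dhol (\<lambda>_. axis j 1) c (fst x) * ?\<phi> (G x) +
       (\<Sum>i\<in>UNIV. (c (fst x) * dhol (\<lambda>_. axis j 1) (g i) (fst x)) * foldr wderiv (DZ i # ds) f (G x)))"
    have "weighted_comb f ?k H" unfolding H_def
    proof (intro weighted_comb_add weighted_comb_sum)
      show "weighted_comb f ?k (\<lambda>x. dhol (\<lambda>_. axis j 1) c (fst x) * ?\<phi> (G x))"
        by (rule weighted_comb_term) (use dc(1)[OF wc_step.hyps(2), of j] DZ in \<open>simp add: algebra_simps\<close>)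
      show "weighted_comb f ?k (\<lambda>x. (c (fst x) * dhol (\<lambda>_. axis j 1) (g i) (fst x)) * foldr wderiv (DZ i # ds) f (G x))" for i
        by (rule weighted_comb_term[where c="\<lambda>z. c z * dhol (\<lambda>_. axis j 1) (g i) z"], rule bipoly_mult[OF wc_step.hyps(2) dg])
           (auto simp: DZ wlen_add weight_def)
    qed
    moreover have "wderiv d (\<lambda>x. c (fst x) * ?\<phi> (G x)) x = H x" if "x \<in> G -` V" for x
      unfolding H_def DZ wderiv_mult[OF differentiable_fst_poly[OF c] differentiable_comp[OF that]]
      using that by (simp add: wderiv_bipoly_fst[OF c] wderiv_compose_G differentiable_foldr sum_distrib_left mult.assoc
          del: wderiv.simps)
    ultimately show ?thesis by blast
  next
    case (DZbar j)
    define H where "H = (\<lambda>x. dbar (\<lambda>_. axis j 1) c (fst x) * ?\<phi> (G x) +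
       (\<Sum>i\<in>UNIV. (c (fst x) * cnj (dhol (\<lambda>_. axis j 1) (g i) (fst x))) * foldr wderiv (DZbar i # ds) f (G x)))"
    have "weighted_comb f ?k H" unfolding H_def
    proof (intro weighted_comb_add weighted_comb_sum)
      show "weighted_comb f ?k (\<lambda>x. dbar (\<lambda>_. axis j 1) c (fst x) * ?\<phi> (G x))"
        by (rule weighted_comb_term) (use dc(2)[OF wc_step.hyps(2), of j] DZbar in \<open>simp add: algebra_simps\<close>)
      show "weighted_comb f ?k (\<lambda>x. (c (fst x) * cnj (dhol (\<lambda>_. axis j 1) (g i) (fst x))) * foldr wderiv (DZbar i # ds) f (G x))" for i
        by (rule weighted_comb_term[where c="\<lambda>z. c z * cnj (dhol (\<lambda>_. axis j 1) (g i) z)"], rule bipoly_mult[OF wc_step.hyps(2) bipoly_cnj[OF dg]])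
           (auto simp: DZbar wlen_add weight_def)
    qed
    moreover have "wderiv d (\<lambda>x. c (fst x) * ?\<phi> (G x)) x = H x" if "x \<in> G -` V" for x
      unfolding H_def DZbar wderiv_mult[OF differentiable_fst_poly[OF c] differentiable_comp[OF that]]
      using that by (simp add: wderiv_bipoly_fst[OF c] wderiv_compose_G differentiable_foldr sum_distrib_left mult.assoc
          del: wderiv.simps)
    ultimately show ?thesis by blast
  next
    case DU
    have "weighted_comb f ?k (\<lambda>x. c (fst x) * foldr wderiv (DU # ds) f (G x))"
      by (rule weighted_comb_term) (use wc_step.hyps(2) DU in \<open>simp add: weight_def\<close>)
    moreover have "wderiv d (\<lambda>x. c (fst x) * ?\<phi> (G x)) x = c (fst x) * foldr wderiv (DU # ds) f (G x)" if "x \<in> G -` V" for x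
      unfolding DU wderiv_mult[OF differentiable_fst_poly[OF c] differentiable_comp[OF that]]
      using that by (simp add: wderiv_bipoly_fst[OF c] wderiv_compose_G differentiable_foldr del: wderiv.simps)
    ultimately show ?thesis by blast
  qed
  then obtain H where H: "weighted_comb f ?k H" "\<And>x. x \<in> G -` V \<Longrightarrow> wderiv d (\<lambda>x. c (fst x) * ?\<phi> (G x)) x = H x" by blast
  have "weighted_comb f ?k (\<lambda>x. H x + F' x)" by (rule weighted_comb_add[OF H(1) F'(2)])
  moreover have "wderiv d (\<lambda>x. c (fst x) * ?\<phi> (G x) + F x) x = H x + F' x" if "x \<in> G -` V" for x
    using wderiv_add[OF d1[OF that] F'(1)[OF that]] H(2)[OF that] F'(3)[OF that] by simp
  ultimately show ?case using d1 F'(1) by (auto intro: differentiable_add)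
qed

lemma foldr_wderiv_compose:
  "\<exists>F. weighted_comb f (weight ds) F \<and> (\<forall>x\<in>G -` V. foldr wderiv ds (\<lambda>x. f (G x)) x = F x)"
proof (induction ds)
  case Nil
  have "weighted_comb f 0 (\<lambda>x. 1 * foldr wderiv [] f (G x))"
    by (rule weighted_comb_term[where c="\<lambda>_. 1"]) (simp add: bipoly_const weight_def)
  then show ?case by (auto simp: weight_def)
next
  case (Cons d ds)
  then obtain F where F: "weighted_comb f (weight ds) F" "\<And>x. x \<in> G -` V \<Longrightarrow> foldr wderiv ds (\<lambda>x. f (G x)) x = F x" by blast
  from wderiv_weighted_comb[OF F(1), of d] obtain F' where F': "weighted_comb f (weight ds + wdir_weight \<mu> d) F'"
    "\<And>x. x \<in> G -` V \<Longrightarrow> wderiv d F x = F' x" by blast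
  have "foldr wderiv (d # ds) (\<lambda>x. f (G x)) x = F' x" if "x \<in> G -` V" for x
    using wderiv_cong_open[OF open_preimage that F(2), where d=d] F'(2)[OF that] by simp
  then show ?case using F'(1) by (auto simp: weight_def add.commute)
qed

text \<open>Derivatives of \<open>f\<close> of order at most 1 vanish at 0 by assumption; those of
  higher order have a coefficient of positive weight, which vanishes there.\<close>

lemma weighted_comb_vanish:
  assumes "weighted_comb f k F" "k \<le> 1" "\<And>ds. weight ds \<le> 1 \<Longrightarrow> foldr wderiv ds f 0 = 0"
  shows "F 0 = 0"
  using assms(1)
proof induction
  case (wc_step F ds c)
  have "c 0 = 0 \<or> foldr wderiv ds f 0 = 0"
  proof (cases "weight ds \<le> 1")
    case False
    then have "c 0 = 0" using assms(2) by (intro bipoly_zero_at_0[OF wc_step.hyps(2)]) simp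
    then show ?thesis ..
  qed (use assms(3) in blast)
  then show ?case using wc_step by (auto simp: G0)
qed simp

end

lemma weighted_little_o_compose:
  assumes "smooth_on V R" "weighted_little_o \<mu> R" "0 \<in> V"
  shows "smooth_on (G -` V) (\<lambda>x. R (G x))" "weighted_little_o \<mu> (\<lambda>x. R (G x))"
proof -
  have V: "open V" and R: "Ck_on k V R" for k using assms(1) by (auto simp: smooth_on_def)
  define f where "f x = complex_of_real (R x)" for x
  have f: "Ck_on k V f" for k
    unfolding f_def[abs_def] by (rule Ck_on_linear_compose[OF V bounded_linear_of_real R])
  note op = open_preimage[OF V f]
  show "smooth_on (G -` V) (\<lambda>x. R (G x))"
    unfolding smooth_on_def using op V R by (auto intro: Ck_on_compose Ck_on_G)
  have "foldr wderiv ds (\<lambda>x. complex_of_real (R (G x))) 0 = 0" if "sum_list (map (wdir_weight \<mu>) ds) \<le> 1" for ds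
  proof -
    obtain F where F: "weighted_comb f (weight ds) F" "\<And>x. x \<in> G -` V \<Longrightarrow> foldr wderiv ds (\<lambda>x. f (G x)) x = F x"
      using foldr_wderiv_compose[OF V f] by blast
    have "F 0 = 0"
      by (rule weighted_comb_vanish[OF V f F(1)])
         (use that assms(2) in \<open>auto simp: weight_def weighted_little_o_def f_def[abs_def]\<close>)
    moreover have "0 \<in> G -` V" using assms(3) by (simp add: G0)
    ultimately show ?thesis using F(2) by (simp add: f_def)
  qed
  then show "weighted_little_o \<mu> (\<lambda>x. R (G x))" by (simp add: weighted_little_o_def)
qed

end

subsection \<open>From fields of weight 1 to balanced coordinates\<close>

lemma hol_on_compose:
  fixes F G :: "'n csp \<Rightarrow> 'n::finite csp"
  assumes "hol_on V F" "hol_on U G" "\<And>x. x \<in> U \<Longrightarrow> G x \<in> V"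
  shows "hol_on U (\<lambda>x. F (G x))"
  unfolding hol_on_def
proof (intro conjI ballI)
  show "open U" using assms by (simp add: hol_on_def)
  fix x assume x: "x \<in> U"
  obtain D where D: "(G has_derivative D) (at x)" "\<And>c v. D (cscale c v) = cscale c (D v)"
    using assms(2) x by (auto simp: hol_on_def)
  obtain E where E: "(F has_derivative E) (at (G x))" "\<And>c v. E (cscale c v) = cscale c (E v)"
    using assms(1) assms(3)[OF x] by (auto simp: hol_on_def)
  show "\<exists>D. ((\<lambda>x. F (G x)) has_derivative D) (at x) \<and> (\<forall>c v. D (cscale c v) = cscale c (D v))"
    by (rule exI[of _ "\<lambda>v. E (D v)"]) (auto intro: has_derivative_compose[OF D(1) E(1)] simp: D E)
qed

lemma hol_on_cong:
  assumes "hol_on U F" "\<And>x. x \<in> U \<Longrightarrow> F x = G x"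
  shows "hol_on U G"
  unfolding hol_on_def
proof (intro conjI ballI)
  show op: "open U" using assms(1) by (simp add: hol_on_def)
  fix x assume x: "x \<in> U"
  then obtain D where "(F has_derivative D) (at x)" "\<forall>c v. D (cscale c v) = cscale c (D v)"
    using assms(1) by (auto simp: hol_on_def)
  then show "\<exists>D. (G has_derivative D) (at x) \<and> (\<forall>c v. D (cscale c v) = cscale c (D v))"
    using has_derivative_transform_within_open[where f=F and g=G, OF _ op x assms(2)] by blast
qed

lemma hol_on_continuous: "hol_on U F \<Longrightarrow> continuous_on U F"
  unfolding hol_on_def
  by (intro continuous_at_imp_continuous_on ballI) (blast dest: has_derivative_continuous)

section \<open>The dimension of \<open>g1\<close>\<close>

lemma g1_nonzero_if_dim_pos:
  assumes "vf.dim (g1 \<mu> P) > 0"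
  obtains X where "X \<in> g1 \<mu> P" "X \<noteq> (\<lambda>x. 0)"
proof -
  obtain B where B: "B \<subseteq> g1 \<mu> P" "vf.independent B" "card B = vf.dim (g1 \<mu> P)"
    by (rule vf.basis_exists)
  then have "B \<noteq> {}" using assms by auto
  then obtain X where "X \<in> B" by blast
  moreover have "X \<noteq> 0" using B(2) \<open>X \<in> B\<close> vf.dependent_zero by blast
  ultimately show ?thesis using that B(1) by (auto simp: zero_fun_def)
qed

text \<open>\<open>dim\<close> is the cardinality of a basis, which is 0 for an infinite one; so
  finite dimension has to be shown as well. It holds because only finitely many monomials have
  weight at most 2.\<close>

lemma (in poly_model) dim_g1_pos:
  fixes X :: "'n vfield"
  assumes "X \<in> g1 \<mu> P" "X \<noteq> (\<lambda>x. 0)"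
  shows "vf.dim (g1 \<mu> P) > 0"
proof -
  define I where "I = {\<alpha>. wlen \<mu> \<alpha> \<le> 2} \<times> {..2::nat}"
  define m :: "('n \<Rightarrow> nat) \<times> nat \<Rightarrow> 'n csp \<Rightarrow> complex" where "m s x = zmonom (fst s) (fst x) * snd x ^ snd s" for s x
  \<comment> \<open>Places a scalar in one component of a field; \<open>None\<close> stands for the
    last component.\<close>
  define e :: "'n option \<Rightarrow> complex \<Rightarrow> 'n csp" where "e k c = (case k of None \<Rightarrow> (0, c) | Some j \<Rightarrow> (axis j c, 0))" for k c
  \<comment> \<open>The span is taken over the reals, so every monomial field enters with the
    coefficients 1 and \<open>\<i>\<close>.\<close>
  define T where "T = (\<lambda>(k, s, d). (\<lambda>x. e k (d * m s x))) ` (UNIV \<times> I \<times> {1, \<i>})"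
  have finT: "finite T" unfolding T_def I_def using finite_weight_le by (intro finite_imageI finite_cartesian_product) auto
  have e: "e k (a + b) = e k a + e k b" "e k (r *\<^sub>R a) = r *\<^sub>R e k a" "e k 0 = 0" for k a b r
    by (auto simp: e_def axis_def vec_eq_iff zero_prod_def split: option.splits)
  have mono: "(\<lambda>x. e k (c * m s x)) \<in> vf.span T" if "s \<in> I" for k c s
  proof -
    have 1: "(\<lambda>x. e k (d * m s x)) \<in> vf.span T" if "d \<in> {1, \<i>}" for d
      using that \<open>s \<in> I\<close> by (intro vf.span_base) (force simp: T_def)
    have "(\<lambda>x. Re c *\<^sub>R e k (1 * m s x)) + (\<lambda>x. Im c *\<^sub>R e k (\<i> * m s x)) \<in> vf.span T"
      by (intro vf.span_add vf.span_scale 1) auto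
    also have "(\<lambda>x. Re c *\<^sub>R e k (1 * m s x)) + (\<lambda>x. Im c *\<^sub>R e k (\<i> * m s x)) = (\<lambda>x. e k (c * m s x))"
    proof
      fix x
      have "c * m s x = Re c *\<^sub>R (1 * m s x) + Im c *\<^sub>R (\<i> * m s x)" by (simp add: complex_eq_iff)
      then show "((\<lambda>x. Re c *\<^sub>R e k (1 * m s x)) + (\<lambda>x. Im c *\<^sub>R e k (\<i> * m s x))) x = e k (c * m s x)"
        by (simp only: plus_fun_def e)
    qed
    finally show ?thesis .
  qed
  have comp: "(\<lambda>x. e k (f x)) \<in> vf.span T" if f: "hol_weighted_homogeneous \<mu> \<kappa> f" "\<kappa> \<le> 2" for k \<kappa> f
  proof -
    obtain C :: "('n \<Rightarrow> nat) \<Rightarrow> nat \<Rightarrow> complex" where C: "finite {(\<alpha>, l). C \<alpha> l \<noteq> 0}"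
      "\<And>z w. f (z, w) = (\<Sum>(\<alpha>, l)\<in>{(\<alpha>, l). C \<alpha> l \<noteq> 0}. C \<alpha> l * zmonom \<alpha> z * w ^ l)"
      "\<And>\<alpha> l. C \<alpha> l \<noteq> 0 \<Longrightarrow> wlen \<mu> \<alpha> + real l = \<kappa>"
      using f(1) unfolding hol_weighted_homogeneous_def by blast
    have "S \<subseteq> {(\<alpha>, l). C \<alpha> l \<noteq> 0} \<Longrightarrow> (\<lambda>x. e k (\<Sum>s\<in>S. C (fst s) (snd s) * m s x)) \<in> vf.span T" if "finite S" for S
      using that
    proof induction
      case empty
      show ?case using vf.span_zero by (simp add: e zero_fun_def)
    next
      case (insert s S)
      have "s \<in> I" using insert.prems C(3)[of "fst s" "snd s"] f(2) wlen_nonneg[of "fst s"]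
        by (cases s) (auto simp: I_def)
      from vf.span_add[OF mono[OF this, of k "C (fst s) (snd s)"] insert.IH] insert
      show ?case by (simp add: e plus_fun_def)
    qed
    from this[OF C(1) order.refl] have "(\<lambda>x. e k (\<Sum>s\<in>{(\<alpha>, l). C \<alpha> l \<noteq> 0}. C (fst s) (snd s) * m s x)) \<in> vf.span T" .
    moreover have "f x = (\<Sum>s\<in>{(\<alpha>, l). C \<alpha> l \<noteq> 0}. C (fst s) (snd s) * m s x)" for x
      using C(2)[of "fst x" "snd x"] by (simp add: m_def case_prod_unfold mult.assoc)
    ultimately show ?thesis by simp
  qed
  have sub: "g1 \<mu> P \<subseteq> vf.span T"
  proof
    fix Y :: "'n vfield" assume Y: "Y \<in> g1 \<mu> P"
    have F: "(\<lambda>x. e (Some j) (fst (Y x) $ j)) \<in> vf.span T" for j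
      by (rule comp[where \<kappa>="1 + \<mu> j"]) (use Y \<mu>_half[of j] in \<open>auto simp: g1_def vfield_weight_def\<close>)
    have G: "(\<lambda>x. e None (snd (Y x))) \<in> vf.span T"
      by (rule comp[where \<kappa>="1 + 1"]) (use Y in \<open>auto simp: g1_def vfield_weight_def\<close>)
    have "(\<lambda>x. \<Sum>j\<in>J. e (Some j) (fst (Y x) $ j)) \<in> vf.span T" if "finite J" for J
      using that
    proof induction
      case empty
      show ?case using vf.span_zero by (simp add: zero_fun_def)
    next
      case (insert j J)
      then show ?case using vf.span_add[OF F[of j] insert.IH] by (simp add: plus_fun_def)
    qed
    from vf.span_add[OF this[of UNIV] G]
    have "(\<lambda>x. (\<Sum>j\<in>UNIV. e (Some j) (fst (Y x) $ j)) + e None (snd (Y x))) \<in> vf.span T" by (simp add: plus_fun_def)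
    moreover have "(\<Sum>j\<in>UNIV. e (Some j) (fst (Y x) $ j)) + e None (snd (Y x)) = Y x" for x
    proof -
      have "(\<Sum>j\<in>UNIV. (axis j (fst (Y x) $ j), 0::complex)) = (fst (Y x), 0)"
        by (simp add: sum_prod vec_eq_iff axis_def)
      then show ?thesis by (simp add: e_def)
    qed
    ultimately show "Y \<in> vf.span T" by simp
  qed
  obtain B where B: "B \<subseteq> g1 \<mu> P" "vf.independent B" "g1 \<mu> P \<subseteq> vf.span B" "card B = vf.dim (g1 \<mu> P)"
    by (rule vf.basis_exists)
  have "finite B" using vf.independent_span_bound[OF finT B(2)] B(1) sub by blast
  moreover have "B \<noteq> {}"
  proof
    assume "B = {}"
    then have "X \<in> {0}" using B(3) assms(1) by auto
    then show False using assms(2) by (auto simp: zero_fun_def)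
  qed
  ultimately show ?thesis using B(4) by (metis card_gt_0_iff)
qed

text \<open>The change acts on \<open>z\<close> alone: it keeps \<open>w\<close>, composes
  \<open>P\<close> with the inverse map and preserves the weighted vanishing order of the remainder.
  Hence the same \<open>\<mu>\<close> is distinguished in the new coordinates.\<close>

lemma distinguished_form_change:
  fixes \<Phi> :: "'n csp \<Rightarrow> 'n::finite csp"
  assumes dist: "distinguished_form \<mu> M x0 \<Phi> P" and pos: "\<And>j. 0 < \<mu> j" "\<And>j. \<mu> j \<le> 1/2"
    and h: "\<And>j. hpoly (\<lambda>\<alpha>. wlen \<mu> \<alpha> = \<mu> j) (h j)" and g: "\<And>j. hpoly (\<lambda>\<alpha>. wlen \<mu> \<alpha> = \<mu> j) (g j)"
    and gh: "\<And>i z. g i (\<chi> j. h j z) = z $ i" and hg: "\<And>j y. h j (\<chi> i. g i y) = y $ j"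
    and model': "model_polynomial \<mu> (\<lambda>y. P (\<chi> i. g i y))"
  defines "\<Psi> \<equiv> \<lambda>x. (\<chi> j. h j (fst x), snd x)"
  shows "distinguished_form \<mu> M x0 (\<Psi> \<circ> \<Phi>) (\<lambda>y. P (\<chi> i. g i y))"
    and "model_in_coords P \<Psi> (\<lambda>y. P (\<chi> i. g i y))"
proof -
  interpret weighted_change \<mu> P g
    using dist pos g by unfold_locales (auto simp: distinguished_form_def)
  define \<Theta> :: "'n csp \<Rightarrow> 'n csp" where "\<Theta> = (\<lambda>x. (\<chi> i. g i (fst x), snd x))"
  have \<Theta>\<Psi>: "\<Theta> (\<Psi> x) = x" for x by (simp add: \<Theta>_def \<Psi>_def gh prod_eq_iff vec_eq_iff)
  have \<Psi>\<Theta>: "\<Psi> (\<Theta> x) = x" for x by (simp add: \<Theta>_def \<Psi>_def hg prod_eq_iff vec_eq_iff)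
  have \<Psi>0: "\<Psi> 0 = 0" using hpoly_zero_at_0[OF h] by (simp add: \<Psi>_def prod_eq_iff vec_eq_iff)
  have hol\<Psi>: "hol_on UNIV \<Psi>"
    by (rule hol_onI) (auto simp: \<Psi>_def intro: chol_hpoly_fst[OF h] chol_snd)
  have hol\<Theta>: "hol_on UNIV \<Theta>"
    by (rule hol_onI) (auto simp: \<Theta>_def intro: chol_hpoly_fst[OF g] chol_snd)
  \<comment> \<open>\<open>\<Psi>\<close> is biholomorphic on the whole space with inverse
    \<open>\<Theta>\<close>, so the domain \<open>U\<close> is kept and the new image is a preimage
    under \<open>\<Theta>\<close>.\<close>
  have change: "local_coords U y (\<Psi> \<circ> \<Xi>)" if L: "local_coords U y \<Xi>" for U y and \<Xi> :: "'n csp \<Rightarrow> 'n csp"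
    unfolding local_coords_def
  proof (intro conjI)
    show "y \<in> U" "(\<Psi> \<circ> \<Xi>) y = 0" using L by (auto simp: local_coords_def \<Psi>0)
    have hol: "hol_on U \<Xi>" and inj: "inj_on \<Xi> U" and holi: "hol_on (\<Xi> ` U) (inv_into U \<Xi>)"
      using L by (auto simp: local_coords_def)
    show "hol_on U (\<Psi> \<circ> \<Xi>)" using hol_on_compose[OF hol\<Psi> hol] by (simp add: comp_def)
    have inj\<Psi>: "inj \<Psi>" by (rule inj_on_inverseI[where g=\<Theta>]) (rule \<Theta>\<Psi>)
    show inj': "inj_on (\<Psi> \<circ> \<Xi>) U" using inj inj\<Psi> by (intro comp_inj_on) (auto intro: inj_on_subset)
    have im: "(\<Psi> \<circ> \<Xi>) ` U = \<Theta> -` (\<Xi> ` U)"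
    proof
      show "(\<Psi> \<circ> \<Xi>) ` U \<subseteq> \<Theta> -` (\<Xi> ` U)" by (auto simp: \<Theta>\<Psi>)
      show "\<Theta> -` (\<Xi> ` U) \<subseteq> (\<Psi> \<circ> \<Xi>) ` U"
      proof
        fix x assume "x \<in> \<Theta> -` (\<Xi> ` U)"
        then obtain u where "u \<in> U" "\<Theta> x = \<Xi> u" by auto
        then have "x = (\<Psi> \<circ> \<Xi>) u" using \<Psi>\<Theta>[of x] by simp
        with \<open>u \<in> U\<close> show "x \<in> (\<Psi> \<circ> \<Xi>) ` U" by blast
      qed
    qed
    have op: "open (\<Theta> -` (\<Xi> ` U))"
      using hol_on_continuous[OF hol\<Theta>] holi by (auto simp: hol_on_def intro: open_vimage)
    have "hol_on (\<Theta> -` (\<Xi> ` U)) \<Theta>" using hol\<Theta> op by (auto simp: hol_on_def)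
    from hol_on_compose[OF holi this]
    have "hol_on (\<Theta> -` (\<Xi> ` U)) (\<lambda>x. inv_into U \<Xi> (\<Theta> x))" by auto
    then show "hol_on ((\<Psi> \<circ> \<Xi>) ` U) (inv_into U (\<Psi> \<circ> \<Xi>))"
      unfolding im
    proof (rule hol_on_cong)
      fix x assume "x \<in> \<Theta> -` (\<Xi> ` U)"
      then obtain u where u: "u \<in> U" "\<Theta> x = \<Xi> u" by auto
      then have "x = (\<Psi> \<circ> \<Xi>) u" using \<Psi>\<Theta>[of x] by simp
      then have "inv_into U (\<Psi> \<circ> \<Xi>) x = u" using inv_into_f_f[OF inj' u(1)] by simp
      then show "inv_into U \<Xi> (\<Theta> x) = inv_into U (\<Psi> \<circ> \<Xi>) x" using u inj by simp
    qed
  qed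
  from dist obtain U V R where UVR: "local_coords U x0 \<Phi>" "smooth_on V R" "weighted_little_o \<mu> R"
    "\<And>x. x \<in> U \<Longrightarrow> (fst (\<Phi> x), Re (snd (\<Phi> x))) \<in> V"
    "\<And>x. x \<in> U \<Longrightarrow> x \<in> M \<longleftrightarrow> Im (snd (\<Phi> x)) = P (fst (\<Phi> x)) + R (fst (\<Phi> x), Re (snd (\<Phi> x)))"
    unfolding distinguished_form_def by blast
  have "0 \<in> V" using UVR(4)[of x0] UVR(1) by (simp add: local_coords_def zero_prod_def)
  note R' = weighted_little_o_compose[OF UVR(2,3) this]
  have G\<Psi>: "G (fst (\<Psi> x), r) = (fst x, r)" "(\<chi> i. g i (fst (\<Psi> x))) = fst x" for x r
    by (simp_all add: G_def \<Psi>_def gh vec_eq_iff)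
  show "distinguished_form \<mu> M x0 (\<Psi> \<circ> \<Phi>) (\<lambda>y. P (\<chi> i. g i y))"
    unfolding distinguished_form_def
  proof (intro conjI exI)
    show "model_polynomial \<mu> (\<lambda>y. P (\<chi> i. g i y))" by fact
    show "local_coords U x0 (\<Psi> \<circ> \<Phi>)" by (rule change[OF UVR(1)])
    show "smooth_on (G -` V) (\<lambda>x. R (G x))" "weighted_little_o \<mu> (\<lambda>x. R (G x))" by (rule R')+
    show "\<forall>x\<in>U. (fst ((\<Psi> \<circ> \<Phi>) x), Re (snd ((\<Psi> \<circ> \<Phi>) x))) \<in> G -` V"
      using UVR(4) by (auto simp: G\<Psi>) (simp add: \<Psi>_def)
    show "\<forall>x\<in>U. (x \<in> M) = (Im (snd ((\<Psi> \<circ> \<Phi>) x)) = P (\<chi> i. g i (fst ((\<Psi> \<circ> \<Phi>) x))) +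
        R (G (fst ((\<Psi> \<circ> \<Phi>) x), Re (snd ((\<Psi> \<circ> \<Phi>) x)))))"
      using UVR(5) by (auto simp: G\<Psi>) (simp_all add: \<Psi>_def)
  qed
  have "local_coords UNIV 0 (\<lambda>x::'n csp. x)"
    by (auto simp: local_coords_def hol_on_def inj_on_def intro!: exI[of _ "\<lambda>x. x"])
  from change[OF this] have "local_coords UNIV 0 \<Psi>" by (simp add: comp_def)
  then show "model_in_coords P \<Psi> (\<lambda>y. P (\<chi> i. g i y))"
    unfolding model_in_coords_def
    by (intro exI[of _ UNIV]) (auto simp: model_hypersurface_def G\<Psi>, simp_all add: \<Psi>_def)
qed

lemma poly_modelI:
  assumes "multitype_coords M x0 \<mu> \<Phi> P" "\<forall>j. \<mu> j \<noteq> 0"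
  shows "poly_model \<mu> P"
proof
  fix j
  have w: "is_weight \<mu>" using assms by (simp add: multitype_coords_def)
  then show "\<mu> j \<le> 1/2" by (simp add: is_weight_def)
  show "0 < \<mu> j" using w assms(2) unfolding is_weight_def by (metis order_le_less)
  show "model_polynomial \<mu> P" using assms(1) by (simp add: multitype_coords_def distinguished_form_def)
qed

lemma balanced_coordinates_if_dim_pos:
  assumes mt: "multitype_coords M x0 \<mu> \<Phi> P" and nz: "\<forall>j. \<mu> j \<noteq> 0" and nd: "hol_nondegenerate P"
    and dim: "vf.dim (g1 \<mu> P) > 0"
  shows "\<exists>\<Psi> P'. multitype_coords M x0 \<mu> (\<Psi> \<circ> \<Phi>) P' \<and> model_in_coords P \<Psi> P' \<and> balanced P'"
proof -
  interpret poly_model \<mu> P by (rule poly_modelI[OF mt nz])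
  interpret nondeg_model \<mu> P by unfold_locales (rule nd)
  obtain X where "X \<in> g1 \<mu> P" "X \<noteq> (\<lambda>x. 0)" using g1_nonzero_if_dim_pos[OF dim] .
  then obtain h g where hg: "\<And>j. hpoly (\<lambda>\<alpha>. wlen \<mu> \<alpha> = \<mu> j) (h j)" "\<And>j. hpoly (\<lambda>\<alpha>. wlen \<mu> \<alpha> = \<mu> j) (g j)"
    "\<And>i z. g i (\<chi> j. h j z) = z $ i" "\<And>j y. h j (\<chi> i. g i y) = y $ j"
    "model_polynomial \<mu> (\<lambda>y. P (\<chi> i. g i y))" "balanced (\<lambda>y. P (\<chi> i. g i y))"
    using balanced_coordinates by blast
  have dist: "distinguished_form \<mu> M x0 \<Phi> P" using mt by (simp add: multitype_coords_def)
  note change = distinguished_form_change[OF dist \<mu>_pos \<mu>_half hg(1-5)]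
  show ?thesis
    using change hg(6) mt unfolding multitype_coords_def by blast
qed

subsection \<open>Separately holomorphic functions on polydiscs\<close>

definition polydisc :: "real \<Rightarrow> (complex^'m::finite) set" where
  "polydisc r = {x. \<forall>i. norm (x $ i) < r}"

definition upd :: "complex^'m::finite \<Rightarrow> 'm \<Rightarrow> complex \<Rightarrow> complex^'m" where
  "upd x i \<zeta> = (\<chi> k. if k = i then \<zeta> else x $ k)"

text \<open>Holomorphy in several variables, phrased through slices so that the Cauchy formula in
  one variable applies. Joint continuity is included because contour integrals over one variable
  then depend continuously on the others.\<close>

definition sephol :: "real \<Rightarrow> (complex^'m::finite \<Rightarrow> complex) \<Rightarrow> bool" where
  "sephol r f \<longleftrightarrow> continuous_on (polydisc r) f \<and>
     (\<forall>i. \<forall>x\<in>polydisc r. (\<lambda>\<zeta>. f (upd x i \<zeta>)) holomorphic_on ball 0 r)"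

lemma upd_nth: "upd x i \<zeta> $ k = (if k = i then \<zeta> else x $ k)"
  by (simp add: upd_def)

lemma upd_same [simp]: "upd x i (x $ i) = x"
  by (simp add: vec_eq_iff upd_nth)

lemma upd_upd_same [simp]: "upd (upd x i a) i b = upd x i b"
  by (simp add: vec_eq_iff upd_nth)

lemma upd_commute: "i \<noteq> k \<Longrightarrow> upd (upd x i a) k b = upd (upd x k b) i a"
  by (simp add: vec_eq_iff upd_nth)

lemma upd_in_polydisc: "x \<in> polydisc r \<Longrightarrow> norm \<zeta> < r \<Longrightarrow> upd x i \<zeta> \<in> polydisc r"
  by (simp add: polydisc_def upd_nth)

lemma open_polydisc: "open (polydisc r :: (complex^'m::finite) set)"
proof -
  have "open (\<Inter>i\<in>UNIV. {x::complex^'m. norm (x $ i) < r})"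
    by (intro open_INT ballI open_Collect_less continuous_on_norm linear_continuous_on[OF bounded_linear_vec_nth]
        continuous_on_const finite)
  moreover have "polydisc r = (\<Inter>i\<in>UNIV. {x::complex^'m. norm (x $ i) < r})" by (auto simp: polydisc_def)
  ultimately show ?thesis by simp
qed

lemma polydisc_mono: "r \<le> s \<Longrightarrow> polydisc r \<subseteq> polydisc s"
  unfolding polydisc_def by (auto intro: less_le_trans)

lemma zero_in_polydisc: "r > 0 \<Longrightarrow> 0 \<in> polydisc r"
  by (simp add: polydisc_def)

lemma continuous_on_upd [continuous_intros]:
  "continuous_on S f \<Longrightarrow> continuous_on S g \<Longrightarrow> continuous_on S (\<lambda>x. upd (f x) i (g x))"
  unfolding upd_def
proof (intro continuous_on_vec_lambda)
  fix k assume "continuous_on S f" "continuous_on S g"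
  then show "continuous_on S (\<lambda>x. if k = i then g x else f x $ k)"
    by (cases "k = i") (auto intro: continuous_intros)
qed

lemma sephol_subset: "sephol r f \<Longrightarrow> s \<le> r \<Longrightarrow> sephol s f"
  unfolding sephol_def using polydisc_mono[of s r] subset_ball[of s r 0]
  by (meson continuous_on_subset holomorphic_on_subset subsetD)

lemma sephol_zero:
  fixes f :: "complex^'m::finite \<Rightarrow> complex"
  assumes "sephol r f" "r > 0"
  shows "sephol r (\<lambda>x. f (upd x i 0))"
  unfolding sephol_def
proof (intro conjI allI ballI)
  show "continuous_on (polydisc r) (\<lambda>x. f (upd x i 0))"
    by (rule continuous_on_compose2[of "polydisc r" f])
       (use assms in \<open>auto simp: sephol_def intro!: continuous_intros upd_in_polydisc\<close>)
  fix k and x :: "complex^'m" assume x: "x \<in> polydisc r"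
  show "(\<lambda>\<zeta>. f (upd (upd x k \<zeta>) i 0)) holomorphic_on ball 0 r"
  proof (cases "k = i")
    case False
    then have "(\<lambda>\<zeta>. f (upd (upd x k \<zeta>) i 0)) = (\<lambda>\<zeta>. f (upd (upd x i 0) k \<zeta>))" by (simp add: upd_commute)
    then show ?thesis using assms x upd_in_polydisc[OF x, of 0 i] by (simp add: sephol_def)
  qed simp
qed

text \<open>The difference quotient in the i-th variable is defined by a Cauchy integral, which also
  makes sense on \<open>x $ i = 0\<close> and is continuous in all variables. The radius shrinks
  because the contour has to lie inside the original polydisc.\<close>

lemma hadamard_quotient:
  fixes f :: "complex^'m::finite \<Rightarrow> complex"
  assumes f: "sephol r f" and \<rho>: "0 < \<rho>" "\<rho> < r"
  shows "\<exists>g. sephol \<rho> g \<and> (\<forall>x\<in>polydisc \<rho>. f x = f (upd x i 0) + x $ i * g x)"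
proof -
  let ?c = "circlepath 0 \<rho>"
  \<comment> \<open>Partial fractions of \<open>1 / (u * (u - x $ i))\<close> combine the Cauchy
    formulas at \<open>x $ i\<close> and at 0.\<close>
  define g where "g x = contour_integral ?c (\<lambda>u. f (upd x i u) / (u * (u - x $ i))) / (2 * of_real pi * \<i>)" for x
  have hol: "(\<lambda>\<zeta>. f (upd x k \<zeta>)) holomorphic_on ball 0 r" if "x \<in> polydisc \<rho>" for x k
    using f that polydisc_mono[of \<rho> r] \<rho> by (auto simp: sephol_def)
  have quot: "x $ i * g x = f x - f (upd x i 0)" if x: "x \<in> polydisc \<rho>" for x
  proof (cases "x $ i = 0")
    case True
    then show ?thesis by (metis cancel_comm_monoid_add_class.diff_cancel mult_zero_left upd_same)
  next
    case False
    have "cball 0 \<rho> \<subseteq> ball (0::complex) r" using \<rho> by auto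
    then have h: "continuous_on (cball 0 \<rho>) (\<lambda>u. f (upd x i u))" "(\<lambda>u. f (upd x i u)) holomorphic_on ball 0 \<rho>"
      using hol[OF x] subset_ball[of \<rho> r 0] \<rho>
      by (auto intro: holomorphic_on_imp_continuous_on continuous_on_subset holomorphic_on_subset[of _ "ball 0 r"])
    have xi: "x $ i \<in> ball 0 \<rho>" using x by (simp add: polydisc_def)
    have "((\<lambda>u. f (upd x i u) / (u - x $ i)) has_contour_integral (2 * of_real pi * \<i> * f (upd x i (x $ i)))) ?c"
      "((\<lambda>u. f (upd x i u) / (u - 0)) has_contour_integral (2 * of_real pi * \<i> * f (upd x i 0))) ?c"
      by (rule Cauchy_integral_circlepath[OF h]; use xi \<rho> in simp)+
    from has_contour_integral_div[OF has_contour_integral_diff[OF this], of "x $ i"]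
    have "((\<lambda>u. (f (upd x i u) / (u - x $ i) - f (upd x i u) / u) / x $ i) has_contour_integral
        (2 * of_real pi * \<i> * f x - 2 * of_real pi * \<i> * f (upd x i 0)) / x $ i) ?c" by simp
    then have "((\<lambda>u. f (upd x i u) / (u * (u - x $ i))) has_contour_integral
        (2 * of_real pi * \<i> * f x - 2 * of_real pi * \<i> * f (upd x i 0)) / x $ i) ?c"
    proof (rule has_contour_integral_eq)
      fix u assume "u \<in> path_image ?c"
      then have "norm u = \<rho>" using \<rho> by (simp add: path_image_circlepath sphere_def dist_norm)
      then have "u \<noteq> 0" "u \<noteq> x $ i" using \<rho> xi by auto
      then show "(f (upd x i u) / (u - x $ i) - f (upd x i u) / u) / x $ i = f (upd x i u) / (u * (u - x $ i))"
        using False by (simp add: divide_simps) (simp add: algebra_simps)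
    qed
    from contour_integral_unique[OF this] show ?thesis using False by (simp add: g_def field_simps)
  qed
  have cont: "continuous_on (polydisc \<rho>) g"
  proof -
    let ?F = "\<lambda>x t. f (upd x i (?c t)) / (?c t * (?c t - x $ i)) * (2 * of_real pi * \<i> * of_real \<rho> * exp (2 * of_real pi * \<i> * of_real t))"
    have nc: "norm (?c t) = \<rho>" for t using \<rho> by (simp add: circlepath norm_mult)
    have "g x = integral (cbox 0 1) (?F x) / (2 * of_real pi * \<i>)" for x
      unfolding g_def contour_integral_integral by (simp add: vector_derivative_circlepath cbox_interval)
    moreover have "continuous_on (polydisc \<rho>) (\<lambda>x. integral (cbox 0 1) (?F x))"
    proof (rule integral_continuous_on_param)
      have ct: "continuous_on (polydisc \<rho> \<times> cbox 0 1) (\<lambda>p::(complex^'m) \<times> real. ?c (snd p))"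
        unfolding circlepath by (intro continuous_intros)
      have "continuous_on (polydisc \<rho> \<times> cbox 0 1) (\<lambda>p::(complex^'m) \<times> real. f (upd (fst p) i (?c (snd p))))"
      proof (rule continuous_on_compose2[of "polydisc r" f])
        show "continuous_on (polydisc r) f" using f by (simp add: sephol_def)
        show "continuous_on (polydisc \<rho> \<times> cbox 0 1) (\<lambda>p::(complex^'m) \<times> real. upd (fst p) i (?c (snd p)))"
          by (intro continuous_intros ct)
        show "(\<lambda>p. upd (fst p) i (?c (snd p))) ` (polydisc \<rho> \<times> cbox 0 1) \<subseteq> polydisc r"
          using polydisc_mono[of \<rho> r] \<rho> nc by (auto intro!: upd_in_polydisc)
      qed
      moreover have "?c t * (?c t - x $ i) \<noteq> 0" if "x \<in> polydisc \<rho>" for x t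
        using nc[of t] that \<rho> by (auto simp: polydisc_def)
      ultimately have "continuous_on (polydisc \<rho> \<times> cbox 0 1) (\<lambda>p::(complex^'m) \<times> real. ?F (fst p) (snd p))"
        by (intro continuous_intros ct) auto
      then show "continuous_on (polydisc \<rho> \<times> cbox 0 1) (\<lambda>(x, t). ?F x t)" by (simp add: case_prod_unfold)
    qed
    ultimately show ?thesis by (auto intro: continuous_intros)
  qed
  have slice: "continuous_on (ball 0 \<rho>) (\<lambda>\<zeta>. g (upd x k \<zeta>))" if "x \<in> polydisc \<rho>" for x k
    by (rule continuous_on_compose2[OF cont]) (use that in \<open>auto intro!: continuous_intros upd_in_polydisc\<close>)
  have "(\<lambda>\<zeta>. g (upd x k \<zeta>)) holomorphic_on ball 0 \<rho>" if x: "x \<in> polydisc \<rho>" for k x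
  proof (cases "k = i")
    case True
    \<comment> \<open>In the variable \<open>i\<close> itself the origin is a removable singularity,
      because \<open>g\<close> is continuous.\<close>
    have "(\<lambda>\<zeta>. g (upd x i \<zeta>)) holomorphic_on ball 0 \<rho> - {0}"
    proof (rule holomorphic_transform[of "\<lambda>\<zeta>. (f (upd x i \<zeta>) - f (upd x i 0)) / \<zeta>"])
      show "(\<lambda>\<zeta>. (f (upd x i \<zeta>) - f (upd x i 0)) / \<zeta>) holomorphic_on ball 0 \<rho> - {0}"
        by (intro holomorphic_intros holomorphic_on_subset[OF hol[OF x]]) (use \<rho> in auto)
      show "(f (upd x i \<zeta>) - f (upd x i 0)) / \<zeta> = g (upd x i \<zeta>)" if "\<zeta> \<in> ball 0 \<rho> - {0}" for \<zeta>
        using quot[OF upd_in_polydisc[OF x, of \<zeta> i]] that by (simp add: upd_nth field_simps)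
    qed
    from no_isolated_singularity[OF slice[OF x] this] True show ?thesis by simp
  next
    case False
    have ne: "(\<lambda>\<zeta>. g (upd y k \<zeta>)) holomorphic_on ball 0 \<rho>" if y: "y \<in> polydisc \<rho>" "y $ i \<noteq> 0" for y
    proof (rule holomorphic_transform[of "\<lambda>\<zeta>. (f (upd y k \<zeta>) - f (upd (upd y i 0) k \<zeta>)) / y $ i"])
      show "(\<lambda>\<zeta>. (f (upd y k \<zeta>) - f (upd (upd y i 0) k \<zeta>)) / y $ i) holomorphic_on ball 0 \<rho>"
        by (intro holomorphic_intros holomorphic_on_subset[OF hol] upd_in_polydisc y) (use \<rho> y in auto)
      show "(f (upd y k \<zeta>) - f (upd (upd y i 0) k \<zeta>)) / y $ i = g (upd y k \<zeta>)" if "\<zeta> \<in> ball 0 \<rho>" for \<zeta>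
        using quot[OF upd_in_polydisc[OF y(1), of \<zeta> k]] that False y(2)
        by (simp add: upd_nth upd_commute field_simps)
    qed
    show ?thesis
    proof (cases "x $ i = 0")
      case True
      \<comment> \<open>On \<open>x $ i = 0\<close> no quotient formula is available in the other
        variables; the slice is a locally uniform limit of the slices with
        \<open>x $ i = e n\<close>. The shift by 2 puts already \<open>e 0\<close> strictly inside
        the disc.\<close>
      define e where "e n = complex_of_real (\<rho> / real (n + 2))" for n
      have en: "norm (e n) < \<rho>" "e n \<noteq> 0" for n
      proof -
        have "\<rho> < \<rho> * real (n + 2)" using \<rho> by (simp add: algebra_simps add_pos_nonneg)
        then have "\<rho> / real (n + 2) < \<rho>" by (simp add: divide_less_eq)
        then show "norm (e n) < \<rho>" using \<rho> unfolding e_def norm_of_real by simp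
        show "e n \<noteq> 0" unfolding e_def of_real_eq_0_iff using \<rho> by simp
      qed
      have e0: "e \<longlonglongrightarrow> 0"
      proof -
        have "(\<lambda>n. \<rho> * inverse (real (n + 2))) \<longlonglongrightarrow> \<rho> * 0"
          by (intro tendsto_intros LIMSEQ_ignore_initial_segment[OF lim_inverse_n])
        then have "(\<lambda>n. of_real (\<rho> * inverse (real (n + 2)))) \<longlonglongrightarrow> complex_of_real (\<rho> * 0)" by (rule tendsto_of_real)
        then show ?thesis unfolding e_def by (simp add: divide_inverse)
      qed
      show ?thesis
      proof (rule holomorphic_uniform_sequence[of _ "\<lambda>n \<zeta>. g (upd (upd x i (e n)) k \<zeta>)"])
        show "(\<lambda>\<zeta>. g (upd (upd x i (e n)) k \<zeta>)) holomorphic_on ball 0 \<rho>" for n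
          by (rule ne) (use en in \<open>auto intro!: upd_in_polydisc x simp: upd_nth\<close>)
        fix \<zeta>0 :: complex assume \<zeta>0: "\<zeta>0 \<in> ball 0 \<rho>"
        then obtain d where d: "d > 0" "cball \<zeta>0 d \<subseteq> ball 0 \<rho>" using open_contains_cball[of "ball (0::complex) \<rho>"] by blast
        define h where "h = (\<lambda>p. g (upd (upd x i (fst p)) k (snd p)))"
        have hc: "continuous_on (cball 0 (\<rho>/2) \<times> cball \<zeta>0 d) h"
          unfolding h_def
          by (rule continuous_on_compose2[OF cont])
             (use d \<rho> in \<open>auto intro!: continuous_intros upd_in_polydisc x dest: subsetD\<close>)
        have "uniformly_continuous_on (cball 0 (\<rho>/2) \<times> cball \<zeta>0 d) h"
          by (rule compact_uniformly_continuous[OF hc compact_Times]) auto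
        then have uc: "\<exists>\<delta>>0. \<forall>p\<in>cball 0 (\<rho>/2) \<times> cball \<zeta>0 d. \<forall>q\<in>cball 0 (\<rho>/2) \<times> cball \<zeta>0 d. dist q p < \<delta> \<longrightarrow> dist (h q) (h p) < \<epsilon>"
          if "\<epsilon> > 0" for \<epsilon> using that unfolding uniformly_continuous_on_def by blast
        have "uniform_limit (cball \<zeta>0 d) (\<lambda>n \<zeta>. g (upd (upd x i (e n)) k \<zeta>)) (\<lambda>\<zeta>. g (upd x k \<zeta>)) sequentially"
        proof (rule uniform_limitI)
          fix \<epsilon> :: real assume "\<epsilon> > 0"
          from uc[OF this] obtain \<delta> where \<delta>: "\<delta> > 0" "\<And>p q. p \<in> cball 0 (\<rho>/2) \<times> cball \<zeta>0 d \<Longrightarrow> q \<in> cball 0 (\<rho>/2) \<times> cball \<zeta>0 d \<Longrightarrow>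
             dist q p < \<delta> \<Longrightarrow> dist (h q) (h p) < \<epsilon>" by blast
          have "min \<delta> (\<rho>/2) > 0" using \<delta> \<rho> by simp
          with e0 have "\<forall>\<^sub>F n in sequentially. dist (e n) 0 < min \<delta> (\<rho>/2)" by (rule tendstoD)
          then show "\<forall>\<^sub>F n in sequentially. \<forall>\<zeta>\<in>cball \<zeta>0 d. dist (g (upd (upd x i (e n)) k \<zeta>)) (g (upd x k \<zeta>)) < \<epsilon>"
          proof eventually_elim
            case (elim n)
            show ?case
            proof
              fix \<zeta> assume "\<zeta> \<in> cball \<zeta>0 d"
              then have "dist (h (e n, \<zeta>)) (h (0, \<zeta>)) < \<epsilon>"
                using elim \<rho> by (intro \<delta>(2)) (auto simp: dist_Pair_Pair)
              moreover have "h (0, \<zeta>) = g (upd x k \<zeta>)" using True by (metis fst_conv h_def snd_conv upd_same)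
              ultimately show "dist (g (upd (upd x i (e n)) k \<zeta>)) (g (upd x k \<zeta>)) < \<epsilon>" by (simp add: h_def)
            qed
          qed
        qed
        with d show "\<exists>d>0. cball \<zeta>0 d \<subseteq> ball 0 \<rho> \<and>
          uniform_limit (cball \<zeta>0 d) (\<lambda>n \<zeta>. g (upd (upd x i (e n)) k \<zeta>)) (\<lambda>\<zeta>. g (upd x k \<zeta>)) sequentially" by blast
      qed simp
    qed (rule ne[OF x])
  qed
  with cont have "sephol \<rho> g" by (simp add: sephol_def)
  moreover have "\<forall>x\<in>polydisc \<rho>. f x = f (upd x i 0) + x $ i * g x" using quot by (simp add: algebra_simps)
  ultimately show ?thesis by blast
qed

text \<open>Setting the coordinates to 0 one after another telescopes \<open>f x - f 0\<close>. Each
  step is one Hadamard quotient and halves the radius.\<close>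

lemma hadamard_sum:
  fixes f :: "complex^'m::finite \<Rightarrow> complex"
  assumes f: "sephol r f" "r > 0"
  obtains g s where "s > 0" "\<And>i. sephol s (g i)" "\<And>x. x \<in> polydisc s \<Longrightarrow> f x = f 0 + (\<Sum>i\<in>UNIV. x $ i * g i x)"
proof -
  have "\<exists>g s h. 0 < s \<and> s \<le> r \<and> (\<forall>i\<in>S. sephol s (g i)) \<and> sephol s h \<and> (\<forall>x. h x = f (\<chi> k. if k \<in> S then 0 else x $ k)) \<and>
      (\<forall>x\<in>polydisc s. f x = h x + (\<Sum>i\<in>S. x $ i * g i x))" if "finite S" for S
    using that
  proof induction
    case empty
    then show ?case using f by (intro exI[of _ "\<lambda>_ _. 0"] exI[of _ r] exI[of _ f]) auto
  next
    case (insert i S)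
    then obtain g s h where gh: "0 < s" "s \<le> r" "\<And>i. i \<in> S \<Longrightarrow> sephol s (g i)" "sephol s h"
      "\<And>x. h x = f (\<chi> k. if k \<in> S then 0 else x $ k)" "\<And>x. x \<in> polydisc s \<Longrightarrow> f x = h x + (\<Sum>i\<in>S. x $ i * g i x)" by blast
    obtain q where q: "sephol (s/2) q" "\<And>x. x \<in> polydisc (s/2) \<Longrightarrow> h x = h (upd x i 0) + x $ i * q x"
      using hadamard_quotient[OF gh(4), of "s/2" i] gh(1) by auto
    let ?h = "\<lambda>x. h (upd x i 0)" and ?g = "g(i := q)"
    have "?h x = f (\<chi> k. if k \<in> insert i S then 0 else x $ k)" for x
      unfolding gh(5) by (rule arg_cong[of _ _ f]) (simp add: vec_eq_iff upd_nth)
    moreover have "\<forall>j\<in>insert i S. sephol (s/2) (?g j)"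
      using gh(1) q(1) insert.hyps(2) sephol_subset[OF gh(3), of _ "s/2"] by auto
    moreover have "sephol (s/2) ?h" using sephol_subset[OF gh(4), of "s/2"] gh(1) by (intro sephol_zero) auto
    moreover have "f x = ?h x + (\<Sum>j\<in>insert i S. x $ j * ?g j x)" if x: "x \<in> polydisc (s/2)" for x
    proof -
      have "x \<in> polydisc s" using x polydisc_mono[of "s/2" s] gh(1) by auto
      from gh(6)[OF this] q(2)[OF x] have "f x = ?h x + (x $ i * q x + (\<Sum>j\<in>S. x $ j * g j x))" by simp
      also have "(\<Sum>j\<in>S. x $ j * g j x) = (\<Sum>j\<in>S. x $ j * ?g j x)"
        using insert.hyps(2) by (intro sum.cong) auto
      finally show ?thesis using insert.hyps by simp
    qed
    ultimately show ?case using gh(1,2) by (intro exI[of _ ?g] exI[of _ "s/2"] exI[of _ ?h]) auto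
  qed
  from this[of UNIV] obtain g s h where gh: "0 < s" "\<forall>i\<in>UNIV. sephol s (g i)"
     "\<And>x. h x = f (\<chi> k. if k \<in> UNIV then 0 else x $ k)" "\<And>x. x \<in> polydisc s \<Longrightarrow> f x = h x + (\<Sum>i\<in>UNIV. x $ i * g i x)"
    by (auto simp del: UNIV_I)
  have "(\<chi> k. if k \<in> UNIV then 0 else x $ k) = 0" for x :: "complex^'m" by (simp add: vec_eq_iff)
  with gh(3) have "h x = f 0" for x by simp
  with gh(4) have "f x = f 0 + (\<Sum>i\<in>UNIV. x $ i * g i x)" if "x \<in> polydisc s" for x using that by simp
  with gh(1,2) show ?thesis by (intro that[of s g]) auto
qed

text \<open>Expand every Hadamard quotient to order \<open>K\<close>; the factor
  \<open>x $ i\<close> in front of it adds one order.\<close>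

lemma sephol_taylor:
  fixes f :: "complex^'m::finite \<Rightarrow> complex"
  assumes "sephol r f" "r > 0"
  shows "\<exists>q C. hpoly (\<lambda>_. True) q \<and> (\<forall>\<^sub>F x in nhds 0. norm (f x - q x) \<le> C * norm x ^ K)"
  using assms
proof (induction K arbitrary: f r)
  case 0
  have "isCont f 0"
    using 0(1) zero_in_polydisc[OF 0(2)] continuous_on_eq_continuous_at[OF open_polydisc]
    by (auto simp: sephol_def)
  then have "(f \<longlongrightarrow> f 0) (nhds 0)" by (simp add: continuous_at tendsto_at_iff_tendsto_nhds)
  from tendstoD[OF this zero_less_one] have "\<forall>\<^sub>F x in nhds 0. norm (f x - 0) \<le> (norm (f 0) + 1) * norm x ^ 0"
  proof eventually_elim
    case (elim x)
    then show ?case using norm_triangle_ineq2[of "f x" "f 0"] by (simp add: dist_norm)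
  qed
  then show ?case by (intro exI[of _ "\<lambda>_. 0"] exI[of _ "norm (f 0) + 1"]) (simp add: bipoly.zero)
next
  case (Suc K)
  obtain g s where g: "s > 0" "\<And>i. sephol s (g i)" "\<And>x. x \<in> polydisc s \<Longrightarrow> f x = f 0 + (\<Sum>i\<in>UNIV. x $ i * g i x)"
    by (rule hadamard_sum[OF Suc.prems]) (rule that; assumption)
  have "\<exists>qC. hpoly (\<lambda>_. True) (fst qC) \<and> (\<forall>\<^sub>F x in nhds 0. norm (g i x - fst qC x) \<le> snd qC * norm x ^ K)" for i
  proof -
    obtain q C where "hpoly (\<lambda>_. True) q" "\<forall>\<^sub>F x in nhds 0. norm (g i x - q x) \<le> C * norm x ^ K"
      using Suc.IH[OF g(2)[of i] g(1)] by blast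
    then show ?thesis by (intro exI[of _ "(q, C)"]) simp
  qed
  then have "\<forall>i. \<exists>qC. hpoly (\<lambda>_. True) (fst qC) \<and> (\<forall>\<^sub>F x in nhds 0. norm (g i x - fst qC x) \<le> snd qC * norm x ^ K)" ..
  from choice[OF this] obtain qC where qC: "\<And>i. hpoly (\<lambda>_. True) (fst (qC i))"
    "\<And>i. \<forall>\<^sub>F x in nhds 0. norm (g i x - fst (qC i) x) \<le> snd (qC i) * norm x ^ K" by blast
  define q where "q x = f 0 + (\<Sum>i\<in>UNIV. x $ i * fst (qC i) x)" for x
  define C where "C = (\<Sum>i\<in>UNIV. snd (qC i))"
  have "hpoly (\<lambda>_. True) q" unfolding q_def[abs_def]
  proof (intro bipoly_add bipoly_sum)
    show "hpoly (\<lambda>_. True) (\<lambda>x. f 0)" by (rule bipoly_const) simp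
    show "hpoly (\<lambda>_. True) (\<lambda>x. x $ i * fst (qC i) x)" for i
      by (rule bipoly_mult[OF bipoly_coord[where Q="\<lambda>\<alpha> \<beta>. \<beta> = (\<lambda>_. 0) \<and> True"] qC(1)]) auto
  qed
  moreover have "\<forall>\<^sub>F x in nhds 0. x \<in> polydisc s"
    using open_polydisc zero_in_polydisc[OF g(1)] by (rule eventually_nhds_in_open)
  then have "\<forall>\<^sub>F x in nhds 0. x \<in> polydisc s \<and> (\<forall>i. norm (g i x - fst (qC i) x) \<le> snd (qC i) * norm x ^ K)"
    using qC(2) by (intro eventually_conj eventually_all_finite) auto
  then have "\<forall>\<^sub>F x in nhds 0. norm (f x - q x) \<le> C * norm x ^ Suc K"
  proof eventually_elim
    case (elim x)
    have "f x - q x = (\<Sum>i\<in>UNIV. x $ i * (g i x - fst (qC i) x))"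
      using elim g(3) by (simp add: q_def algebra_simps sum_subtractf)
    also have "norm \<dots> \<le> (\<Sum>i\<in>UNIV. norm x * (snd (qC i) * norm x ^ K))"
      using elim by (intro sum_norm_le) (auto simp: norm_mult intro!: mult_mono Finite_Cartesian_Product.norm_nth_le)
    also have "\<dots> = C * norm x ^ Suc K" by (simp add: C_def sum_distrib_left sum_distrib_right mult_ac)
    finally show ?case .
  qed
  ultimately show ?case by blast
qed

subsection \<open>Invariance of the Segre variety of the origin\<close>

text \<open>The case \<open>\<tau> = cnj\<close> covers antiholomorphic curves, which parametrize
  the conjugate variables of a polarized equation. Conjugating the composition makes it holomorphic
  again.\<close>

lemma holomorphic_curve_compose:
  fixes \<Psi> :: "'n csp \<Rightarrow> 'n::finite csp" and X :: "complex \<Rightarrow> 'n csp"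
  assumes \<tau>: "\<tau> = (\<lambda>x. x) \<or> \<tau> = cnj" and \<Psi>: "hol_on V \<Psi>" and S: "open S" and XV: "\<And>\<zeta>. \<zeta> \<in> S \<Longrightarrow> X \<zeta> \<in> V"
    and X: "\<And>j. (\<lambda>\<zeta>. \<tau> (fst (X \<zeta>) $ j)) holomorphic_on S" "(\<lambda>\<zeta>. \<tau> (snd (X \<zeta>))) holomorphic_on S"
  shows "(\<lambda>\<zeta>. \<tau> (fst (\<Psi> (X \<zeta>)) $ j)) holomorphic_on S" "(\<lambda>\<zeta>. \<tau> (snd (\<Psi> (X \<zeta>)))) holomorphic_on S"
proof -
  have \<tau>\<tau>: "\<tau> (\<tau> x) = x" and \<tau>m: "\<tau> (x * y) = \<tau> x * \<tau> y" and lin: "bounded_linear \<tau>" for x y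
    using \<tau> bounded_linear_cnj bounded_linear_ident by auto
  have main: "((\<lambda>\<zeta>. \<tau> (fst (\<Psi> (X \<zeta>)) $ j)) has_field_derivative d1 \<zeta> j) (at \<zeta>) \<and>
        ((\<lambda>\<zeta>. \<tau> (snd (\<Psi> (X \<zeta>)))) has_field_derivative d2 \<zeta>) (at \<zeta>)"
    if \<zeta>: "\<zeta> \<in> S" and d: "d1 = (\<lambda>\<zeta> j. \<tau> (fst (frechet_derivative \<Psi> (at (X \<zeta>)) (\<chi> j. \<tau> (deriv (\<lambda>\<zeta>. \<tau> (fst (X \<zeta>) $ j)) \<zeta>), \<tau> (deriv (\<lambda>\<zeta>. \<tau> (snd (X \<zeta>))) \<zeta>))) $ j))"
      "d2 = (\<lambda>\<zeta>. \<tau> (snd (frechet_derivative \<Psi> (at (X \<zeta>)) (\<chi> j. \<tau> (deriv (\<lambda>\<zeta>. \<tau> (fst (X \<zeta>) $ j)) \<zeta>), \<tau> (deriv (\<lambda>\<zeta>. \<tau> (snd (X \<zeta>))) \<zeta>)))))"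
    for \<zeta> j d1 d2
  proof -
    define u :: "'n csp" where "u = (\<chi> j. \<tau> (deriv (\<lambda>\<zeta>. \<tau> (fst (X \<zeta>) $ j)) \<zeta>), \<tau> (deriv (\<lambda>\<zeta>. \<tau> (snd (X \<zeta>))) \<zeta>))"
    have "((\<lambda>\<zeta>. \<tau> (fst (X \<zeta>) $ j)) has_derivative (\<lambda>h. deriv (\<lambda>\<zeta>. \<tau> (fst (X \<zeta>) $ j)) \<zeta> * h)) (at \<zeta>)" for j
      using holomorphic_derivI[OF X(1) S \<zeta>] by (simp add: has_field_derivative_def)
    from bounded_linear.has_derivative[OF lin this]
    have 1: "((\<lambda>\<zeta>. fst (X \<zeta>) $ j) has_derivative (\<lambda>h. \<tau> h * fst u $ j)) (at \<zeta>)" for j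
      by (simp add: \<tau>\<tau> \<tau>m u_def mult.commute)
    have "((\<lambda>\<zeta>. \<tau> (snd (X \<zeta>))) has_derivative (\<lambda>h. deriv (\<lambda>\<zeta>. \<tau> (snd (X \<zeta>))) \<zeta> * h)) (at \<zeta>)"
      using holomorphic_derivI[OF X(2) S \<zeta>] by (simp add: has_field_derivative_def)
    from bounded_linear.has_derivative[OF lin this]
    have 2: "((\<lambda>\<zeta>. snd (X \<zeta>)) has_derivative (\<lambda>h. \<tau> h * snd u)) (at \<zeta>)"
      by (simp add: \<tau>\<tau> \<tau>m u_def mult.commute)
    have "((\<lambda>\<zeta>. (fst (X \<zeta>), snd (X \<zeta>))) has_derivative (\<lambda>h. (\<tau> h *s fst u, \<tau> h * snd u))) (at \<zeta>)"
      by (intro has_derivative_Pair 2 has_derivative_cvec) (simp add: 1)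
    then have X': "(X has_derivative (\<lambda>h. cscale (\<tau> h) u)) (at \<zeta>)" by (simp add: cscale_def)
    obtain D where D: "(\<Psi> has_derivative D) (at (X \<zeta>))" "\<And>c v. D (cscale c v) = cscale c (D v)"
      using \<Psi> XV[OF \<zeta>] by (auto simp: hol_on_def)
    have Du: "D = frechet_derivative \<Psi> (at (X \<zeta>))" by (rule frechet_derivative_at[OF D(1)])
    have C: "((\<lambda>\<zeta>. \<Psi> (X \<zeta>)) has_derivative (\<lambda>h. cscale (\<tau> h) (D u))) (at \<zeta>)"
      using has_derivative_compose[OF X' D(1)] by (simp add: D(2))
    have "((\<lambda>\<zeta>. \<tau> (fst (\<Psi> (X \<zeta>)) $ j)) has_derivative (\<lambda>h. \<tau> (fst (cscale (\<tau> h) (D u)) $ j))) (at \<zeta>)"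
      "((\<lambda>\<zeta>. \<tau> (snd (\<Psi> (X \<zeta>)))) has_derivative (\<lambda>h. \<tau> (snd (cscale (\<tau> h) (D u))))) (at \<zeta>)"
      by (intro bounded_linear.has_derivative[OF lin] bounded_linear.has_derivative[OF bounded_linear_vec_nth]
          has_derivative_fst has_derivative_snd C)+
    then show ?thesis
      unfolding d u_def[symmetric] Du[symmetric] has_field_derivative_def
      by (simp add: cscale_def \<tau>\<tau> \<tau>m mult_commute_abs)
  qed
  show "(\<lambda>\<zeta>. \<tau> (fst (\<Psi> (X \<zeta>)) $ j)) holomorphic_on S" "(\<lambda>\<zeta>. \<tau> (snd (\<Psi> (X \<zeta>)))) holomorphic_on S"
    unfolding holomorphic_on_open[OF S] using main[OF _ refl refl] by blast+
qed

lemma zmonom_holomorphic: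
  "(\<And>j. (\<lambda>\<zeta>. X \<zeta> $ j) holomorphic_on S) \<Longrightarrow> (\<lambda>\<zeta>. zmonom \<alpha> (X \<zeta>)) holomorphic_on S"
  unfolding zmonom_def by (intro holomorphic_on_prod holomorphic_on_power)

lemma cnj_zmonom: "cnj (zmonom \<alpha> z) = zmonom \<alpha> (\<chi> j. cnj (z $ j))"
  by (simp add: zmonom_def)

lemma zmonom_0: "\<alpha> \<noteq> (\<lambda>_. 0) \<Longrightarrow> zmonom \<alpha> 0 = 0"
  by (auto simp: zmonom_def fun_eq_iff prod_zero_iff)

text \<open>Polarization: the conjugate variable becomes an independent one, with
  \<open>F x y\<close> holomorphic in \<open>x\<close> and antiholomorphic in \<open>y\<close>.
  Excluding the exponent \<open>\<beta> = 0\<close> gives \<open>F x 0 = 0\<close>.\<close>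

lemma bipoly_polarize:
  assumes "bipoly Q f" "\<forall>\<alpha> \<beta>. Q \<alpha> \<beta> \<longrightarrow> \<beta> \<noteq> (\<lambda>_. 0)"
  shows "\<exists>F. (\<forall>z. F z z = f z) \<and> (\<forall>x. F x 0 = 0) \<and> continuous_on UNIV (\<lambda>p. F (fst p) (snd p)) \<and>
     (\<forall>S X Y. (\<forall>j. (\<lambda>\<zeta>. X \<zeta> $ j) holomorphic_on S) \<longrightarrow> (\<forall>j. (\<lambda>\<zeta>. cnj (Y \<zeta> $ j)) holomorphic_on S) \<longrightarrow>
       (\<lambda>\<zeta>. F (X \<zeta>) (Y \<zeta>)) holomorphic_on S)"
  using assms(1)
proof induction
  case zero
  show ?case by (rule exI[of _ "\<lambda>_ _. 0"]) auto
next
  case (step f \<alpha> \<beta> c)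
  then obtain F where F: "\<And>z. F z z = f z" "\<And>x. F x 0 = 0" "continuous_on UNIV (\<lambda>p. F (fst p) (snd p))"
    "\<And>S X Y. (\<And>j. (\<lambda>\<zeta>. X \<zeta> $ j) holomorphic_on S) \<Longrightarrow> (\<And>j. (\<lambda>\<zeta>. cnj (Y \<zeta> $ j)) holomorphic_on S) \<Longrightarrow>
       (\<lambda>\<zeta>. F (X \<zeta>) (Y \<zeta>)) holomorphic_on S" by blast
  define H where "H x y = c * (zmonom \<alpha> x * cnj (zmonom \<beta> y)) + F x y" for x y
  have "H z z = c * bimonom \<alpha> \<beta> z + f z" for z by (simp add: H_def F bimonom_def)
  moreover have "H x 0 = 0" for x using zmonom_0[of \<beta>] assms(2) step.hyps(2) by (simp add: H_def F)
  moreover have "continuous_on UNIV (\<lambda>p. H (fst p) (snd p))"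
    unfolding H_def zmonom_def by (intro continuous_intros F continuous_on_prod)
  moreover have "(\<lambda>\<zeta>. H (X \<zeta>) (Y \<zeta>)) holomorphic_on S"
    if "\<And>j. (\<lambda>\<zeta>. X \<zeta> $ j) holomorphic_on S" "\<And>j. (\<lambda>\<zeta>. cnj (Y \<zeta> $ j)) holomorphic_on S" for S X Y
    unfolding H_def cnj_zmonom
    by (intro holomorphic_intros zmonom_holomorphic F) (simp_all add: that)
  ultimately show ?case by (intro exI[of _ H]) blast
qed

lemma zero_if_zero_on_reals:
  fixes k :: "complex \<Rightarrow> complex"
  assumes "k holomorphic_on ball 0 r" "r > 0" "\<And>t::real. \<bar>t\<bar> < r \<Longrightarrow> k (of_real t) = 0" "norm z < r"
  shows "k z = 0"
proof (rule analytic_continuation[of k "ball 0 r" "complex_of_real ` {-r<..<r}" 0])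
  show "complex_of_real ` {-r<..<r} \<subseteq> ball 0 r" by (auto simp: norm_of_real abs_less_iff)
  show "0 islimpt complex_of_real ` {- r<..<r}"
  proof (rule islimptI)
    fix T :: "complex set" assume "0 \<in> T" "open T"
    then obtain e where e: "e > 0" "ball 0 e \<subseteq> T" by (meson openE)
    define t where "t = min e r / 2"
    have "t > 0" "t < e" "t < r" using e(1) assms(2) by (auto simp: t_def min_def field_simps)
    then have "complex_of_real t \<in> complex_of_real ` {-r<..<r}" "complex_of_real t \<in> T" "complex_of_real t \<noteq> 0"
      using e(2) by (auto intro!: subsetD[OF e(2)])
    then show "\<exists>y\<in>complex_of_real ` {- r<..<r}. y \<in> T \<and> y \<noteq> 0" by blast
  qed
  show "k z = 0" if "z \<in> complex_of_real ` {- r<..<r}" for z using that assms(3) by (auto simp: abs_less_iff)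
qed (use assms in auto)

lemma eventually_nhds_pair0:
  fixes V :: "('a::real_normed_vector \<times> 'b::real_normed_vector) set"
  assumes "open V" "(0, 0) \<in> V"
  obtains r where "r > 0" "\<And>x. norm x < r \<Longrightarrow> (x, 0) \<in> V"
proof -
  obtain e where e: "e > 0" "ball (0, 0) e \<subseteq> V" using assms by (meson openE)
  have "(x, 0) \<in> V" if "norm x < e" for x
    by (rule subsetD[OF e(2)]) (use that in \<open>simp add: dist_Pair_Pair\<close>)
  with e(1) that show ?thesis by blast
qed

text \<open>Complexifying \<open>Im w' = P'(z')\<close> on the hypersurface and freezing the conjugate variable at 0 shows that
  \<open>w = 0\<close>, the Segre variety of the origin, is mapped to \<open>w' = 0\<close>.\<close>

lemma segre_invariance:
  fixes P P' :: "complex^'n::finite \<Rightarrow> real"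
  assumes P: "bipoly Q (\<lambda>z. complex_of_real (P z))" "\<forall>\<alpha> \<beta>. Q \<alpha> \<beta> \<longrightarrow> \<beta> \<noteq> (\<lambda>_. 0)"
    and P': "bipoly Q' (\<lambda>z. complex_of_real (P' z))" "\<forall>\<alpha> \<beta>. Q' \<alpha> \<beta> \<longrightarrow> \<beta> \<noteq> (\<lambda>_. 0)"
    and \<Psi>: "hol_on V \<Psi>" "0 \<in> V" "\<Psi> 0 = 0"
    and map: "\<And>x. x \<in> V \<Longrightarrow> x \<in> model_hypersurface P \<Longrightarrow> \<Psi> x \<in> model_hypersurface P'"
  shows "\<exists>\<rho>>0. \<forall>z. norm z < \<rho> \<longrightarrow> (z, 0) \<in> V \<and> snd (\<Psi> (z, 0)) = 0"
proof -
  have V: "open V" using \<Psi>(1) by (simp add: hol_on_def)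
  obtain F where F: "\<And>z. F z z = of_real (P z)" "\<And>x. F x 0 = 0" "continuous_on UNIV (\<lambda>p. F (fst p) (snd p))"
    "\<And>S X Y. (\<And>j. (\<lambda>\<zeta>. X \<zeta> $ j) holomorphic_on S) \<Longrightarrow> (\<And>j. (\<lambda>\<zeta>. cnj (Y \<zeta> $ j)) holomorphic_on S) \<Longrightarrow>
       (\<lambda>\<zeta>. F (X \<zeta>) (Y \<zeta>)) holomorphic_on S"
    using bipoly_polarize[OF P] by blast
  obtain F' where F': "\<And>z. F' z z = of_real (P' z)" "\<And>x. F' x 0 = 0" "continuous_on UNIV (\<lambda>p. F' (fst p) (snd p))"
    "\<And>S X Y. (\<And>j. (\<lambda>\<zeta>. X \<zeta> $ j) holomorphic_on S) \<Longrightarrow> (\<And>j. (\<lambda>\<zeta>. cnj (Y \<zeta> $ j)) holomorphic_on S) \<Longrightarrow>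
       (\<lambda>\<zeta>. F' (X \<zeta>) (Y \<zeta>)) holomorphic_on S"
    using bipoly_polarize[OF P'] by blast
  have local: "\<exists>r>0. \<forall>s. norm s < r \<longrightarrow> (s *s v, 0) \<in> V \<and> snd (\<Psi> (s *s v, 0)) = 0" for v :: "complex^'n"
  proof -
    \<comment> \<open>For real \<open>a\<close> and \<open>b\<close> both arguments of
      \<open>F\<close> equal \<open>(a + \<i> b) v\<close>. With complex \<open>a\<close> and
      \<open>b\<close> the numbers \<open>a + \<i> b\<close> and \<open>a - \<i> b\<close> become
      independent.\<close>
    define W where "W a b = F ((a + \<i> * b) *s v) (cnj (a - \<i> * b) *s v)" for a b
    \<comment> \<open>At real parameters \<open>X\<close> and \<open>Y\<close> are the same point of
      the hypersurface; in general \<open>X\<close> is holomorphic and \<open>Y\<close>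
      antiholomorphic in the parameters.\<close>
    define X where "X a b = ((a + \<i> * b) *s v, \<i> * W a b)" for a b
    define Y where "Y a b = (cnj (a - \<i> * b) *s v, cnj (- \<i> * W a b))" for a b
    have smult_cont: "continuous_on UNIV (\<lambda>p. g p *s v)" if "continuous_on UNIV g" for g :: "complex \<times> complex \<Rightarrow> complex"
      unfolding vector_scalar_mult_def by (intro continuous_intros continuous_on_vec_lambda that)
    have Wc: "continuous_on UNIV (\<lambda>p. W (fst p) (snd p))"
    proof -
      have "continuous_on UNIV (\<lambda>p::complex \<times> complex. ((fst p + \<i> * snd p) *s v, cnj (fst p - \<i> * snd p) *s v))"
        by (intro continuous_on_Pair smult_cont continuous_intros)
      from continuous_on_compose2[OF F(3) this] show ?thesis by (simp add: W_def)
    qed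
    have "open ((\<lambda>p. X (fst p) (snd p)) -` V \<inter> (\<lambda>p. Y (fst p) (snd p)) -` V)"
      unfolding X_def Y_def
      by (intro open_Int open_vimage V continuous_on_Pair smult_cont continuous_intros Wc)
    moreover have W0: "W 0 0 = 0" by (simp add: W_def F(2))
    then have "(0, 0) \<in> (\<lambda>p. X (fst p) (snd p)) -` V \<inter> (\<lambda>p. Y (fst p) (snd p)) -` V"
      using \<Psi>(2) by (simp add: X_def Y_def zero_prod_def)
    ultimately obtain e where e: "e > 0" "ball (0, 0) e \<subseteq> (\<lambda>p. X (fst p) (snd p)) -` V \<inter> (\<lambda>p. Y (fst p) (snd p)) -` V"
      by (meson openE)
    define r where "r = e / 2"
    have r: "r > 0" using e by (simp add: r_def)
    have XY: "X a b \<in> V" "Y a b \<in> V" if "norm a < r" "norm b < r" for a b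
    proof -
      have "norm (a, b) \<le> norm a + norm b" by (rule norm_Pair_le)
      then have "(a, b) \<in> ball (0, 0) e" using that by (simp add: r_def dist_norm norm_Pair)
      from subsetD[OF e(2) this] show "X a b \<in> V" "Y a b \<in> V" by auto
    qed
    \<comment> \<open>The equation \<open>2 \<i> Im w' = 2 \<i> P'(z')\<close> at the image of
      \<open>X\<close>, with the image of \<open>Y\<close> in the conjugated places.\<close>
    define k where "k a b = snd (\<Psi> (X a b)) - cnj (snd (\<Psi> (Y a b))) - 2 * \<i> * F' (fst (\<Psi> (X a b))) (fst (\<Psi> (Y a b)))" for a b
    have hol: "(\<lambda>\<zeta>. k (p \<zeta>) (q \<zeta>)) holomorphic_on ball 0 r"
      if "p holomorphic_on ball 0 r" "q holomorphic_on ball 0 r" "\<And>\<zeta>. \<zeta> \<in> ball 0 r \<Longrightarrow> norm (p \<zeta>) < r \<and> norm (q \<zeta>) < r" for p q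
    proof -
      have W: "(\<lambda>\<zeta>. W (p \<zeta>) (q \<zeta>)) holomorphic_on ball 0 r"
        unfolding W_def by (rule F(4)) (simp_all, (intro holomorphic_intros that)+)
      note hX = holomorphic_curve_compose[of "\<lambda>x. x" V \<Psi> "ball 0 r" "\<lambda>\<zeta>. X (p \<zeta>) (q \<zeta>)", OF disjI1[OF refl] \<Psi>(1) open_ball]
      note hY = holomorphic_curve_compose[of cnj V \<Psi> "ball 0 r" "\<lambda>\<zeta>. Y (p \<zeta>) (q \<zeta>)", OF disjI2[OF refl] \<Psi>(1) open_ball]
      have pq: "(\<lambda>\<zeta>. (p \<zeta> + \<i> * q \<zeta>) * c) holomorphic_on ball 0 r" "(\<lambda>\<zeta>. (p \<zeta> - \<i> * q \<zeta>) * c) holomorphic_on ball 0 r" for c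
        by (intro holomorphic_intros that)+
      have X1: "(\<lambda>\<zeta>. fst (\<Psi> (X (p \<zeta>) (q \<zeta>))) $ j) holomorphic_on ball 0 r" "(\<lambda>\<zeta>. snd (\<Psi> (X (p \<zeta>) (q \<zeta>)))) holomorphic_on ball 0 r" for j
      proof -
        have 1: "\<And>\<zeta>. \<zeta> \<in> ball 0 r \<Longrightarrow> X (p \<zeta>) (q \<zeta>) \<in> V" using XY that(3) by blast
        have 2: "\<And>j. (\<lambda>\<zeta>. fst (X (p \<zeta>) (q \<zeta>)) $ j) holomorphic_on ball 0 r" by (simp only: X_def fst_conv vector_smult_component pq)
        have 3: "(\<lambda>\<zeta>. snd (X (p \<zeta>) (q \<zeta>))) holomorphic_on ball 0 r" unfolding X_def snd_conv by (intro holomorphic_intros W)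
        show "(\<lambda>\<zeta>. fst (\<Psi> (X (p \<zeta>) (q \<zeta>))) $ j) holomorphic_on ball 0 r" "(\<lambda>\<zeta>. snd (\<Psi> (X (p \<zeta>) (q \<zeta>)))) holomorphic_on ball 0 r"
          using hX[OF 1 2 3] by auto
      qed
      have Y1: "(\<lambda>\<zeta>. cnj (fst (\<Psi> (Y (p \<zeta>) (q \<zeta>))) $ j)) holomorphic_on ball 0 r" "(\<lambda>\<zeta>. cnj (snd (\<Psi> (Y (p \<zeta>) (q \<zeta>))))) holomorphic_on ball 0 r" for j
      proof -
        have 1: "\<And>\<zeta>. \<zeta> \<in> ball 0 r \<Longrightarrow> Y (p \<zeta>) (q \<zeta>) \<in> V" using XY that(3) by blast
        have 2: "\<And>j. (\<lambda>\<zeta>. cnj (fst (Y (p \<zeta>) (q \<zeta>)) $ j)) holomorphic_on ball 0 r" by (simp only: Y_def fst_conv vector_smult_component complex_cnj_mult complex_cnj_cnj pq)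
        have 3: "(\<lambda>\<zeta>. cnj (snd (Y (p \<zeta>) (q \<zeta>)))) holomorphic_on ball 0 r"
          unfolding Y_def snd_conv complex_cnj_cnj by (intro holomorphic_intros W)
        show "(\<lambda>\<zeta>. cnj (fst (\<Psi> (Y (p \<zeta>) (q \<zeta>))) $ j)) holomorphic_on ball 0 r" "(\<lambda>\<zeta>. cnj (snd (\<Psi> (Y (p \<zeta>) (q \<zeta>))))) holomorphic_on ball 0 r"
          using hY[OF 1 2 3] by auto
      qed
      show ?thesis unfolding k_def by (intro holomorphic_intros F'(4) X1 Y1)
    qed
    have kr: "k (of_real a) (of_real b) = 0" if ab: "\<bar>a\<bar> < r" "\<bar>b\<bar> < r" for a b :: real
    proof -
      have "cnj (of_real a - \<i> * of_real b) = of_real a + \<i> * of_real b" by (simp add: complex_eq_iff)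
      then have Wr: "W (of_real a) (of_real b) = of_real (P ((of_real a + \<i> * of_real b) *s v))" by (simp add: W_def F(1))
      have XeY: "Y (of_real a) (of_real b) = X (of_real a) (of_real b)"
        unfolding X_def Y_def Wr by (simp add: complex_eq_iff prod_eq_iff vec_eq_iff)
      have "X (of_real a) (of_real b) \<in> model_hypersurface P" unfolding X_def Wr by (simp add: model_hypersurface_def)
      from map[OF XY(1)[of "of_real a" "of_real b"] this] ab
      have "Im (snd (\<Psi> (X (of_real a) (of_real b)))) = P' (fst (\<Psi> (X (of_real a) (of_real b))))"
        by (simp add: model_hypersurface_def)
      then show ?thesis unfolding k_def XeY F'(1) by (simp add: complex_eq_iff)
    qed
    \<comment> \<open>The identity theorem is used in one parameter at a time, passing from real to
      complex values.\<close>
    have k1: "k a (of_real b) = 0" if "norm a < r" "\<bar>b\<bar> < r" for a and b :: real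
      by (rule zero_if_zero_on_reals[of "\<lambda>a. k a (of_real b)" r])
         (use hol[of "\<lambda>a. a" "\<lambda>_. of_real b"] r that kr in auto)
    have k2: "k a b = 0" if "norm a < r" "norm b < r" for a b
      by (rule zero_if_zero_on_reals[of "\<lambda>b. k a b" r])
         (use hol[of "\<lambda>_. a" "\<lambda>b. b"] r that k1 in auto)
    have "(s *s v, 0) \<in> V \<and> snd (\<Psi> (s *s v, 0)) = 0" if s: "norm s < r" for s
    proof -
      \<comment> \<open>These parameters give \<open>a + \<i> b = s\<close> and
        \<open>a - \<i> b = 0\<close>, so \<open>Y\<close> is the origin and all terms with
        conjugated variables drop out.\<close>
      have ab: "norm (s / 2) < r" "norm (- \<i> * s / 2) < r" using s r by (auto simp: norm_mult norm_divide)
      have e1: "s / 2 + \<i> * (- \<i> * s / 2) = s" "s / 2 - \<i> * (- \<i> * s / 2) = 0" by (simp_all add: field_simps)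
      have "W (s / 2) (- \<i> * s / 2) = 0" unfolding W_def e1 by (simp add: F(2))
      then have "X (s / 2) (- \<i> * s / 2) = (s *s v, 0)" "Y (s / 2) (- \<i> * s / 2) = 0"
        unfolding X_def Y_def e1 by (simp_all add: zero_prod_def)
      then show ?thesis using k2[OF ab] XY(1)[OF ab] by (simp add: k_def \<Psi>(3) F'(2))
    qed
    with r show ?thesis by blast
  qed
  obtain \<rho> where \<rho>: "\<rho> > 0" "\<And>z. norm z < \<rho> \<Longrightarrow> (z, 0) \<in> V"
    using eventually_nhds_pair0[OF V] \<Psi>(2) by (metis zero_prod_def)
  have "snd (\<Psi> (z, 0)) = 0" if z: "norm z < \<rho>" for z
  proof (cases "z = 0")
    case True
    then show ?thesis using \<Psi>(3) by (simp add: zero_prod_def)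
  next
    case False
    \<comment> \<open>The radius found above depends on the direction. Analytic continuation along
      the complex line through \<open>z\<close> reaches the parameter 1 and gives the uniform radius
      \<open>\<rho>\<close>.\<close>
    define R where "R = \<rho> / norm z"
    have R: "R > 1" using z False by (simp add: R_def)
    have inV: "(s *s z, 0) \<in> V" if "s \<in> ball 0 R" for s
    proof (rule \<rho>(2))
      have "norm (s *s z) = norm s * norm z"
        by (simp add: norm_vec_def norm_mult L2_set_right_distrib)
      also have "\<dots> < R * norm z" using that False by simp
      finally show "norm (s *s z) < \<rho>" using False by (simp add: R_def)
    qed
    have "(\<lambda>\<zeta>. \<zeta> * z $ j) holomorphic_on ball 0 R" for j by (intro holomorphic_intros)
    then have h: "(\<lambda>s. snd (\<Psi> (s *s z, 0))) holomorphic_on ball 0 R"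
      using holomorphic_curve_compose(2)[of "\<lambda>x. x" V \<Psi> "ball 0 R" "\<lambda>s. (s *s z, 0)"] \<Psi>(1) inV
      by auto
    obtain r where r: "r > 0" "\<And>s. norm s < r \<Longrightarrow> snd (\<Psi> (s *s z, 0)) = 0" using local[of z] by blast
    define r' where "r' = min r R"
    have "(\<lambda>s. snd (\<Psi> (s *s z, 0))) 1 = 0"
    proof (rule analytic_continuation[OF h])
      show "ball 0 r' \<subseteq> ball 0 R" by (auto simp: r'_def)
      have "0 \<in> ball (0::complex) r'" using r R by (simp add: r'_def)
      then show "0 islimpt ball (0::complex) r'" by (simp add: interior_limit_point)
      show "0 \<in> ball (0::complex) R" "1 \<in> ball (0::complex) R" using R by auto
      show "snd (\<Psi> (s *s z, 0)) = 0" if "s \<in> ball 0 r'" for s using that r(2) by (simp add: r'_def)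
    qed auto
    then show ?thesis by simp
  qed
  with \<rho> show ?thesis by blast
qed

subsection \<open>The leading part of a pulled back field\<close>

text \<open>A time \<open>t\<close>, the point \<open>z\<close> and \<open>w\<close> are collected
  in one vector, so that the polydisc results cover all variables at once. \<open>Inr True\<close>
  is the slot of the time and \<open>Inr False\<close> that of \<open>w\<close>.\<close>

definition emb :: "complex \<Rightarrow> complex^'n::finite \<Rightarrow> complex \<Rightarrow> complex^('n + bool)" where
  "emb t z w = (\<chi> k. case k of Inl j \<Rightarrow> z $ j | Inr b \<Rightarrow> if b then t else w)"

lemma emb_nth [simp]: "emb t z w $ Inl j = z $ j" "emb t z w $ Inr True = t" "emb t z w $ Inr False = w"
  by (simp_all add: emb_def)

lemma emb_0: "emb 0 0 0 = 0"
  by (simp add: emb_def vec_eq_iff split: sum.split)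

lemma upd_emb: "upd (emb t z w) (Inr True) t' = emb t' z w" "upd (emb t z w) (Inr False) w' = emb t z w'"
  by (auto simp: emb_def vec_eq_iff upd_nth split: sum.split)

lemma emb_in_polydisc:
  "emb t z w \<in> polydisc r \<longleftrightarrow> norm t < r \<and> norm w < r \<and> (\<forall>j. norm (z $ j) < r)"
proof
  assume "emb t z w \<in> polydisc r"
  then have "norm (emb t z w $ k) < r" for k by (simp add: polydisc_def)
  from this[of "Inr True"] this[of "Inr False"] this[of "Inl _"]
  show "norm t < r \<and> norm w < r \<and> (\<forall>j. norm (z $ j) < r)" by simp
next
  assume "norm t < r \<and> norm w < r \<and> (\<forall>j. norm (z $ j) < r)"
  then show "emb t z w \<in> polydisc r" by (auto simp: polydisc_def emb_def split: sum.split)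
qed

lemma tendsto_emb:
  assumes "(f \<longlongrightarrow> t) F" "(g \<longlongrightarrow> z) F" "(h \<longlongrightarrow> w) F"
  shows "((\<lambda>x. emb (f x) (g x) (h x)) \<longlongrightarrow> emb t z w) F"
proof (rule vec_tendstoI)
  fix k
  show "((\<lambda>x. emb (f x) (g x) (h x) $ k) \<longlongrightarrow> emb t z w $ k) F"
    using assms by (cases k) (auto simp: emb_def intro: tendsto_intros split: sum.split)
qed

lemma hpoly_emb:
  fixes q :: "complex^('n::finite + bool) \<Rightarrow> complex"
  assumes "hpoly (\<lambda>_. True) q"
  shows "hpoly (\<lambda>_. True) (\<lambda>z::complex^'n. q (emb 0 z 0))"
proof -
  have m: "hpoly (\<lambda>_. True) (\<lambda>z::complex^'n. zmonom \<alpha> (emb 0 z 0))" for \<alpha> :: "'n + bool \<Rightarrow> nat"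
  proof (rule zmonom_induct[where R="\<lambda>f. hpoly (\<lambda>_. True) (\<lambda>z::complex^'n. f (emb 0 z 0))"])
    show "hpoly (\<lambda>_. True) (\<lambda>z::complex^'n. emb 0 z 0 $ k)" for k
      by (cases k) (auto simp: emb_def intro: bipoly_coord bipoly.zero)
    show "hpoly (\<lambda>_. True) (\<lambda>z::complex^'n. f (emb 0 z 0) * g (emb 0 z 0))"
      if "hpoly (\<lambda>_. True) (\<lambda>z::complex^'n. f (emb 0 z 0))" "hpoly (\<lambda>_. True) (\<lambda>z::complex^'n. g (emb 0 z 0))" for f g
      by (rule bipoly_mult[OF that]) auto
  qed (auto intro: bipoly_const)
  from assms show ?thesis
  proof (induction rule: hpoly_induct)
    case zero
    show ?case by (rule bipoly.zero)
  next
    case (step f \<alpha> c)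
    show ?case by (intro bipoly_add bipoly_scale m step.IH)
  qed
qed

lemma sephol_isCont: "sephol r f \<Longrightarrow> x \<in> polydisc r \<Longrightarrow> isCont f x"
  using continuous_on_eq_continuous_at[OF open_polydisc] by (auto simp: sephol_def)

lemma hpoly_coeffs:
  assumes "hpoly Q f"
  shows "\<exists>B. finite {\<alpha>. B \<alpha> \<noteq> 0} \<and> (\<forall>\<alpha>. B \<alpha> \<noteq> 0 \<longrightarrow> Q \<alpha>) \<and> (\<forall>z. f z = (\<Sum>\<alpha>\<in>{\<alpha>. B \<alpha> \<noteq> 0}. B \<alpha> * zmonom \<alpha> z))"
proof -
  from assms obtain A where A: "finite {(\<alpha>, \<beta>). A \<alpha> \<beta> \<noteq> 0}" "\<And>\<alpha> \<beta>. A \<alpha> \<beta> \<noteq> 0 \<Longrightarrow> \<beta> = (\<lambda>_. 0) \<and> Q \<alpha>"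
    "\<And>z. f z = (\<Sum>(\<alpha>, \<beta>)\<in>{(\<alpha>, \<beta>). A \<alpha> \<beta> \<noteq> 0}. A \<alpha> \<beta> * bimonom \<alpha> \<beta> z)"
    unfolding bipoly_iff_coeffs by blast
  define B where "B \<alpha> = A \<alpha> (\<lambda>_. 0)" for \<alpha>
  have "A \<alpha> \<beta> \<noteq> 0 \<longleftrightarrow> \<beta> = (\<lambda>_. 0) \<and> B \<alpha> \<noteq> 0" for \<alpha> \<beta>
    using A(2)[of \<alpha> \<beta>] by (cases "\<beta> = (\<lambda>_. 0)") (auto simp: B_def)
  then have eq: "{(\<alpha>, \<beta>). A \<alpha> \<beta> \<noteq> 0} = (\<lambda>\<alpha>. (\<alpha>, \<lambda>_. 0)) ` {\<alpha>. B \<alpha> \<noteq> 0}"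
    by (auto simp: image_iff)
  have inj: "inj_on (\<lambda>\<alpha>. (\<alpha>, \<lambda>_. 0 :: nat)) {\<alpha>. B \<alpha> \<noteq> 0}" by (auto simp: inj_on_def)
  have "finite {\<alpha>. B \<alpha> \<noteq> 0}" using A(1) unfolding eq by (rule finite_imageD) (rule inj)
  moreover have "f z = (\<Sum>\<alpha>\<in>{\<alpha>. B \<alpha> \<noteq> 0}. B \<alpha> * zmonom \<alpha> z)" for z
    unfolding A(3) eq by (subst sum.reindex[OF inj]) (simp add: B_def bimonom_def)
  moreover have "\<forall>\<alpha>. B \<alpha> \<noteq> 0 \<longrightarrow> Q \<alpha>" using A(2) unfolding B_def by blast
  ultimately show ?thesis by blast
qed

lemma norm_le_sum_nth: "norm (x :: complex^'m::finite) \<le> (\<Sum>i\<in>UNIV. norm (x $ i))"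
  unfolding norm_vec_def by (rule L2_set_le_sum) simp

section \<open>Weighted scaling on the model\<close>

context poly_model
begin

lemma dhol_axes:
  "dhol (\<lambda>_. v) p z = (\<Sum>j\<in>UNIV. v $ j * dhol (\<lambda>_. axis j 1) p z)"
proof -
  have "dhol (\<lambda>_. \<Sum>j\<in>J. v $ j *s axis j 1) p z = (\<Sum>j\<in>J. v $ j * dhol (\<lambda>_. axis j 1) p z)" if "finite J" for J
    using that
  proof induction
    case empty
    show ?case using dhol_fscale[of 0 0 z] by simp
  qed (simp add: dhol_fadd dhol_fscale)
  from this[of UNIV] have "dhol (\<lambda>_. \<Sum>j\<in>UNIV. v $ j *s axis j 1) p z = (\<Sum>j\<in>UNIV. v $ j * dhol (\<lambda>_. axis j 1) p z)" by simp
  moreover have "(\<Sum>j\<in>UNIV. v $ j *s axis j 1) = v"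
    by (simp add: vec_eq_iff axis_def if_distrib cong: if_cong)
  ultimately show ?thesis by simp
qed

lemma bipoly_dhol_axis:
  "bipoly (\<lambda>\<alpha> \<beta>. wlen \<mu> \<alpha> + wlen \<mu> \<beta> = 1 - \<mu> j \<and> \<beta> \<noteq> (\<lambda>_. 0)) (dhol (\<lambda>_. axis j 1) p)"
proof (rule bipoly_dhol[OF bipoly_p])
  show "hpoly (\<lambda>\<alpha>. \<alpha> = (\<lambda>_. 0) \<and> i = j) (\<lambda>z. (axis j 1 :: complex^'n) $ i)" for i
    by (cases "i = j") (auto simp: axis_def intro: bipoly_const bipoly.zero)
qed (auto simp: mixed_def wlen_add wlen_dec[unfolded One_nat_def] simp del: fun_upd_apply)

lemma dhol_axis_dil: "s > 0 \<Longrightarrow> dhol (\<lambda>_. axis j 1) p (dil \<mu> s z) = of_real (s powr (1 - \<mu> j)) * dhol (\<lambda>_. axis j 1) p z"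
  by (rule bipoly_dil, rule bipoly_mono[OF bipoly_dhol_axis]) auto

lemma dhol_p_0: "dhol (\<lambda>_. v) p 0 = 0"
  by (subst dhol_axes) (simp add: bipoly_zero_at_0[OF bipoly_dhol_axis])

lemma P_0: "P 0 = 0"
  using bipoly_zero_at_0[OF bipoly_p] by (simp add: mixed_def p_def)

text \<open>On the hypersurface \<open>Im (w\<^sup>2 / 2)\<close> equals \<open>u P\<close> with
  \<open>u = Re w\<close>, so the assumed identity is the tangency condition of this field.\<close>

lemma g1_intro:
  assumes a: "\<And>j. hpoly (\<lambda>\<alpha>. wlen \<mu> \<alpha> = \<mu> j) (\<lambda>z. a z $ j)"
    and t: "\<And>z u. 2 * Re (Complex u (P z) * dhol a p z) = u * P z"
  shows "(\<lambda>x. (snd x *s a (fst x), (snd x)\<^sup>2 / 2)) \<in> g1 \<mu> P" (is "?X \<in> _")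
proof -
  have "hol_on UNIV ?X"
  proof (rule hol_onI)
    show "chol (\<lambda>x. fst (?X x) $ j) x" for x j
      using chol_mult[OF chol_snd chol_hpoly_fst[OF a[of j]]] by simp
    show "chol (\<lambda>x. snd (?X x)) x" for x :: "'n csp"
      using chol_mult[OF chol_mult[OF chol_snd chol_snd] chol_const[of "1/2"]] by (simp add: power2_eq_square)
  qed simp
  moreover have "frechet_derivative (model_defining P) (at x) (?X x) = 0" if "x \<in> model_hypersurface P" for x
  proof -
    obtain z w where x: "x = (z, w)" by fastforce
    have w: "w = Complex (Re w) (P z)" using that by (simp add: model_hypersurface_def x complex_eq_iff)
    have "dhol (\<lambda>_. w *s a z) p z = w * dhol a p z"
      unfolding dhol_fscale using dhol_cong[of "\<lambda>_. a z" z a p] by simp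
    then have "2 * Re (dhol (\<lambda>_. w *s a z) p z) = Re w * P z" using t[of "Re w" z] w by metis
    moreover have "Im (w\<^sup>2 / 2) = Re w * P z" by (subst w, simp add: power2_eq_square)
    ultimately show ?thesis by (simp add: model_frechet x)
  qed
  ultimately have "?X \<in> aut_model P" unfolding aut_model_def by blast
  moreover have "hol_weighted_homogeneous \<mu> (1 + \<mu> j) (\<lambda>x. fst (?X x) $ j)" for j
  proof -
    obtain B where B: "finite {\<alpha>. B \<alpha> \<noteq> 0}" "\<And>\<alpha>. B \<alpha> \<noteq> 0 \<Longrightarrow> wlen \<mu> \<alpha> = \<mu> j"
      "\<And>z. a z $ j = (\<Sum>\<alpha>\<in>{\<alpha>. B \<alpha> \<noteq> 0}. B \<alpha> * zmonom \<alpha> z)" using hpoly_coeffs[OF a[of j]] by blast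
    define C where "C \<alpha> l = (if l = 1 then B \<alpha> else 0)" for \<alpha> and l :: nat
    have eq: "{(\<alpha>, l). C \<alpha> l \<noteq> 0} = (\<lambda>\<alpha>. (\<alpha>, 1)) ` {\<alpha>. B \<alpha> \<noteq> 0}" by (auto simp: C_def split: if_splits)
    have inj: "inj_on (\<lambda>\<alpha>. (\<alpha>, 1::nat)) {\<alpha>. B \<alpha> \<noteq> 0}" by (auto simp: inj_on_def)
    show ?thesis unfolding hol_weighted_homogeneous_def
    proof (intro exI[of _ C] conjI allI impI)
      show "finite {(\<alpha>, l). C \<alpha> l \<noteq> 0}" unfolding eq using B(1) by simp
      show "fst (?X (z, w)) $ j = (\<Sum>(\<alpha>, l)\<in>{(\<alpha>, l). C \<alpha> l \<noteq> 0}. C \<alpha> l * zmonom \<alpha> z * w ^ l)" for z w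
        unfolding eq by (subst sum.reindex[OF inj]) (simp add: C_def B(3) sum_distrib_left mult_ac)
      show "wlen \<mu> \<alpha> + real l = 1 + \<mu> j" if "C \<alpha> l \<noteq> 0" for \<alpha> l
        using that B(2) by (auto simp: C_def split: if_splits)
    qed
  qed
  moreover have "hol_weighted_homogeneous \<mu> (1 + 1) (\<lambda>x. snd (?X x))"
    unfolding hol_weighted_homogeneous_def
  proof (intro exI[of _ "\<lambda>\<alpha> l. if \<alpha> = (\<lambda>_. 0) \<and> l = 2 then 1/2 else 0"] conjI allI impI)
    have eq: "{(\<alpha>::'n \<Rightarrow> nat, l::nat). (if \<alpha> = (\<lambda>_. 0) \<and> l = 2 then 1/2 else 0) \<noteq> (0::complex)} = {(\<lambda>_. 0, 2)}" by auto
    show "finite {(\<alpha>::'n \<Rightarrow> nat, l::nat). (if \<alpha> = (\<lambda>_. 0) \<and> l = 2 then 1/2 else 0) \<noteq> (0::complex)}" unfolding eq by simp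
    show "snd (?X (z, w)) = (\<Sum>(\<alpha>, l)\<in>{(\<alpha>, l). (if \<alpha> = (\<lambda>_. 0) \<and> l = 2 then 1/2 else 0) \<noteq> (0::complex)}.
        (if \<alpha> = (\<lambda>_. 0) \<and> l = 2 then 1/2 else 0) * zmonom \<alpha> z * w ^ l)" for z w
      unfolding eq by simp
  qed (auto split: if_splits)
  ultimately show ?thesis by (simp add: g1_def vfield_weight_def)
qed

lemma powr_limit: "k \<ge> 0 \<Longrightarrow> ((\<lambda>s::real. s powr k) \<longlongrightarrow> (if k = 0 then 1 else 0)) (at_right 0)"
proof (cases "k = 0")
  case True
  have "\<forall>\<^sub>F s::real in at_right 0. s powr k = 1"
    using eventually_at_right_less[of "0::real"] by eventually_elim (simp add: True)
  then show ?thesis using True by (simp add: tendsto_eventually)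
next
  case False
  assume "k \<ge> 0"
  with False have "k > 0" by simp
  have "((\<lambda>s::real. s powr k) \<longlongrightarrow> 0) (at_right 0)"
    by (rule tendsto_zero_powrI[OF tendsto_ident_at tendsto_const _ \<open>k > 0\<close>])
       (use eventually_at_right_less in eventually_elim, simp)
  with False show ?thesis by simp
qed

text \<open>With the weight gap \<open>e\<close>, the size of \<open>dil \<mu> s z\<close> is at
  most a multiple of \<open>s powr e\<close>. An order \<open>K\<close> with \<open>K e > 2\<close>
  pushes Taylor remainders beyond the weights that matter, which are at most 1.\<close>

lemma norm_emb_dil_power:
  "\<exists>K::nat. \<forall>z. \<exists>B. \<forall>s. 0 < s \<and> s \<le> 1 \<longrightarrow> norm (emb 0 (dil \<mu> s z) 0) ^ K \<le> B * s powr 2"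
proof -
  obtain e where e: "e > 0" "\<And>\<alpha>. wlen \<mu> \<alpha> > 0 \<Longrightarrow> wlen \<mu> \<alpha> \<ge> e" using wlen_gap by blast
  obtain K :: nat where K: "2 / e < real K" using reals_Archimedean2 by blast
  have "\<exists>B. \<forall>s. 0 < s \<and> s \<le> 1 \<longrightarrow> norm (emb 0 (dil \<mu> s z) 0) ^ K \<le> B * s powr 2" for z
  proof -
    have em: "\<mu> j \<ge> e" for j using e(2)[of "unit_index j"] \<mu>_pos[of j] by simp
    define B where "B = (\<Sum>k\<in>UNIV. norm (emb 0 z 0 $ k))"
    have B0: "B \<ge> 0" by (simp add: B_def sum_nonneg)
    have "norm (emb 0 (dil \<mu> s z) 0) ^ K \<le> B ^ K * s powr 2" if s: "0 < s" "s \<le> 1" for s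
    proof -
      have "norm (emb 0 (dil \<mu> s z) 0 $ k) \<le> norm (emb 0 z 0 $ k) * s powr e" for k
      proof (cases k)
        case (Inl j)
        have "s powr \<mu> j \<le> s powr e" using s em[of j] by (intro powr_mono') auto
        from mult_left_mono[OF this, of "norm (z $ j)"] show ?thesis using s by (simp add: Inl norm_mult mult.commute)
      qed (auto simp: emb_def)
      then have "norm (emb 0 (dil \<mu> s z) 0) \<le> (\<Sum>k\<in>UNIV. norm (emb 0 z 0 $ k) * s powr e)"
        by (intro order.trans[OF norm_le_sum_nth] sum_mono)
      also have "\<dots> = B * s powr e" by (simp add: B_def sum_distrib_right)
      finally have "norm (emb 0 (dil \<mu> s z) 0) ^ K \<le> (B * s powr e) ^ K" by (intro power_mono) auto
      also have "\<dots> = B ^ K * s powr (e * real K)"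
        using s by (simp add: power_mult_distrib powr_powr[symmetric] powr_realpow)
      also have "\<dots> \<le> B ^ K * s powr 2"
        using s K e B0 by (intro mult_left_mono powr_mono') (auto simp: field_simps)
      finally show ?thesis .
    qed
    then show ?thesis by blast
  qed
  then show ?thesis by blast
qed

end

context nondeg_model
begin

text \<open>The component of weight 0 of the field \<open>(F, w G)\<close> is the sought one: on \<open>x = (dil s z, s w)\<close> its tangency
  condition, divided by the appropriate power of \<open>s\<close>, first kills the components of negative weight and
  then becomes the tangency condition of weight 1.\<close>

lemma weight_1_part:
  fixes E G1 :: "complex^('a + bool) \<Rightarrow> complex" and F :: "'a \<Rightarrow> complex^('a + bool) \<Rightarrow> complex" and c :: real
  assumes r: "r > 0" and E: "sephol r E" "E 0 = of_real c" "c \<noteq> 0" and G1: "sephol r G1" "G1 0 = 1/2"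
    and F: "\<And>j. sephol r (F j)"
    and tang: "\<And>y w. emb 0 y w \<in> polydisc r \<Longrightarrow> Im w = P y \<Longrightarrow>
      Im ((w * E (emb 0 y w)) * (w * G1 (emb 0 y w))) =
      2 * Re (dhol (\<lambda>_. (w * E (emb 0 y w)) *s (\<chi> j. F j (emb 0 y w))) p y)"
  shows "\<exists>X. X \<in> g1 \<mu> P \<and> X \<noteq> (\<lambda>x. 0)"
proof -
  define r' where "r' = r / 2"
  have r': "0 < r'" "r' < r" using r by (auto simp: r'_def)
  \<comment> \<open>The dependence of \<open>F j\<close> on \<open>w\<close> is split off with an
    additional factor \<open>w\<close>, whose weight 1 makes it disappear in the scaling
    limit.\<close>
  have "\<forall>j. \<exists>h. sephol r' h \<and> (\<forall>x\<in>polydisc r'. F j x = F j (upd x (Inr False) 0) + x $ Inr False * h x)"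
    using hadamard_quotient[OF F r'] by blast
  from choice[OF this] obtain h where h: "\<And>j. sephol r' (h j)"
    "\<And>j x. x \<in> polydisc r' \<Longrightarrow> F j x = F j (upd x (Inr False) 0) + x $ Inr False * h j x" by blast
  \<comment> \<open>Weighted Taylor expansion of \<open>F j\<close> on \<open>w = 0\<close>, with an
    error that is small compared with \<open>s powr k\<close> for each
    \<open>k \<le> 1\<close>.\<close>
  have ex: "\<exists>I f. finite I \<and> (\<forall>v. hpoly (\<lambda>\<alpha>. wlen \<mu> \<alpha> = v) (f v)) \<and> (\<forall>v. v \<notin> I \<longrightarrow> f v = (\<lambda>z. 0)) \<and>
      (\<forall>k\<le>1. \<forall>z. ((\<lambda>s. s powr (- k) * norm (F j (emb 0 (dil \<mu> s z) 0) - (\<Sum>v\<in>I. of_real (s powr v) * f v z))) \<longlongrightarrow> 0) (at_right 0))" for j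
  proof -
    obtain K :: nat where K: "\<And>z. \<exists>B. \<forall>s. 0 < s \<and> s \<le> 1 \<longrightarrow> norm (emb 0 (dil \<mu> s z) 0) ^ K \<le> B * s powr 2"
      using norm_emb_dil_power by blast
    obtain Q C where Q: "hpoly (\<lambda>_. True) Q" "\<forall>\<^sub>F x in nhds 0. norm (F j x - Q x) \<le> C * norm x ^ K"
      using sephol_taylor[OF F r] by blast
    obtain I f where If: "finite I" "\<And>v. bipoly (\<lambda>\<alpha> \<beta>. (\<beta> = (\<lambda>_. 0) \<and> True) \<and> wlen \<mu> \<alpha> = v) (f v)"
      "\<And>v. v \<notin> I \<Longrightarrow> f v = (\<lambda>z. 0)" "(\<lambda>z. Q (emb 0 z 0)) = (\<lambda>z. \<Sum>v\<in>I. f v z)"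
      using bipoly_weight_decomposition[OF hpoly_emb[OF Q(1)], of "wlen \<mu>"] by blast
    have f: "hpoly (\<lambda>\<alpha>. wlen \<mu> \<alpha> = v) (f v)" for v by (rule bipoly_mono[OF If(2)]) auto
    have "((\<lambda>s. s powr (- k) * norm (F j (emb 0 (dil \<mu> s z) 0) - (\<Sum>v\<in>I. of_real (s powr v) * f v z))) \<longlongrightarrow> 0) (at_right 0)"
      if k: "k \<le> 1" for k z
    proof -
      obtain B where B: "\<And>s. 0 < s \<Longrightarrow> s \<le> 1 \<Longrightarrow> norm (emb 0 (dil \<mu> s z) 0) ^ K \<le> B * s powr 2" using K[of z] by blast
      have "((\<lambda>s. emb 0 (dil \<mu> s z) 0) \<longlongrightarrow> emb 0 0 0) (at_right 0)"
        by (intro tendsto_emb tendsto_const dil_tendsto)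
      then have "((\<lambda>s. emb 0 (dil \<mu> s z) 0) \<longlongrightarrow> 0) (at_right 0)" by (simp add: emb_0)
      from eventually_compose_filterlim[OF Q(2) this]
      have ev: "\<forall>\<^sub>F s in at_right 0. norm (s powr (- k) * norm (F j (emb 0 (dil \<mu> s z) 0) - (\<Sum>v\<in>I. of_real (s powr v) * f v z)))
           \<le> \<bar>C\<bar> * \<bar>B\<bar> * s powr (2 - k)"
        using eventually_at_right_less[of "0::real"] eventually_at_right_real[of 0 1, simplified]
      proof eventually_elim
        case (elim s)
        then have s: "0 < s" "s \<le> 1" by auto
        have "Q (emb 0 (dil \<mu> s z) 0) = (\<Sum>v\<in>I. of_real (s powr v) * f v z)"
          using fun_cong[OF If(4), of "dil \<mu> s z"] by (simp add: hpoly_dil[OF f s(1)])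
        then have "norm (F j (emb 0 (dil \<mu> s z) 0) - (\<Sum>v\<in>I. of_real (s powr v) * f v z)) \<le> C * norm (emb 0 (dil \<mu> s z) 0) ^ K"
          using elim by simp
        also have "\<dots> \<le> \<bar>C\<bar> * (\<bar>B\<bar> * s powr 2)"
          using B[OF s] mult_right_mono[OF abs_ge_self[of B], of "s powr 2"] by (intro mult_mono) auto
        finally have "s powr (- k) * norm (F j (emb 0 (dil \<mu> s z) 0) - (\<Sum>v\<in>I. of_real (s powr v) * f v z)) \<le>
            s powr (- k) * (\<bar>C\<bar> * (\<bar>B\<bar> * s powr 2))" by (intro mult_left_mono) auto
        also have "\<dots> = \<bar>C\<bar> * \<bar>B\<bar> * (s powr 2 * s powr (- k))" by (simp only: mult_ac)
        also have "s powr 2 * s powr (- k) = s powr (2 - k)" unfolding powr_add[symmetric] by simp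
        finally show ?case by simp
      qed
      have "((\<lambda>s. \<bar>C\<bar> * \<bar>B\<bar> * s powr (2 - k)) \<longlongrightarrow> \<bar>C\<bar> * \<bar>B\<bar> * 0) (at_right 0)"
        using powr_limit[of "2 - k"] k by (intro tendsto_intros) auto
      then show ?thesis using Lim_null_comparison[OF ev] by simp
    qed
    with If f show ?thesis by (intro exI[of _ I] exI[of _ f]) auto
  qed
  have "\<forall>j. \<exists>If. finite (fst If) \<and> (\<forall>v. hpoly (\<lambda>\<alpha>. wlen \<mu> \<alpha> = v) (snd If v)) \<and> (\<forall>v. v \<notin> fst If \<longrightarrow> snd If v = (\<lambda>z. 0)) \<and>
      (\<forall>k\<le>1. \<forall>z. ((\<lambda>s. s powr (- k) * norm (F j (emb 0 (dil \<mu> s z) 0) - (\<Sum>v\<in>fst If. of_real (s powr v) * snd If v z))) \<longlongrightarrow> 0) (at_right 0))"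
  proof
    fix j
    obtain I f where "finite I \<and> (\<forall>v. hpoly (\<lambda>\<alpha>. wlen \<mu> \<alpha> = v) (f v)) \<and> (\<forall>v. v \<notin> I \<longrightarrow> f v = (\<lambda>z. 0)) \<and>
      (\<forall>k\<le>1. \<forall>z. ((\<lambda>s. s powr (- k) * norm (F j (emb 0 (dil \<mu> s z) 0) - (\<Sum>v\<in>I. of_real (s powr v) * f v z))) \<longlongrightarrow> 0) (at_right 0))"
      using ex[of j] by (elim exE)
    then show "\<exists>If. finite (fst If) \<and> (\<forall>v. hpoly (\<lambda>\<alpha>. wlen \<mu> \<alpha> = v) (snd If v)) \<and> (\<forall>v. v \<notin> fst If \<longrightarrow> snd If v = (\<lambda>z. 0)) \<and>
      (\<forall>k\<le>1. \<forall>z. ((\<lambda>s. s powr (- k) * norm (F j (emb 0 (dil \<mu> s z) 0) - (\<Sum>v\<in>fst If. of_real (s powr v) * snd If v z))) \<longlongrightarrow> 0) (at_right 0))"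
      by (intro exI[of _ "(I, f)"]) (unfold fst_conv snd_conv)
  qed
  from choice[OF this] obtain If where If: "\<And>j. finite (fst (If j))" "\<And>j v. hpoly (\<lambda>\<alpha>. wlen \<mu> \<alpha> = v) (snd (If j) v)"
    "\<And>j v. v \<notin> fst (If j) \<Longrightarrow> snd (If j) v = (\<lambda>z. 0)"
    "\<And>j k z. k \<le> 1 \<Longrightarrow> ((\<lambda>s. s powr (- k) * norm (F j (emb 0 (dil \<mu> s z) 0) - (\<Sum>v\<in>fst (If j). of_real (s powr v) * snd (If j) v z))) \<longlongrightarrow> 0) (at_right 0)"
    by blast
  define I where "I j = fst (If j)" for j
  define f where "f j v = snd (If j) v" for j v
  have f: "finite (I j)" "hpoly (\<lambda>\<alpha>. wlen \<mu> \<alpha> = v) (f j v)" "v \<notin> I j \<Longrightarrow> f j v = (\<lambda>z. 0)"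
    "k \<le> 1 \<Longrightarrow> ((\<lambda>s. s powr (- k) * norm (F j (emb 0 (dil \<mu> s z) 0) - (\<Sum>v\<in>I j. of_real (s powr v) * f j v z))) \<longlongrightarrow> 0) (at_right 0)"
    for j v k z using If(1)[of j] If(2)[of v j] If(3)[of v j] If(4)[of k j z] by (auto simp: I_def f_def)
  \<comment> \<open>The part of weight \<open>\<nu>\<close> of the field \<open>F\<close>; its j-th
    component has weight \<open>\<mu> j + \<nu>\<close>.\<close>
  define a where "a \<nu> z = (\<chi> j. f j (\<mu> j + \<nu>) z)" for \<nu> z
  have a: "hpoly (\<lambda>\<alpha>. wlen \<mu> \<alpha> = \<mu> j + \<nu>) (\<lambda>z. a \<nu> z $ j)" for \<nu> j by (simp add: a_def f(2))
  have cancel: "s powr (- k) * L = R" if "s > 0" "s\<^sup>2 * L = s\<^sup>2 * s powr k * R" for s k L R :: real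
    using that by (simp add: powr_minus field_simps)
  have ReIm: "Re (of_real r * z) = r * Re z" "Im (of_real r * z) = r * Im z" for r z by simp_all
  \<comment> \<open>At the dilated point the left side of the tangency condition has order
    \<open>s\<^sup>2\<close>. On the right \<open>s\<close>, \<open>s powr (\<mu> j + \<nu>)\<close>
    and \<open>s powr (1 - \<mu> j)\<close> combine to \<open>s powr (2 + \<nu>)\<close>. After
    division the left side survives in the limit only if \<open>\<nu> = 0\<close>.\<close>
  have limit: "(if \<nu> = 0 then c * u * P z else 0) = 2 * c * Re (Complex u (P z) * dhol (a \<nu>) p z)"
    if \<nu>: "\<nu> \<le> 0" and low: "\<And>j v. v < \<mu> j + \<nu> \<Longrightarrow> f j v = (\<lambda>z. 0)" for \<nu> u z
  proof -
    define w where "w = Complex u (P z)"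
    define x where "x s = emb 0 (dil \<mu> s z) (of_real s * w)" for s
    have x0: "(x \<longlongrightarrow> 0) (at_right 0)"
    proof -
      have "(x \<longlongrightarrow> emb 0 0 (of_real 0 * w)) (at_right 0)"
        unfolding x_def by (intro tendsto_emb tendsto_const dil_tendsto tendsto_intros)
      then show ?thesis by (simp add: emb_0)
    qed
    have lim0: "((\<lambda>s. g (x s)) \<longlongrightarrow> g 0) (at_right 0)" if "sephol q g" "q > 0" for g q
      using isCont_tendsto_compose[OF sephol_isCont[OF that(1) zero_in_polydisc[OF that(2)]] x0] .
    have Fj: "((\<lambda>s. of_real (s powr (- \<nu> - \<mu> j)) * F j (x s)) \<longlongrightarrow> a \<nu> z $ j) (at_right 0)" for j
    proof -
      let ?k = "\<mu> j + \<nu>"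
      have k1: "?k \<le> 1" "?k < 1" using \<nu> \<mu>_half[of j] by auto
      have "((\<lambda>s. of_real (s powr (- ?k)) * (F j (emb 0 (dil \<mu> s z) 0) - (\<Sum>v\<in>I j. of_real (s powr v) * f j v z))) \<longlongrightarrow> 0) (at_right 0)"
        by (rule tendsto_norm_zero_cancel) (use f(4)[OF k1(1), of j z] in \<open>simp add: norm_mult\<close>)
      moreover have "((\<lambda>s. of_real (s powr (- ?k)) * (\<Sum>v\<in>I j. of_real (s powr v) * f j v z)) \<longlongrightarrow> f j ?k z) (at_right 0)"
      proof -
        have "((\<lambda>s. \<Sum>v\<in>I j. of_real (s powr (v - ?k)) * f j v z) \<longlongrightarrow> (\<Sum>v\<in>I j. (if v = ?k then f j v z else 0))) (at_right 0)"
        proof (intro tendsto_sum)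
          fix v
          show "((\<lambda>s. of_real (s powr (v - ?k)) * f j v z) \<longlongrightarrow> (if v = ?k then f j v z else 0)) (at_right 0)"
          proof (cases "v < ?k")
            case True
            then show ?thesis using low by simp
          next
            case False
            then have "((\<lambda>s. of_real (s powr (v - ?k)) * f j v z) \<longlongrightarrow> of_real (if v - ?k = 0 then 1 else 0) * f j v z) (at_right 0)"
              by (intro tendsto_intros powr_limit) simp
            then show ?thesis by (simp split: if_splits)
          qed
        qed
        also have "(\<Sum>v\<in>I j. (if v = ?k then f j v z else 0)) = f j ?k z"
          using f(1)[of j] f(3)[of ?k j] by (cases "?k \<in> I j") simp_all
        finally show ?thesis
        proof (rule Lim_transform_eventually)
          show "\<forall>\<^sub>F s in at_right 0. (\<Sum>v\<in>I j. of_real (s powr (v - ?k)) * f j v z) =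
              of_real (s powr (- ?k)) * (\<Sum>v\<in>I j. of_real (s powr v) * f j v z)"
            using eventually_at_right_less[of "0::real"]
            by eventually_elim (simp add: sum_distrib_left powr_diff powr_minus powr_add field_simps)
        qed
      qed
      \<comment> \<open>The exponent is positive, because
        \<open>\<mu> j + \<nu> \<le> 1/2\<close>.\<close>
      moreover have "((\<lambda>s. of_real (s powr (1 - ?k)) * (w * h j (x s))) \<longlongrightarrow> of_real 0 * (w * h j 0)) (at_right 0)"
        using powr_limit[of "1 - ?k"] k1 lim0[OF h(1) r'(1)] by (intro tendsto_intros) auto
      ultimately have "((\<lambda>s. of_real (s powr (- ?k)) * (F j (emb 0 (dil \<mu> s z) 0) - (\<Sum>v\<in>I j. of_real (s powr v) * f j v z)) +
          of_real (s powr (- ?k)) * (\<Sum>v\<in>I j. of_real (s powr v) * f j v z) + of_real (s powr (1 - ?k)) * (w * h j (x s)))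
          \<longlongrightarrow> 0 + f j ?k z + of_real 0 * (w * h j 0)) (at_right 0)"
        by (intro tendsto_add)
      then have L: "((\<lambda>s. of_real (s powr (- ?k)) * (F j (emb 0 (dil \<mu> s z) 0) - (\<Sum>v\<in>I j. of_real (s powr v) * f j v z)) +
          of_real (s powr (- ?k)) * (\<Sum>v\<in>I j. of_real (s powr v) * f j v z) + of_real (s powr (1 - ?k)) * (w * h j (x s)))
          \<longlongrightarrow> a \<nu> z $ j) (at_right 0)" by (simp add: a_def)
      have "\<forall>\<^sub>F s in at_right 0. x s \<in> polydisc r'"
        using topological_tendstoD[OF x0 open_polydisc zero_in_polydisc[OF r'(1)]] .
      then have "\<forall>\<^sub>F s in at_right 0. of_real (s powr (- ?k)) * (F j (emb 0 (dil \<mu> s z) 0) - (\<Sum>v\<in>I j. of_real (s powr v) * f j v z)) +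
          of_real (s powr (- ?k)) * (\<Sum>v\<in>I j. of_real (s powr v) * f j v z) + of_real (s powr (1 - ?k)) * (w * h j (x s)) =
          of_real (s powr (- \<nu> - \<mu> j)) * F j (x s)"
        using eventually_at_right_less[of "0::real"]
      proof eventually_elim
        case (elim s)
        have Fx: "F j (x s) = F j (emb 0 (dil \<mu> s z) 0) + of_real s * w * h j (x s)"
          using h(2)[OF elim(1), of j] by (simp add: x_def upd_emb)
        have "s powr (1 - ?k) = s powr (- ?k) * s" using elim(2) by (simp add: powr_diff powr_minus powr_add field_simps)
        then show ?case unfolding Fx by (simp add: algebra_simps)
      qed
      from Lim_transform_eventually[OF L this] show ?thesis .
    qed
    have R: "dhol (a \<nu>) p z = (\<Sum>j\<in>UNIV. a \<nu> z $ j * dhol (\<lambda>_. axis j 1) p z)"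
      using dhol_axes[of "a \<nu> z" z] dhol_cong[of "\<lambda>_. a \<nu> z" z "a \<nu>" p] by simp
    have rhs: "((\<lambda>s. 2 * Re (w * E (x s) * (\<Sum>j\<in>UNIV. (of_real (s powr (- \<nu> - \<mu> j)) * F j (x s)) * dhol (\<lambda>_. axis j 1) p z)))
        \<longlongrightarrow> 2 * Re (w * of_real c * dhol (a \<nu>) p z)) (at_right 0)"
      unfolding R using lim0[OF E(1) r] by (intro tendsto_intros Fj) (simp add: E(2))
    have lhs: "((\<lambda>s. s powr (- \<nu>) * Im (w * E (x s) * (w * G1 (x s)))) \<longlongrightarrow> (if - \<nu> = 0 then 1 else 0) * Im (w * of_real c * (w * (1/2)))) (at_right 0)"
      using lim0[OF E(1) r] lim0[OF G1(1) r] \<nu> by (intro tendsto_intros powr_limit) (simp_all add: E(2) G1(2))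
    have "\<forall>\<^sub>F s in at_right 0. x s \<in> polydisc r"
      using topological_tendstoD[OF x0 open_polydisc zero_in_polydisc[OF r]] .
    then have "\<forall>\<^sub>F s in at_right 0. s powr (- \<nu>) * Im (w * E (x s) * (w * G1 (x s))) =
        2 * Re (w * E (x s) * (\<Sum>j\<in>UNIV. (of_real (s powr (- \<nu> - \<mu> j)) * F j (x s)) * dhol (\<lambda>_. axis j 1) p z))"
      using eventually_at_right_less[of "0::real"]
    proof eventually_elim
      case (elim s)
      have "Im (of_real s * w) = P (dil \<mu> s z)" using elim(2) by (simp add: P_dil w_def)
      from tang[OF elim(1)[unfolded x_def] this, folded x_def]
      have t: "Im ((of_real s * w * E (x s)) * (of_real s * w * G1 (x s))) =
         2 * Re (of_real s * w * E (x s) * (\<Sum>j\<in>UNIV. F j (x s) * dhol (\<lambda>_. axis j 1) p (dil \<mu> s z)))"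
        unfolding dhol_fscale dhol_axes[of "\<chi> j. F j (x s)"] by simp
      have A: "Im ((of_real s * w * E (x s)) * (of_real s * w * G1 (x s))) = s\<^sup>2 * Im (w * E (x s) * (w * G1 (x s)))"
      proof -
        have "(of_real s * w * E (x s)) * (of_real s * w * G1 (x s)) = of_real (s\<^sup>2) * (w * E (x s) * (w * G1 (x s)))"
          by (simp add: power2_eq_square mult_ac)
        then show ?thesis by (simp only: ReIm)
      qed
      have B: "of_real s * w * E (x s) * (\<Sum>j\<in>UNIV. F j (x s) * dhol (\<lambda>_. axis j 1) p (dil \<mu> s z)) =
         of_real (s\<^sup>2 * s powr \<nu>) * (w * E (x s) * (\<Sum>j\<in>UNIV. (of_real (s powr (- \<nu> - \<mu> j)) * F j (x s)) * dhol (\<lambda>_. axis j 1) p z))"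
      proof -
        have "of_real s * F j (x s) * dhol (\<lambda>_. axis j 1) p (dil \<mu> s z) =
            of_real (s\<^sup>2 * s powr \<nu>) * (of_real (s powr (- \<nu> - \<mu> j)) * F j (x s) * dhol (\<lambda>_. axis j 1) p z)" for j
        proof -
          have "s * s powr (1 - \<mu> j) = s\<^sup>2 * s powr \<nu> * s powr (- \<nu> - \<mu> j)"
            using elim(2) by (simp add: powr_diff powr_minus powr_add power2_eq_square field_simps)
          then have e: "complex_of_real s * of_real (s powr (1 - \<mu> j)) = of_real (s\<^sup>2 * s powr \<nu>) * of_real (s powr (- \<nu> - \<mu> j))"
            by (metis of_real_mult)
          have "of_real s * F j (x s) * dhol (\<lambda>_. axis j 1) p (dil \<mu> s z) =
             (of_real s * of_real (s powr (1 - \<mu> j))) * (F j (x s) * dhol (\<lambda>_. axis j 1) p z)"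
            by (simp add: dhol_axis_dil[OF elim(2)] mult_ac)
          then show ?thesis unfolding e by (simp only: mult_ac)
        qed
        note ej = this
        have "of_real s * w * E (x s) * (\<Sum>j\<in>UNIV. F j (x s) * dhol (\<lambda>_. axis j 1) p (dil \<mu> s z)) =
            w * E (x s) * (\<Sum>j\<in>UNIV. of_real s * F j (x s) * dhol (\<lambda>_. axis j 1) p (dil \<mu> s z))"
          by (simp add: sum_distrib_left mult_ac)
        also have "\<dots> = w * E (x s) * (\<Sum>j\<in>UNIV. of_real (s\<^sup>2 * s powr \<nu>) * (of_real (s powr (- \<nu> - \<mu> j)) * F j (x s) * dhol (\<lambda>_. axis j 1) p z))"
          by (simp only: ej)
        also have "\<dots> = w * E (x s) * (of_real (s\<^sup>2 * s powr \<nu>) * (\<Sum>j\<in>UNIV. of_real (s powr (- \<nu> - \<mu> j)) * F j (x s) * dhol (\<lambda>_. axis j 1) p z))"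
          unfolding sum_distrib_left[symmetric] ..
        finally show ?thesis by (simp only: mult_ac)
      qed
      have "s\<^sup>2 * Im (w * E (x s) * (w * G1 (x s))) = s\<^sup>2 * s powr \<nu> *
          (2 * Re (w * E (x s) * (\<Sum>j\<in>UNIV. (of_real (s powr (- \<nu> - \<mu> j)) * F j (x s)) * dhol (\<lambda>_. axis j 1) p z)))"
        using t unfolding A B ReIm by (simp only: mult_ac)
      then show ?case by (rule cancel[OF elim(2)])
    qed
    note L = tendsto_unique[OF trivial_limit_at_right_real Lim_transform_eventually[OF lhs this] rhs]
    have IM: "Im (w * of_real c * (w * (1/2))) = c * u * P z" by (simp add: w_def algebra_simps)
    have "w * of_real c * dhol (a \<nu>) p z = of_real c * (w * dhol (a \<nu>) p z)" by (simp only: mult_ac)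
    then have RE: "Re (w * of_real c * dhol (a \<nu>) p z) = c * Re (w * dhol (a \<nu>) p z)" by (simp only: ReIm)
    have "(if - \<nu> = 0 then 1 else 0) * (c * u * P z) = 2 * c * Re (w * dhol (a \<nu>) p z)"
      using L unfolding IM RE by (simp only: mult.assoc)
    then show ?thesis unfolding w_def[symmetric] by (cases "\<nu> = 0") (simp_all only: neg_equal_0_iff_equal if_True if_False mult_1 mult_zero_left simp_thms refl)
  qed
  define N where "N = {v - \<mu> j | v j. v \<in> I j \<and> f j v \<noteq> (\<lambda>z. 0)}"
  have N: "finite N"
  proof (rule finite_subset)
    show "N \<subseteq> (\<Union>j. (\<lambda>v. v - \<mu> j) ` I j)" by (auto simp: N_def)
  qed (simp add: f(1))
  have nonneg: "\<nu> \<ge> 0" if "\<nu> \<in> N" for \<nu>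
  proof (rule ccontr)
    assume "\<not> \<nu> \<ge> 0"
    define m where "m = Min N"
    have m: "m \<in> N" unfolding m_def using that by (intro Min_in N) auto
    have "m \<le> \<nu>" unfolding m_def by (rule Min_le[OF N that])
    then have m0: "m < 0" using \<open>\<not> \<nu> \<ge> 0\<close> by simp
    have low: "f j v = (\<lambda>z. 0)" if "v < \<mu> j + m" for j v
    proof (rule ccontr)
      assume nz: "f j v \<noteq> (\<lambda>z. 0)"
      then have "v - \<mu> j \<in> N" using f(3)[of v j] by (auto simp: N_def)
      then have "m \<le> v - \<mu> j" unfolding m_def by (rule Min_le[OF N])
      with that show False by simp
    qed
    have "Re (Complex u (P z) * dhol (a m) p z) = 0" for u z
      using limit[OF less_imp_le[OF m0] low, of u z] m0 E(3) by simp
    \<comment> \<open>\<open>u = 0\<close> kills \<open>P\<close> times the imaginary part of the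
      derivative, and \<open>u = 1\<close> then kills its real part. Absence of zero divisors
      removes the factor \<open>p\<close>.\<close>
    from this[of 1] this[of 0] have "p z * dhol (a m) p z = 0" for z
      by (simp add: complex_eq_iff p_def)
    moreover have "anypoly (dhol (a m) p)" by (intro anypoly_dhol anypoly_p hpoly_any[OF a])
    moreover obtain z0 where "p z0 \<noteq> 0" using P_nonzero by (auto simp: p_def)
    ultimately have "dhol (a m) p z = 0" for z using bipoly_no_zero_divisors[OF anypoly_p] by blast
    then have am: "a m z = 0" for z using field_zero[OF a] by blast
    obtain v j where vj: "m = v - \<mu> j" "f j v \<noteq> (\<lambda>z. 0)" using m by (auto simp: N_def)
    have "f j v z = a m z $ j" for z by (simp add: a_def vj(1))
    with am vj(2) show False by (auto simp: fun_eq_iff)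
  qed
  have low: "f j v = (\<lambda>z. 0)" if "v < \<mu> j + 0" for j v
  proof (rule ccontr)
    assume nz: "f j v \<noteq> (\<lambda>z. 0)"
    then have "v - \<mu> j \<in> N" using f(3)[of v j] by (auto simp: N_def)
    from nonneg[OF this] that show False by simp
  qed
  have "2 * Re (Complex u (P z) * dhol (a 0) p z) = u * P z" for u z
  proof -
    have "c * u * P z = 2 * c * Re (Complex u (P z) * dhol (a 0) p z)" using limit[OF order.refl low, of u z] by simp
    then have "c * (2 * Re (Complex u (P z) * dhol (a 0) p z)) = c * (u * P z)" by (simp only: mult_ac)
    with E(3) show ?thesis by (simp only: mult_left_cancel[OF E(3)])
  qed
  then have "(\<lambda>x. (snd x *s a 0 (fst x), (snd x)\<^sup>2 / 2)) \<in> g1 \<mu> P"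
    using a[of _ 0] by (intro g1_intro) auto
  moreover have "(\<lambda>x. (snd x *s a 0 (fst x), (snd x)\<^sup>2 / 2)) \<noteq> (\<lambda>x. 0)"
  proof
    assume "(\<lambda>x. (snd x *s a 0 (fst x), (snd x)\<^sup>2 / 2)) = (\<lambda>x. 0)"
    from fun_cong[OF this, of "(0, 1)"] show False by (simp add: zero_prod_def)
  qed
  ultimately show ?thesis by blast
qed

end

subsection \<open>From balanced coordinates to fields of weight 1\<close>

lemma sephol_const: "sephol r (\<lambda>x. c)"
  by (simp add: sephol_def)

lemma sephol_nth: "sephol r (\<lambda>x. x $ k)"
proof -
  have "(\<lambda>\<zeta>. upd x i \<zeta> $ k) holomorphic_on ball 0 r" for x i
    by (cases "k = i") (simp_all add: upd_nth)
  then show ?thesis by (simp add: sephol_def linear_continuous_on bounded_linear_vec_nth)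
qed

lemma sephol_add: "sephol r f \<Longrightarrow> sephol r g \<Longrightarrow> sephol r (\<lambda>x. f x + g x)"
  by (auto simp: sephol_def intro: continuous_intros holomorphic_intros)

lemma sephol_mult: "sephol r f \<Longrightarrow> sephol r g \<Longrightarrow> sephol r (\<lambda>x. f x * g x)"
  by (auto simp: sephol_def intro: continuous_intros holomorphic_intros)

lemma sephol_compose:
  fixes \<Psi> :: "'n csp \<Rightarrow> 'n::finite csp" and X :: "complex^'m::finite \<Rightarrow> 'n csp"
  assumes \<Psi>: "hol_on V \<Psi>" and XV: "\<And>x. x \<in> polydisc r \<Longrightarrow> X x \<in> V"
    and X: "\<And>j. sephol r (\<lambda>x. fst (X x) $ j)" "sephol r (\<lambda>x. snd (X x))"
  shows "sephol r (\<lambda>x. fst (\<Psi> (X x)) $ j)" "sephol r (\<lambda>x. snd (\<Psi> (X x)))"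
proof -
  have "continuous_on (polydisc r) (\<lambda>x. (\<chi> j. fst (X x) $ j, snd (X x)))"
    using X by (intro continuous_on_Pair continuous_on_vec_lambda) (auto simp: sephol_def)
  then have "continuous_on (polydisc r) X" by simp
  then have C: "continuous_on (polydisc r) (\<lambda>x. \<Psi> (X x))"
    by (rule continuous_on_compose2[OF hol_on_continuous[OF \<Psi>]]) (use XV in auto)
  have H: "(\<lambda>\<zeta>. fst (\<Psi> (X (upd x i \<zeta>))) $ j) holomorphic_on ball 0 r"
    "(\<lambda>\<zeta>. snd (\<Psi> (X (upd x i \<zeta>)))) holomorphic_on ball 0 r" if "x \<in> polydisc r" for x i j
    by (rule holomorphic_curve_compose[where \<tau>="\<lambda>x. x" and V=V and X="\<lambda>\<zeta>. X (upd x i \<zeta>)", OF _ \<Psi> open_ball],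
        use X that in \<open>auto simp: sephol_def intro: XV upd_in_polydisc\<close>)+
  show "sephol r (\<lambda>x. fst (\<Psi> (X x)) $ j)"
    using H C unfolding sephol_def
    by (auto intro!: bounded_linear.continuous_on[OF bounded_linear_vec_nth] continuous_on_fst)
  show "sephol r (\<lambda>x. snd (\<Psi> (X x)))"
    using H C unfolding sephol_def by (auto intro!: continuous_on_snd)
qed

lemma eventually_polydisc:
  fixes Q :: "complex^'m::finite \<Rightarrow> bool"
  assumes "\<forall>\<^sub>F x in nhds 0. Q x"
  obtains r where "r > 0" "\<And>x. x \<in> polydisc r \<Longrightarrow> Q x"
proof -
  obtain d where d: "d > 0" "\<And>x. norm x < d \<Longrightarrow> Q x"
    using assms unfolding eventually_nhds_metric by auto
  define r where "r = d / real CARD('m)"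
  have "norm x < d" if "x \<in> polydisc r" for x :: "complex^'m"
  proof -
    have "norm x \<le> (\<Sum>i\<in>UNIV. norm (x $ i))" by (rule norm_le_sum_nth)
    also have "\<dots> < (\<Sum>i\<in>(UNIV::'m set). r)" using that by (intro sum_strict_mono) (auto simp: polydisc_def)
    also have "\<dots> = d" by (simp add: r_def)
    finally show ?thesis .
  qed
  then show ?thesis using d by (intro that[of r]) (auto simp: r_def)
qed

definition unemb :: "complex^('n::finite + bool) \<Rightarrow> 'n csp" where
  "unemb x = (\<chi> j. x $ Inl j, x $ Inr False)"

lemma unemb_emb [simp]: "unemb (emb t z w) = (z, w)"
  by (simp add: unemb_def vec_eq_iff)

lemma tendsto_unemb: "(unemb \<longlongrightarrow> 0) (nhds (0 :: complex^('n::finite + bool)))"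
proof -
  have "((\<lambda>x :: complex^('n + bool). x $ k) \<longlongrightarrow> 0 $ k) (nhds 0)" for k
    by (rule tendsto_vec_nth) (simp add: filterlim_ident)
  then have n: "((\<lambda>x :: complex^('n + bool). x $ k) \<longlongrightarrow> 0) (nhds 0)" for k by simp
  have "((\<lambda>x :: complex^('n + bool). \<chi> j. x $ Inl j) \<longlongrightarrow> 0) (nhds 0)"
    by (rule vec_tendstoI) (simp add: n)
  from tendsto_Pair[OF this n] show ?thesis unfolding unemb_def[abs_def] zero_prod_def .
qed

lemma sephol_unemb: "sephol r (\<lambda>x. fst (unemb x) $ j)" "sephol r (\<lambda>x. snd (unemb x))"
  by (simp_all add: unemb_def sephol_nth)

text \<open>The last component of the map vanishes on \<open>w = 0\<close> by
  \<open>segre_invariance\<close>, so its Hadamard quotient in \<open>w\<close> exhibits it as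
  \<open>w\<close> times a holomorphic factor.\<close>

lemma segre_quotient:
  fixes P P' :: "complex^'n::finite \<Rightarrow> real"
  assumes P: "bipoly Q (\<lambda>z. complex_of_real (P z))" "\<forall>\<alpha> \<beta>. Q \<alpha> \<beta> \<longrightarrow> \<beta> \<noteq> (\<lambda>_. 0)"
    and P': "bipoly Q' (\<lambda>z. complex_of_real (P' z))" "\<forall>\<alpha> \<beta>. Q' \<alpha> \<beta> \<longrightarrow> \<beta> \<noteq> (\<lambda>_. 0)"
    and \<Psi>: "hol_on V \<Psi>" "0 \<in> V" "\<Psi> 0 = 0"
    and map: "\<And>x. x \<in> V \<Longrightarrow> x \<in> model_hypersurface P \<Longrightarrow> \<Psi> x \<in> model_hypersurface P'"
  obtains \<rho> e where "\<rho> > 0" "sephol \<rho> e"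
    "\<And>z w. emb 0 z w \<in> polydisc \<rho> \<Longrightarrow> (z, w) \<in> V \<and> snd (\<Psi> (z, w)) = w * e (emb 0 z w)"
proof -
  obtain d where d: "d > 0" "\<And>z. norm z < d \<Longrightarrow> (z, 0) \<in> V \<and> snd (\<Psi> (z, 0)) = 0"
    using segre_invariance[OF P P' \<Psi> map] by blast
  have "open V" using \<Psi>(1) by (simp add: hol_on_def)
  then have "\<forall>\<^sub>F x in nhds 0. unemb x \<in> V \<and> unemb x \<in> ball 0 d"
    using topological_tendstoD[OF tendsto_unemb, of V] topological_tendstoD[OF tendsto_unemb, of "ball 0 d"] \<Psi>(2) d(1)
    by (intro eventually_conj) auto
  then obtain r where r: "r > 0" "\<And>x. x \<in> polydisc r \<Longrightarrow> unemb x \<in> V \<and> unemb x \<in> ball 0 d"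
    by (rule eventually_polydisc) blast
  have s: "sephol r (\<lambda>x. snd (\<Psi> (unemb x)))"
    by (rule sephol_compose[OF \<Psi>(1) _ sephol_unemb]) (use r in auto)
  have "0 < r / 2" "r / 2 < r" using r(1) by auto
  from hadamard_quotient[OF s this, of "Inr False"]
  obtain e where e: "sephol (r/2) e" "\<And>x. x \<in> polydisc (r/2) \<Longrightarrow>
     snd (\<Psi> (unemb x)) = snd (\<Psi> (unemb (upd x (Inr False) 0))) + x $ Inr False * e x" by blast
  show thesis
  proof (rule that)
    show "r / 2 > 0" using r by simp
    show "sephol (r/2) e" by fact
    fix z :: "complex^'n" and w assume x: "emb 0 z w \<in> polydisc (r/2)"
    then have x': "emb 0 z w \<in> polydisc r" using polydisc_mono[of "r/2" r] r(1) by auto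
    have "norm z \<le> norm (z, w)" by (rule norm_fst_le)
    then have "norm z < d" using r(2)[OF x'] by simp
    then show "(z, w) \<in> V \<and> snd (\<Psi> (z, w)) = w * e (emb 0 z w)"
      using r(2)[OF x'] d(2) e(2)[OF x] by (simp add: upd_emb)
  qed
qed

lemma (in poly_model) balanced_euler:
  assumes "balanced P"
  obtains \<Lambda> where "\<And>z. dhol (euler \<Lambda>) p z = p z"
proof -
  obtain \<Lambda> A where A: "poly_rep A P" "\<And>\<alpha> \<beta>. A \<alpha> \<beta> \<noteq> 0 \<Longrightarrow> wlen \<Lambda> \<alpha> = 1 \<and> wlen \<Lambda> \<beta> = 1"
    using assms unfolding balanced_def by blast
  have "bipoly (\<lambda>\<alpha> \<beta>. wlen \<Lambda> \<beta> = 1 \<and> wlen \<Lambda> \<alpha> = 1) p"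
    unfolding p_def[abs_def] by (rule poly_rep_imp_bipoly[OF A(1)]) (use A(2) in auto)
  from dhol_euler[OF this] have "dhol (euler \<Lambda>) p z = p z" for z by simp
  then show thesis by (rule that)
qed

text \<open>With a Hadamard quotient as \<open>g\<close>, this identifies a derivative at time 0
  with the value of a function already known to be holomorphic.\<close>

lemma DERIV_0_eq_limit:
  fixes f g :: "'a::real_normed_field \<Rightarrow> 'a"
  assumes "(f has_field_derivative D) (at 0)" "r > 0" "\<And>t. norm t < r \<Longrightarrow> f t = k + t * g t" "(g \<longlongrightarrow> l) (at 0)"
  shows "D = l"
proof -
  have "((\<lambda>t. (f t - f 0) / (t - 0)) \<longlongrightarrow> D) (at 0)"
    using assms(1) unfolding has_field_derivative_iff .
  moreover have "\<forall>\<^sub>F t in at 0. (f t - f 0) / (t - 0) = g t"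
    unfolding eventually_at using assms(2,3) by (intro exI[of _ r]) auto
  ultimately have "(g \<longlongrightarrow> D) (at 0)" by (rule Lim_transform_eventually)
  from LIM_unique[OF this assms(4)] show ?thesis .
qed

context poly_model
begin

lemma bipoly_P: "bipoly mixed (\<lambda>z. complex_of_real (P z))" "\<forall>\<alpha> \<beta>. mixed \<alpha> \<beta> \<longrightarrow> \<beta> \<noteq> (\<lambda>_. 0)"
  using bipoly_p by (auto simp: p_def[abs_def] mixed_def)

text \<open>The vector field with components \<open>w \<Lambda>\<^sub>j z\<^sub>j / 2\<close> and \<open>w\<^sup>2 / 2\<close> is tangent to a balanced
  hypersurface; this curve in the hypersurface has its value at \<open>(z, w)\<close> as velocity.\<close>

lemma balanced_tangent_curve:
  assumes \<Lambda>: "\<And>z. dhol (euler \<Lambda>) p z = p z" and w: "Im w = P z"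
  defines "a \<equiv> w *s ((1/2) *s euler \<Lambda> z)" and "b \<equiv> w * (w / 2)"
  defines "\<gamma> \<equiv> \<lambda>\<tau>::real. (z + \<tau> *\<^sub>R a, Complex (Re w + \<tau> * Re b) (P (z + \<tau> *\<^sub>R a)))"
  shows "(\<gamma> has_vector_derivative (a, b)) (at 0)"
proof -
  have e: "dhol (\<lambda>_. euler \<Lambda> z) p z = p z"
    using \<Lambda>[of z] dhol_cong[of "\<lambda>_. euler \<Lambda> z" z "euler \<Lambda>" p] by simp
  have D: "dhol (\<lambda>_. a) p z = of_real (P z / 2) * w"
    unfolding a_def dhol_fscale e by (simp add: p_def)
  then have Ib: "2 * Re (dhol (\<lambda>_. a) p z) = Im b"
    by (simp only:) (simp add: b_def w)
  have 1: "((\<lambda>\<tau>::real. z + \<tau> *\<^sub>R a) has_vector_derivative a) (at 0)"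
    by (auto intro!: derivative_eq_intros)
  have "(P has_derivative (\<lambda>v. 2 * Re (dhol (\<lambda>_. v) p z))) (at (z + 0 *\<^sub>R a))"
    using bipoly_real_derivative(1)[OF bipoly_P(1), of z] by (simp add: p_def[abs_def])
  from has_derivative_compose[OF 1[unfolded has_vector_derivative_def] this]
  have "((\<lambda>\<tau>. P (z + \<tau> *\<^sub>R a)) has_derivative (\<lambda>h. 2 * Re (dhol (\<lambda>_. h *\<^sub>R a) p z))) (at 0)" .
  moreover have "2 * Re (dhol (\<lambda>_. h *\<^sub>R a) p z) = h *\<^sub>R Im b" for h
  proof -
    have "dhol (\<lambda>_. h *\<^sub>R a) p z = of_real h * dhol (\<lambda>_. a) p z"
      unfolding dhol_fscale[symmetric] by (simp add: scaleR_vec_def scaleR_conv_of_real[where 'a=complex] vector_scalar_mult_def)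
    then show ?thesis using Ib by (simp add: algebra_simps)
  qed
  ultimately have 2: "((\<lambda>\<tau>. P (z + \<tau> *\<^sub>R a)) has_vector_derivative Im b) (at 0)"
    by (simp add: has_vector_derivative_def)
  have "((\<lambda>\<tau>. Re w + \<tau> * Re b) has_vector_derivative Re b) (at 0)"
    by (auto intro!: derivative_eq_intros simp: has_vector_derivative_def)
  from has_vector_derivative_add[OF bounded_linear.has_vector_derivative[OF bounded_linear_of_real this]
      bounded_linear.has_vector_derivative[OF bounded_linear_compose[OF bounded_linear_mult_right[of \<i>] bounded_linear_of_real] 2]]
  have "((\<lambda>\<tau>. Complex (Re w + \<tau> * Re b) (P (z + \<tau> *\<^sub>R a))) has_vector_derivative b) (at 0)"
    unfolding Complex_eq[symmetric] by simp
  from has_vector_derivative_Pair[OF 1 this]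
  show "(\<gamma> has_vector_derivative (a, b)) (at 0)" by (simp add: \<gamma>_def)
qed


text \<open>The pulled back field is the derivative at \<open>t = 0\<close> of \<open>\<Theta> \<circ> S t \<circ> \<Psi>\<close>, where \<open>\<Theta>\<close> inverts \<open>\<Psi>\<close>. It is
  written as a Hadamard quotient in \<open>t\<close>, so that its holomorphy comes for free.\<close>

lemma pulled_back_field:
  assumes P': "poly_model \<mu> P'" "balanced P'" and \<Psi>: "model_in_coords P \<Psi> P'"
  obtains r c E F G where "r > 0" "sephol r E" "E 0 = of_real c" "c \<noteq> 0" "sephol r G" "G 0 = 1/2"
    "\<And>j. sephol r (F j)"
    "\<And>y w. emb 0 y w \<in> polydisc r \<Longrightarrow> Im w = P y \<Longrightarrow>
       Im ((w * E (emb 0 y w)) * (w * G (emb 0 y w))) =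
       2 * Re (dhol (\<lambda>_. (w * E (emb 0 y w)) *s (\<chi> j. F j (emb 0 y w))) p y)"
proof -
  interpret B: poly_model \<mu> P' by (rule P'(1))
  obtain \<Lambda> where \<Lambda>: "\<And>z. dhol (euler \<Lambda>) B.p z = B.p z" using B.balanced_euler[OF P'(2)] by blast
  obtain V where V: "0 \<in> V" "\<Psi> 0 = 0" "hol_on V \<Psi>" "inj_on \<Psi> V" "hol_on (\<Psi> ` V) (inv_into V \<Psi>)"
    and iff: "\<And>x. x \<in> V \<Longrightarrow> x \<in> model_hypersurface P \<longleftrightarrow> \<Psi> x \<in> model_hypersurface P'"
    using \<Psi> unfolding model_in_coords_def local_coords_def by blast
  define V' where "V' = \<Psi> ` V"
  define \<Theta> where "\<Theta> = inv_into V \<Psi>"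
  have \<Theta>: "hol_on V' \<Theta>" using V(5) by (simp add: V'_def \<Theta>_def)
  have \<Theta>\<Psi>: "\<Theta> (\<Psi> x) = x" and \<Psi>V: "\<Psi> x \<in> V'" if "x \<in> V" for x
    using V(4) that by (simp_all add: \<Theta>_def V'_def)
  have \<Theta>V: "\<Theta> y \<in> V" and \<Psi>\<Theta>: "\<Psi> (\<Theta> y) = y" if "y \<in> V'" for y
    using that by (auto simp: \<Theta>_def V'_def inv_into_into f_inv_into_f)
  have V'0: "0 \<in> V'" "\<Theta> 0 = 0" using V(1,2) \<Psi>V[of 0] \<Theta>\<Psi>[of 0] by simp_all
  have op: "open V" "open V'" using V(3) \<Theta> by (simp_all add: hol_on_def)
  have \<Theta>M: "\<Theta> y \<in> model_hypersurface P" if "y \<in> V'" "y \<in> model_hypersurface P'" for y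
    using iff[OF \<Theta>V[OF that(1)]] \<Psi>\<Theta>[OF that(1)] that(2) by simp
  \<comment> \<open>Both \<open>\<Psi>\<close> and its inverse preserve \<open>w = 0\<close>; the
    values at 0 of the two quotients by \<open>w\<close> turn out to be inverse to each
    other.\<close>
  obtain \<rho> e where e: "\<rho> > 0" "sephol \<rho> e"
    "\<And>z w. emb 0 z w \<in> polydisc \<rho> \<Longrightarrow> (z, w) \<in> V \<and> snd (\<Psi> (z, w)) = w * e (emb 0 z w)"
    using segre_quotient[OF bipoly_P B.bipoly_P V(3,1,2)] iff by blast
  obtain \<rho>' e' where e': "\<rho>' > 0" "sephol \<rho>' e'"
    "\<And>z w. emb 0 z w \<in> polydisc \<rho>' \<Longrightarrow> (z, w) \<in> V' \<and> snd (\<Theta> (z, w)) = w * e' (emb 0 z w)"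
    using segre_quotient[OF B.bipoly_P bipoly_P \<Theta> V'0 \<Theta>M] by blast
  \<comment> \<open>The tangent field of the balanced hypersurface is its last coordinate times the
    velocity of \<open>S t\<close> at \<open>t = 0\<close>. This factor is split off here and
    returns as \<open>w * E\<close>.\<close>
  define S :: "complex \<Rightarrow> 'n csp \<Rightarrow> 'n csp" where "S t y = (fst y + (t / 2) *s euler \<Lambda> (fst y), snd y + t / 2 * snd y)" for t y
  define X where "X x = S (x $ Inr True) (\<Psi> (unemb x))" for x
  have S0: "S 0 y = y" for y by (simp add: S_def)
  have \<Psi>c: "isCont \<Psi> 0" using hol_on_continuous[OF V(3)] op(1) V(1) continuous_on_eq_continuous_at by blast
  have \<Psi>0: "((\<lambda>x. \<Psi> (unemb x)) \<longlongrightarrow> 0) (nhds 0)"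
    using isCont_tendsto_compose[OF \<Psi>c tendsto_unemb] V(2) by simp
  have X0: "(X \<longlongrightarrow> 0) (nhds 0)"
  proof -
    have t: "((\<lambda>x :: complex^('n + bool). x $ Inr True) \<longlongrightarrow> (0 :: complex^('n + bool)) $ Inr True) (nhds 0)"
      by (rule tendsto_vec_nth) (simp add: filterlim_ident)
    have z: "((\<lambda>x. fst (\<Psi> (unemb x)) $ j) \<longlongrightarrow> 0 $ j) (nhds 0)" for j
      using tendsto_vec_nth[OF tendsto_fst[OF \<Psi>0]] by (simp add: zero_prod_def)
    have w: "((\<lambda>x. snd (\<Psi> (unemb x))) \<longlongrightarrow> 0) (nhds 0)"
      using tendsto_snd[OF \<Psi>0] by simp
    have "((\<lambda>x. fst (X x) $ j) \<longlongrightarrow> 0 $ j + (0 :: complex^('n + bool)) $ Inr True / 2 * (of_real (\<Lambda> j) * 0 $ j)) (nhds 0)" for j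
      unfolding X_def S_def euler_def fst_conv vector_add_component vector_smult_component vec_lambda_beta
      by (intro tendsto_intros t z) simp
    then have "((\<lambda>x. fst (X x)) \<longlongrightarrow> 0) (nhds 0)" by (intro vec_tendstoI) simp
    moreover have "((\<lambda>x. snd (X x)) \<longlongrightarrow> 0 + (0 :: complex^('n + bool)) $ Inr True / 2 * 0) (nhds 0)"
      unfolding X_def S_def snd_conv by (intro tendsto_intros t w) simp
    ultimately show ?thesis using tendsto_Pair[of "\<lambda>x. fst (X x)" 0 _ "\<lambda>x. snd (X x)" 0] by (simp add: zero_prod_def)
  qed
  have ev: "\<forall>\<^sub>F x in nhds 0. unemb x \<in> V \<and> X x \<in> V' \<and> emb 0 (fst (X x)) (snd (X x)) \<in> polydisc \<rho>'"
  proof (intro eventually_conj)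
    show "\<forall>\<^sub>F x in nhds 0. unemb x \<in> V" by (rule topological_tendstoD[OF tendsto_unemb op(1) V(1)])
    show "\<forall>\<^sub>F x in nhds 0. X x \<in> V'" by (rule topological_tendstoD[OF X0 op(2) V'0(1)])
    have "((\<lambda>x. emb 0 (fst (X x)) (snd (X x))) \<longlongrightarrow> emb 0 0 0) (nhds 0)"
      using tendsto_fst[OF X0] tendsto_snd[OF X0] by (intro tendsto_emb) simp_all
    then show "\<forall>\<^sub>F x in nhds 0. emb 0 (fst (X x)) (snd (X x)) \<in> polydisc \<rho>'"
      unfolding emb_0 by (rule topological_tendstoD[OF _ open_polydisc zero_in_polydisc[OF e'(1)]])
  qed
  obtain r0 where r0: "r0 > 0" "\<And>x. x \<in> polydisc r0 \<Longrightarrow> unemb x \<in> V \<and> X x \<in> V' \<and> emb 0 (fst (X x)) (snd (X x)) \<in> polydisc \<rho>'"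
    using ev by (rule eventually_polydisc) blast
  define r1 where "r1 = min r0 \<rho>"
  have r1: "r1 > 0" "r1 \<le> r0" "r1 \<le> \<rho>" using r0(1) e(1) by (auto simp: r1_def)
  note sub0 = subsetD[OF polydisc_mono[OF r1(2)]] and sub\<rho> = subsetD[OF polydisc_mono[OF r1(3)]]
  have s\<Psi>: "sephol r1 (\<lambda>x. fst (\<Psi> (unemb x)) $ j)" "sephol r1 (\<lambda>x. snd (\<Psi> (unemb x)))" for j
    by (rule sephol_compose[OF V(3) _ sephol_unemb], use r0(2) sub0 in blast)+
  have sX: "sephol r1 (\<lambda>x. fst (X x) $ j)" "sephol r1 (\<lambda>x. snd (X x))" for j
    unfolding X_def S_def euler_def fst_conv snd_conv vector_add_component vector_smult_component vec_lambda_beta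
      divide_inverse[of _ "2::complex"]
    by (intro sephol_add sephol_mult sephol_const sephol_nth s\<Psi>)+
  have s\<Theta>: "sephol r1 (\<lambda>x. fst (\<Theta> (X x)) $ j)" "sephol r1 (\<lambda>x. snd (\<Theta> (X x)))" for j
    by (rule sephol_compose[OF \<Theta> _ sX], use r0(2) sub0 in blast)+
  have \<Theta>X0: "\<Theta> (X (emb 0 z w)) = (z, w)" if "emb 0 z w \<in> polydisc r1" for z w
    using r0(2)[OF sub0[OF that]] by (simp add: X_def S0 \<Theta>\<Psi>)
  \<comment> \<open>The factor \<open>w\<close> is present for every \<open>t\<close>, which allows
    dividing by \<open>w\<close> first and by \<open>t\<close> afterwards.\<close>
  have snd\<Theta>: "snd (\<Theta> (X (emb t z w))) = (1 + t / 2) * (w * e (emb 0 z w)) * e' (emb 0 (fst (X (emb t z w))) (snd (X (emb t z w))))"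
    if "emb t z w \<in> polydisc r1" for t z w
  proof -
    have "emb 0 z w \<in> polydisc r1" using that r1(1) by (auto simp: emb_in_polydisc)
    then have "snd (X (emb t z w)) = (1 + t / 2) * (w * e (emb 0 z w))"
      using e(3)[OF sub\<rho>] by (simp add: X_def S_def algebra_simps)
    moreover have "snd (\<Theta> (X (emb t z w))) = snd (X (emb t z w)) * e' (emb 0 (fst (X (emb t z w))) (snd (X (emb t z w))))"
      using e'(3)[of "fst (X (emb t z w))" "snd (X (emb t z w))"] r0(2)[OF sub0[OF that]] by (simp only: prod.collapse)
    ultimately show ?thesis by (simp only:)
  qed
  define r2 where "r2 = r1 / 2"
  define r where "r = r2 / 2"
  have r: "0 < r" "r < r2" "r < r1" "0 < r2" "r2 < r1" using r1(1) by (auto simp: r_def r2_def)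
  note sub1 = subsetD[OF polydisc_mono[OF less_imp_le[OF r(3)]]]
    and sub2 = subsetD[OF polydisc_mono[OF less_imp_le[OF r(2)]]]
    and sub21 = subsetD[OF polydisc_mono[OF less_imp_le[OF r(5)]]]
  have "\<exists>q. sephol r2 q \<and> (\<forall>t z w. emb t z w \<in> polydisc r2 \<longrightarrow> snd (\<Theta> (X (emb t z w))) = w * q (emb t z w))"
  proof -
    obtain q where q: "sephol r2 q" "\<And>x. x \<in> polydisc r2 \<Longrightarrow>
        snd (\<Theta> (X x)) = snd (\<Theta> (X (upd x (Inr False) 0))) + x $ Inr False * q x"
      using hadamard_quotient[OF s\<Theta>(2) r(4,5)] by blast
    have "snd (\<Theta> (X (emb t z w))) = w * q (emb t z w)" if x: "emb t z w \<in> polydisc r2" for t z w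
    proof -
      have "emb t z 0 \<in> polydisc r1" using sub21[OF x] r1(1) by (auto simp: emb_in_polydisc)
      then show ?thesis using q(2)[OF x] by (simp add: upd_emb snd\<Theta>)
    qed
    with q(1) show ?thesis by blast
  qed
  then obtain q where q: "sephol r2 q" "\<And>t z w. emb t z w \<in> polydisc r2 \<Longrightarrow> snd (\<Theta> (X (emb t z w))) = w * q (emb t z w)"
    by blast
  obtain G where G: "sephol r G" "\<And>x. x \<in> polydisc r \<Longrightarrow> q x = q (upd x (Inr True) 0) + x $ Inr True * G x"
    using hadamard_quotient[OF q(1) r(1,2)] by blast
  have "\<forall>j. \<exists>f. sephol r f \<and> (\<forall>x\<in>polydisc r. fst (\<Theta> (X x)) $ j = fst (\<Theta> (X (upd x (Inr True) 0))) $ j + x $ Inr True * f x)"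
    using hadamard_quotient[OF s\<Theta>(1) r(1,3)] by blast
  then obtain F where F: "\<And>j. sephol r (F j)" "\<And>j x. x \<in> polydisc r \<Longrightarrow>
      fst (\<Theta> (X x)) $ j = fst (\<Theta> (X (upd x (Inr True) 0))) $ j + x $ Inr True * F j x"
    using choice[of "\<lambda>j f. sephol r f \<and> (\<forall>x\<in>polydisc r. fst (\<Theta> (X x)) $ j = fst (\<Theta> (X (upd x (Inr True) 0))) $ j + x $ Inr True * f x)"] by blast
  have emb_t: "emb t 0 w \<in> polydisc d \<longleftrightarrow> norm t < d \<and> norm w < d" if "d > 0" for t w d
    using that by (simp add: emb_in_polydisc)
  have ew: "((\<lambda>w. emb t 0 w) \<longlongrightarrow> emb t 0 0) (at 0)" for t
    by (intro tendsto_emb tendsto_intros)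
  have ecw: "((\<lambda>w. e (emb 0 0 w)) \<longlongrightarrow> e 0) (at 0)"
    using isCont_tendsto_compose[OF sephol_isCont[OF e(2) zero_in_polydisc[OF e(1)]]] ew[of 0] by (simp add: emb_0)
  have e'cw: "((\<lambda>w. e' (emb 0 (fst (X (emb t 0 w))) (snd (X (emb t 0 w))))) \<longlongrightarrow> e' 0) (at 0)" if t: "norm t < r2" for t
  proof -
    have x: "emb t 0 0 \<in> polydisc r1" using t r by (simp add: emb_t)
    have Xt0: "X (emb t 0 0) = 0" by (simp add: X_def S_def V(2) euler_def zero_prod_def[symmetric] vec_eq_iff prod_eq_iff)
    have "((\<lambda>w. fst (X (emb t 0 w)) $ j) \<longlongrightarrow> 0 $ j) (at 0)" for j
      using isCont_tendsto_compose[OF sephol_isCont[OF sX(1) x] ew] by (simp add: Xt0)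
    then have 1: "((\<lambda>w. fst (X (emb t 0 w))) \<longlongrightarrow> 0) (at 0)" by (rule vec_tendstoI)
    have 2: "((\<lambda>w. snd (X (emb t 0 w))) \<longlongrightarrow> 0) (at 0)"
      using isCont_tendsto_compose[OF sephol_isCont[OF sX(2) x] ew] by (simp add: Xt0)
    have "((\<lambda>w. emb 0 (fst (X (emb t 0 w))) (snd (X (emb t 0 w)))) \<longlongrightarrow> 0) (at 0)"
      unfolding emb_0[symmetric] by (intro tendsto_emb 1 2 tendsto_const)
    then show ?thesis using isCont_tendsto_compose[OF sephol_isCont[OF e'(2) zero_in_polydisc[OF e'(1)]]] by blast
  qed
  \<comment> \<open>The formula for \<open>q\<close> results from cancelling \<open>w\<close>, so
    its value at \<open>w = 0\<close> is reached as a limit.\<close>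
  have qt: "q (emb t 0 0) = (1 + t / 2) * e 0 * e' 0" if t: "norm t < r2" for t
  proof (rule LIM_unique)
    have x: "emb t 0 0 \<in> polydisc r2" using t r by (simp add: emb_t)
    show "((\<lambda>w. q (emb t 0 w)) \<longlongrightarrow> q (emb t 0 0)) (at 0)"
      by (rule isCont_tendsto_compose[OF sephol_isCont[OF q(1) x] ew])
    have "((\<lambda>w. (1 + t / 2) * e (emb 0 0 w) * e' (emb 0 (fst (X (emb t 0 w))) (snd (X (emb t 0 w))))) \<longlongrightarrow> (1 + t / 2) * e 0 * e' 0) (at 0)"
      by (intro tendsto_intros ecw e'cw[OF t])
    moreover have "\<forall>\<^sub>F w in at 0. (1 + t / 2) * e (emb 0 0 w) * e' (emb 0 (fst (X (emb t 0 w))) (snd (X (emb t 0 w)))) = q (emb t 0 w)"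
      unfolding eventually_at
    proof (intro exI[of _ r2] conjI ballI impI r(4))
      fix w :: complex assume "w \<noteq> 0 \<and> dist w 0 < r2"
      then have w: "w \<noteq> 0" "emb t 0 w \<in> polydisc r2" using t r by (simp_all add: emb_t)
      from q(2)[OF w(2)] snd\<Theta>[OF sub21[OF w(2)]] w(1)
      show "(1 + t / 2) * e (emb 0 0 w) * e' (emb 0 (fst (X (emb t 0 w))) (snd (X (emb t 0 w)))) = q (emb t 0 w)"
        by (simp add: mult_ac)
    qed
    ultimately show "((\<lambda>w. q (emb t 0 w)) \<longlongrightarrow> (1 + t / 2) * e 0 * e' 0) (at 0)" by (rule Lim_transform_eventually)
  qed
  \<comment> \<open>At \<open>t = 0\<close> the map is the identity, hence \<open>q\<close> equals 1
    there.\<close>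
  have ee: "e 0 * e' 0 = 1"
  proof (rule LIM_unique)
    have "((\<lambda>w. q (emb 0 0 w)) \<longlongrightarrow> q (emb 0 0 0)) (at 0)"
      by (rule isCont_tendsto_compose[OF sephol_isCont[OF q(1)] ew]) (use r in \<open>simp add: emb_t\<close>)
    then show "((\<lambda>w. q (emb 0 0 w)) \<longlongrightarrow> e 0 * e' 0) (at 0)" using qt[of 0] r by simp
    have "\<forall>\<^sub>F w in at 0. 1 = q (emb 0 0 w)"
      unfolding eventually_at
    proof (intro exI[of _ r2] conjI ballI impI r(4))
      fix w :: complex assume "w \<noteq> 0 \<and> dist w 0 < r2"
      then have w: "w \<noteq> 0" "emb 0 0 w \<in> polydisc r2" using r by (simp_all add: emb_t)
      from q(2)[OF w(2)] \<Theta>X0[OF sub21[OF w(2)]] w(1) show "1 = q (emb 0 0 w)" by simp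
    qed
    then show "((\<lambda>w. q (emb 0 0 w)) \<longlongrightarrow> 1) (at 0)" by (rule Lim_transform_eventually[OF tendsto_const])
  qed
  \<comment> \<open>On this axis \<open>q (emb t 0 0) = 1 + t / 2\<close>, and the quotient of the
    increment by \<open>t\<close> is constant.\<close>
  have G0: "G 0 = 1/2"
  proof (rule LIM_unique)
    have "((\<lambda>t. emb t 0 0) \<longlongrightarrow> emb 0 0 0) (at 0)" by (intro tendsto_emb tendsto_intros)
    then show "((\<lambda>t. G (emb t 0 0)) \<longlongrightarrow> G 0) (at 0)"
      unfolding emb_0 by (rule isCont_tendsto_compose[OF sephol_isCont[OF G(1) zero_in_polydisc[OF r(1)]]])
    have "\<forall>\<^sub>F t in at 0. 1/2 = G (emb t 0 0)"
      unfolding eventually_at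
    proof (intro exI[of _ r] conjI ballI impI r(1))
      fix t :: complex assume "t \<noteq> 0 \<and> dist t 0 < r"
      then have t: "t \<noteq> 0" "norm t < r2" "norm t < r" "emb t 0 0 \<in> polydisc r" using r by (simp_all add: emb_t)
      have "q (emb t 0 0) = 1 + t / 2" "q (emb 0 0 0) = 1" using qt[OF t(2)] qt[of 0] ee r by (simp_all add: mult.assoc)
      with G(2)[OF t(4)] t(1) show "1/2 = G (emb t 0 0)" by (simp add: upd_emb field_simps)
    qed
    then show "((\<lambda>t. G (emb t 0 0)) \<longlongrightarrow> 1/2) (at 0)" by (rule Lim_transform_eventually[OF tendsto_const])
  qed
  \<comment> \<open>The points \<open>(0, u)\<close> with real \<open>u\<close> lie in the model, as
    \<open>P 0 = 0\<close>. On their images \<open>Im w' = P'(z')\<close>, and the right side has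
    derivative 0 at the origin because the differential of \<open>P'\<close> vanishes there. The
    derivative of the left side is \<open>Im (e 0)\<close>.\<close>
  have Ime: "Im (e 0) = 0"
  proof -
    obtain D where D: "(\<Psi> has_derivative D) (at 0)" using V(1,3) unfolding hol_on_def by blast
    have 1: "((\<lambda>u::real. (0 :: complex^'n, complex_of_real u)) has_derivative (\<lambda>h. (0, of_real h))) (at 0)"
      by (intro derivative_intros)
    have 2: "((\<lambda>u::real. fst (\<Psi> (0, of_real u))) has_derivative (\<lambda>h. fst (D (0, of_real h)))) (at 0)"
      by (rule has_derivative_fst[OF has_derivative_compose[OF 1]]) (use D in \<open>simp add: zero_prod_def\<close>)
    have 3: "(P' has_derivative (\<lambda>v. 2 * Re (dhol (\<lambda>_. v) B.p 0))) (at 0)"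
      using bipoly_real_derivative(1)[OF B.bipoly_P(1), of 0] by (simp add: B.p_def[abs_def])
    have "((\<lambda>u::real. P' (fst (\<Psi> (0, of_real u)))) has_derivative (\<lambda>h. 0)) (at 0)"
      using has_derivative_compose[OF 2, of P' "\<lambda>v. 2 * Re (dhol (\<lambda>_. v) B.p 0)"] 3 V(2)
      by (simp add: B.dhol_p_0 flip: zero_prod_def)
    then have A1: "((\<lambda>u::real. P' (fst (\<Psi> (0, of_real u)))) has_field_derivative 0) (at 0)"
      by (simp add: has_field_derivative_def lambda_zero)
    have A2: "P' (fst (\<Psi> (0, of_real u))) = 0 + u * Im (e (emb 0 0 (of_real u)))" if u: "norm u < \<rho>" for u
    proof -
      have "emb 0 0 (complex_of_real u) \<in> polydisc \<rho>" using u e(1) by (simp add: emb_in_polydisc)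
      from e(3)[OF this] have x: "(0, of_real u) \<in> V" "snd (\<Psi> (0, of_real u)) = of_real u * e (emb 0 0 (of_real u))" by blast+
      have "(0, complex_of_real u) \<in> model_hypersurface P" by (simp add: model_hypersurface_def P_0)
      then have "\<Psi> (0, of_real u) \<in> model_hypersurface P'" using iff[OF x(1)] by simp
      then show ?thesis by (simp add: model_hypersurface_def x(2))
    qed
    have A3: "((\<lambda>u::real. Im (e (emb 0 0 (of_real u)))) \<longlongrightarrow> Im (e 0)) (at 0)"
    proof -
      have "((\<lambda>u. emb 0 0 (complex_of_real u)) \<longlongrightarrow> emb 0 0 (of_real 0)) (at 0)" by (intro tendsto_emb tendsto_intros)
      then have "((\<lambda>u. emb 0 0 (complex_of_real u)) \<longlongrightarrow> 0) (at 0)" by (simp add: emb_0)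
      from isCont_tendsto_compose[OF sephol_isCont[OF e(2) zero_in_polydisc[OF e(1)]] this] show ?thesis by (rule tendsto_Im)
    qed
    show ?thesis using DERIV_0_eq_limit[OF A1 e(1) A2 A3] by simp
  qed
  show thesis
  proof (rule that[of r e "Re (e 0)" G F])
    show "r > 0" by fact
    show "sephol r e" using sephol_subset[OF e(2), of r] r(3) r1(3) by simp
    show "e 0 = of_real (Re (e 0))" using Ime by (simp add: complex_eq_iff)
    then show "Re (e 0) \<noteq> 0" using ee by auto
    show "sephol r G" "G 0 = 1/2" "\<And>j. sephol r (F j)" by (rule G(1) G0 F(1))+
    fix y w assume x: "emb 0 y w \<in> polydisc r" and M: "Im w = P y"
    have x\<rho>: "emb 0 y w \<in> polydisc \<rho>" using sub\<rho>[OF sub1[OF x]] .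
    have yV: "(y, w) \<in> V" and sw: "snd (\<Psi> (y, w)) = w * e (emb 0 y w)" using e(3)[OF x\<rho>] by auto
    define z' where "z' = fst (\<Psi> (y, w))"
    define w' where "w' = w * e (emb 0 y w)"
    have \<Psi>y: "\<Psi> (y, w) = (z', w')" by (simp add: z'_def w'_def prod_eq_iff sw)
    have M': "Im w' = P' z'" using iff[OF yV] M \<Psi>y by (simp add: model_hypersurface_def)
    have V'y: "(z', w') \<in> V'" and \<Theta>y: "\<Theta> (z', w') = (y, w)" using \<Psi>V[OF yV] \<Theta>\<Psi>[OF yV] \<Psi>y by simp_all
    obtain D where D: "(\<Theta> has_derivative D) (at (z', w'))" "\<And>c v. D (cscale c v) = cscale c (D v)"
      using \<Theta> V'y unfolding hol_on_def by blast
    \<comment> \<open>Image of the velocity of \<open>S\<close> under the differential of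
      \<open>\<Theta>\<close>; complex linearity puts the factor \<open>w'\<close> back in
      front.\<close>
    define Z where "Z = D ((1/2) *s euler \<Lambda> z', w' / 2)"
    have ab: "D (w' *s ((1/2) *s euler \<Lambda> z'), w' * (w' / 2)) = cscale w' Z"
      unfolding Z_def D(2)[symmetric] by (simp add: cscale_def)
    define \<gamma> where "\<gamma> = (\<lambda>\<tau>::real. (z' + \<tau> *\<^sub>R (w' *s ((1/2) *s euler \<Lambda> z')),
        Complex (Re w' + \<tau> * Re (w' * (w' / 2))) (P' (z' + \<tau> *\<^sub>R (w' *s ((1/2) *s euler \<Lambda> z'))))))"
    have \<gamma>: "(\<gamma> has_vector_derivative (w' *s ((1/2) *s euler \<Lambda> z'), w' * (w' / 2))) (at 0)"
      "\<gamma> 0 = (z', w')" "\<gamma> \<tau> \<in> model_hypersurface P'" for \<tau>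
      using B.balanced_tangent_curve[OF \<Lambda> M'] by (simp_all add: \<gamma>_def model_hypersurface_def complex_eq_iff M')
    have "(\<Theta> has_derivative D) (at (\<gamma> 0))" using D(1) \<gamma>(2) by simp
    from has_derivative_compose[OF \<gamma>(1)[unfolded has_vector_derivative_def] this]
    have d\<Theta>\<gamma>: "((\<lambda>\<tau>. \<Theta> (\<gamma> \<tau>)) has_derivative (\<lambda>h. D (h *\<^sub>R (w' *s ((1/2) *s euler \<Lambda> z'), w' * (w' / 2))))) (at 0)" .
    define L where "L v = Im (snd v) - 2 * Re (dhol (\<lambda>_. fst v) p y)" for v
    have "(model_defining P has_derivative L) (at (\<Theta> (\<gamma> 0)))"
      using model_defining_derivative[OF bipoly_P(1), of "(y, w)"] by (simp add: \<gamma>(2) \<Theta>y L_def[abs_def] p_def[abs_def])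
    from has_derivative_compose[OF d\<Theta>\<gamma> this]
    have "((\<lambda>\<tau>. model_defining P (\<Theta> (\<gamma> \<tau>))) has_derivative (\<lambda>h. L (D (h *\<^sub>R (w' *s ((1/2) *s euler \<Lambda> z'), w' * (w' / 2)))))) (at 0)" .
    \<comment> \<open>\<open>\<Theta>\<close> maps the curve \<open>\<gamma>\<close> into the model,
      so the defining function is 0 along the image and the pulled back field is tangent.\<close>
    moreover have "((\<lambda>\<tau>. model_defining P (\<Theta> (\<gamma> \<tau>))) has_derivative (\<lambda>h. 0)) (at 0)"
    proof (rule has_derivative_transform_eventually[OF has_derivative_const])
      have c\<gamma>: "(\<gamma> \<longlongrightarrow> \<gamma> 0) (nhds 0)"
        using has_vector_derivative_continuous[OF \<gamma>(1)] by (simp add: isCont_def tendsto_nhds_iff)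
      have "\<forall>\<^sub>F \<tau> in nhds 0. \<gamma> \<tau> \<in> V'" by (rule topological_tendstoD[OF c\<gamma> op(2)]) (simp add: \<gamma>(2) V'y)
      then have "\<forall>\<^sub>F \<tau> in nhds 0. 0 = model_defining P (\<Theta> (\<gamma> \<tau>))"
      proof eventually_elim
        case (elim \<tau>)
        from \<Theta>M[OF elim \<gamma>(3)] show ?case by (simp add: model_defining_def model_hypersurface_def)
      qed
      then show "\<forall>\<^sub>F \<tau> in at 0. 0 = model_defining P (\<Theta> (\<gamma> \<tau>))" "0 = model_defining P (\<Theta> (\<gamma> 0))"
        by (auto simp: eventually_nhds_conv_at)
    qed simp
    ultimately have "(\<lambda>h. L (D (h *\<^sub>R (w' *s ((1/2) *s euler \<Lambda> z'), w' * (w' / 2))))) = (\<lambda>h. 0)"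
      by (rule has_derivative_unique)
    from fun_cong[OF this, of 1] have LZ: "L (cscale w' Z) = 0" by (simp only: scaleR_one ab)
    have S': "((\<lambda>t. S t (z', w')) has_derivative (\<lambda>h. cscale h ((1/2) *s euler \<Lambda> z', w' / 2))) (at 0)"
    proof -
      have "((\<lambda>t. v + t / 2 * u) has_derivative (\<lambda>h. h * (1/2 * u))) (at 0)" for u v :: complex
        by (auto intro!: derivative_eq_intros)
      from this[of "z' $ _" "euler \<Lambda> z' $ _"] this[of w' w'] show ?thesis
        unfolding S_def cscale_def fst_conv snd_conv
        by (intro has_derivative_Pair has_derivative_cvec) simp_all
    qed
    have "(\<Theta> has_derivative D) (at (S 0 (z', w')))" using D(1) by (simp add: S0)
    from has_derivative_compose[OF S' this]
    have d\<Theta>: "((\<lambda>t. \<Theta> (S t (z', w'))) has_derivative (\<lambda>h. cscale h Z)) (at 0)" by (simp add: D(2) Z_def)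
    have SX: "S t (z', w') = X (emb t y w)" for t by (simp add: X_def \<Psi>y)
    have xt: "emb t y w \<in> polydisc r" if "norm t < r" for t using x that by (simp add: emb_in_polydisc)
    have et: "((\<lambda>t. emb t y w) \<longlongrightarrow> emb 0 y w) (at 0)" by (intro tendsto_emb tendsto_intros)
    have FZ: "fst Z $ j = F j (emb 0 y w)" for j
    proof (rule DERIV_0_eq_limit[OF _ r(1)])
      show "((\<lambda>t. fst (\<Theta> (S t (z', w'))) $ j) has_field_derivative fst Z $ j) (at 0)"
        using bounded_linear.has_derivative[OF bounded_linear_vec_nth has_derivative_fst[OF d\<Theta>], of j]
        by (simp add: has_field_derivative_def cscale_def mult_commute_abs)
      show "fst (\<Theta> (S t (z', w'))) $ j = y $ j + t * F j (emb t y w)" if "norm t < r" for t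
        unfolding SX F(2)[OF xt[OF that]] upd_emb \<Theta>X0[OF sub1[OF x]] by simp
      show "((\<lambda>t. F j (emb t y w)) \<longlongrightarrow> F j (emb 0 y w)) (at 0)"
        by (rule isCont_tendsto_compose[OF sephol_isCont[OF F(1) x] et])
    qed
    have GZ: "snd Z = w * G (emb 0 y w)"
    proof (rule DERIV_0_eq_limit[OF _ r(1)])
      show "((\<lambda>t. snd (\<Theta> (S t (z', w')))) has_field_derivative snd Z) (at 0)"
        using has_derivative_snd[OF d\<Theta>] by (simp add: has_field_derivative_def cscale_def mult_commute_abs)
      show "snd (\<Theta> (S t (z', w'))) = w + t * (w * G (emb t y w))" if "norm t < r" for t
      proof -
        have "w * q (emb 0 y w) = w" using q(2)[OF sub2[OF x]] \<Theta>X0[OF sub1[OF x]] by simp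
        then show ?thesis unfolding SX q(2)[OF sub2[OF xt[OF that]]] G(2)[OF xt[OF that]] upd_emb
          by (simp add: algebra_simps)
      qed
      show "((\<lambda>t. w * G (emb t y w)) \<longlongrightarrow> w * G (emb 0 y w)) (at 0)"
        by (intro tendsto_intros isCont_tendsto_compose[OF sephol_isCont[OF G(1) x] et])
    qed
    have "cscale w' Z = (w' *s (\<chi> j. F j (emb 0 y w)), w' * (w * G (emb 0 y w)))"
      by (simp add: cscale_def GZ FZ vec_eq_iff)
    with LZ show "Im ((w * e (emb 0 y w)) * (w * G (emb 0 y w))) =
        2 * Re (dhol (\<lambda>_. (w * e (emb 0 y w)) *s (\<chi> j. F j (emb 0 y w))) p y)"
      by (simp add: L_def w'_def)
  qed
qed

end

lemma dim_pos_if_balanced_coordinates: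
  assumes "poly_model \<mu> P" "hol_nondegenerate P" "poly_model \<mu> P'" "model_in_coords P \<Psi> P'" "balanced P'"
  shows "vf.dim (g1 \<mu> P) > 0"
proof -
  interpret nondeg_model \<mu> P using assms(1,2) by (simp add: nondeg_model_def nondeg_model_axioms_def)
  show ?thesis
  proof (rule pulled_back_field[OF assms(3,5,4)])
    fix r c E F G
    assume *: "r > 0" "sephol r E" "E 0 = of_real c" "c \<noteq> 0" "sephol r G" "G 0 = 1/2" "\<And>j. sephol r (F j)"
      "\<And>y w. emb 0 y w \<in> polydisc r \<Longrightarrow> Im w = P y \<Longrightarrow>
         Im ((w * E (emb 0 y w)) * (w * G (emb 0 y w))) =
         2 * Re (dhol (\<lambda>_. (w * E (emb 0 y w)) *s (\<chi> j. F j (emb 0 y w))) p y)"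
    obtain X where "X \<in> g1 \<mu> P" "X \<noteq> (\<lambda>x. 0)" using weight_1_part[OF *] by blast
    then show ?thesis by (rule dim_g1_pos)
  qed
qed

theorem theorem1p7:
  fixes M :: "'n::{finite,linorder} csp set"
    and p :: "'n csp"
    and \<mu> :: "'n \<Rightarrow> real"
    and \<Phi> :: "'n csp \<Rightarrow> 'n csp"
    and P\<^sub>C :: "complex^'n::{finite,linorder} \<Rightarrow> real"
  assumes "smooth_real_hypersurface M" and "p \<in> M" and "finite_type M p"
    and "multitype_coords M p \<mu> \<Phi> P\<^sub>C"
    and "\<forall>j. \<mu> j \<noteq> 0"
    and "hol_nondegenerate P\<^sub>C"
  shows "vf.dim (g1 \<mu> P\<^sub>C) > 0 \<longleftrightarrow>
    (\<exists>\<Psi> P'. multitype_coords M p \<mu> (\<Psi> \<circ> \<Phi>) P' \<and> model_in_coords P\<^sub>C \<Psi> P' \<and> balanced P')"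
proof
  assume "vf.dim (g1 \<mu> P\<^sub>C) > 0"
  then show "\<exists>\<Psi> P'. multitype_coords M p \<mu> (\<Psi> \<circ> \<Phi>) P' \<and> model_in_coords P\<^sub>C \<Psi> P' \<and> balanced P'"
    by (rule balanced_coordinates_if_dim_pos[OF assms(4-6)])
next
  assume "\<exists>\<Psi> P'. multitype_coords M p \<mu> (\<Psi> \<circ> \<Phi>) P' \<and> model_in_coords P\<^sub>C \<Psi> P' \<and> balanced P'"
  then obtain \<Psi> P' where "multitype_coords M p \<mu> (\<Psi> \<circ> \<Phi>) P'" "model_in_coords P\<^sub>C \<Psi> P'" "balanced P'"
    by blast
  then show "vf.dim (g1 \<mu> P\<^sub>C) > 0"
    using dim_pos_if_balanced_coordinates[OF poly_modelI[OF assms(4,5)] assms(6)] poly_modelI[OF _ assms(5)] by blast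
qed

end
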